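(* Let $p>2$. If $A$ is an $n\times d$ matrix with entries bounded in absolute value by $\mathrm{poly}(n)$, then there is a $(3+\varepsilon)$-approximation algorithm running in time $n^{\mathrm{poly}(k/\varepsilon)}$ for finding the closest rank-$k$ matrix to $A$ in the entrywise $\ell_p$ norm; i.e., it outputs $U\in\mathbb{R}^{n\times k}$, $V\in\mathbb{R}^{k\times d}$ with $\|UV-A\|_p\le(3+\varepsilon)\min_{U',V'}\|U'V'-A\|_p$.
   Context: For a matrix $M$, $\|M\|_p=(\sum_{i,j}|M_{i,j}|^p)^{1/p}$; the minimum is over $U'\in\mathbb{R}^{n\times k}$, $V'\in\mathbb{R}^{k\times d}$.
   Formalization: The number of columns d is assumed at most poly(n), since otherwise V cannot be written within the stated time; ε is taken in (0,1]; the time bound has base max(n,2), as for n=1 it would allow one step; time is counted on a unit-cost real RAM. *)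

theory Defs
  imports Complex_Main "HOL-Computational_Algebra.Polynomial" "Jordan_Normal_Form.Matrix"
begin

section \<open>Entrywise norm and rank-k approximation\<close>

definition entrywise_norm :: "real \<Rightarrow> real mat \<Rightarrow> real" where
  "entrywise_norm p M =
     (\<Sum>i<dim_row M. \<Sum>j<dim_col M. \<bar>M $$ (i, j)\<bar> powr p) powr (1 / p)"

text \<open>The minimum of the norm of \<open>U' V' - A\<close>. The set is nonempty and bounded below by 0, so
  the infimum is meaningful, and it coincides with the minimum because the matrices of rank at
  most \<open>k\<close> form a closed set.\<close>

definition lowrank_opt :: "real \<Rightarrow> nat \<Rightarrow> real mat \<Rightarrow> real" where
  "lowrank_opt p k A =
     Inf {entrywise_norm p (U * V - A) | U V.
            U \<in> carrier_mat (dim_row A) k \<and> V \<in> carrier_mat k (dim_col A)}"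

section \<open>The real RAM\<close>

text \<open>Algorithms are programs of a deterministic unit-cost real RAM. A state has one memory of
  natural numbers, used for control and addressing, and one memory of real numbers. The reals
  have exact field arithmetic and order tests, but no rounding and no conversion to naturals; the
  naturals have addition and truncated subtraction only, so that numbers of \<open>t\<close> bits take about
  \<open>t\<close> steps to build. All program constants are integers: no real constant can smuggle
  information into a program. Division by 0 yields 0, as everywhere in HOL.\<close>

record ram =
  nmem :: "nat \<Rightarrow> nat"
  rmem :: "nat \<Rightarrow> real"

text \<open>\<open>Dir a\<close> is the cell with address \<open>a\<close>; \<open>Ind a\<close> is the cell whose address is stored in
  natural-number cell \<open>a\<close>.\<close>

datatype loc = Dir nat | Ind nat

fun addr :: "ram \<Rightarrow> loc \<Rightarrow> nat" where
  "addr s (Dir a) = a"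
| "addr s (Ind a) = nmem s a"

definition nval :: "ram \<Rightarrow> loc \<Rightarrow> nat" where
  "nval s x = nmem s (addr s x)"

definition rval :: "ram \<Rightarrow> loc \<Rightarrow> real" where
  "rval s x = rmem s (addr s x)"

definition nput :: "loc \<Rightarrow> nat \<Rightarrow> ram \<Rightarrow> ram" where
  "nput x v s = s\<lparr>nmem := (nmem s)(addr s x := v)\<rparr>"

definition rput :: "loc \<Rightarrow> real \<Rightarrow> ram \<Rightarrow> ram" where
  "rput x v s = s\<lparr>rmem := (rmem s)(addr s x := v)\<rparr>"

datatype instr =
    NConst loc nat | NAdd loc loc loc | NSub loc loc loc
  | RConst loc int | RAdd loc loc loc | RSub loc loc loc
  | RMul loc loc loc | RDiv loc loc loc

fun step :: "instr \<Rightarrow> ram \<Rightarrow> ram" where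
  "step (NConst z c) s = nput z c s"
| "step (NAdd z x y) s = nput z (nval s x + nval s y) s"
| "step (NSub z x y) s = nput z (nval s x - nval s y) s"
| "step (RConst z c) s = rput z (of_int c) s"
| "step (RAdd z x y) s = rput z (rval s x + rval s y) s"
| "step (RSub z x y) s = rput z (rval s x - rval s y) s"
| "step (RMul z x y) s = rput z (rval s x * rval s y) s"
| "step (RDiv z x y) s = rput z (rval s x / rval s y) s"

datatype test = NLess loc loc | RLess loc loc

fun holds :: "test \<Rightarrow> ram \<Rightarrow> bool" where
  "holds (NLess x y) s = (nval s x < nval s y)"
| "holds (RLess x y) s = (rval s x < rval s y)"

datatype prog =
    Do instr
  | Seq prog prog
  | Cond test prog prog
  | Loop test prog

text \<open>\<open>exec P s t s'\<close>: started in state \<open>s\<close>, program \<open>P\<close> halts in state \<open>s'\<close> after \<open>t\<close> steps,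
  where every instruction and every evaluation of a test is one step.\<close>

inductive exec :: "prog \<Rightarrow> ram \<Rightarrow> nat \<Rightarrow> ram \<Rightarrow> bool" where
  Do: "exec (Do i) s 1 (step i s)"
| Seq: "exec P s t s' \<Longrightarrow> exec Q s' u s'' \<Longrightarrow> exec (Seq P Q) s (t + u) s''"
| CondTrue: "holds b s \<Longrightarrow> exec P s t s' \<Longrightarrow> exec (Cond b P Q) s (Suc t) s'"
| CondFalse: "\<not> holds b s \<Longrightarrow> exec Q s t s' \<Longrightarrow> exec (Cond b P Q) s (Suc t) s'"
| LoopFalse: "\<not> holds b s \<Longrightarrow> exec (Loop b P) s 1 s"
| LoopTrue: "holds b s \<Longrightarrow> exec P s t s' \<Longrightarrow> exec (Loop b P) s' u s'' \<Longrightarrow>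
    exec (Loop b P) s (Suc (t + u)) s''"

section \<open>Input and output conventions\<close>

text \<open>The naturals \<open>n, d, k\<close> occupy natural-number cells 0, 1, 2. The reals \<open>p, \<epsilon>\<close> occupy real cells 0, 1,
  followed by the entries of \<open>A\<close> in row-major order. All other cells are 0.\<close>

definition input_state :: "real \<Rightarrow> real \<Rightarrow> nat \<Rightarrow> real mat \<Rightarrow> ram" where
  "input_state p \<epsilon> k A =
     (let n = dim_row A; d = dim_col A in
      \<lparr>nmem = (\<lambda>a. if a = 0 then n else if a = 1 then d else if a = 2 then k else 0),
       rmem = (\<lambda>a. if a = 0 then p else if a = 1 then \<epsilon>
                   else if a - 2 < n * d then A $$ ((a - 2) div d, (a - 2) mod d) else 0)\<rparr>)"

text \<open>On halting, the real memory holds \<open>U\<close> and then \<open>V\<close>, each in row-major order.\<close>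

definition output_U :: "nat \<Rightarrow> nat \<Rightarrow> ram \<Rightarrow> real mat" where
  "output_U n k s = mat n k (\<lambda>(i, j). rmem s (i * k + j))"

definition output_V :: "nat \<Rightarrow> nat \<Rightarrow> nat \<Rightarrow> ram \<Rightarrow> real mat" where
  "output_V n d k s = mat k d (\<lambda>(i, j). rmem s (n * k + i * d + j))"

end

theory Submission
 imports Defs "HOL-Analysis.Convex" "HOL-Combinatorics.Transposition" "HOL-Library.Nat_Bijection"
  "Jordan_Normal_Form.Determinant"
begin

text \<open>
 Let \<open>B = W V\<close> be any matrix of rank \<open>k\<close>, where \<open>V\<close> consists of \<open>k\<close> rows of \<open>B\<close> and \<open>W\<close> has bounded entries.
 Sampling \<open>m = poly(k / \<epsilon>)\<close> columns with probabilities proportional to their sensitivities, read off an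
 Auerbach basis of the row space, gives a reweighted subset of the columns that preserves \<open>\<parallel>x V\<parallel>\<^sub>p\<close> for all \<open>x\<close>
 up to a factor \<open>1 + \<gamma>\<close> and that does not increase \<open>\<parallel>B - A\<parallel>\<^sub>p\<close> by more than that. A random sample does this on average,
 hence some sample does, and the program tries them all, together with all weights and all values of the
 sampled entries of \<open>V\<close> on a fine grid around \<open>A\<close>. Given the right guess, regressing every row of \<open>A\<close> on the sampled columns gives
 \<open>W'\<close> with \<open>\<parallel>W' V - B\<parallel> \<le> (2 + O(\<gamma>)) \<parallel>B - A\<parallel>\<close>: this is the triangle inequality on the sampled columns, and it is the source of the constant 3.
 Regressing the columns of \<open>A\<close> on \<open>W'\<close> then yields \<open>V'\<close>.

 Both regressions are solved by brute force over a grid. Elimination with complete pivoting (a pivot of maximal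
 modulus) writes a residual in terms of \<open>k\<close> of its own entries with coefficients bounded by 1, so only these entries have
 to be guessed. The residual of the same elimination applied to \<open>A\<close> is within a factor \<open>8^k\<close> of the optimum, which
 gives the scale \<open>sc\<close> of all grids; if it vanishes, \<open>A\<close> has rank at most \<open>k\<close> and the
 elimination solves the problem exactly. The machine has no powers with exponent \<open>p\<close>: it replaces \<open>x powr p\<close> by a step function,
 \<open>(1 + p / y^2)^t\<close> for the least \<open>t\<close> with \<open>x \<le> z (1 + 1 / y^2)^t\<close>.
\<close>


section \<open>Weighted p-norms\<close>

text \<open>Nothing bounds the minimiser of a sampled regression when the rows of \<open>V\<close>
  are nearly dependent, and then the error of the guessed entries of \<open>V\<close> could not be
  controlled. Hence every row regression carries \<open>k\<close> additional rows, \<mu> times the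
  identity (\<open>aug\<close>): they bound the solution by a power of \<open>Y\<close>, make the
  unit ball bounded as an Auerbach basis requires, and return the solution as the negated residual
  in these rows divided by \<mu>. The price is of lower order because \<mu> =
  \<open>sc / Y ^ 8\<close>. The optimum itself is known only to within powers of \<open>Y\<close>:
  \<open>sc \<le> 8 ^ k * Opt\<close>, and \<open>Opt \<le> Y ^ 2 * sc\<close> may be assumed, since
  otherwise the approximation left by the elimination is a better reference matrix. All
  perturbations are therefore compared with \<open>sc / Y ^ a\<close>; the exponents 8, 24, 28, 29
  are spaced so that every multiplication by a power of \<open>Y\<close> on the way still leaves a
  term below \<gamma> * \<open>Opt\<close>. Time is controlled by one number: all natural-number
  arrays stay below a bound \<open>X\<close>, a power of \<open>max n 2\<close> with exponent
  polynomial in k / \<epsilon>, and the program has a fixed nesting depth.\<close>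

definition lpn :: "real => 'a set => ('a => real) => ('a => real) => real" where
 "lpn p I w f = (\<Sum>i\<in>I. w i * \<bar>f i\<bar> powr p) powr (1 / p)"

lemma lpn_sum_nonneg:
 fixes w f :: "'a => real"
 assumes "\<And>i. i \<in> I ==> 0 \<le> w i"
 shows "0 \<le> (\<Sum>i\<in>I. w i * \<bar>f i\<bar> powr p)"
 by (auto intro!: sum_nonneg mult_nonneg_nonneg simp: assms)

lemma lpn_nonneg: "0 \<le> lpn p I w f"
 by (simp add: lpn_def)

lemma lpn_powr:
 assumes "p > 0" "\<And>i. i \<in> I ==> 0 \<le> w i"
 shows "lpn p I w f powr p = (\<Sum>i\<in>I. w i * \<bar>f i\<bar> powr p)"
 using assms lpn_sum_nonneg[of I w f p] by (simp add: lpn_def powr_powr)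

lemma lpn_leI:
 assumes "p > 0" "0 \<le> c" "(\<Sum>i\<in>I. w i * \<bar>f i\<bar> powr p) \<le> c powr p"
  "\<And>i. i \<in> I ==> 0 \<le> w i"
 shows "lpn p I w f \<le> c"
proof -
 have "lpn p I w f \<le> (c powr p) powr (1 / p)"
  unfolding lpn_def using assms lpn_sum_nonneg[of I w f p] by (intro powr_mono2) auto
 then show ?thesis using assms by (simp add: powr_powr)
qed

lemma lpn_mono:
 assumes "p > 0" "\<And>i. i \<in> I ==> 0 \<le> w i" "\<And>i. i \<in> I ==> \<bar>f i\<bar> \<le> \<bar>g i\<bar>"
 shows "lpn p I w f \<le> lpn p I w g"
 unfolding lpn_def using assms
 by (intro powr_mono2 sum_mono mult_left_mono lpn_sum_nonneg) auto

lemma lpn_cong: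
 assumes "\<And>i. i \<in> I ==> w i = w' i" "\<And>i. i \<in> I ==> \<bar>f i\<bar> = \<bar>g i\<bar>"
 shows "lpn p I w f = lpn p I w' g"
 unfolding lpn_def using assms by simp

lemma lpn_cmult:
 assumes "p > 0" "\<And>i. i \<in> I ==> 0 \<le> w i"
 shows "lpn p I w (%i. c * f i) = \<bar>c\<bar> * lpn p I w f"
proof -
 have "(\<Sum>i\<in>I. w i * \<bar>c * f i\<bar> powr p) = \<bar>c\<bar> powr p * (\<Sum>i\<in>I. w i * \<bar>f i\<bar> powr p)"
  by (simp add: abs_mult powr_mult sum_distrib_left algebra_simps)
 then show ?thesis
  using assms lpn_sum_nonneg[of I w f p] by (simp add: lpn_def powr_mult powr_powr)
qed

lemma lpn_uminus: "lpn p I w (%i. - f i) = lpn p I w f"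
 by (simp add: lpn_def)

text \<open>Convexity on the open half-line covers positive arguments. At an endpoint 0 only one
  term survives, and \<open>s powr p \<le> s\<close> for s between 0 and 1 suffices.\<close>

lemma powr_convex_combination:
 fixes a b s t p :: real
 assumes "1 \<le> p" "0 \<le> a" "0 \<le> b" "0 \<le> s" "0 \<le> t" "s + t = 1"
 shows "(s * a + t * b) powr p \<le> s * a powr p + t * b powr p"
proof (cases "a = 0 \<or> b = 0")
 case True
 have pw: "x powr p \<le> x" if "0 \<le> x" "x \<le> 1" for x :: real
  using powr_mono'[of 1 p x] that assms by (cases "x = 0") auto
 have "s \<le> 1" "t \<le> 1" using assms by auto
 then have "s powr p \<le> s" "t powr p \<le> t" using pw assms by auto
 then show ?thesis using True assms by (auto simp: powr_mult intro!: mult_right_mono)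
next
 case False
 then have "a > 0" "b > 0" using assms by auto
 then show ?thesis
  using convex_onD[OF powr_convex[OF assms(1)], of t a b] assms
  by (metis (no_types, lifting) add_diff_cancel_right' atLeastLessThan_iff greaterThan_iff le_add_same_cancel2 real_scaleR_def)
qed

text \<open>Minkowski's inequality by normalisation:
  \<open>\<bar>f i\<bar> + \<bar>g i\<bar>\<close> divided by \<open>a + b\<close> is a convex
  combination of \<open>\<bar>f i\<bar> / a\<close> and \<open>\<bar>g i\<bar> / b\<close>, so
  termwise convexity of the p-th power gives a weighted sum of at most 1.\<close>

lemma lpn_triangle:
 assumes p: "1 \<le> p" and fin: "finite I" and w: "\<And>i. i \<in> I ==> 0 \<le> w i"
 shows "lpn p I w (%i. f i + g i) \<le> lpn p I w f + lpn p I w g"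
proof -
 have p0: "p > 0" using p by simp
 \<comment> \<open>A null function may be nonzero where its weight is 0, so its values cannot be
   cancelled; only the weighted terms vanish.\<close>
 have null: "lpn p I w (%i. f i + g i) \<le> lpn p I w g" if "lpn p I w f = 0" for f g
 proof -
  have "(\<Sum>i\<in>I. w i * \<bar>f i\<bar> powr p) = 0"
   using that lpn_powr[of p I w f, OF p0 w] by simp
  then have z: "\<forall>i\<in>I. w i * \<bar>f i\<bar> powr p = 0"
   using w by (subst (asm) sum_nonneg_eq_0_iff[OF fin]) auto
  then have "(\<Sum>i\<in>I. w i * \<bar>f i + g i\<bar> powr p) = (\<Sum>i\<in>I. w i * \<bar>g i\<bar> powr p)"
   by (intro sum.cong) auto
  then show ?thesis by (simp add: lpn_def)
 qed
 define a where "a = lpn p I w f"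
 define b where "b = lpn p I w g"
 have ab: "0 \<le> a" "0 \<le> b" by (simp_all add: a_def b_def lpn_nonneg)
 consider "a = 0" | "b = 0" | "a > 0" "b > 0" using ab by linarith
 then show ?thesis
 proof cases
  case 1
  then show ?thesis using null[of f g] by (simp add: a_def)
 next
  case 2
  then show ?thesis using null[of g f] by (simp add: b_def add.commute)
 next
  case 3
  have trm: "w i * \<bar>f i + g i\<bar> powr p \<le>
    (a + b) powr p * (a / (a + b) * (w i * \<bar>f i\<bar> powr p / a powr p)
     + b / (a + b) * (w i * \<bar>g i\<bar> powr p / b powr p))" if "i \<in> I" for i
  proof -
   have "\<bar>f i + g i\<bar> \<le> \<bar>f i\<bar> + \<bar>g i\<bar>" by simp
   also have "\<dots> = (a + b) * (a / (a + b) * (\<bar>f i\<bar> / a) + b / (a + b) * (\<bar>g i\<bar> / b))"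
    using 3 by (simp add: distrib_left)
   finally have "\<bar>f i + g i\<bar> powr p
     \<le> ((a + b) * (a / (a + b) * (\<bar>f i\<bar> / a) + b / (a + b) * (\<bar>g i\<bar> / b))) powr p"
    using p0 by (intro powr_mono2) auto
   also have "\<dots> = (a + b) powr p * (a / (a + b) * (\<bar>f i\<bar> / a) + b / (a + b) * (\<bar>g i\<bar> / b)) powr p"
    using 3 by (intro powr_mult)
   also have "\<dots> \<le> (a + b) powr p * (a / (a + b) * (\<bar>f i\<bar> / a) powr p + b / (a + b) * (\<bar>g i\<bar> / b) powr p)"
    using 3 p by (intro mult_left_mono powr_convex_combination) (auto simp: add_divide_distrib[symmetric])
   also have "\<dots> = (a + b) powr p * (a / (a + b) * (\<bar>f i\<bar> powr p / a powr p) + b / (a + b) * (\<bar>g i\<bar> powr p / b powr p))"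
    using 3 by (simp add: powr_divide)
   finally show ?thesis
    using mult_left_mono[OF _ w[OF that]] by (fastforce simp: algebra_simps)
  qed
  have "(\<Sum>i\<in>I. w i * \<bar>f i + g i\<bar> powr p) \<le> (\<Sum>i\<in>I. (a + b) powr p * (a / (a + b) * (w i * \<bar>f i\<bar> powr p / a powr p)
     + b / (a + b) * (w i * \<bar>g i\<bar> powr p / b powr p)))"
   by (intro sum_mono trm)
  also have "\<dots> = (a + b) powr p * (a / (a + b) * ((\<Sum>i\<in>I. w i * \<bar>f i\<bar> powr p) / a powr p)
     + b / (a + b) * ((\<Sum>i\<in>I. w i * \<bar>g i\<bar> powr p) / b powr p))"
   by (simp add: sum_distrib_left sum_divide_distrib sum.distrib algebra_simps)
  also have "\<dots> = (a + b) powr p * (a / (a + b) + b / (a + b))"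
  proof -
   have "(\<Sum>i\<in>I. w i * \<bar>f i\<bar> powr p) = a powr p" "(\<Sum>i\<in>I. w i * \<bar>g i\<bar> powr p) = b powr p"
    using lpn_powr[of p I w f, OF p0 w] lpn_powr[of p I w g, OF p0 w] by (simp_all add: a_def b_def)
   then show ?thesis using 3 by simp
  qed
  also have "\<dots> = (a + b) powr p" using 3 by (simp add: add_divide_distrib[symmetric])
  finally show ?thesis
   unfolding a_def[symmetric] b_def[symmetric] using 3 p0 w by (intro lpn_leI) auto
 qed
qed

lemma lpn_triangle_diff:
 assumes "1 \<le> p" "finite I" "\<And>i. i \<in> I ==> 0 \<le> w i"
 shows "lpn p I w (%i. f i - g i) \<le> lpn p I w f + lpn p I w g"
 using lpn_triangle[OF assms, where f = f and g = "%i. - g i"] by (simp add: lpn_uminus)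

text \<open>The factor \<open>W\<close> replaces the sharper \<open>W powr (1 / p)\<close>. As
  \<open>1 \<le> W\<close>, the cruder bound keeps the later error estimates polynomial in
  \<open>y\<close> with exponents independent of p.\<close>

lemma lpn_bounded:
 assumes p: "1 \<le> p" and fin: "finite I" and w: "\<And>i. i \<in> I ==> 0 \<le> w i"
  and f: "\<And>i. i \<in> I ==> \<bar>f i\<bar> \<le> c" and c: "0 \<le> c" and W: "sum w I \<le> W" "1 \<le> W"
 shows "lpn p I w f \<le> W * c"
proof (rule lpn_leI)
 have "(\<Sum>i\<in>I. w i * \<bar>f i\<bar> powr p) \<le> (\<Sum>i\<in>I. w i * c powr p)"
  using p f w by (intro sum_mono mult_left_mono powr_mono2) auto
 also have "\<dots> = sum w I * c powr p" by (simp add: sum_distrib_right)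
 also have "\<dots> \<le> W powr p * c powr p"
 proof (intro mult_right_mono)
  have "W powr 1 \<le> W powr p" using p W by (intro powr_mono) auto
  then show "sum w I \<le> W powr p" using W by simp
 qed simp
 finally show "(\<Sum>i\<in>I. w i * \<bar>f i\<bar> powr p) \<le> (W * c) powr p"
  using W c by (simp add: powr_mult)
qed (use p W c w in auto)

lemma lpn_entry:
 assumes p: "p > 0" and fin: "finite I" and w: "\<And>i. i \<in> I ==> 0 \<le> w i"
  and "i \<in> I" "lpn p I w f \<le> c"
 shows "w i * \<bar>f i\<bar> powr p \<le> c powr p"
proof -
 have "w i * \<bar>f i\<bar> powr p \<le> (\<Sum>i\<in>I. w i * \<bar>f i\<bar> powr p)"
  using assms by (intro member_le_sum) auto
 also have "\<dots> = lpn p I w f powr p" using lpn_powr[of p I w f, OF p w] by simp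
 also have "\<dots> \<le> c powr p" using assms lpn_nonneg by (intro powr_mono2) auto
 finally show ?thesis .
qed

lemma lpn_entry1:
 assumes p: "p > 0" and fin: "finite I" and w: "\<And>i. i \<in> I ==> 0 \<le> w i"
  and i: "i \<in> I" "1 \<le> w i"
 shows "\<bar>f i\<bar> \<le> lpn p I w f"
proof -
 have "1 * \<bar>f i\<bar> powr p \<le> w i * \<bar>f i\<bar> powr p" using i by (intro mult_right_mono) auto
 also have "\<dots> \<le> lpn p I w f powr p" using lpn_entry[OF p fin w i(1) order.refl] .
 finally show ?thesis using p lpn_nonneg[of p I w f] powr_less_mono2[of p "lpn p I w f" "\<bar>f i\<bar>"]
  by (cases "\<bar>f i\<bar> \<le> lpn p I w f") auto
qed

text \<open>This lets a matrix norm be taken row by row or column by column, which is how the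
  regressions decouple.\<close>

lemma lpn_Sigma:
 assumes p: "p > 0" and "finite I" "finite J" and w: "\<And>j. j \<in> J ==> 0 \<le> w j"
 shows "lpn p I (%_. 1) (%i. lpn p J w (f i)) = lpn p (I \<times> J) (%(i, j). w j) (%(i, j). f i j)"
proof -
 have "(\<Sum>i\<in>I. 1 * \<bar>lpn p J w (f i)\<bar> powr p) = (\<Sum>i\<in>I. \<Sum>j\<in>J. w j * \<bar>f i j\<bar> powr p)"
  using lpn_powr[of p J w, OF p w] lpn_nonneg[of p J w] by simp
 also have "\<dots> = (\<Sum>x\<in>I \<times> J. (%(i, j). w j) x * \<bar>(%(i, j). f i j) x\<bar> powr p)"
  by (simp add: sum.cartesian_product case_prod_beta)
 finally show ?thesis by (simp add: lpn_def)
qed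

section \<open>Elimination with complete pivoting\<close>

text \<open>The rank bound is stated through a factorisation because this is the object that an
  elimination step transforms; values outside the n by d block are unconstrained.\<close>

definition lowrank :: "nat => nat => nat => (nat => nat => real) => bool" where
 "lowrank k n d B \<longleftrightarrow> (\<exists>u v. \<forall>x<n. \<forall>y<d. B x y = (\<Sum>t<k. u x t * v t y))"

lemma lowrank_zero:
 assumes "\<And>x y. x < n ==> y < d ==> B x y = 0"
 shows "lowrank k n d B"
 unfolding lowrank_def using assms by (intro exI[of _ "%_ _. 0"]) simp

lemma lowrank_columns: "lowrank d n d B"
 unfolding lowrank_def
 by (intro exI[of _ B] exI[of _ "%t y. if t = y then 1 else 0"]) (auto simp: if_distrib cong: if_cong)

lemma lowrank_cong:
 assumes "\<And>x y. x < n ==> y < d ==> B x y = C x y"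
 shows "lowrank k n d B \<longleftrightarrow> lowrank k n d C"
 unfolding lowrank_def using assms by simp

text \<open>Wedderburn's rank reduction. The factorisation is changed so that only its last factor
  meets column j; subtracting the product of pivot column and pivot row over the pivot then cancels
  this factor.\<close>

lemma lowrank_reduce:
 assumes "lowrank (Suc k) n d B" "i < n" "j < d" "B i j \<noteq> 0"
 shows "lowrank k n d (%x y. B x y - B x j * B i y / B i j)"
proof -
 obtain u0 v0 where B0: "\<And>x y. x < n ==> y < d ==> B x y = (\<Sum>t<Suc k. u0 x t * v0 t y)"
  using assms(1) unfolding lowrank_def by blast
 have "\<exists>t<Suc k. v0 t j \<noteq> 0"
 proof (rule ccontr)
  assume "\<not> ?thesis"
  then have "(\<Sum>t<Suc k. u0 i t * v0 t j) = 0" by (intro sum.neutral) auto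
  then show False using B0[OF assms(2,3)] assms(4) by simp
 qed
 then obtain t0 where t0: "t0 < Suc k" "v0 t0 j \<noteq> 0" by blast
 \<comment> \<open>The transposition moves a factor with a nonzero entry in column j to the last
   place.\<close>
 define s where "s = transpose t0 k"
 define u where "u x t = u0 x (s t)" for x t
 define v where "v t = v0 (s t)" for t
 have bij: "bij_betw s {..<Suc k} {..<Suc k}"
  unfolding s_def using t0 by simp
 have B: "B x y = (\<Sum>t<Suc k. u x t * v t y)" if "x < n" "y < d" for x y
  unfolding B0[OF that] u_def v_def using sum.reindex_bij_betw[OF bij, of "%t. u0 x t * v0 t y"] by simp
 have vk: "v k j \<noteq> 0" using t0 by (simp add: v_def s_def)
 define U where "U x = (\<Sum>t<Suc k. u x t * (v t j / v k j))" for x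
 \<comment> \<open>Multiples of the last factor clear column j from the other factors, and
   \<open>U\<close> absorbs the change.\<close>
 define w where "w t y = v t y - v t j / v k j * v k y" for t y
 have split: "B x y = (\<Sum>t<k. u x t * w t y) + U x * v k y" if "x < n" "y < d" for x y
 proof -
  have "(\<Sum>t<k. u x t * w t y) + U x * v k y
    = (\<Sum>t<k. u x t * v t y) - (\<Sum>t<k. u x t * (v t j / v k j)) * v k y + U x * v k y"
   by (simp add: w_def algebra_simps sum_subtractf sum_distrib_left sum_distrib_right)
  also have "\<dots> = (\<Sum>t<k. u x t * v t y) + u x k * v k y"
   using vk by (simp add: U_def algebra_simps)
  finally show ?thesis using B[OF that] by simp
 qed
 have wj: "w t j = 0" for t using vk by (simp add: w_def)
 have Bj: "B x j = U x * v k j" if "x < n" for x using split[OF that assms(3)] by (simp add: wj)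
 have Ui: "U i \<noteq> 0" using Bj[OF assms(2)] assms(4) by auto
 show ?thesis unfolding lowrank_def
 proof (intro exI allI impI)
  fix x y assume xy: "x < n" "y < d"
  have "B x j * B i y / B i j = U x / U i * B i y"
   using Bj[OF xy(1)] Bj[OF assms(2)] vk by simp
  also have "\<dots> = U x / U i * (\<Sum>t<k. u i t * w t y) + U x * v k y"
   using split[OF assms(2) xy(2)] Ui by (simp add: distrib_left)
  finally show "B x y - B x j * B i y / B i j = (\<Sum>t<k. (u x t - U x / U i * u i t) * w t y)"
   using split[OF xy] by (simp add: algebra_simps sum_subtractf sum_distrib_left)
 qed
qed

lemma argmax_exists:
 fixes B :: "nat => nat => real"
 assumes "x0 < n" "y0 < d"
 shows "\<exists>i<n. \<exists>j<d. \<forall>x<n. \<forall>y<d. \<bar>B x y\<bar> \<le> \<bar>B i j\<bar>"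
proof -
 let ?S = "(%(x, y). \<bar>B x y\<bar>) ` ({..<n} \<times> {..<d})"
 have "Max ?S \<in> ?S" using assms by (intro Max_in) auto
 then obtain i j where ij: "i < n" "j < d" "Max ?S = \<bar>B i j\<bar>" by auto
 have "\<bar>B x y\<bar> \<le> Max ?S" if "x < n" "y < d" for x y
  using that by (intro Max_ge) (auto intro!: image_eqI[of _ _ "(x, y)"])
 then show ?thesis using ij by auto
qed

text \<open>Complete pivoting keeps the multipliers \<open>b x\<close> at most 1 in modulus, so the
  coefficient of a new pivot row is at most \<open>1 + k * (k + 1) ^ k\<close>, whence the bound by
  induction. If the remainder vanishes early, any row with coefficient 0 fills the missing
  places.\<close>

lemma lowrank_rows:
 assumes "lowrank k n d B" "0 < n"
 shows "\<exists>Q W. (\<forall>u<k. Q u < n) \<and> (\<forall>x<n. \<forall>u<k. \<bar>W x u\<bar> \<le> (real k + 1) ^ k) \<and>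
  (\<forall>x<n. \<forall>y<d. B x y = (\<Sum>u<k. W x u * B (Q u) y))"
 using assms(1)
proof (induction k arbitrary: B)
 case 0
 then show ?case by (simp add: lowrank_def)
next
 case (Suc k)
 show ?case
 proof (cases "\<forall>x<n. \<forall>y<d. B x y = 0")
  case True
  then show ?thesis using assms(2)
   by (intro exI[of _ "%_. 0"] exI[of _ "%_ _. 0"]) auto
 next
  case False
  then obtain x0 y0 where x0: "x0 < n" "y0 < d" "B x0 y0 \<noteq> 0" by blast
  obtain i j where ij: "i < n" "j < d" and mx: "\<And>x y. x < n ==> y < d ==> \<bar>B x y\<bar> \<le> \<bar>B i j\<bar>"
   using argmax_exists[of x0 n y0 d B] x0 by blast
  have nz: "B i j \<noteq> 0" using mx[OF x0(1,2)] x0(3) by auto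
  obtain Q W where Q: "\<forall>u<k. Q u < n" and W: "\<forall>x<n. \<forall>u<k. \<bar>W x u\<bar> \<le> (real k + 1) ^ k"
   and eq: "\<And>x y. x < n ==> y < d ==> B x y - B x j * B i y / B i j
    = (\<Sum>u<k. W x u * (B (Q u) y - B (Q u) j * B i y / B i j))"
   using Suc.IH[OF lowrank_reduce[OF Suc.prems ij nz]] by blast
  define b where "b x = B x j / B i j" for x
  have b1: "\<bar>b x\<bar> \<le> 1" if "x < n" for x
   using mx[OF that ij(2)] nz by (simp add: b_def)
  \<comment> \<open>Undoing the elimination step turns reduced rows back into rows of
    \<open>B\<close>; the coefficient of the pivot row collects the corrections.\<close>
  define W' where "W' x u = (if u < k then W x u else b x - (\<Sum>u<k. W x u * b (Q u)))" for x u
  define Q' where "Q' u = (if u < k then Q u else i)" for u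
  have pw: "1 + real k * (real k + 1) ^ k \<le> (real (Suc k) + 1) ^ Suc k"
  proof -
   have "(real k + 1) ^ k \<ge> 1" by (intro one_le_power) simp
   then have "1 + real k * (real k + 1) ^ k \<le> (real k + 2) * (real k + 1) ^ k"
    unfolding distrib_right by linarith
   also have "\<dots> \<le> (real k + 2) * (real k + 2) ^ k"
    by (intro mult_left_mono power_mono) auto
   finally show ?thesis by (simp add: algebra_simps)
  qed
  have le: "(real k + 1) ^ k \<le> 1 + real k * (real k + 1) ^ k \<or> k = 0"
  proof (cases k)
   case (Suc j)
   then have "1 * (real k + 1) ^ k \<le> real k * (real k + 1) ^ k" by (intro mult_right_mono) auto
   then show ?thesis by linarith
  qed simp
  have "\<bar>W' x u\<bar> \<le> (real (Suc k) + 1) ^ Suc k" if "x < n" "u < Suc k" for x u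
  proof (cases "u < k")
   case True
   then show ?thesis using W that le pw by (fastforce simp: W'_def)
  next
   case False
   have "\<bar>\<Sum>u<k. W x u * b (Q u)\<bar> \<le> (\<Sum>u<k. \<bar>W x u\<bar> * \<bar>b (Q u)\<bar>)"
    by (rule order_trans[OF sum_abs]) (simp add: abs_mult)
   also have "\<dots> \<le> (\<Sum>u<k. (real k + 1) ^ k * 1)"
    using W Q b1 that by (intro sum_mono mult_mono) auto
   finally have "\<bar>b x - (\<Sum>u<k. W x u * b (Q u))\<bar> \<le> 1 + real k * (real k + 1) ^ k"
    using b1[OF that(1)] by simp
   then show ?thesis using False pw by (simp add: W'_def)
  qed
  moreover have "B x y = (\<Sum>u<Suc k. W' x u * B (Q' u) y)" if "x < n" "y < d" for x y
  proof -
   have "(\<Sum>u<Suc k. W' x u * B (Q' u) y)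
     = (\<Sum>u<k. W x u * B (Q u) y) + (b x - (\<Sum>u<k. W x u * b (Q u))) * B i y"
    by (simp add: W'_def Q'_def)
   also have "\<dots> = (\<Sum>u<k. W x u * (B (Q u) y - B (Q u) j * B i y / B i j)) + b x * B i y"
    by (simp add: b_def algebra_simps sum_subtractf sum_distrib_left sum_distrib_right)
   also have "\<dots> = B x y" using eq[OF that] by (simp add: b_def)
   finally show ?thesis by simp
  qed
  moreover have "\<forall>u<Suc k. Q' u < n" using Q ij by (auto simp: Q'_def)
  ultimately show ?thesis by blast
 qed
qed

text \<open>A trace of elimination: \<open>H t\<close> is the matrix before step t,
  \<open>Q t\<close> its pivot row and \<open>b t\<close> the pivot column divided by the pivot.
  Pivots come from the first \<open>N\<close> rows, but all \<open>L\<close> rows are transformed,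
  so the others can carry bookkeeping. It is a relation rather than a function, to fit whatever
  maximal entry the program picks. Once the matrix is exhausted, division by 0 gives multipliers 0
  and further steps change nothing.\<close>

definition elims :: "nat => nat => nat => nat => (nat => nat => nat => real) => (nat => nat => real)
  => (nat => nat) => bool" where
 "elims N L m K H b Q \<longleftrightarrow> (\<forall>t<K. Q t < N \<and> (\<exists>c<m.
   (\<forall>x<N. \<forall>y<m. \<bar>H t x y\<bar> \<le> \<bar>H t (Q t) c\<bar>) \<and>
   (\<forall>x<L. b t x = H t x c / H t (Q t) c)) \<and>
   (\<forall>x<L. \<forall>y<m. H (Suc t) x y = H t x y - H t (Q t) y * b t x))"

context
 fixes N L m K H b Q
 assumes el: "elims N L m K H b Q" and NL: "N \<le> L"
begin

lemma elims_row: "t < K ==> Q t < N"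
 by (rule conjunct1[OF el[unfolded elims_def, THEN spec, THEN mp]])

lemma elims_step:
 assumes "t < K" "x < L" "y < m"
 shows "H (Suc t) x y = H t x y - H t (Q t) y * b t x"
 using conjunct2[OF conjunct2[OF el[unfolded elims_def, THEN spec, THEN mp, OF assms(1)]]] assms(2,3) by blast

lemma elims_col:
 assumes "t < K"
 obtains c where "c < m" "\<And>x y. x < N ==> y < m ==> \<bar>H t x y\<bar> \<le> \<bar>H t (Q t) c\<bar>"
  "\<And>x. x < L ==> b t x = H t x c / H t (Q t) c"
proof -
 have "\<exists>c<m. (\<forall>x<N. \<forall>y<m. \<bar>H t x y\<bar> \<le> \<bar>H t (Q t) c\<bar>) \<and>
   (\<forall>x<L. b t x = H t x c / H t (Q t) c)"
  by (rule conjunct1[OF conjunct2[OF el[unfolded elims_def, THEN spec, THEN mp, OF assms]]])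
 then show ?thesis using that by blast
qed

lemma elims_bound:
 assumes "t < K" "x < N"
 shows "\<bar>b t x\<bar> \<le> 1"
proof -
 obtain c where c: "c < m" "\<And>x y. x < N ==> y < m ==> \<bar>H t x y\<bar> \<le> \<bar>H t (Q t) c\<bar>"
  "\<And>x. x < L ==> b t x = H t x c / H t (Q t) c"
  using elims_col[OF assms(1)] by blast
 have "b t x = H t x c / H t (Q t) c" using c(3) assms NL by simp
 then show ?thesis using c(2)[OF assms(2) c(1)] by (auto simp: divide_le_eq_1)
qed

text \<open>A pivot 0 is maximal only if nothing is left; any other pivot is divided by
  itself.\<close>

lemma elims_pivot:
 assumes "t < K"
 shows "(\<forall>x<N. \<forall>y<m. H t x y = 0) \<or> b t (Q t) = 1"
proof -
 obtain c where c: "c < m" "\<And>x y. x < N ==> y < m ==> \<bar>H t x y\<bar> \<le> \<bar>H t (Q t) c\<bar>"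
  "\<And>x. x < L ==> b t x = H t x c / H t (Q t) c"
  using elims_col[OF assms(1)] by blast
 have "b t (Q t) = H t (Q t) c / H t (Q t) c"
  using c(3)[of "Q t"] elims_row[OF assms] NL by simp
 moreover have "\<forall>x<N. \<forall>y<m. H t x y = 0" if "H t (Q t) c = 0" using c(2) unfolding that by simp
 ultimately show ?thesis by (cases "H t (Q t) c = 0") auto
qed

text \<open>The pivot row is cleared in its own step. Afterwards its multiplier is a quotient with
  numerator 0, so it is never refilled.\<close>

lemma elims_row_zero:
 assumes "t < u" "u \<le> K" "y < m"
 shows "H u (Q t) y = 0"
 using assms
proof (induction u arbitrary: y)
 case (Suc u)
 have t: "t < K" using Suc.prems by simp
 have Qt: "Q t < N" "Q t < L" using elims_row[OF t] NL by auto
 show ?case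
 proof (cases "t = u")
  case True
  have "H (Suc t) (Q t) y = H t (Q t) y - H t (Q t) y * b t (Q t)"
   using elims_step[OF t Qt(2) Suc.prems(3)] .
  note st = this
  from elims_pivot[OF t] show ?thesis
  proof
   assume "\<forall>x<N. \<forall>y<m. H t x y = 0"
   then have "H t (Q t) y = 0" using Qt(1) Suc.prems(3) by blast
   with st show ?thesis using True by simp
  next
   assume "b t (Q t) = 1"
   with st show ?thesis using True by simp
  qed
 next
  case False
  then have tu: "t < u" "u < K" using Suc.prems by auto
  obtain c where c: "c < m" "\<And>x y. x < N ==> y < m ==> \<bar>H u x y\<bar> \<le> \<bar>H u (Q u) c\<bar>"
   "\<And>x. x < L ==> b u x = H u x c / H u (Q u) c"
   using elims_col[OF tu(2)] by blast
  have uK: "u \<le> K" using tu by simp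
  have "b u (Q t) = 0" using c(3)[OF Qt(2)] Suc.IH[OF tu(1) uK c(1)] by simp
  with Suc.IH[OF tu(1) uK Suc.prems(3)] elims_step[OF tu(2) Qt(2) Suc.prems(3)]
  show ?thesis by simp
 qed
qed simp

text \<open>This triangular structure makes an expansion along the \<open>b u\<close>, read in row
  \<open>Q t\<close>, depend on the first \<open>t + 1\<close> coefficients alone.\<close>

lemma elims_vec_zero:
 assumes "t < u" "u < K"
 shows "b u (Q t) = 0"
proof -
 obtain c where c: "c < m" "\<And>x y. x < N ==> y < m ==> \<bar>H u x y\<bar> \<le> \<bar>H u (Q u) c\<bar>"
  "\<And>x. x < L ==> b u x = H u x c / H u (Q u) c"
  using elims_col[OF assms(2)] by blast
 have "Q t < L" using elims_row[of t] assms NL by simp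
 then show ?thesis using c(3)[of "Q t"] elims_row_zero[OF assms(1) _ c(1)] assms(2) by simp
qed

lemma elims_expand:
 assumes "t \<le> K" "x < L" "y < m"
 shows "H 0 x y = H t x y + (\<Sum>u<t. H u (Q u) y * b u x)"
 using assms
proof (induction t)
 case (Suc t)
 then show ?case using elims_step[of t x y] by simp
qed simp

text \<open>Each step is a rank reduction unless the matrix is already 0.\<close>

lemma elims_lowrank:
 assumes "lowrank r N m (H 0)" "t \<le> r" "r \<le> K"
 shows "lowrank (r - t) N m (H t)"
 using assms(2)
proof (induction t)
 case (Suc t)
 have t: "t < K" using Suc assms by simp
 obtain c where c: "c < m" "\<And>x y. x < N ==> y < m ==> \<bar>H t x y\<bar> \<le> \<bar>H t (Q t) c\<bar>"
  "\<And>x. x < L ==> b t x = H t x c / H t (Q t) c"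
  using elims_col[OF t] by blast
 have step: "H (Suc t) x y = H t x y - H t x c * H t (Q t) y / H t (Q t) c" if "x < N" "y < m" for x y
  using elims_step[OF t, of x y] c(3)[of x] that NL by simp
 show ?case
 proof (cases "H t (Q t) c = 0")
  case True
  then have "\<And>x y. x < N ==> y < m ==> H t x y = 0" using c(2) unfolding True by simp
  then show ?thesis using step True by (intro lowrank_zero) auto
 next
  case False
  have "lowrank (Suc (r - Suc t)) N m (H t)" using Suc by (simp add: Suc_diff_Suc)
  from lowrank_reduce[OF this elims_row[OF t] c(1) False]
  show ?thesis by (subst lowrank_cong[OF step]) auto
 qed
qed (use assms in simp)

lemma elims_zero:
 assumes "lowrank r N m (H 0)" "r \<le> K" "x < N" "y < m"
 shows "H r x y = 0"
 using elims_lowrank[OF assms(1) order.refl assms(2)] assms(3,4) by (simp add: lowrank_def)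

text \<open>Seen by columns, a step adds a multiple of the pivot column c to column y. Hence the
  coefficients are the same in all \<open>L\<close> rows, including those from which no pivot is
  taken.\<close>

lemma elims_span:
 assumes "t \<le> K" "y < m"
 shows "\<exists>g. \<forall>x<L. H t x y = (\<Sum>u<m. H 0 x u * g u)"
 using assms
proof (induction t arbitrary: y)
 case 0
 then show ?case
  by (intro exI[of _ "%u. if u = y then 1 else 0"]) (auto simp: if_distrib cong: if_cong)
next
 case (Suc t)
 have t: "t < K" "t \<le> K" using Suc by auto
 obtain c where c: "c < m" "\<And>x y. x < N ==> y < m ==> \<bar>H t x y\<bar> \<le> \<bar>H t (Q t) c\<bar>"
   "\<And>x. x < L ==> b t x = H t x c / H t (Q t) c"
   using elims_col[OF t(1)] by blast
 obtain g where g: "\<And>x. x < L ==> H t x y = (\<Sum>u<m. H 0 x u * g u)"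
  using Suc.IH[OF t(2) Suc.prems(2)] by blast
 obtain g' where g': "\<And>x. x < L ==> H t x c = (\<Sum>u<m. H 0 x u * g' u)"
  using Suc.IH[OF t(2) c(1)] by blast
 define \<alpha> where "\<alpha> = H t (Q t) y / H t (Q t) c"
 have "H (Suc t) x y = (\<Sum>u<m. H 0 x u * (g u - \<alpha> * g' u))" if "x < L" for x
 proof -
  have "(\<Sum>u<m. H 0 x u * (g u - \<alpha> * g' u)) = H t x y - \<alpha> * H t x c"
   using g[OF that] g'[OF that] by (simp add: right_diff_distrib sum_subtractf sum_distrib_left mult_ac)
  then show ?thesis
   using elims_step[OF t(1) that Suc.prems(2)] c(3)[OF that] by (simp add: \<alpha>_def)
 qed
 then show ?case by (intro exI allI impI)
qed

lemma elims_vec_span: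
 assumes "t < K"
 shows "\<exists>g. \<forall>x<L. b t x = (\<Sum>u<m. H 0 x u * g u)"
proof -
 obtain c where c: "c < m" "\<And>x y. x < N ==> y < m ==> \<bar>H t x y\<bar> \<le> \<bar>H t (Q t) c\<bar>"
   "\<And>x. x < L ==> b t x = H t x c / H t (Q t) c"
   using elims_col[OF assms] by blast
 obtain g where g: "\<And>x. x < L ==> H t x c = (\<Sum>u<m. H 0 x u * g u)"
  using elims_span[of t c] assms c(1) by auto
 show ?thesis using c(3) g
  by (intro exI[of _ "%u. g u / H t (Q t) c"]) (simp add: sum_divide_distrib)
qed

end

lemma elims_tail:
 assumes "elims N L m (Suc K) H b Q"
 shows "elims N L m K (%t. H (Suc t)) (%t. b (Suc t)) (%t. Q (Suc t))"
 unfolding elims_def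
proof (intro allI impI)
 fix t assume "t < K"
 then have lt: "Suc t < Suc K" by simp
 show "Q (Suc t) < N \<and> (\<exists>c<m.
   (\<forall>x<N. \<forall>y<m. \<bar>H (Suc t) x y\<bar> \<le> \<bar>H (Suc t) (Q (Suc t)) c\<bar>) \<and>
   (\<forall>x<L. b (Suc t) x = H (Suc t) x c / H (Suc t) (Q (Suc t)) c)) \<and>
   (\<forall>x<L. \<forall>y<m. H (Suc (Suc t)) x y = H (Suc t) x y - H (Suc t) (Q (Suc t)) y * b (Suc t) x)"
  by (rule assms[unfolded elims_def, THEN spec, THEN mp, OF lt])
qed

text \<open>A dominant pivot of \<open>H\<close> is a pivot of the nearby matrix \<open>B\<close> as well, so both can be
 eliminated in parallel; a small pivot bounds \<open>H\<close> itself.\<close>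

lemma elims_residual:
 assumes "elims N L m r H b Q" "N \<le> L" "lowrank r N m B" "0 \<le> e"
  "\<And>x y. x < N ==> y < m ==> \<bar>H 0 x y - B x y\<bar> \<le> e" "x < N" "y < m"
 shows "\<bar>H r x y\<bar> \<le> 8 ^ r * e"
 using assms
proof (induction r arbitrary: H b Q B e x y)
 case 0
 then show ?case by (force simp: lowrank_def)
next
 case (Suc r)
 note el = Suc.prems(1) and NL = Suc.prems(2)
 obtain c where c: "c < m" "\<And>x y. x < N ==> y < m ==> \<bar>H 0 x y\<bar> \<le> \<bar>H 0 (Q 0) c\<bar>"
  "\<And>x. x < L ==> b 0 x = H 0 x c / H 0 (Q 0) c"
  using elims_col[OF el NL, of 0] by blast
 have Q0: "Q 0 < N" using elims_row[OF el NL, of 0] by simp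
 have b1: "\<bar>b 0 x\<bar> \<le> 1" if "x < N" for x using elims_bound[OF el NL, of 0 x] that by simp
 have step: "H (Suc 0) x y = H 0 x y - H 0 (Q 0) y * b 0 x" if "x < N" "y < m" for x y
  using elims_step[OF el NL, of 0 x y] that NL by simp
 let ?p = "H 0 (Q 0) c"
 show ?case
 proof (cases "\<bar>?p\<bar> \<le> 2 * e")
  case True
  \<comment> \<open>All entries are at most \<open>2 * e\<close>, so one step at most doubles them,
    and the rest of the run can be compared with the zero matrix.\<close>
  have "\<bar>H (Suc 0) x y - 0\<bar> \<le> 8 * e" if "x < N" "y < m" for x y
  proof -
   have "\<bar>H 0 (Q 0) y * b 0 x\<bar> \<le> \<bar>?p\<bar> * 1"
    unfolding abs_mult using c(2)[OF Q0 that(2)] b1[OF that(1)] by (intro mult_mono) auto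
   then show ?thesis using step[OF that] c(2)[OF that] True Suc.prems(4) by linarith
  qed
  then have "\<bar>H (Suc r) x y\<bar> \<le> 8 ^ r * (8 * e)"
   using Suc.IH[OF elims_tail[OF el] NL lowrank_zero[of N m "%_ _. 0"], of "8 * e" x y] Suc.prems by simp
  then show ?thesis by simp
 next
  case False
  let ?p' = "B (Q 0) c"
  have e: "0 \<le> e" by fact
  have p': "\<bar>?p'\<bar> \<ge> \<bar>?p\<bar> / 2" using Suc.prems(5)[OF Q0 c(1)] False by linarith
  have pnz: "?p \<noteq> 0" "?p' \<noteq> 0" using p' False e by auto
  let ?B = "%x y. B x y - B x c * B (Q 0) y / ?p'"
  \<comment> \<open>The budget of \<open>8 * e\<close> splits into \<open>e\<close> for the entry,
    \<open>e\<close> for the pivot row and \<open>6 * e\<close> for the change of the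
    multiplier.\<close>
  have "\<bar>H (Suc 0) x y - ?B x y\<bar> \<le> 8 * e" if xy: "x < N" "y < m" for x y
  proof -
   let ?a = "b 0 x" let ?a' = "B x c / ?p'"
   have "\<bar>B (Q 0) y\<bar> \<le> 3 / 2 * \<bar>?p\<bar>"
    using Suc.prems(5)[OF Q0 xy(2)] c(2)[OF Q0 xy(2)] False by linarith
   have xL: "x < L" using xy NL by simp
   have "(?a - ?a') * ?p' = (H 0 x c - B x c) + ?a * (?p' - ?p)"
    using pnz c(3)[OF xL] by (simp add: field_simps)
   then have "\<bar>?a - ?a'\<bar> * \<bar>?p'\<bar> \<le> \<bar>H 0 x c - B x c\<bar> + \<bar>?a\<bar> * \<bar>?p' - ?p\<bar>"
    by (metis abs_mult abs_triangle_ineq)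
   also have "\<dots> \<le> e + 1 * e"
    using Suc.prems(5)[OF xy(1) c(1)] Suc.prems(5)[OF Q0 c(1)] b1[OF xy(1)]
    by (intro add_mono mult_mono) (auto simp: abs_minus_commute)
   finally have "\<bar>?a - ?a'\<bar> * \<bar>?p'\<bar> \<le> 2 * e" by simp
   moreover have "\<bar>?a - ?a'\<bar> * (\<bar>?p\<bar> / 2) \<le> \<bar>?a - ?a'\<bar> * \<bar>?p'\<bar>"
    using p' by (intro mult_left_mono) auto
   ultimately have d: "\<bar>?a - ?a'\<bar> * \<bar>?p\<bar> \<le> 4 * e" by simp
   have "\<bar>(?a - ?a') * B (Q 0) y\<bar> \<le> \<bar>?a - ?a'\<bar> * (3 / 2 * \<bar>?p\<bar>)"
    unfolding abs_mult by (intro mult_left_mono) (use \<open>\<bar>B (Q 0) y\<bar> \<le> 3 / 2 * \<bar>?p\<bar>\<close> in auto)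
   then have 1: "\<bar>(?a - ?a') * B (Q 0) y\<bar> \<le> 6 * e" using d by simp
   have 2: "\<bar>?a * (H 0 (Q 0) y - B (Q 0) y)\<bar> \<le> 1 * e"
    unfolding abs_mult using b1[OF xy(1)] Suc.prems(5)[OF Q0 xy(2)] by (intro mult_mono) auto
   have "H (Suc 0) x y - ?B x y = (H 0 x y - B x y) - ?a * (H 0 (Q 0) y - B (Q 0) y) - (?a - ?a') * B (Q 0) y"
    using step[OF xy] by (simp add: algebra_simps)
   then show ?thesis using 1 2 Suc.prems(5)[OF xy] by linarith
  qed
  then have "\<bar>H (Suc r) x y\<bar> \<le> 8 ^ r * (8 * e)"
   using Suc.IH[OF elims_tail[OF el] NL lowrank_reduce[OF Suc.prems(3) Q0 c(1) pnz(2)], of "8 * e" x y] Suc.prems by simp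
  then show ?thesis by simp
 qed
qed

text \<open>For multipliers from an elimination, step t with a nonzero pivot gives the residual the
  value \<open>- r t\<close> in row \<open>Q t\<close>, and no later step changes it there. A
  residual is thus parametrised by its own entries in the pivot rows instead of a solution vector,
  whose size is not controlled.\<close>

primrec resid :: "(nat => real) => (nat => nat => real) => (nat => nat) => (nat => real) => nat => nat => real" where
 "resid a b Q r 0 = a"
| "resid a b Q r (Suc t) = (%x. resid a b Q r t x - (resid a b Q r t (Q t) + r t) * b t x)"

lemma resid_cong:
 assumes "\<And>i. i < t ==> r i = r' i"
 shows "resid a b Q r t = resid a b Q r' t"
 using assms by (induction t) auto

text \<open>Whatever is guessed for \<open>r\<close>, the result is the residual of an actual
  solution, in all \<open>L\<close> rows; a wrong guess can only cost quality.\<close>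

lemma resid_span:
 assumes el: "elims N L m K H b Q" "N \<le> L" and "t \<le> K"
 shows "\<exists>v. \<forall>x<L. resid a b Q r t x = a x - (\<Sum>u<m. H 0 x u * v u)"
 using assms(3)
proof (induction t)
 case 0
 then show ?case by (intro exI[of _ "%_. 0"]) simp
next
 case (Suc t)
 obtain v where v: "\<And>x. x < L ==> resid a b Q r t x = a x - (\<Sum>u<m. H 0 x u * v u)"
  using Suc by auto
 obtain g where g: "\<And>x. x < L ==> b t x = (\<Sum>u<m. H 0 x u * g u)"
  using elims_vec_span[OF el, of t] Suc by auto
 define y where "y = resid a b Q r t (Q t) + r t"
 have "resid a b Q r (Suc t) x = a x - (\<Sum>u<m. H 0 x u * (v u + y * g u))" if "x < L" for x
  using v[OF that] g[OF that] by (simp add: y_def[symmetric]) (simp add: distrib_left sum.distrib sum_distrib_left mult_ac)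
 then show ?case by (intro exI allI impI)
qed

lemma grid_point:
 fixes \<eta> v :: real
 assumes "0 \<le> \<eta>" "\<bar>v\<bar> \<le> real h * \<eta>"
 shows "\<exists>g\<le>2 * h. \<bar>(real g - real h) * \<eta> - v\<bar> \<le> \<eta>"
proof (cases "\<eta> = 0")
 case True
 then show ?thesis using assms by auto
next
 case False
 then have \<eta>: "\<eta> > 0" using assms by simp
 define g where "g = nat (\<lfloor>v / \<eta>\<rfloor> + int h)"
 have vb: "- real h \<le> v / \<eta>" "v / \<eta> \<le> real h" using assms \<eta> by (auto simp: field_simps)
 have fl: "- int h \<le> \<lfloor>v / \<eta>\<rfloor>" "\<lfloor>v / \<eta>\<rfloor> \<le> int h" using vb by linarith+
 have rg: "real g = real_of_int \<lfloor>v / \<eta>\<rfloor> + real h" using fl by (simp add: g_def)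
 have "\<bar>real_of_int \<lfloor>v / \<eta>\<rfloor> - v / \<eta>\<bar> \<le> 1" by linarith
 then have "\<bar>real_of_int \<lfloor>v / \<eta>\<rfloor> - v / \<eta>\<bar> * \<eta> \<le> 1 * \<eta>" using \<eta> by (intro mult_right_mono) auto
 moreover have "(real g - real h) * \<eta> - v = (real_of_int \<lfloor>v / \<eta>\<rfloor> - v / \<eta>) * \<eta>"
  using \<eta> rg by (simp add: field_simps)
 ultimately have "\<bar>(real g - real h) * \<eta> - v\<bar> \<le> \<eta>" using \<eta> by (simp add: abs_mult)
 moreover have "g \<le> 2 * h" using fl by (simp add: g_def)
 ultimately show ?thesis by blast
qed

text \<open>The entry of the true residual in row \<open>Q t\<close> is at most \<Gamma>, so a grid
  of range \<open>h * \<eta>\<close> has a point within \<eta> of the value needed. As the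
  multipliers have modulus at most 1, each of the k roundings adds at most \<eta> to any
  entry.\<close>

lemma resid_approx:
 assumes el: "elims N L k k H b Q" "N \<le> L" and \<eta>: "0 \<le> \<eta>" and rng: "\<Gamma> + real k * \<eta> \<le> real h * \<eta>"
  and xs: "\<And>x. x < N ==> \<bar>a x - (\<Sum>u<k. H 0 x u * xs u)\<bar> \<le> \<Gamma>"
 shows "\<exists>g. (\<forall>t. g t \<le> 2 * h) \<and> (\<forall>x<N.
  \<bar>resid a b Q (%t. (real (g t) - real h) * \<eta>) k x - (a x - (\<Sum>u<k. H 0 x u * xs u))\<bar> \<le> real k * \<eta>)"
proof -
 \<comment> \<open>The coefficient of \<open>b t\<close> when \<open>H 0\<close> times
   \<open>xs\<close> is expanded along the elimination.\<close>
 define y where "y t = (\<Sum>u<k. xs u * H t (Q t) u)" for t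
 have M: "(\<Sum>u<k. H 0 x u * xs u) = (\<Sum>t<k. y t * b t x)" if "x < N" for x
 proof -
  \<comment> \<open>After k steps on k columns nothing is left, so the expansion has no
    remainder.\<close>
  have "H 0 x u = (\<Sum>t<k. H t (Q t) u * b t x)" if "u < k" for u
   using elims_expand[OF el order.refl, of x u] elims_zero[OF el lowrank_columns order.refl, of x u]
    that \<open>x < N\<close> el(2) by simp
  then have "(\<Sum>u<k. H 0 x u * xs u) = (\<Sum>u<k. \<Sum>t<k. H t (Q t) u * b t x * xs u)"
   by (simp add: sum_distrib_right)
  also have "\<dots> = (\<Sum>t<k. \<Sum>u<k. H t (Q t) u * b t x * xs u)" by (rule sum.swap)
  finally show ?thesis by (simp add: y_def sum_distrib_left mult_ac)
 qed
 have "\<exists>g. (\<forall>i. g i \<le> 2 * h) \<and> (\<forall>x<N.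
  \<bar>resid a b Q (%t. (real (g t) - real h) * \<eta>) t x - (a x - (\<Sum>u<t. y u * b u x))\<bar> \<le> real t * \<eta>)"
  if "t \<le> k" for t
  using that
 proof (induction t)
  case 0
  then show ?case by (intro exI[of _ "%_. 0"]) simp
 next
  case (Suc t)
  then have t: "t < k" by simp
  obtain g where g: "\<And>i. g i \<le> 2 * h" and D: "\<And>x. x < N ==>
   \<bar>resid a b Q (%t. (real (g t) - real h) * \<eta>) t x - (a x - (\<Sum>u<t. y u * b u x))\<bar> \<le> real t * \<eta>"
   using Suc by auto
  let ?\<rho> = "resid a b Q (%t. (real (g t) - real h) * \<eta>) t"
  have Qt: "Q t < N" using elims_row[OF el t] .
  \<comment> \<open>A vanishing pivot makes step t void, and then any digit will do.\<close>
  have "\<exists>g0\<le>2 * h. \<bar>(?\<rho> (Q t) + (real g0 - real h) * \<eta> - y t)\<bar> \<le> \<eta> \<or> (\<forall>x<N. b t x = 0)"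
  proof (cases "\<forall>x<N. \<forall>u<k. H t x u = 0")
   case True
   obtain c where c: "c < k" "\<And>x y. x < N ==> y < k ==> \<bar>H t x y\<bar> \<le> \<bar>H t (Q t) c\<bar>"
     "\<And>x. x < L ==> b t x = H t x c / H t (Q t) c"
    using elims_col[OF el t] by blast
   have "b t x = 0" if "x < N" for x using c(3)[of x] c(1) True el(2) that by simp
   then have "\<forall>x<N. b t x = 0" by blast
   then show ?thesis by auto
  next
   case False
   then have b1: "b t (Q t) = 1" using elims_pivot[OF el t] by auto
   \<comment> \<open>Row \<open>Q t\<close> does not see the multipliers of later steps, so the sum
     stops at t.\<close>
   have "(\<Sum>u<k. y u * b u (Q t)) = (\<Sum>u<Suc t. y u * b u (Q t))"
    using t elims_vec_zero[OF el, of t] by (intro sum.mono_neutral_right) auto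
   then have "(\<Sum>u<k. H 0 (Q t) u * xs u) = (\<Sum>u<t. y u * b u (Q t)) + y t"
    using M[OF Qt] b1 by simp
   then have "\<bar>y t - ?\<rho> (Q t)\<bar> \<le> real t * \<eta> + \<Gamma>"
    using D[OF Qt] xs[OF Qt] by linarith
   also have "\<dots> \<le> real h * \<eta>"
    using rng mult_right_mono[of "real t" "real k" \<eta>] t \<eta> by simp
   finally obtain g0 where "g0 \<le> 2 * h" "\<bar>(real g0 - real h) * \<eta> - (y t - ?\<rho> (Q t))\<bar> \<le> \<eta>"
    using grid_point[OF \<eta>] by blast
   then show ?thesis by (auto simp: algebra_simps)
  qed
  then obtain g0 where g0: "g0 \<le> 2 * h"
   "\<bar>(?\<rho> (Q t) + (real g0 - real h) * \<eta> - y t)\<bar> \<le> \<eta> \<or> (\<forall>x<N. b t x = 0)" by blast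
  let ?g = "g(t := g0)"
  have same: "resid a b Q (%t. (real (?g t) - real h) * \<eta>) t = ?\<rho>"
   by (intro resid_cong) simp
  have "\<bar>resid a b Q (%t. (real (?g t) - real h) * \<eta>) (Suc t) x - (a x - (\<Sum>u<Suc t. y u * b u x))\<bar>
    \<le> real (Suc t) * \<eta>" if x: "x < N" for x
  proof -
   let ?d = "?\<rho> (Q t) + (real g0 - real h) * \<eta> - y t"
   have "\<bar>?d * b t x\<bar> \<le> \<eta>"
   proof (cases "\<forall>x<N. b t x = 0")
    case True
    then show ?thesis using x \<eta> by simp
   next
    case False
    then have "\<bar>?d * b t x\<bar> \<le> \<eta> * 1"
     unfolding abs_mult using g0(2) elims_bound[OF el t x] by (intro mult_mono) auto
    then show ?thesis by simp
   qed
   moreover have "resid a b Q (%t. (real (?g t) - real h) * \<eta>) (Suc t) x - (a x - (\<Sum>u<Suc t. y u * b u x))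
     = ?\<rho> x - (a x - (\<Sum>u<t. y u * b u x)) - ?d * b t x"
    using same by (simp add: algebra_simps)
   ultimately show ?thesis using D[OF x] by (simp add: algebra_simps)
  qed
  moreover have "\<forall>i. ?g i \<le> 2 * h" using g g0 by simp
  ultimately show ?case by blast
 qed
 from this[OF order.refl] show ?thesis using M by simp
qed

section \<open>Auerbach bases\<close>

text \<open>Choose k vectors of \<open>X\<close> whose determinant exceeds half of the supremum in
  modulus. By Cramer's rule each coefficient of x is a quotient of two such determinants, hence at
  most 2. Allowing 2 instead of the 1 of a true Auerbach basis makes it unnecessary to attain the
  supremum.\<close>

lemma auerbach_basis:
 fixes X :: "(nat => real) set"
 assumes bnd: "\<And>x u. x \<in> X ==> u < k ==> \<bar>x u\<bar> \<le> C"
  and c: "c > 0" "\<And>i. i < k ==> (%u. if u = i then c else 0) \<in> X"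
 shows "\<exists>v. (\<forall>i<k. v i \<in> X) \<and>
  (\<forall>x\<in>X. \<exists>\<alpha>. (\<forall>i<k. \<bar>\<alpha> i\<bar> \<le> 2) \<and> (\<forall>u<k. x u = (\<Sum>i<k. \<alpha> i * v i u)))"
proof -
 define M :: "(nat => nat => real) => real mat" where "M f = mat k k (%(r, j). f j r)" for f
 define F where "F = {f :: nat => nat => real. \<forall>i<k. f i \<in> X}"
 have Mc: "M f \<in> carrier_mat k k" for f by (simp add: M_def)
 \<comment> \<open>The Leibniz formula bounds all determinants, so the supremum is finite.\<close>
 have "\<bar>det (M f)\<bar> \<le> (\<Sum>q\<in>{q. q permutes {0..<k}}. \<bar>C\<bar> ^ k)" if "f \<in> F" for f
 proof -
  have "\<bar>det (M f)\<bar> \<le> (\<Sum>q\<in>{q. q permutes {0..<k}}. \<bar>signof q * (\<Prod>i = 0..<k. M f $$ (i, q i))\<bar>)"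
   unfolding det_def'[OF Mc] by (rule sum_abs)
  also have "\<dots> \<le> (\<Sum>q\<in>{q. q permutes {0..<k}}. \<bar>C\<bar> ^ k)"
  proof (rule sum_mono)
   fix q assume "q \<in> {q. q permutes {0..<k}}"
   then have q: "q i < k" if "i < k" for i using that permutes_in_image[of q "{0..<k}" i] by auto
   have "(\<Prod>i = 0..<k. \<bar>M f $$ (i, q i)\<bar>) \<le> (\<Prod>i = 0..<k. \<bar>C\<bar>)"
   proof (rule prod_mono)
    fix i assume i: "i \<in> {0..<k}"
    then have "\<bar>f (q i) i\<bar> \<le> C" using bnd that q by (auto simp: F_def)
    then show "0 \<le> \<bar>M f $$ (i, q i)\<bar> \<and> \<bar>M f $$ (i, q i)\<bar> \<le> \<bar>C\<bar>" using i q by (auto simp: M_def)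
   qed
   then show "\<bar>signof q * (\<Prod>i = 0..<k. M f $$ (i, q i))\<bar> \<le> \<bar>C\<bar> ^ k"
    by (simp add: abs_mult abs_prod sign_def)
  qed
  finally show ?thesis .
 qed
 then have bdd: "bdd_above ((%f. \<bar>det (M f)\<bar>) ` F)" by (intro bdd_aboveI2) auto
 define S where "S = Sup ((%f. \<bar>det (M f)\<bar>) ` F)"
 \<comment> \<open>Scaled unit vectors show that the supremum is positive.\<close>
 define f0 where "f0 i u = (if u = i then c else 0)" for i u :: nat
 have "f0 i = (%u. if u = i then c else 0)" for i by (simp add: f0_def fun_eq_iff)
 then have f0: "f0 \<in> F" using c(2) by (simp add: F_def)
 have "M f0 = c \<cdot>\<^sub>m 1\<^sub>m k" by (intro eq_matI) (auto simp: M_def f0_def)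
 then have "\<bar>det (M f0)\<bar> > 0" using c(1) by simp
 moreover have le: "\<bar>det (M f)\<bar> \<le> S" if "f \<in> F" for f
  unfolding S_def using bdd that by (intro cSup_upper) auto
 ultimately have S: "S > 0" using le[OF f0] by linarith
 have "\<exists>f\<in>F. S / 2 < \<bar>det (M f)\<bar>"
  using less_cSup_iff[of "(%f. \<bar>det (M f)\<bar>) ` F" "S / 2"] bdd f0 S by (auto simp: S_def)
 then obtain f where f: "f \<in> F" "S / 2 < \<bar>det (M f)\<bar>" by blast
 have det: "det (M f) \<noteq> 0" using f S by auto
 have "\<exists>\<alpha>. (\<forall>i<k. \<bar>\<alpha> i\<bar> \<le> 2) \<and> (\<forall>u<k. x u = (\<Sum>i<k. \<alpha> i * f i u))" if x: "x \<in> X" for x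
 proof -
  define xv where "xv = vec k x"
  define a where "a = (1 / det (M f)) \<cdot>\<^sub>v (adj_mat (M f) *\<^sub>v xv)"
  have adj: "adj_mat (M f) \<in> carrier_mat k k" "M f * adj_mat (M f) = det (M f) \<cdot>\<^sub>m 1\<^sub>m k"
   using adj_mat[OF Mc[of f]] by auto
  have a: "a \<in> carrier_vec k" using adj by (simp add: a_def xv_def)
  have "M f *\<^sub>v a = (1 / det (M f)) \<cdot>\<^sub>v (M f *\<^sub>v (adj_mat (M f) *\<^sub>v xv))"
   unfolding a_def using adj Mc[of f] by (intro mult_mat_vec) (auto simp: xv_def)
  also have "M f *\<^sub>v (adj_mat (M f) *\<^sub>v xv) = (det (M f) \<cdot>\<^sub>m 1\<^sub>m k) *\<^sub>v xv"
   using adj Mc[of f] by (subst assoc_mult_mat_vec[symmetric]) (auto simp: xv_def)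
  also have "(1 / det (M f)) \<cdot>\<^sub>v ((det (M f) \<cdot>\<^sub>m 1\<^sub>m k) *\<^sub>v xv) = xv"
  proof (intro eq_vecI)
   fix u assume "u < dim_vec xv"
   then have u: "u < k" by (simp add: xv_def)
   have "((det (M f) \<cdot>\<^sub>m 1\<^sub>m k) *\<^sub>v xv) $ u = (\<Sum>i = 0..<k. (if u = i then det (M f) else 0) * x i)"
    using u by (simp add: xv_def scalar_prod_def) (intro sum.cong, auto)
   also have "\<dots> = (\<Sum>i = 0..<k. if i = u then det (M f) * x i else 0)"
    by (intro sum.cong) auto
   finally have "((det (M f) \<cdot>\<^sub>m 1\<^sub>m k) *\<^sub>v xv) $ u = det (M f) * x u" using u by simp
   then show "((1 / det (M f)) \<cdot>\<^sub>v ((det (M f) \<cdot>\<^sub>m 1\<^sub>m k) *\<^sub>v xv)) $ u = xv $ u"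
    using u det by (simp add: xv_def)
  qed (simp add: xv_def)
  finally have Ma: "M f *\<^sub>v a = xv" .
  have "\<bar>a $ i\<bar> \<le> 2" if i: "i < k" for i
  proof -
   have "replace_col (M f) xv i = M (f(i := x))"
    by (intro eq_matI) (auto simp: replace_col_def M_def xv_def)
   then have "det (M (f(i := x))) = a $ i * det (M f)"
    using cramer_lemma_mat[OF Mc[of f] a i] Ma by simp
   moreover have "f(i := x) \<in> F" using f x by (auto simp: F_def)
   ultimately have "\<bar>a $ i\<bar> * \<bar>det (M f)\<bar> \<le> S" using le by (metis abs_mult)
   then have "\<bar>a $ i\<bar> * \<bar>det (M f)\<bar> \<le> 2 * \<bar>det (M f)\<bar>" using f by simp
   then show ?thesis using det by simp
  qed
  moreover have "x u = (\<Sum>i<k. a $ i * f i u)" if u: "u < k" for u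
  proof -
   have "x u = (M f *\<^sub>v a) $ u" using Ma u by (simp add: xv_def)
   also have "\<dots> = (\<Sum>i = 0..<k. f i u * a $ i)"
    using u a by (simp add: scalar_prod_def M_def)
   finally show ?thesis by (simp add: mult.commute atLeast0LessThan)
  qed
  ultimately show ?thesis by blast
 qed
 moreover have "\<forall>i<k. f i \<in> X" using f by (auto simp: F_def)
 ultimately show ?thesis by blast
qed

section \<open>Sampling columns by sensitivities\<close>

text \<open>Because \<open>(1 + x) * (1 - x + x\<^sup>2) = 1 + x ^ 3\<close> and
  \<open>1 + x \<le> exp x\<close>.\<close>

lemma exp_minus_le:
 fixes x :: real
 assumes "0 \<le> x"
 shows "exp (- x) \<le> 1 - x + x\<^sup>2"
proof -
 have "1 \<le> 1 + x ^ 3" using assms by simp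
 also have "\<dots> = (1 + x) * (1 - x + x\<^sup>2)" by (simp add: algebra_simps power2_eq_square power3_eq_cube)
 also have "\<dots> \<le> exp x * (1 - x + x\<^sup>2)"
 proof (intro mult_right_mono)
  have "0 \<le> (x - 1 / 2)\<^sup>2 + 3 / 4" by simp
  then show "0 \<le> 1 - x + x\<^sup>2" by (simp add: algebra_simps power2_eq_square)
 qed (simp add: exp_ge_add_one_self)
 finally show ?thesis by (simp add: exp_minus field_simps)
qed

text \<open>Derandomised sampling: the expectation of the final value of the potential, conditioned on
 the columns chosen so far, does not increase under a suitable next choice.\<close>

lemma sampling_potential:
 fixes P cw :: "nat => real" and a :: "'b => nat => real"
 assumes P: "\<And>j. j < d ==> 0 < P j" "(\<Sum>j<d. P j) = 1" and Y: "finite Y"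
  and a: "\<And>y j. y \<in> Y ==> j < d ==> 0 \<le> a y j"
   "\<And>y j. y \<in> Y ==> j < d ==> a y j \<le> R"
   "\<And>y. y \<in> Y ==> (\<Sum>j<d. P j * a y j) = \<tau> y / real m"
  and c: "\<And>j. j < d ==> 0 \<le> cw j" "(\<Sum>j<d. P j * cw j) = C / real m" "0 < C"
  and \<tau>: "\<And>y. y \<in> Y ==> \<tau> y \<le> T" and m: "m > 0" and R: "R > 0" "T > 0"
  and \<gamma>: "0 < \<gamma>" and \<epsilon>: "0 < \<epsilon>"
  and card: "real (card Y) * exp (- (\<epsilon>\<^sup>2 / (4 * T * R))) < \<gamma> / (1 + \<gamma>)"
 shows "\<exists>S. (\<forall>t<m. S t < d) \<and> (\<Sum>t<m. cw (S t)) \<le> (1 + \<gamma>) * C \<and>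
  (\<forall>y\<in>Y. \<tau> y - \<epsilon> \<le> (\<Sum>t<m. a y (S t)))"
proof -
 \<comment> \<open>The minimiser of \<open>l\<^sup>2 * R * T - l * \<epsilon>\<close>, the exponent
   of the Chernoff bound.\<close>
 define l where "l = \<epsilon> / (2 * T * R)"
 have l: "l > 0" using \<epsilon> R by (simp add: l_def)
 define q where "q y = (\<Sum>j<d. P j * exp (- l * a y j))" for y
 \<comment> \<open>A Markov term for the cost plus one exponential moment for each \<open>y\<close>.
   The rounds still to come enter through their exact means, and a final value below 1 rules out
   every violation at once.\<close>
 define \<Psi> where "\<Psi> t S = ((\<Sum>s<t. cw (S s)) + real (m - t) * (C / real m)) / ((1 + \<gamma>) * C)
  + (\<Sum>y\<in>Y. exp (l * (\<tau> y - \<epsilon>)) * exp (- l * (\<Sum>s<t. a y (S s))) * q y ^ (m - t))" for t S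
 have q0: "0 \<le> q y" for y unfolding q_def using P by (intro sum_nonneg) (auto simp: less_imp_le)
 have ex: "\<exists>S. (\<forall>s<t. S s < d) \<and> \<Psi> t S \<le> \<Psi> 0 (%_. 0)" if "t \<le> m" for t
  using that
 proof (induction t)
  case 0
  then show ?case by (intro exI[of _ "%_. 0"]) simp
 next
  case (Suc t)
  then obtain S where S: "\<forall>s<t. S s < d" "\<Psi> t S \<le> \<Psi> 0 (%_. 0)" by auto
  have mt: "m - t = Suc (m - Suc t)" using Suc by simp
  let ?S = "%j. S(t := j)"
  have eq: "\<Psi> (Suc t) (?S j) = ((\<Sum>s<t. cw (S s)) + cw j + real (m - Suc t) * (C / real m)) / ((1 + \<gamma>) * C)
   + (\<Sum>y\<in>Y. exp (l * (\<tau> y - \<epsilon>)) * exp (- l * (\<Sum>s<t. a y (S s))) * exp (- l * a y j) * q y ^ (m - Suc t))" for j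
  proof -
   have "(\<Sum>s<t. cw (?S j s)) = (\<Sum>s<t. cw (S s))" "(\<Sum>s<t. a y (?S j s)) = (\<Sum>s<t. a y (S s))" for y
    by (auto intro: sum.cong)
   moreover have "exp (- l * (x + z)) = exp (- l * x) * exp (- l * z)" for x z
    by (simp add: exp_add[symmetric] algebra_simps)
   ultimately show ?thesis by (simp add: \<Psi>_def mult.assoc add.assoc)
  qed
  \<comment> \<open>Averaging over the next column reproduces the current value, so some column does
    not exceed it.\<close>
  have "(\<Sum>j<d. P j * \<Psi> (Suc t) (?S j)) = \<Psi> t S"
  proof -
   let ?A = "(\<Sum>s<t. cw (S s)) + real (m - Suc t) * (C / real m)"
   let ?B = "%y. exp (l * (\<tau> y - \<epsilon>)) * exp (- l * (\<Sum>s<t. a y (S s))) * q y ^ (m - Suc t)"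
   have "(\<Sum>j<d. P j * \<Psi> (Suc t) (?S j)) = (\<Sum>j<d. P j * (?A / ((1 + \<gamma>) * C))
     + P j * cw j / ((1 + \<gamma>) * C) + (\<Sum>y\<in>Y. ?B y * (P j * exp (- l * a y j))))"
    unfolding eq by (intro sum.cong refl) (simp add: distrib_left add_divide_distrib sum_distrib_left mult_ac)
   also have "\<dots> = (\<Sum>j<d. P j) * (?A / ((1 + \<gamma>) * C)) + (\<Sum>j<d. P j * cw j) / ((1 + \<gamma>) * C)
     + (\<Sum>j<d. \<Sum>y\<in>Y. ?B y * (P j * exp (- l * a y j)))"
    by (simp only: sum.distrib sum_distrib_right sum_divide_distrib)
   also have "(\<Sum>j<d. \<Sum>y\<in>Y. ?B y * (P j * exp (- l * a y j))) = (\<Sum>y\<in>Y. ?B y * q y)"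
    by (subst sum.swap) (simp add: q_def sum_distrib_left)
   also have "(\<Sum>j<d. P j) * (?A / ((1 + \<gamma>) * C)) + (\<Sum>j<d. P j * cw j) / ((1 + \<gamma>) * C)
     = (?A + C / real m) / ((1 + \<gamma>) * C)"
    using P(2) c(2) by (simp add: add_divide_distrib)
   also have "?A + C / real m = (\<Sum>s<t. cw (S s)) + real (m - t) * (C / real m)"
    unfolding mt by (simp add: add_divide_distrib distrib_right)
   also have "(\<Sum>y\<in>Y. ?B y * q y)
     = (\<Sum>y\<in>Y. exp (l * (\<tau> y - \<epsilon>)) * exp (- l * (\<Sum>s<t. a y (S s))) * q y ^ (m - t))"
    unfolding mt by (simp add: mult_ac)
   finally show ?thesis by (simp add: \<Psi>_def)
  qed
  moreover have "\<exists>j<d. \<Psi> (Suc t) (?S j) \<le> \<Psi> t S" if "(\<Sum>j<d. P j * \<Psi> (Suc t) (?S j)) = \<Psi> t S"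
  proof (rule ccontr)
   assume "\<not> ?thesis"
   then have "\<And>j. j < d ==> \<Psi> t S < \<Psi> (Suc t) (?S j)" by (meson not_le)
   moreover have "{..<d} \<noteq> {}" using P(2) by auto
   ultimately have "(\<Sum>j<d. P j * \<Psi> t S) < (\<Sum>j<d. P j * \<Psi> (Suc t) (?S j))"
    using P by (intro sum_strict_mono) auto
   then show False using that P(2) by (simp add: sum_distrib_right[symmetric])
  qed
  ultimately obtain j where "j < d" "\<Psi> (Suc t) (?S j) \<le> \<Psi> t S" by blast
  then show ?case using S by (intro exI[of _ "?S j"] conjI) (simp add: less_Suc_eq, linarith)
 qed
 obtain S where S: "\<forall>s<m. S s < d" "\<Psi> m S \<le> \<Psi> 0 (%_. 0)" using ex[of m] by blast
 have small: "exp (l * (\<tau> y - \<epsilon>)) * q y ^ m \<le> exp (- (\<epsilon>\<^sup>2 / (4 * T * R)))" if y: "y \<in> Y" for y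
 proof -
  \<comment> \<open>The bound \<open>R\<close> turns the quadratic term into a linear one, so that
    only the mean of \<open>a y\<close> enters.\<close>
  have "q y \<le> (\<Sum>j<d. P j * (1 - l * a y j + l\<^sup>2 * R * a y j))"
   unfolding q_def
  proof (intro sum_mono mult_left_mono)
   fix j assume j: "j \<in> {..<d}"
   have "exp (- l * a y j) \<le> 1 - l * a y j + (l * a y j)\<^sup>2"
    using exp_minus_le[of "l * a y j"] l a(1)[OF y] j by simp
   also have "(l * a y j)\<^sup>2 = l\<^sup>2 * a y j * a y j" by (simp add: power2_eq_square)
   also have "\<dots> \<le> l\<^sup>2 * R * a y j"
    using a(1,2)[OF y, of j] j by (intro mult_right_mono mult_left_mono) auto
   finally show "exp (- l * a y j) \<le> 1 - l * a y j + l\<^sup>2 * R * a y j" by simp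
  qed (use P in \<open>auto simp: less_imp_le\<close>)
  also have "\<dots> = 1 - l * (\<tau> y / real m) + l\<^sup>2 * R * (\<tau> y / real m)"
  proof -
   have "(\<Sum>j<d. P j * (1 - l * a y j + l\<^sup>2 * R * a y j))
     = (\<Sum>j<d. P j) - l * (\<Sum>j<d. P j * a y j) + l\<^sup>2 * R * (\<Sum>j<d. P j * a y j)"
    by (simp add: sum_distrib_left sum.distrib sum_subtractf algebra_simps)
   then show ?thesis using P(2) a(3)[OF y] by simp
  qed
  also have "\<dots> = 1 + (l\<^sup>2 * R * \<tau> y - l * \<tau> y) / real m" by (simp add: diff_divide_distrib)
  also have "\<dots> \<le> exp ((l\<^sup>2 * R * \<tau> y - l * \<tau> y) / real m)" by (rule exp_ge_add_one_self)
  finally have "q y ^ m \<le> exp ((l\<^sup>2 * R * \<tau> y - l * \<tau> y) / real m) ^ m"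
   using q0 by (intro power_mono)
  also have "\<dots> = exp (l\<^sup>2 * R * \<tau> y - l * \<tau> y)" using m by (simp add: exp_of_nat_mult[symmetric])
  finally have "exp (l * (\<tau> y - \<epsilon>)) * q y ^ m \<le> exp (l * (\<tau> y - \<epsilon>)) * exp (l\<^sup>2 * R * \<tau> y - l * \<tau> y)"
   by (intro mult_left_mono) auto
  also have "\<dots> = exp (l\<^sup>2 * R * \<tau> y - l * \<epsilon>)" by (simp add: exp_add[symmetric] algebra_simps)
  also have "l\<^sup>2 * R * \<tau> y - l * \<epsilon> \<le> l\<^sup>2 * R * T - l * \<epsilon>"
   using \<tau>[OF y] R l by (intro diff_mono mult_left_mono) auto
  also have "\<dots> = - (\<epsilon>\<^sup>2 / (4 * T * R))"
   using R by (simp add: l_def power2_eq_square field_simps)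
  finally show ?thesis by simp
 qed
 have "\<Psi> 0 (%_. 0) = 1 / (1 + \<gamma>) + (\<Sum>y\<in>Y. exp (l * (\<tau> y - \<epsilon>)) * q y ^ m)"
  using c(3) m \<gamma> by (simp add: \<Psi>_def)
 also have "\<dots> \<le> 1 / (1 + \<gamma>) + (\<Sum>y\<in>Y. exp (- (\<epsilon>\<^sup>2 / (4 * T * R))))"
  by (intro add_left_mono sum_mono small)
 also have "\<dots> < 1 / (1 + \<gamma>) + \<gamma> / (1 + \<gamma>)" using card by simp
 also have "\<dots> = 1" using \<gamma> by (simp add: add_divide_distrib[symmetric])
 finally have lt1: "\<Psi> m S < 1" using S by simp
 have nn1: "0 \<le> (\<Sum>s<m. cw (S s)) / ((1 + \<gamma>) * C)"
  using S c \<gamma> by (intro divide_nonneg_pos sum_nonneg) auto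
 have \<Psi>m: "\<Psi> m S = (\<Sum>s<m. cw (S s)) / ((1 + \<gamma>) * C) + (\<Sum>y\<in>Y. exp (l * (\<tau> y - \<epsilon> - (\<Sum>s<m. a y (S s)))))"
  by (simp add: \<Psi>_def exp_add[symmetric] algebra_simps)
 have nn2: "0 \<le> (\<Sum>y\<in>Y. exp (l * (\<tau> y - \<epsilon> - (\<Sum>s<m. a y (S s)))))" by (intro sum_nonneg) simp
 have "(\<Sum>s<m. cw (S s)) / ((1 + \<gamma>) * C) < 1" using lt1 \<Psi>m nn2 by linarith
 moreover have "0 < (1 + \<gamma>) * C" using c(3) \<gamma> by simp
 ultimately have "(\<Sum>s<m. cw (S s)) \<le> (1 + \<gamma>) * C"
  by (metis divide_less_eq_1_pos less_imp_le)
 moreover have "\<tau> y - \<epsilon> \<le> (\<Sum>s<m. a y (S s))" if y: "y \<in> Y" for y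
 proof (rule ccontr)
  assume "\<not> ?thesis"
  then have "0 < l * (\<tau> y - \<epsilon> - (\<Sum>s<m. a y (S s)))" using l by simp
  then have "1 < exp (l * (\<tau> y - \<epsilon> - (\<Sum>s<m. a y (S s))))" by simp
  also have "\<dots> \<le> (\<Sum>y\<in>Y. exp (l * (\<tau> y - \<epsilon> - (\<Sum>s<m. a y (S s)))))"
   using y Y by (intro member_le_sum) auto
  finally show False using lt1 \<Psi>m nn1 by linarith
 qed
 ultimately show ?thesis using S by blast
qed


text \<open>The row vector x times the matrix \<open>Z\<close>, followed by \<mu> times x itself.
  With the second block, p-norms of the result are norms in x even if the rows of \<open>Z\<close>
  are dependent.\<close>

definition aug :: "(nat => nat => real) => real => nat => nat => (nat => real) => nat => real" where
 "aug Z \<mu> k m x t = (if t < m then \<Sum>u<k. x u * Z u t else \<mu> * x (t - m))"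

definition wext :: "nat => (nat => real) => nat => real" where
 "wext m w t = (if t < m then w t else 1)"

lemma aug_cong: "(\<And>u. u < k ==> x u = y u) ==> t < m + k ==> aug Z \<mu> k m x t = aug Z \<mu> k m y t"
 by (auto simp: aug_def)

lemma aug_diff: "aug Z \<mu> k m (%u. x u - y u) t = aug Z \<mu> k m x t - aug Z \<mu> k m y t"
 by (simp add: aug_def algebra_simps sum_subtractf)

lemma aug_cmult: "aug Z \<mu> k m (%u. c * x u) t = c * aug Z \<mu> k m x t"
 by (simp add: aug_def sum_distrib_left algebra_simps)

lemma aug_sum:
 fixes r :: nat
 shows "aug Z \<mu> k m (%u. \<Sum>i<r. \<alpha> i * v i u) t = (\<Sum>i<r. \<alpha> i * aug Z \<mu> k m (v i) t)"
 by (induction r) (auto simp: aug_def algebra_simps sum.distrib sum_distrib_left)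

lemma wext_nonneg: "(\<And>t. t < m ==> 0 \<le> w t) ==> 0 \<le> wext m w t"
 by (simp add: wext_def)

lemma sum_split_add:
 fixes f :: "nat => real"
 shows "(\<Sum>t<m + k. f t) = (\<Sum>t<m. f t) + (\<Sum>u<k. f (m + u))"
 by (induction k) auto

lemma lpn_aug_powr:
 assumes "p > 0" "\<And>t. t < m ==> 0 \<le> w t"
 shows "lpn p {..<m + k} (wext m w) (aug Z \<mu> k m x) powr p
  = (\<Sum>t<m. w t * \<bar>\<Sum>u<k. x u * Z u t\<bar> powr p) + (\<Sum>u<k. \<bar>\<mu> * x u\<bar> powr p)"
proof -
 have "lpn p {..<m + k} (wext m w) (aug Z \<mu> k m x) powr p
   = (\<Sum>t<m + k. wext m w t * \<bar>aug Z \<mu> k m x t\<bar> powr p)"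
  using assms wext_nonneg[of m w] by (intro lpn_powr) auto
 also have "\<dots> = (\<Sum>t<m. w t * \<bar>\<Sum>u<k. x u * Z u t\<bar> powr p) + (\<Sum>u<k. \<bar>\<mu> * x u\<bar> powr p)"
  unfolding sum_split_add by (simp add: wext_def aug_def)
 finally show ?thesis .
qed

lemma lpn_aug_cong:
 assumes "\<And>u. u < k ==> x u = y u"
 shows "lpn p {..<m + k} w (aug Z \<mu> k m x) = lpn p {..<m + k} w (aug Z \<mu> k m y)"
 using assms by (intro lpn_cong) (auto intro!: arg_cong[of _ _ abs] aug_cong)

lemma lpn_sum_le:
 assumes "1 \<le> p" "finite I" "\<And>i. i \<in> I ==> 0 \<le> w i"
 shows "lpn p I w (%t. \<Sum>i<(r::nat). \<alpha> i * f i t) \<le> (\<Sum>i<r. \<bar>\<alpha> i\<bar> * lpn p I w (f i))"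
proof (induction r)
 case 0
 then show ?case using assms by (simp add: lpn_def)
next
 case (Suc r)
 have "lpn p I w (%t. \<Sum>i<Suc r. \<alpha> i * f i t) = lpn p I w (%t. (\<Sum>i<r. \<alpha> i * f i t) + \<alpha> r * f r t)" by simp
 also have "\<dots> \<le> lpn p I w (%t. \<Sum>i<r. \<alpha> i * f i t) + lpn p I w (%t. \<alpha> r * f r t)"
  by (rule lpn_triangle[OF assms])
 also have "lpn p I w (%t. \<alpha> r * f r t) = \<bar>\<alpha> r\<bar> * lpn p I w (f r)"
  using assms by (intro lpn_cmult) auto
 finally show ?case using Suc by simp
qed

text \<open>In terms of an Auerbach basis \<open>v\<close> of the unit ball, entry j of
  \<open>x V\<close> is at most 2 k times the p-norm of the j-th entries of the
  \<open>v i V\<close>. Summed over the columns, the p-th powers for one \<open>v i\<close> amount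
  to at most its own norm to the power p, hence to at most 1.\<close>

lemma sensitivities:
 fixes V :: "nat => nat => real" and d :: nat
 assumes p: "1 \<le> p" and k: "k \<ge> 1" and \<mu>: "\<mu> > 0"
 defines "nu \<equiv> %x. lpn p {..<d + k} (wext d (%_. 1)) (aug V \<mu> k d x)"
 shows "\<exists>v \<sigma>. (\<forall>i<k. nu (v i) \<le> 1) \<and>
  (\<forall>x. nu x \<le> 1 \<longrightarrow> (\<exists>\<alpha>. (\<forall>i<k. \<bar>\<alpha> i\<bar> \<le> 2) \<and> (\<forall>u<k. x u = (\<Sum>i<k. \<alpha> i * v i u)))) \<and>
  (\<forall>j. 0 \<le> \<sigma> j) \<and> (\<Sum>j<d. \<sigma> j) \<le> (2 * real k) powr p * real k \<and>
  (\<forall>x j. nu x \<le> 1 \<longrightarrow> j < d \<longrightarrow> \<bar>\<Sum>u<k. x u * V u j\<bar> powr p \<le> \<sigma> j)"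
proof -
 have p0: "p > 0" using p by simp
 have w0: "0 \<le> wext d (%_. 1) t" for t by (simp add: wext_def)
 have nu0: "0 \<le> nu x" for x by (simp add: nu_def lpn_nonneg)
 have nuc: "nu (%u. c * x u) = \<bar>c\<bar> * nu x" for c x
  unfolding nu_def aug_cmult using p0 w0 by (rule lpn_cmult)
 define e where "e i u = (if u = i then 1 else 0 :: real)" for i u :: nat
 \<comment> \<open>This factor puts all scaled coordinate vectors \<open>c * e i\<close> into the
   unit ball.\<close>
 define c where "c = 1 / (1 + (\<Sum>i<k. nu (e i)))"
 have s0: "0 \<le> (\<Sum>i<k. nu (e i))" using nu0 by (intro sum_nonneg) auto
 have cpos: "c > 0" unfolding c_def using s0 by (intro divide_pos_pos) auto
 have "\<exists>v. (\<forall>i<k. v i \<in> {x. nu x \<le> 1}) \<and>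
  (\<forall>x\<in>{x. nu x \<le> 1}. \<exists>\<alpha>. (\<forall>i<k. \<bar>\<alpha> i\<bar> \<le> 2) \<and> (\<forall>u<k. x u = (\<Sum>i<k. \<alpha> i * v i u)))"
 proof (rule auerbach_basis)
  fix x u assume x: "x \<in> {x. nu x \<le> 1}" and u: "u < k"
  \<comment> \<open>The regularising block bounds the ball: each coordinate is at most 1 /
    \<mu>.\<close>
  have "\<bar>aug V \<mu> k d x (d + u)\<bar> \<le> nu x"
   unfolding nu_def using p0 u by (intro lpn_entry1) (auto simp: wext_def)
  then have "\<mu> * \<bar>x u\<bar> \<le> 1" using x \<mu> by (simp add: aug_def abs_mult)
  then show "\<bar>x u\<bar> \<le> 1 / \<mu>" using \<mu> by (simp add: field_simps)
 next
  fix i assume i: "i < k"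
  have "(%u. if u = i then c else 0) = (%u. c * e i u)" by (auto simp: e_def)
  moreover have "nu (%u. c * e i u) \<le> 1"
  proof -
   have "nu (e i) \<le> (\<Sum>i<k. nu (e i))" using i nu0 by (intro member_le_sum) auto
   then have "c * nu (e i) \<le> c * (1 + (\<Sum>i<k. nu (e i)))" using cpos by (intro mult_left_mono) auto
   also have "\<dots> = 1" using s0 by (simp add: c_def)
   finally show ?thesis using nuc cpos by simp
  qed
  ultimately show "(%u. if u = i then c else 0) \<in> {x. nu x \<le> 1}" by simp
 qed (rule cpos)
 then obtain v where v: "\<And>i. i < k ==> nu (v i) \<le> 1"
  and rep: "\<And>x. nu x \<le> 1 ==> \<exists>\<alpha>. (\<forall>i<k. \<bar>\<alpha> i\<bar> \<le> 2) \<and> (\<forall>u<k. x u = (\<Sum>i<k. \<alpha> i * v i u))" by auto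
 define pr where "pr x j = (\<Sum>u<k. x u * V u j)" for x j
 define \<sigma> where "\<sigma> j = (2 * real k) powr p * (\<Sum>i<k. \<bar>pr (v i) j\<bar> powr p)" for j
 have sum0: "0 \<le> (\<Sum>i<k. \<bar>pr (v i) j\<bar> powr p)" for j by (intro sum_nonneg) simp
 have "\<forall>j. 0 \<le> \<sigma> j" using sum0 by (simp add: \<sigma>_def)
 moreover have "(\<Sum>j<d. \<sigma> j) \<le> (2 * real k) powr p * real k"
 proof -
  have "(\<Sum>j<d. \<sigma> j) = (2 * real k) powr p * (\<Sum>i<k. \<Sum>j<d. \<bar>pr (v i) j\<bar> powr p)"
   unfolding \<sigma>_def sum_distrib_left[symmetric] by (subst sum.swap) simp
  also have "\<dots> \<le> (2 * real k) powr p * (\<Sum>i<k. 1)"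
  proof (intro mult_left_mono sum_mono)
   fix i assume i: "i \<in> {..<k}"
   have "(\<Sum>j<d. \<bar>pr (v i) j\<bar> powr p) \<le> nu (v i) powr p"
    unfolding nu_def by (subst lpn_aug_powr) (use p0 in \<open>auto simp: pr_def intro!: sum_nonneg\<close>)
   also have "\<dots> \<le> 1" using v[of i] i nu0[of "v i"] p0 powr_mono2[of p "nu (v i)" 1] by auto
   finally show "(\<Sum>j<d. \<bar>pr (v i) j\<bar> powr p) \<le> 1" .
  qed simp
  finally show ?thesis by simp
 qed
 moreover have "\<bar>pr x j\<bar> powr p \<le> \<sigma> j" if x: "nu x \<le> 1" for x j
 proof -
  obtain \<alpha> where \<alpha>: "\<forall>i<k. \<bar>\<alpha> i\<bar> \<le> 2" "\<forall>u<k. x u = (\<Sum>i<k. \<alpha> i * v i u)" using rep[OF x] by blast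
  define s where "s = (\<Sum>i<k. \<bar>pr (v i) j\<bar> powr p) powr (1 / p)"
  have sp: "s powr p = (\<Sum>i<k. \<bar>pr (v i) j\<bar> powr p)"
   using p0 sum0 by (simp add: s_def powr_powr)
  have s_ge: "\<bar>pr (v i) j\<bar> \<le> s" if "i < k" for i
  proof -
   have "\<bar>pr (v i) j\<bar> powr p \<le> s powr p" unfolding sp using that by (intro member_le_sum) auto
   then show ?thesis using p0 powr_less_mono2[of p s "\<bar>pr (v i) j\<bar>"]
    by (cases "\<bar>pr (v i) j\<bar> \<le> s") (auto simp: s_def)
  qed
  have "pr x j = (\<Sum>u<k. (\<Sum>i<k. \<alpha> i * v i u) * V u j)" using \<alpha>(2) by (simp add: pr_def)
  also have "\<dots> = (\<Sum>i<k. \<alpha> i * pr (v i) j)"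
   unfolding sum_distrib_right by (subst sum.swap) (simp add: pr_def sum_distrib_left mult_ac)
  finally have "\<bar>pr x j\<bar> \<le> (\<Sum>i<k. \<bar>\<alpha> i\<bar> * \<bar>pr (v i) j\<bar>)"
   using sum_abs[of "%i. \<alpha> i * pr (v i) j" "{..<k}"] by (simp add: abs_mult)
  also have "\<dots> \<le> (\<Sum>i<k. 2 * s)"
   using \<alpha>(1) s_ge by (intro sum_mono mult_mono) auto
  finally have "\<bar>pr x j\<bar> \<le> 2 * real k * s" by simp
  then have "\<bar>pr x j\<bar> powr p \<le> (2 * real k * s) powr p" using p0 by (intro powr_mono2) auto
  also have "\<dots> = \<sigma> j" using sp by (simp add: powr_mult \<sigma>_def s_def)
  finally show ?thesis .
 qed
 ultimately show ?thesis using v rep unfolding pr_def by blast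
qed

lemma bernoulli_powr:
 fixes x p :: real
 assumes "0 \<le> x" "x \<le> 1" "1 \<le> p"
 shows "1 - p * x \<le> (1 - x) powr p"
proof (cases "x = 1")
 case False
 define f where "f y = (1 - y) powr p + p * y" for y :: real
 have "f 0 \<le> f x"
 proof (rule DERIV_nonneg_imp_nondecreasing[OF assms(1)])
  fix y assume y: "0 \<le> y" "y \<le> x"
  then have y1: "y < 1" using False assms by simp
  have "(f has_real_derivative p - p * (1 - y) powr (p - 1)) (at y)"
   unfolding f_def using y1 by (auto intro!: derivative_eq_intros)
  moreover have "(1 - y) powr (p - 1) \<le> 1"
   using powr_mono2[of "p - 1" "1 - y" 1] y y1 assms by simp
  then have "0 \<le> p - p * (1 - y) powr (p - 1)"
   using assms by (simp add: mult_left_le)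
  ultimately show "\<exists>z. (f has_real_derivative z) (at y) \<and> 0 \<le> z" by blast
 qed
 then show ?thesis by (simp add: f_def)
qed (use assms in simp)

text \<open>Sampling columns with probabilities proportional to their sensitivities preserves the
 regularised norm from below; since sampled norms never exceed \<open>2 \<kappa> + 1\<close> times the
 original one, a net of the unit ball suffices.\<close>

lemma sampling_norm:
 fixes V :: "nat => nat => real" and c :: "nat => real" and d k m G :: nat
 assumes p: "1 \<le> p" and pos: "k \<ge> 1" "d \<ge> 1" "m \<ge> 1" "\<mu> > 0" and \<gamma>: "0 < \<gamma>" "\<gamma> \<le> 1"
  and c: "\<And>j. j < d ==> 0 \<le> c j" "0 < (\<Sum>j<d. c j)"
  and \<kappa>: "\<kappa> = (2 * real k) powr p * real k"
  and G: "8 * real k * (p + 2 * \<kappa> + 1) \<le> real G * \<gamma>"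
  and card: "(2 * real G + 1) ^ k * exp (- (\<gamma>\<^sup>2 * real m / (128 * 4 powr p * \<kappa>))) < \<gamma> / (1 + \<gamma>)"
 shows "\<exists>S w. (\<forall>t<m. S t < d \<and> 1 / real m \<le> w t \<and> w t \<le> 2 * real d / real m) \<and>
  (\<forall>x. lpn p {..<d + k} (wext d (%_. 1)) (aug V \<mu> k d x)
   \<le> (1 + \<gamma>) * lpn p {..<m + k} (wext m w) (aug (%u t. V u (S t)) \<mu> k m x)) \<and>
  (\<Sum>t<m. w t * c (S t)) \<le> (1 + \<gamma>) * (\<Sum>j<d. c j)"
proof -
 have p0: "p > 0" using p by simp
 define nu where "nu x = lpn p {..<d + k} (wext d (%_. 1)) (aug V \<mu> k d x)" for x
 define pr where "pr x j = (\<Sum>u<k. x u * V u j)" for x j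
 have nu0: "0 \<le> nu x" for x by (simp add: nu_def lpn_nonneg)
 have nuc: "nu (%u. a * x u) = \<bar>a\<bar> * nu x" for a x
  unfolding nu_def aug_cmult using p0 by (intro lpn_cmult wext_nonneg) auto
 have nup: "nu x powr p = (\<Sum>j<d. \<bar>pr x j\<bar> powr p) + (\<Sum>u<k. \<bar>\<mu> * x u\<bar> powr p)" for x
  unfolding nu_def pr_def using p0 by (subst lpn_aug_powr) auto
 obtain v \<sigma> where v: "\<And>i. i < k ==> nu (v i) \<le> 1"
  and rep: "\<And>x. nu x \<le> 1 ==> \<exists>\<alpha>. (\<forall>i<k. \<bar>\<alpha> i\<bar> \<le> 2) \<and> (\<forall>u<k. x u = (\<Sum>i<k. \<alpha> i * v i u))"
  and \<sigma>0: "\<And>j. 0 \<le> \<sigma> j" and \<sigma>s: "(\<Sum>j<d. \<sigma> j) \<le> \<kappa>"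
  and \<sigma>1: "\<And>x j. nu x \<le> 1 ==> j < d ==> \<bar>pr x j\<bar> powr p \<le> \<sigma> j"
  using sensitivities[OF p pos(1,4), of d V] unfolding nu_def pr_def \<kappa> by blast
 have \<kappa>0: "\<kappa> > 0" using pos by (simp add: \<kappa>)
 have \<sigma>h: "\<bar>pr x j\<bar> powr p \<le> \<sigma> j * r powr p" if "nu x \<le> r" "j < d" "r > 0" for x j r
 proof -
  have "nu (%u. (1 / r) * x u) \<le> 1" unfolding nuc using that by simp
  from \<sigma>1[OF this that(2)] have "\<bar>pr (%u. (1 / r) * x u) j\<bar> powr p \<le> \<sigma> j" .
  moreover have "pr (%u. (1 / r) * x u) j = pr x j / r"
   by (simp add: pr_def sum_divide_distrib)
  ultimately have "\<bar>pr x j / r\<bar> powr p \<le> \<sigma> j" by simp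
  then have "\<bar>pr x j\<bar> powr p / r powr p \<le> \<sigma> j" using that by (simp add: powr_divide)
  then show ?thesis using that by (simp add: pos_divide_le_eq)
 qed
 \<comment> \<open>The part \<open>\<sigma> j / (2 * \<kappa>)\<close> controls single
   contributions. The rest, at least half of the mass, is spread uniformly and keeps the weights at
   most \<open>2 * d / m\<close>.\<close>
 define P where "P j = \<sigma> j / (2 * \<kappa>) + (1 - (\<Sum>j<d. \<sigma> j) / (2 * \<kappa>)) / real d" for j
 have half: "(\<Sum>j<d. \<sigma> j) / (2 * \<kappa>) \<le> 1 / 2" "0 \<le> (\<Sum>j<d. \<sigma> j) / (2 * \<kappa>)"
  using \<sigma>s \<kappa>0 \<sigma>0 by (auto simp: field_simps intro!: sum_nonneg divide_nonneg_pos)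
 have Pd: "1 / (2 * real d) \<le> P j" for j
 proof -
  have "1 / (2 * real d) = (1 / 2) / real d" by simp
  also have "\<dots> \<le> (1 - (\<Sum>j<d. \<sigma> j) / (2 * \<kappa>)) / real d" using half pos by (intro divide_right_mono) auto
  finally show ?thesis using \<sigma>0[of j] \<kappa>0 by (simp add: P_def add_increasing)
 qed
 have P\<sigma>: "\<sigma> j / (2 * \<kappa>) \<le> P j" for j using half pos by (simp add: P_def)
 have P0: "P j > 0" for j using less_le_trans[OF _ Pd[of j], of 0] pos by simp
 have P1: "(\<Sum>j<d. P j) = 1"
 proof -
  have "(\<Sum>j<d. P j) = (\<Sum>j<d. \<sigma> j) / (2 * \<kappa>) + real d * ((1 - (\<Sum>j<d. \<sigma> j) / (2 * \<kappa>)) / real d)"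
   unfolding P_def by (simp add: sum.distrib sum_divide_distrib[symmetric])
  then show ?thesis using pos by simp
 qed
 have Ple: "P j \<le> 1" if "j < d" for j
  using member_le_sum[of j "{..<d}" P] P1 P0 that by (auto simp: less_imp_le)
 \<comment> \<open>Inverse probabilities make the sampled sums unbiased.\<close>
 define wv where "wv j = 1 / (real m * P j)" for j
 have wv0: "wv j > 0" for j using P0[of j] pos by (simp add: wv_def)
 have PW: "P j * wv j = 1 / real m" for j using P0[of j] by (simp add: wv_def)
 have wv\<sigma>: "wv j * \<sigma> j \<le> 2 * \<kappa> / real m" for j
  using P\<sigma>[of j] P0[of j] pos \<kappa>0 by (simp add: wv_def field_simps)
 \<comment> \<open>The grid runs from -2 to 2, the range of the Auerbach coefficients. Rounding all
   k of them moves a vector by at most \<open>\<nu> = k * h\<close>, since the basis vectors have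
   norm at most 1.\<close>
 define h where "h = 1 / real G * 2"
 define \<nu> where "\<nu> = real k * h"
 have Gpos: "real G > 0"
 proof -
  have "0 < 8 * real k * (p + 2 * \<kappa> + 1)" using pos p0 \<kappa>0 by (intro mult_pos_pos) auto
  then have "0 < real G * \<gamma>" using G by linarith
  then show ?thesis using \<gamma> by (simp add: zero_less_mult_iff)
 qed
 have h0: "h > 0" "real G * h = 2" using Gpos by (simp_all add: h_def)
 have \<nu>0: "\<nu> > 0" using h0 pos by (simp add: \<nu>_def)
 have \<nu>G: "4 * (p + 2 * \<kappa> + 1) * \<nu> \<le> \<gamma>"
  using G Gpos by (simp add: \<nu>_def h_def field_simps)
 have \<nu>p2: "(2 * \<kappa> + 1) * \<nu> \<le> \<gamma> / 4 - p * \<nu>"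
  using \<nu>G by (simp add: algebra_simps)
 have "0 \<le> (2 * \<kappa> + 1) * \<nu>" using \<kappa>0 \<nu>0 by simp
 then have \<nu>p: "p * \<nu> \<le> \<gamma> / 4" "(2 * \<kappa> + 1) * \<nu> \<le> \<gamma> / 4 - p * \<nu>"
  using \<nu>p2 by linarith+
 have \<nu>1: "\<nu> \<le> 1"
 proof -
  have "1 * \<nu> \<le> p * \<nu>" using p \<nu>0 by (intro mult_right_mono) auto
  then show ?thesis using \<nu>p \<gamma> by linarith
 qed
 define point where "point g = (%u. \<Sum>i<k. ((real (g i) - real G) * h) * v i u)" for g :: "nat => nat"
 define Gs where "Gs = (\<Pi>\<^sub>E i\<in>{..<k}. {..2 * G})"
 \<comment> \<open>The net has to be dense near the unit ball only, and the bound 2 on its norms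
   enters the tail estimate as \<open>2 powr p\<close>.\<close>
 define Y where "Y = {y \<in> point ` Gs. nu y \<le> 2}"
 have finGs: "finite Gs" unfolding Gs_def by (intro finite_PiE) auto
 have finY: "finite Y" unfolding Y_def using finGs by simp
 have cardY: "real (card Y) \<le> (2 * real G + 1) ^ k"
 proof -
  have "card Y \<le> card (point ` Gs)" unfolding Y_def using finGs by (intro card_mono) auto
  also have "\<dots> \<le> card Gs" by (rule card_image_le[OF finGs])
  also have "\<dots> = (2 * G + 1) ^ k" by (simp add: Gs_def card_PiE)
  finally show ?thesis by (metis (mono_tags) of_nat_Suc of_nat_mono of_nat_mult of_nat_numeral of_nat_power Suc_eq_plus1 add.commute)
 qed
 have net: "\<exists>y\<in>Y. nu (%u. x u - y u) \<le> \<nu>" if x: "nu x \<le> 1" for x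
 proof -
  obtain \<alpha> where \<alpha>: "\<forall>i<k. \<bar>\<alpha> i\<bar> \<le> 2" "\<forall>u<k. x u = (\<Sum>i<k. \<alpha> i * v i u)" using rep[OF x] by blast
  have "\<exists>g\<le>2 * G. \<bar>(real g - real G) * h - \<alpha> i\<bar> \<le> h" if "i < k" for i
   using \<alpha>(1) that h0 by (intro grid_point) auto
  then obtain g0 where g0: "\<And>i. i < k ==> g0 i \<le> 2 * G \<and> \<bar>(real (g0 i) - real G) * h - \<alpha> i\<bar> \<le> h"
   by metis
  define g where "g = restrict g0 {..<k}"
  have g: "g \<in> Gs" using g0 by (auto simp: g_def Gs_def)
  have "nu (%u. x u - point g u) = nu (%u. \<Sum>i<k. (\<alpha> i - (real (g i) - real G) * h) * v i u)"
   unfolding nu_def using \<alpha>(2)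
   by (intro lpn_aug_cong) (simp add: point_def sum_subtractf left_diff_distrib)
  also have "\<dots> \<le> (\<Sum>i<k. \<bar>\<alpha> i - (real (g i) - real G) * h\<bar> * nu (v i))"
   unfolding nu_def aug_sum using p by (intro lpn_sum_le wext_nonneg) auto
  also have "\<dots> \<le> (\<Sum>i<k. h * 1)"
   using g0 v nu0 h0 by (intro sum_mono mult_mono) (auto simp: g_def abs_minus_commute)
  finally have le: "nu (%u. x u - point g u) \<le> \<nu>" by (simp add: \<nu>_def)
  have "nu (point g) = nu (%u. x u - (x u - point g u))" by simp
  also have "\<dots> \<le> nu x + nu (%u. x u - point g u)"
   unfolding nu_def aug_diff[of V \<mu> k d x] using p by (intro lpn_triangle_diff wext_nonneg) auto
  also have "\<dots> \<le> 2" using le x \<nu>1 by simp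
  finally have "point g \<in> Y" using g by (simp add: Y_def)
  then show ?thesis using le by blast
 qed
 define \<tau> where "\<tau> y = (\<Sum>j<d. \<bar>pr y j\<bar> powr p)" for y
 define a where "a y j = wv j * \<bar>pr y j\<bar> powr p" for y j
 have "\<exists>S. (\<forall>t<m. S t < d) \<and> (\<Sum>t<m. wv (S t) * c (S t)) \<le> (1 + \<gamma>) * (\<Sum>j<d. c j) \<and>
  (\<forall>y\<in>Y. \<tau> y - \<gamma> / 4 \<le> (\<Sum>t<m. a y (S t)))"
 proof (rule sampling_potential[where P = P and R = "2 * \<kappa> / real m * 2 powr p" and T = "2 powr p" and \<gamma> = \<gamma>])
  fix y j assume y: "y \<in> Y" and j: "j < d"
  show "0 \<le> a y j" using wv0[of j] by (simp add: a_def)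
  have "a y j \<le> wv j * (\<sigma> j * 2 powr p)"
   unfolding a_def using \<sigma>h[of y 2 j] y j wv0[of j] by (intro mult_left_mono) (auto simp: Y_def)
  also have "\<dots> \<le> 2 * \<kappa> / real m * 2 powr p"
   using mult_right_mono[OF wv\<sigma>[of j], of "2 powr p"] by (simp add: mult.assoc)
  finally show "a y j \<le> 2 * \<kappa> / real m * 2 powr p" .
 next
  fix y
  show "(\<Sum>j<d. P j * a y j) = \<tau> y / real m"
   unfolding a_def mult.assoc[symmetric] PW by (simp add: \<tau>_def sum_divide_distrib)
 next
  fix y assume "y \<in> Y"
  then have "nu y powr p \<le> 2 powr p" using nu0[of y] p0 by (intro powr_mono2) (auto simp: Y_def)
  moreover have "\<tau> y \<le> nu y powr p" unfolding nup \<tau>_def by (simp add: sum_nonneg)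
  ultimately show "\<tau> y \<le> 2 powr p" by linarith
 next
  show "(\<Sum>j<d. P j * (wv j * c j)) = (\<Sum>j<d. c j) / real m"
   unfolding mult.assoc[symmetric] PW by (simp add: sum_divide_distrib)
 next
  \<comment> \<open>\<open>128 = 16 * 4 * 2\<close>: the square of the deviation \<gamma> / 4, the 4
    of the tail bound and the 2 from halving the sensitivities in \<open>P\<close>.\<close>
  have "(\<gamma> / 4)\<^sup>2 / (4 * 2 powr p * (2 * \<kappa> / real m * 2 powr p)) = \<gamma>\<^sup>2 * real m / (128 * 4 powr p * \<kappa>)"
   using powr_mult[of 2 2 p] by (simp add: power2_eq_square field_simps)
  then have "real (card Y) * exp (- ((\<gamma> / 4)\<^sup>2 / (4 * 2 powr p * (2 * \<kappa> / real m * 2 powr p))))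
    \<le> (2 * real G + 1) ^ k * exp (- (\<gamma>\<^sup>2 * real m / (128 * 4 powr p * \<kappa>)))"
   using cardY by (intro mult_mono) auto
  then show "real (card Y) * exp (- ((\<gamma> / 4)\<^sup>2 / (4 * 2 powr p * (2 * \<kappa> / real m * 2 powr p)))) < \<gamma> / (1 + \<gamma>)"
   using card by linarith
 qed (use P0 P1 finY c wv0 pos \<gamma> \<kappa>0 in \<open>auto simp: less_imp_le\<close>)
 then obtain S where S: "\<And>t. t < m ==> S t < d" "(\<Sum>t<m. wv (S t) * c (S t)) \<le> (1 + \<gamma>) * (\<Sum>j<d. c j)"
  "\<And>y. y \<in> Y ==> \<tau> y - \<gamma> / 4 \<le> (\<Sum>t<m. a y (S t))" by blast
 define w where "w t = wv (S t)" for t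
 define N where "N x = lpn p {..<m + k} (wext m w) (aug (%u t. V u (S t)) \<mu> k m x)" for x
 have w0: "0 \<le> w t" for t using wv0[of "S t"] by (simp add: w_def)
 have N0: "0 \<le> N x" for x by (simp add: N_def lpn_nonneg)
 have Np: "N x powr p = (\<Sum>t<m. a x (S t)) + (\<Sum>u<k. \<bar>\<mu> * x u\<bar> powr p)" for x
  unfolding N_def using p0 w0 by (subst lpn_aug_powr) (auto simp: a_def w_def pr_def)
 have Nc: "N (%u. a * x u) = \<bar>a\<bar> * N x" for a x
  unfolding N_def aug_cmult using p0 w0 by (intro lpn_cmult wext_nonneg) auto
 have unit: "1 \<le> (1 + \<gamma>) * N x" if x: "nu x = 1" for x
 proof -
  obtain y where y: "y \<in> Y" "nu (%u. x u - y u) \<le> \<nu>" using net[of x] x by auto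
  have nuy: "1 - \<nu> \<le> nu y"
  proof -
   have "nu x = nu (%u. y u - (y u - x u))" by simp
   also have "\<dots> \<le> nu y + nu (%u. y u - x u)"
    unfolding nu_def aug_diff[of V \<mu> k d y "%u. y u - x u"] using p by (intro lpn_triangle_diff wext_nonneg) auto
   also have "nu (%u. y u - x u) = nu (%u. x u - y u)" using nuc[of "-1" "%u. x u - y u"] by simp
   finally show ?thesis using y x by simp
  qed
  let ?b = "1 - p * \<nu> - \<gamma> / 4"
  \<comment> \<open>Passing to p-th powers costs \<open>p * \<nu>\<close> for the distance to the
    net and \<gamma> / 4 for the sampling error.\<close>
  have "1 - p * \<nu> \<le> (1 - \<nu>) powr p"
   using bernoulli_powr[of \<nu> p] \<nu>0 \<nu>1 p by simp
  also have "\<dots> \<le> nu y powr p" using nuy \<nu>1 p0 by (intro powr_mono2) auto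
  also have "\<dots> = \<tau> y + (\<Sum>u<k. \<bar>\<mu> * y u\<bar> powr p)" by (simp add: nup \<tau>_def)
  also have "\<dots> \<le> N y powr p + \<gamma> / 4" using S(3)[OF y(1)] by (simp add: Np)
  finally have b: "?b \<le> N y powr p" by simp
  have "0 \<le> p * \<nu>" using p0 \<nu>0 by simp
  then have b0: "0 \<le> ?b" "?b \<le> 1" using \<nu>p \<gamma> by linarith+
  \<comment> \<open>The p-th root is free of charge: for \<open>N y\<close> at least 1 the claim is
    trivial, and below 1 a p-th power is at most its base.\<close>
  have "?b \<le> N y"
  proof (cases "N y \<ge> 1")
   case False
   then have "N y powr p \<le> N y powr 1" using N0[of y] p by (intro powr_mono') auto
   then show ?thesis using b N0[of y] by simp
  qed (use b0 in auto)
  \<comment> \<open>Each sampled column contributes at most \<open>2 * \<kappa> / m\<close> times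
    \<open>\<nu> powr p\<close>, as its weight is matched to its sensitivity; the summand 1 is the
    regularising block.\<close>
  moreover have "N (%u. x u - y u) \<le> (2 * \<kappa> + 1) * \<nu>"
  proof -
   have "N (%u. x u - y u) powr p \<le> (\<Sum>t<m. 2 * \<kappa> / real m * \<nu> powr p) + \<nu> powr p"
    unfolding Np
   proof (intro add_mono sum_mono)
    fix t assume t: "t \<in> {..<m}"
    have "a (%u. x u - y u) (S t) \<le> wv (S t) * (\<sigma> (S t) * \<nu> powr p)"
     unfolding a_def using \<sigma>h[OF y(2) S(1) \<nu>0, of t] t wv0[of "S t"] by (intro mult_left_mono) auto
    also have "\<dots> \<le> 2 * \<kappa> / real m * \<nu> powr p"
     using mult_right_mono[OF wv\<sigma>[of "S t"], of "\<nu> powr p"] by (simp add: mult.assoc)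
    finally show "a (%u. x u - y u) (S t) \<le> 2 * \<kappa> / real m * \<nu> powr p" .
   next
    have "(\<Sum>u<k. \<bar>\<mu> * (x u - y u)\<bar> powr p) \<le> nu (%u. x u - y u) powr p"
     unfolding nup by (simp add: sum_nonneg)
    also have "\<dots> \<le> \<nu> powr p" using y(2) nu0 p0 by (intro powr_mono2) auto
    finally show "(\<Sum>u<k. \<bar>\<mu> * (x u - y u)\<bar> powr p) \<le> \<nu> powr p" .
   qed
   also have "\<dots> = (2 * \<kappa> + 1) powr 1 * \<nu> powr p" using pos \<kappa>0 by (simp add: algebra_simps)
   also have "\<dots> \<le> (2 * \<kappa> + 1) powr p * \<nu> powr p"
    using p \<kappa>0 by (intro mult_right_mono powr_mono) auto
   also have "\<dots> = ((2 * \<kappa> + 1) * \<nu>) powr p" by (simp add: powr_mult)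
   finally have le: "N (%u. x u - y u) powr p \<le> ((2 * \<kappa> + 1) * \<nu>) powr p" .
   show ?thesis
   proof (rule ccontr)
    assume "\<not> ?thesis"
    then have "((2 * \<kappa> + 1) * \<nu>) powr p < N (%u. x u - y u) powr p"
     using p0 \<kappa>0 \<nu>0 by (intro powr_less_mono2) auto
    then show False using le by simp
   qed
  qed
  moreover have "N y \<le> N x + N (%u. x u - y u)"
  proof -
   have "N y = N (%u. x u - (x u - y u))" by simp
   also have "\<dots> \<le> N x + N (%u. x u - y u)"
    unfolding N_def aug_diff[of _ \<mu> k m x "%u. x u - y u"] using p w0
    by (intro lpn_triangle_diff wext_nonneg) auto
   finally show ?thesis .
  qed
  ultimately have "1 - \<gamma> / 2 \<le> N x" using \<nu>p by linarith
  then have "(1 + \<gamma>) * (1 - \<gamma> / 2) \<le> (1 + \<gamma>) * N x" using \<gamma> by (intro mult_left_mono) auto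
  moreover have "1 \<le> (1 + \<gamma>) * (1 - \<gamma> / 2)"
   using \<gamma> mult_left_mono[of \<gamma> 1 \<gamma>] by (simp add: algebra_simps)
  ultimately show ?thesis by linarith
 qed
 have "nu x \<le> (1 + \<gamma>) * N x" for x
 proof (cases "nu x = 0")
  case True
  then show ?thesis using N0[of x] \<gamma> by simp
 next
  case False
  then have "nu x > 0" using nu0[of x] by simp
  then have "nu (%u. (1 / nu x) * x u) = 1" unfolding nuc by simp
  from unit[OF this] \<open>nu x > 0\<close> show ?thesis unfolding Nc by (simp add: field_simps)
 qed
 moreover have "1 / real m \<le> w t \<and> w t \<le> 2 * real d / real m" if "t < m" for t
 proof -
  have "real m * P (S t) \<le> real m * 1" using Ple[OF S(1)[OF that]] by (intro mult_left_mono) auto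
  then have "1 / (real m * 1) \<le> w t"
   unfolding w_def wv_def using P0[of "S t"] pos by (intro divide_left_mono) auto
  moreover have "w t \<le> 1 / (real m * (1 / (2 * real d)))"
   unfolding w_def wv_def using Pd[of "S t"] P0[of "S t"] pos
   by (intro divide_left_mono mult_left_mono mult_pos_pos) auto
  ultimately show ?thesis by simp
 qed
 moreover have "(\<Sum>t<m. w t * c (S t)) \<le> (1 + \<gamma>) * (\<Sum>j<d. c j)" using S(2) by (simp add: w_def)
 ultimately show ?thesis
  using S(1) unfolding nu_def N_def by (intro exI[of _ S] exI[of _ w]) simp
qed

section \<open>A structured language on the real RAM\<close>

text \<open>Total correctness with a time bound. The postcondition may itself be a
  \<open>runs\<close> statement, so sequencing works as for weakest preconditions.\<close>

definition runs :: "prog => ram => nat => (ram => bool) => bool" where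
 "runs P s T Q \<longleftrightarrow> (\<exists>t s'. exec P s t s' \<and> t \<le> T \<and> Q s')"

lemma runs_weaken:
 assumes "runs P s T Q" "T \<le> T'" "\<And>s'. Q s' ==> Q' s'"
 shows "runs P s T' Q'"
 using assms unfolding runs_def by (meson order_trans)

lemma runs_Do: "Q (step i s) ==> 1 \<le> T ==> runs (Do i) s T Q"
 unfolding runs_def using exec.Do by blast

lemma runs_Seq:
 assumes "runs P s T (%s'. runs P' s' T' Q)"
 shows "runs (Seq P P') s (T + T') Q"
 using assms unfolding runs_def by (meson exec.Seq add_mono)

lemma runs_Seq2:
 assumes "runs P s T Q'" "\<And>s'. Q' s' ==> runs P' s' T' Q"
 shows "runs (Seq P P') s (T + T') Q"
 using runs_Seq[OF runs_weaken[OF assms(1) order.refl assms(2)]] .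

lemma runs_Cond:
 assumes "holds b s ==> runs P s T Q" "\<not> holds b s ==> runs P' s T Q"
 shows "runs (Cond b P P') s (Suc T) Q"
 using assms unfolding runs_def by (cases "holds b s") (meson exec.CondTrue exec.CondFalse Suc_le_mono)+

text \<open>The variant proves termination and counts the rounds; a round costs the body and one
  test, and the last, failing test is the outer \<open>Suc\<close>.\<close>

lemma runs_Loop:
 assumes "J s"
  and body: "\<And>s. J s ==> holds b s ==> runs P s T (%s'. J s' \<and> \<mu> s' < \<mu> s)"
  and exit: "\<And>s. J s ==> \<not> holds b s ==> Q s"
 shows "runs (Loop b P) s (Suc (\<mu> s * Suc T)) Q"
 using assms(1)
proof (induction "\<mu> s" arbitrary: s rule: less_induct)
 case less
 show ?case
 proof (cases "holds b s")
  case False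
  then show ?thesis using exit[OF less.prems] exec.LoopFalse[OF False, of P] unfolding runs_def
   by (intro exI[of _ 1] exI[of _ s] conjI) simp_all
 next
  case True
  obtain t s' where t: "exec P s t s'" "t \<le> T" "J s'" "\<mu> s' < \<mu> s"
   using body[OF less.prems True] unfolding runs_def by blast
  obtain u s'' where u: "exec (Loop b P) s' u s''" "u \<le> Suc (\<mu> s' * Suc T)" "Q s''"
   using less.hyps[OF t(4) t(3)] unfolding runs_def by blast
  have "Suc (\<mu> s') * Suc T \<le> \<mu> s * Suc T" using t(4) by (intro mult_le_mono1) simp
  then have "Suc (t + u) \<le> Suc (\<mu> s * Suc T)" using t(2) u(2) by simp
  then show ?thesis unfolding runs_def using exec.LoopTrue[OF True t(1) u(1)] u(3) by blast
 qed
qed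

text \<open>There is no empty program, so the empty list writes a 0 into a scratch cell.\<close>

fun seqs :: "instr list => prog" where
 "seqs [] = Do (NConst (Dir 50) 0)"
| "seqs [i] = Do i"
| "seqs (i # is) = Seq (Do i) (seqs is)"

lemma runs_seqs:
 assumes "is \<noteq> []" "Q (fold step is s)" "length is \<le> T"
 shows "runs (seqs is) s T Q"
proof -
 have "is \<noteq> [] ==> exec (seqs is) s (length is) (fold step is s)"
 proof (induction "is" arbitrary: s rule: seqs.induct)
  case (2 i)
  then show ?case using exec.Do[of i s] by simp
 next
  case (3 i j "is")
  then show ?case using exec.Seq[OF exec.Do[of i s] 3(1)[of "step i s"]] by simp
 qed simp
 then show ?thesis using assms unfolding runs_def by blast
qed

section \<open>Syntax and semantics of the structured language\<close>

lemmas ram_simps = nval_def rval_def nput_def rput_def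

definition frm :: "nat set => ram => ram => bool" where
 "frm A s s' \<longleftrightarrow> rmem s' = rmem s \<and> (\<forall>q. q \<notin> A \<longrightarrow> nmem s' q = nmem s q)"

text \<open>Array indices are names of scalar cells: an operand has a fixed shape while its address
  depends on the state.\<close>

datatype opd = S nat | V nat nat | M nat nat nat

datatype nop = NPlus | NMinus | NTimes | NQuot | NRem
datatype rop = RPlus | RMinus | RTimes | RQuot
datatype cond = TN opd opd | TR opd opd

text \<open>Counted loops are the only loops, so \<open>run\<close> is a total function and the
  running time follows from the syntax once the numbers are bounded. \<open>NR\<close> converts
  naturals to reals; \<open>RGet\<close> and \<open>RPut\<close> reach the cells for input and
  output.\<close>

datatype hcom =
  NC opd nat | NM opd opd | NO nop opd opd opd
 | RC opd int | RM opd opd | RO rop opd opd opd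
 | NR opd opd | RGet opd opd | RPut opd opd
 | Sq hcom hcom | If cond hcom hcom | For nat nat hcom

text \<open>Array cell \<open>a[i,j]\<close> lives at address \<open>64 * prod_encode (i, j) + a\<close>, in the real memory shifted by
 a base address kept in natural-number cell 63; the array numbers 50 to 63 are scratch cells.
 The real cells below the base are reserved for input and output.\<close>

record hst =
 hN :: "nat => nat => nat => nat"
 hR :: "nat => nat => nat => real"
 hI :: "nat => real"
 hb :: nat

fun oarr :: "opd => nat" where
 "oarr (S a) = a" | "oarr (V a i) = a" | "oarr (M a i j) = a"

fun orow :: "hst => opd => nat" where
 "orow s (S a) = 0" | "orow s (V a i) = hN s i 0 0" | "orow s (M a i j) = hN s i 0 0"

fun ocol :: "hst => opd => nat" where
 "ocol s (S a) = 0" | "ocol s (V a i) = 0" | "ocol s (M a i j) = hN s j 0 0"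

fun owf :: "opd => bool" where
 "owf (S a) \<longleftrightarrow> a < 50" | "owf (V a i) \<longleftrightarrow> a < 50 \<and> i < 50" | "owf (M a i j) \<longleftrightarrow> a < 50 \<and> i < 50 \<and> j < 50"

definition nv :: "hst => opd => nat" where
 "nv s x = hN s (oarr x) (orow s x) (ocol s x)"

definition rv :: "hst => opd => real" where
 "rv s x = hR s (oarr x) (orow s x) (ocol s x)"

definition upd3 :: "(nat => nat => nat => 'a) => nat => nat => nat => 'a => nat => nat => nat => 'a" where
 "upd3 f a i j v = (%a' i' j'. if a' = a \<and> i' = i \<and> j' = j then v else f a' i' j')"

definition setn :: "hst => opd => nat => hst" where
 "setn s x v = s\<lparr>hN := upd3 (hN s) (oarr x) (orow s x) (ocol s x) v\<rparr>"

definition setr :: "hst => opd => real => hst" where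
 "setr s x v = s\<lparr>hR := upd3 (hR s) (oarr x) (orow s x) (ocol s x) v\<rparr>"

fun nopv :: "nop => nat => nat => nat" where
 "nopv NPlus x y = x + y" | "nopv NMinus x y = x - y" | "nopv NTimes x y = x * y"
| "nopv NQuot x y = x div y" | "nopv NRem x y = x mod y"

fun ropv :: "rop => real => real => real" where
 "ropv RPlus x y = x + y" | "ropv RMinus x y = x - y" | "ropv RTimes x y = x * y" | "ropv RQuot x y = x / y"

fun evc :: "cond => hst => bool" where
 "evc (TN x y) s = (nv s x < nv s y)" | "evc (TR x y) s = (rv s x < rv s y)"

primrec iter :: "(hst => hst) => nat => nat => hst => hst" where
 "iter f v 0 s = s"
| "iter f v (Suc i) s = f (setn (iter f v i s) (S v) i)"

text \<open>A loop counter ends at the bound, as it does in the compiled loop. Input and output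
  outside the reserved area are ignored, so they cannot touch the arrays.\<close>

primrec run :: "hcom => hst => hst" where
 "run (NC z c) = (%s. setn s z c)"
| "run (NM z x) = (%s. setn s z (nv s x))"
| "run (NO p z x y) = (%s. setn s z (nopv p (nv s x) (nv s y)))"
| "run (RC z c) = (%s. setr s z (of_int c))"
| "run (RM z x) = (%s. setr s z (rv s x))"
| "run (RO p z x y) = (%s. setr s z (ropv p (rv s x) (rv s y)))"
| "run (NR z x) = (%s. setr s z (real (nv s x)))"
| "run (RGet z x) = (%s. if nv s x < hb s then setr s z (hI s (nv s x)) else s)"
| "run (RPut x y) = (%s. if nv s x < hb s then s\<lparr>hI := (hI s)(nv s x := rv s y)\<rparr> else s)"
| "run (Sq P Q) = (%s. run Q (run P s))"
| "run (If c P Q) = (%s. if evc c s then run P s else run Q s)"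
| "run (For v b P) = (%s. setn (iter (run P) v (hN s b 0 0) s) (S v) (hN s b 0 0))"

text \<open>Together with \<open>rmods\<close> and \<open>puts\<close> this provides frame
  conditions by syntax alone.\<close>

primrec nmods :: "hcom => nat set" where
 "nmods (NC z c) = {oarr z}" | "nmods (NM z x) = {oarr z}" | "nmods (NO p z x y) = {oarr z}"
| "nmods (RC z c) = {}" | "nmods (RM z x) = {}" | "nmods (RO p z x y) = {}" | "nmods (NR z x) = {}"
| "nmods (RGet z x) = {}" | "nmods (RPut x y) = {}"
| "nmods (Sq P Q) = nmods P \<union> nmods Q" | "nmods (If c P Q) = nmods P \<union> nmods Q"
| "nmods (For v b P) = insert v (nmods P)"

primrec rmods :: "hcom => nat set" where
 "rmods (NC z c) = {}" | "rmods (NM z x) = {}" | "rmods (NO p z x y) = {}"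
| "rmods (RC z c) = {oarr z}" | "rmods (RM z x) = {oarr z}" | "rmods (RO p z x y) = {oarr z}"
| "rmods (NR z x) = {oarr z}" | "rmods (RGet z x) = {oarr z}" | "rmods (RPut x y) = {}"
| "rmods (Sq P Q) = rmods P \<union> rmods Q" | "rmods (If c P Q) = rmods P \<union> rmods Q"
| "rmods (For v b P) = rmods P"

primrec puts :: "hcom => bool" where
 "puts (NC z c) = False" | "puts (NM z x) = False" | "puts (NO p z x y) = False"
| "puts (RC z c) = False" | "puts (RM z x) = False" | "puts (RO p z x y) = False" | "puts (NR z x) = False"
| "puts (RGet z x) = False" | "puts (RPut x y) = True"
| "puts (Sq P Q) = (puts P \<or> puts Q)" | "puts (If c P Q) = (puts P \<or> puts Q)" | "puts (For v b P) = puts P"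

fun cwf :: "cond => bool" where
 "cwf (TN x y) \<longleftrightarrow> owf x \<and> owf y" | "cwf (TR x y) \<longleftrightarrow> owf x \<and> owf y"

text \<open>The conditions on a loop fix its number of rounds on entry and let the same counter
  drive the compiled loop.\<close>

primrec wf_com :: "hcom => bool" where
 "wf_com (NC z c) = owf z" | "wf_com (NM z x) = (owf z \<and> owf x)" | "wf_com (NO p z x y) = (owf z \<and> owf x \<and> owf y)"
| "wf_com (RC z c) = owf z" | "wf_com (RM z x) = (owf z \<and> owf x)" | "wf_com (RO p z x y) = (owf z \<and> owf x \<and> owf y)"
| "wf_com (NR z x) = (owf z \<and> owf x)" | "wf_com (RGet z x) = (owf z \<and> owf x)" | "wf_com (RPut x y) = (owf x \<and> owf y)"
| "wf_com (Sq P Q) = (wf_com P \<and> wf_com Q)" | "wf_com (If c P Q) = (cwf c \<and> wf_com P \<and> wf_com Q)"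
| "wf_com (For v b P) = (v < 50 \<and> b < 50 \<and> v \<noteq> b \<and> v \<notin> nmods P \<and> b \<notin> nmods P \<and> wf_com P)"

text \<open>Such commands produce no number above 1 and above all those already present. Natural
  numbers cost time proportional to their value, so the main program is kept in this fragment and
  its larger constants are prepared in cells beforehand.\<close>

primrec nogrow :: "hcom => bool" where
 "nogrow (NC z c) = (c \<le> 1)" | "nogrow (NM z x) = True" | "nogrow (NO p z x y) = (p \<notin> {NPlus, NTimes})"
| "nogrow (RC z c) = True" | "nogrow (RM z x) = True" | "nogrow (RO p z x y) = True" | "nogrow (NR z x) = True"
| "nogrow (RGet z x) = True" | "nogrow (RPut x y) = True"
| "nogrow (Sq P Q) = (nogrow P \<and> nogrow Q)" | "nogrow (If c P Q) = (nogrow P \<and> nogrow Q)" | "nogrow (For v b P) = nogrow P"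

lemma hb_setn[simp]: "hb (setn s x v) = hb s" "hb (setr s x w) = hb s"
 by (simp_all add: setn_def setr_def)

lemma hI_setn[simp]: "hI (setn s x v) = hI s" "hI (setr s x w) = hI s"
 by (simp_all add: setn_def setr_def)

lemma hN_setr[simp]: "hN (setr s x v) = hN s" by (simp add: setr_def)
lemma hR_setn[simp]: "hR (setn s x v) = hR s" by (simp add: setn_def)

lemma hb_iter: "(\<And>s. hb (f s) = hb s) ==> hb (iter f v n s) = hb s" by (induction n) auto
lemma hb_run[simp]: "hb (run P s) = hb s"
 by (induction P arbitrary: s) (auto simp: hb_iter)

lemma hN_setn_other: "a \<noteq> oarr x ==> hN (setn s x v) a = hN s a"
 by (auto simp: setn_def upd3_def fun_eq_iff)
lemma hR_setr_other: "a \<noteq> oarr x ==> hR (setr s x v) a = hR s a"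
 by (auto simp: setr_def upd3_def fun_eq_iff)

lemma hN_iter: "(\<And>s. hN (f s) a = hN s a) ==> a \<noteq> v ==> hN (iter f v n s) a = hN s a"
 by (induction n) (auto simp: hN_setn_other)
lemma hR_iter: "(\<And>s. hR (f s) a = hR s a) ==> hR (iter f v n s) a = hR s a"
 by (induction n) auto
lemma hI_iter: "(\<And>s. hI (f s) = hI s) ==> hI (iter f v n s) = hI s"
 by (induction n) auto

lemma hN_run: "a \<notin> nmods P ==> hN (run P s) a = hN s a"
 by (induction P arbitrary: s) (auto simp: hN_setn_other hN_iter)
lemma hR_run: "a \<notin> rmods P ==> hR (run P s) a = hR s a"
 by (induction P arbitrary: s) (auto simp: hR_setr_other hR_iter)
lemma hI_run: "\<not> puts P ==> hI (run P s) = hI s"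
 by (induction P arbitrary: s) (auto simp: hI_iter)

definition bnd :: "nat => hst => bool" where
 "bnd X s \<longleftrightarrow> (\<forall>a<50. \<forall>i j. hN s a i j \<le> X)"

text \<open>The bound must hold in all intermediate states, because the time of an address
  computation depends on the indices in use at that moment.\<close>

primrec safe :: "nat => hcom => hst => bool" where
 "safe X (NC z c) = (%s. bnd X s \<and> bnd X (run (NC z c) s))"
| "safe X (NM z x) = (%s. bnd X s \<and> bnd X (run (NM z x) s))"
| "safe X (NO p z x y) = (%s. bnd X s \<and> bnd X (run (NO p z x y) s))"
| "safe X (RC z c) = bnd X" | "safe X (RM z x) = bnd X" | "safe X (RO p z x y) = bnd X"
| "safe X (NR z x) = bnd X" | "safe X (RGet z x) = bnd X" | "safe X (RPut x y) = bnd X"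
| "safe X (Sq P Q) = (%s. safe X P s \<and> safe X Q (run P s))"
| "safe X (If c P Q) = (%s. bnd X s \<and> (if evc c s then safe X P s else safe X Q s))"
| "safe X (For v b P) = (%s. bnd X s \<and>
  (\<forall>i<hN s b 0 0. safe X P (setn (iter (run P) v i s) (S v) i)))"

lemma bnd_setn: "bnd X s ==> v \<le> X ==> bnd X (setn s x v)"
 by (auto simp: bnd_def setn_def upd3_def)

lemma bnd_setr[simp]: "bnd X (setr s x v) = bnd X s"
 by (simp add: bnd_def)

lemma bnd_nv: "bnd X s ==> owf x ==> nv s x \<le> X"
 by (cases x) (auto simp: bnd_def nv_def)

lemma nogrow_safe:
 assumes "nogrow P" "wf_com P" "bnd X s" "1 \<le> X"
 shows "safe X P s \<and> bnd X (run P s)"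
 using assms
proof (induction P arbitrary: s)
 case (NO p z x y)
 then have "nv s x \<le> X" by (intro bnd_nv) auto
 then have "nopv p (nv s x) (nv s y) \<le> X"
  using NO by (cases p) (auto intro: order_trans[OF div_le_dividend] order_trans[OF mod_less_eq_dividend])
 then show ?case using NO by (simp add: bnd_setn)
next
 case (For v b P)
 let ?n = "hN s b 0 0"
 have IH: "safe X P s' \<and> bnd X (run P s')" if "bnd X s'" for s'
  using For.IH[of s'] For.prems that by simp
 have n: "?n \<le> X" using For.prems by (simp add: bnd_def)
 have it: "i \<le> ?n ==> bnd X (iter (run P) v i s)" for i
 proof (induction i)
  case (Suc i)
  then have "bnd X (setn (iter (run P) v i s) (S v) i)" using n by (intro bnd_setn) auto
  then show ?case using IH by simp
 qed (use For.prems in simp)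
 have "safe X P (setn (iter (run P) v i s) (S v) i)" if "i < ?n" for i
  using IH[of "setn (iter (run P) v i s) (S v) i"] that n it[of i] bnd_setn[of X "iter (run P) v i s" i "S v"] by simp
 then show ?case using For.prems(3) bnd_setn[OF it[of ?n] n, of "S v"] by simp
qed (auto simp: bnd_setn bnd_nv, auto simp: bnd_def)

section \<open>Address computation and natural-number arithmetic\<close>

fun ldix :: "opd => instr list" where
 "ldix (S a) = []"
| "ldix (V a i) = [NAdd (Dir 59) (Dir 59) (Dir i)]"
| "ldix (M a i j) = [NAdd (Dir 59) (Dir 59) (Dir i), NAdd (Dir 60) (Dir 60) (Dir j)]"

text \<open>With addition only, the pairing \<open>prod_encode (i, j) = triangle (i + j) + i\<close>
  is computed by summing the numbers up to i + j. Six doublings multiply by 64, the array number is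
  added, and for real arrays also the base from cell 63.\<close>

definition adr :: "bool => nat => opd => prog" where
 "adr re r x = Seq
   (seqs ([NConst (Dir 59) 0, NConst (Dir 60) 0] @ ldix x @
    [NAdd (Dir 60) (Dir 60) (Dir 59), NConst (Dir 61) 0, NConst (Dir r) 0, NConst (Dir 62) 1]))
   (Seq (Loop (NLess (Dir 61) (Dir 60)) (seqs [NAdd (Dir 61) (Dir 61) (Dir 62), NAdd (Dir r) (Dir r) (Dir 61)]))
   (seqs ([NAdd (Dir r) (Dir r) (Dir 59)] @ replicate 6 (NAdd (Dir r) (Dir r) (Dir r)) @
    [NConst (Dir 61) (oarr x), NAdd (Dir r) (Dir r) (Dir 61)] @
    (if re then [NAdd (Dir r) (Dir r) (Dir 63)] else []))))"

definition cell :: "nat => nat => nat => nat" where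
 "cell a i j = 64 * prod_encode (i, j) + a"

lemma cell_inj: "a < 64 ==> a' < 64 ==> cell a i j = cell a' i' j' \<longleftrightarrow> a = a' \<and> i = i' \<and> j = j'"
proof
 assume a: "a < 64" "a' < 64" and eq: "cell a i j = cell a' i' j'"
 then have "cell a i j mod 64 = cell a' i' j' mod 64" "cell a i j div 64 = cell a' i' j' div 64" by auto
 then have "a = a'" "prod_encode (i, j) = prod_encode (i', j')" using a by (auto simp: cell_def)
 then show "a = a' \<and> i = i' \<and> j = j'" by simp
qed auto

text \<open>Scalars therefore live at the address equal to their array number, in agreement with the
  input convention for n, d and k.\<close>

lemma cell_0: "cell a 0 0 = a"
 by (simp add: cell_def prod_encode_def)

lemma cell_temp: "a < 50 ==> 50 \<le> q ==> q < 64 ==> cell a i j \<noteq> q"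
 using cell_inj[of a q i j 0 0] by (auto simp: cell_0)

text \<open>The scratch cells 50 to 62 are left unconstrained, so code confined to them preserves
  the relation.\<close>

definition rel :: "ram => hst => bool" where
 "rel s h \<longleftrightarrow> nmem s 63 = hb h \<and>
   (\<forall>a<50. \<forall>i j. nmem s (cell a i j) = hN h a i j \<and> rmem s (hb h + cell a i j) = hR h a i j) \<and>
   (\<forall>x<hb h. rmem s x = hI h x)"

lemma rel_N: "rel s h ==> a < 50 ==> nmem s (cell a i j) = hN h a i j"
 by (simp add: rel_def)

lemma rel_N0: "rel s h ==> a < 50 ==> nmem s a = hN h a 0 0"
 using rel_N[of s h a 0 0] by (simp add: cell_0)

lemma rel_frm:
 assumes "rel s h" "frm A s s'" "A \<subseteq> {50..<63}"
 shows "rel s' h"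
proof -
 have "cell a i j \<notin> A" if "a < 50" for a i j
  using cell_temp[OF that, of "cell a i j" i j] assms(3) by auto
 moreover have "63 \<notin> A" using assms(3) by auto
 ultimately show ?thesis using assms(1,2) by (auto simp: rel_def frm_def)
qed

lemma replicate6: "replicate 6 x = [x, x, x, x, x, x]"
 by (simp add: numeral_eq_Suc)

lemma runs_adr:
 assumes rel: "rel s h" and x: "owf x" and r: "r \<in> {56, 57, 58}"
  and bd: "orow h x \<le> X" "ocol h x \<le> X"
 shows "runs (adr re r x) s (25 + 6 * X) (%s'. frm {r, 59, 60, 61, 62} s s' \<and>
  nmem s' r = (if re then hb h else 0) + cell (oarr x) (orow h x) (ocol h x))"
proof -
 let ?I = "orow h x" let ?J = "ocol h x"
 let ?F = "{r, 59, 60, 61, 62}"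
 have rr: "r \<noteq> 59" "r \<noteq> 60" "r \<noteq> 61" "r \<noteq> 62" "r \<noteq> 63" using r by auto
 have "runs (adr re r x) s (8 + (Suc ((?I + ?J) * Suc 2) + 15)) (%s'. frm ?F s s' \<and>
  nmem s' r = (if re then hb h else 0) + cell (oarr x) ?I ?J)"
  unfolding adr_def
 proof (rule runs_Seq2)
  show "runs (seqs ([NConst (Dir 59) 0, NConst (Dir 60) 0] @ ldix x @
    [NAdd (Dir 60) (Dir 60) (Dir 59), NConst (Dir 61) 0, NConst (Dir r) 0, NConst (Dir 62) 1])) s 8
   (%s'. frm ?F s s' \<and> nmem s' 59 = ?I \<and> nmem s' 60 = ?I + ?J \<and> nmem s' 61 = 0 \<and> nmem s' r = 0 \<and> nmem s' 62 = 1)"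
   using rr x rel_N0[OF rel] by (intro runs_seqs; cases x) (auto simp: ram_simps frm_def)
 next
  fix s1 assume s1: "frm ?F s s1 \<and> nmem s1 59 = ?I \<and> nmem s1 60 = ?I + ?J \<and> nmem s1 61 = 0 \<and> nmem s1 r = 0 \<and> nmem s1 62 = 1"
  let ?J1 = "%t. frm ?F s t \<and> nmem t 59 = ?I \<and> nmem t 60 = ?I + ?J \<and> nmem t 61 \<le> ?I + ?J \<and> nmem t r = triangle (nmem t 61) \<and> nmem t 62 = 1"
  show "runs (Seq (Loop (NLess (Dir 61) (Dir 60)) (seqs [NAdd (Dir 61) (Dir 61) (Dir 62), NAdd (Dir r) (Dir r) (Dir 61)]))
   (seqs ([NAdd (Dir r) (Dir r) (Dir 59)] @ replicate 6 (NAdd (Dir r) (Dir r) (Dir r)) @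
    [NConst (Dir 61) (oarr x), NAdd (Dir r) (Dir r) (Dir 61)] @
    (if re then [NAdd (Dir r) (Dir r) (Dir 63)] else [])))) s1 (Suc ((?I + ?J) * Suc 2) + 15) (%s'. frm ?F s s' \<and>
  nmem s' r = (if re then hb h else 0) + cell (oarr x) ?I ?J)"
  proof (rule runs_Seq2)
   have "runs (Loop (NLess (Dir 61) (Dir 60)) (seqs [NAdd (Dir 61) (Dir 61) (Dir 62), NAdd (Dir r) (Dir r) (Dir 61)]))
     s1 (Suc ((?I + ?J - nmem s1 61) * Suc 2)) (%t. ?J1 t \<and> nmem t 61 = ?I + ?J)"
   proof (rule runs_Loop[where J = ?J1 and \<mu> = "%t. ?I + ?J - nmem t 61"])
    show "?J1 s1" using s1 by simp
   next
    fix t assume t: "?J1 t" "holds (NLess (Dir 61) (Dir 60)) t"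
    show "runs (seqs [NAdd (Dir 61) (Dir 61) (Dir 62), NAdd (Dir r) (Dir r) (Dir 61)]) t 2
     (%t'. ?J1 t' \<and> ?I + ?J - nmem t' 61 < ?I + ?J - nmem t 61)"
     using t rr by (intro runs_seqs) (auto simp: ram_simps frm_def)
   next
    fix t assume "?J1 t" "\<not> holds (NLess (Dir 61) (Dir 60)) t"
    then show "?J1 t \<and> nmem t 61 = ?I + ?J" by (auto simp: ram_simps)
   qed
   then show "runs (Loop (NLess (Dir 61) (Dir 60)) (seqs [NAdd (Dir 61) (Dir 61) (Dir 62), NAdd (Dir r) (Dir r) (Dir 61)]))
     s1 (Suc ((?I + ?J) * Suc 2)) (%t. ?J1 t \<and> nmem t 61 = ?I + ?J)"
    using s1 by simp
  next
   fix t assume t: "?J1 t \<and> nmem t 61 = ?I + ?J"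
   have h: "nmem t 63 = hb h" using t rel rr by (auto simp: frm_def rel_def)
   show "runs (seqs ([NAdd (Dir r) (Dir r) (Dir 59)] @ replicate 6 (NAdd (Dir r) (Dir r) (Dir r)) @
    [NConst (Dir 61) (oarr x), NAdd (Dir r) (Dir r) (Dir 61)] @
    (if re then [NAdd (Dir r) (Dir r) (Dir 63)] else []))) t 15 (%s'. frm ?F s s' \<and>
     nmem s' r = (if re then hb h else 0) + cell (oarr x) ?I ?J)"
    unfolding replicate6
    using t rr h by (intro runs_seqs; cases re)
     (auto simp: ram_simps frm_def cell_def prod_encode_def)
  qed
 qed
 then show ?thesis by (rule runs_weaken) (use bd in auto)
qed

text \<open>The arithmetic routines read their arguments from cells 54 and 55 and leave the result in
 cell 53.\<close>

fun nopc :: "nop => prog" where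
 "nopc NPlus = seqs [NAdd (Dir 53) (Dir 54) (Dir 55)]"
| "nopc NMinus = seqs [NSub (Dir 53) (Dir 54) (Dir 55)]"
| "nopc NTimes = Seq (seqs [NConst (Dir 53) 0, NConst (Dir 50) 0, NConst (Dir 51) 1])
   (Loop (NLess (Dir 50) (Dir 55)) (seqs [NAdd (Dir 53) (Dir 53) (Dir 54), NAdd (Dir 50) (Dir 50) (Dir 51)]))"
| "nopc NQuot = Seq (seqs [NConst (Dir 53) 0, NConst (Dir 50) 0, NConst (Dir 51) 1, NAdd (Dir 52) (Dir 54) (Dir 51)])
   (Cond (NLess (Dir 50) (Dir 55))
    (Loop (NLess (Dir 55) (Dir 52)) (seqs [NSub (Dir 52) (Dir 52) (Dir 55), NAdd (Dir 53) (Dir 53) (Dir 51)]))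
    (Do (NConst (Dir 50) 0)))"
| "nopc NRem = Seq (seqs [NConst (Dir 50) 0, NConst (Dir 51) 1, NAdd (Dir 52) (Dir 54) (Dir 51)])
   (Seq (Cond (NLess (Dir 50) (Dir 55))
    (Loop (NLess (Dir 55) (Dir 52)) (seqs [NSub (Dir 52) (Dir 52) (Dir 55)]))
    (Do (NConst (Dir 50) 0)))
   (seqs [NSub (Dir 53) (Dir 52) (Dir 51)]))"

lemma runs_nopc:
 assumes bd: "nmem s 54 \<le> X" "nmem s 55 \<le> X"
 shows "runs (nopc p) s (20 + 4 * X) (%s'. frm {50..53} s s' \<and> nmem s' 53 = nopv p (nmem s 54) (nmem s 55))"
proof (cases p)
 case NPlus
 then show ?thesis by (auto intro!: runs_Do simp: ram_simps frm_def)
next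
 case NMinus
 then show ?thesis by (auto intro!: runs_Do simp: ram_simps frm_def)
next
 case NTimes
 let ?J = "%t. frm {50..53} s t \<and> nmem t 51 = 1 \<and> nmem t 50 \<le> nmem s 55 \<and> nmem t 53 = nmem s 54 * nmem t 50"
 have "runs (nopc p) s (3 + Suc (nmem s 55 * Suc 2)) (%s'. frm {50..53} s s' \<and> nmem s' 53 = nopv p (nmem s 54) (nmem s 55))"
  unfolding NTimes nopc.simps
 proof (rule runs_Seq2)
  show "runs (seqs [NConst (Dir 53) 0, NConst (Dir 50) 0, NConst (Dir 51) 1]) s 3 (%t. ?J t \<and> nmem t 50 = 0)"
   by (intro runs_seqs) (auto simp: ram_simps frm_def)
 next
  fix s1 assume s1: "?J s1 \<and> nmem s1 50 = 0"
  have "runs (Loop (NLess (Dir 50) (Dir 55)) (seqs [NAdd (Dir 53) (Dir 53) (Dir 54), NAdd (Dir 50) (Dir 50) (Dir 51)])) s1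
   (Suc ((nmem s 55 - nmem s1 50) * Suc 2)) (%s'. frm {50..53} s s' \<and> nmem s' 53 = nopv NTimes (nmem s 54) (nmem s 55))"
  proof (rule runs_Loop[where J = ?J and \<mu> = "%t. nmem s 55 - nmem t 50"])
   fix t assume t: "?J t" "holds (NLess (Dir 50) (Dir 55)) t"
   show "runs (seqs [NAdd (Dir 53) (Dir 53) (Dir 54), NAdd (Dir 50) (Dir 50) (Dir 51)]) t 2
    (%t'. ?J t' \<and> nmem s 55 - nmem t' 50 < nmem s 55 - nmem t 50)"
    using t by (intro runs_seqs) (auto simp: ram_simps frm_def algebra_simps)
  next
   fix t assume t: "?J t" "\<not> holds (NLess (Dir 50) (Dir 55)) t"
   then have "nmem t 50 = nmem s 55" by (auto simp: ram_simps frm_def)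
   then show "frm {50..53} s t \<and> nmem t 53 = nopv NTimes (nmem s 54) (nmem s 55)" using t by simp
  qed (use s1 in auto)
  then show "runs (Loop (NLess (Dir 50) (Dir 55)) (seqs [NAdd (Dir 53) (Dir 53) (Dir 54), NAdd (Dir 50) (Dir 50) (Dir 51)])) s1
   (Suc (nmem s 55 * Suc 2)) (%s'. frm {50..53} s s' \<and> nmem s' 53 = nopv NTimes (nmem s 54) (nmem s 55))"
   using s1 by simp
 qed
 then show ?thesis by (rule runs_weaken) (use bd in auto)
next
 case NQuot
 let ?x = "nmem s 54" let ?y = "nmem s 55"
 \<comment> \<open>Cell 52 holds the rest of the dividend plus 1: the machine tests strict order
   only, and \<open>y < rest + 1\<close> expresses \<open>y \<le> rest\<close>.\<close>
 let ?J = "%t. frm {50..53} s t \<and> nmem t 51 = 1 \<and> 1 \<le> nmem t 52 \<and> nmem t 53 * ?y + nmem t 52 = ?x + 1"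
 have "runs (nopc p) s (4 + Suc (Suc (Suc ?x * Suc 2))) (%s'. frm {50..53} s s' \<and> nmem s' 53 = nopv p ?x ?y)"
  unfolding NQuot nopc.simps
 proof (rule runs_Seq2)
  show "runs (seqs [NConst (Dir 53) 0, NConst (Dir 50) 0, NConst (Dir 51) 1, NAdd (Dir 52) (Dir 54) (Dir 51)]) s 4
   (%t. ?J t \<and> nmem t 50 = 0 \<and> nmem t 53 = 0)"
   by (intro runs_seqs) (auto simp: ram_simps frm_def)
 next
  fix s1 assume s1: "?J s1 \<and> nmem s1 50 = 0 \<and> nmem s1 53 = 0"
  have y: "nmem t 55 = ?y" if "?J t" for t using that by (auto simp: frm_def)
  show "runs (Cond (NLess (Dir 50) (Dir 55))
    (Loop (NLess (Dir 55) (Dir 52)) (seqs [NSub (Dir 52) (Dir 52) (Dir 55), NAdd (Dir 53) (Dir 53) (Dir 51)]))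
    (Do (NConst (Dir 50) 0))) s1 (Suc (Suc (Suc ?x * Suc 2))) (%s'. frm {50..53} s s' \<and> nmem s' 53 = nopv NQuot ?x ?y)"
  proof (rule runs_Cond)
   assume "holds (NLess (Dir 50) (Dir 55)) s1"
   then have y0: "?y > 0" using s1 by (auto simp: ram_simps frm_def)
   have "runs (Loop (NLess (Dir 55) (Dir 52)) (seqs [NSub (Dir 52) (Dir 52) (Dir 55), NAdd (Dir 53) (Dir 53) (Dir 51)])) s1
     (Suc (nmem s1 52 * Suc 2)) (%s'. frm {50..53} s s' \<and> nmem s' 53 = nopv NQuot ?x ?y)"
   proof (rule runs_Loop[where J = ?J and \<mu> = "%t. nmem t 52"])
    fix t assume t: "?J t" "holds (NLess (Dir 55) (Dir 52)) t"
    have "?y < nmem t 52" using t y[of t] by (simp add: ram_simps)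
    then show "runs (seqs [NSub (Dir 52) (Dir 52) (Dir 55), NAdd (Dir 53) (Dir 53) (Dir 51)]) t 2
     (%t'. ?J t' \<and> nmem t' 52 < nmem t 52)"
     using t y[of t] y0 by (intro runs_seqs) (auto simp: ram_simps frm_def)
   next
    fix t assume t: "?J t" "\<not> holds (NLess (Dir 55) (Dir 52)) t"
    then have le: "nmem t 52 \<le> ?y" using y[of t] by (simp add: ram_simps)
    obtain c where c: "nmem t 52 = Suc c" using t by (cases "nmem t 52") auto
    have "?x = c + nmem t 53 * ?y" using t c by simp
    then have "?x div ?y = nmem t 53" using c le y0 by simp
    then show "frm {50..53} s t \<and> nmem t 53 = nopv NQuot ?x ?y" using t by simp
   qed (use s1 in auto)
   moreover have "nmem s1 52 = Suc ?x" using s1 by auto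
   ultimately show "runs (Loop (NLess (Dir 55) (Dir 52)) (seqs [NSub (Dir 52) (Dir 52) (Dir 55), NAdd (Dir 53) (Dir 53) (Dir 51)])) s1
     (Suc (Suc ?x * Suc 2)) (%s'. frm {50..53} s s' \<and> nmem s' 53 = nopv NQuot ?x ?y)" by simp
  next
   \<comment> \<open>A divisor 0 would make the loop run forever; the result 0 agrees with
     \<open>div\<close>.\<close>
   assume "\<not> holds (NLess (Dir 50) (Dir 55)) s1"
   then have "?y = 0" using s1 by (auto simp: ram_simps frm_def)
   then show "runs (Do (NConst (Dir 50) 0)) s1 (Suc (Suc ?x * Suc 2)) (%s'. frm {50..53} s s' \<and> nmem s' 53 = nopv NQuot ?x ?y)"
    using s1 by (intro runs_Do) (auto simp: ram_simps frm_def)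
  qed
 qed
 then show ?thesis by (rule runs_weaken) (use bd in auto)
next
 case NRem
 let ?x = "nmem s 54" let ?y = "nmem s 55"
 let ?J = "%t. frm {50..53} s t \<and> nmem t 51 = 1 \<and> 1 \<le> nmem t 52 \<and> nmem t 52 \<le> ?x + 1 \<and> (nmem t 52 - 1) mod ?y = ?x mod ?y"
 have y: "nmem t 55 = ?y" if "?J t" for t using that by (auto simp: frm_def)
 have "runs (nopc p) s (3 + (Suc (Suc (Suc ?x * Suc 1)) + 1)) (%s'. frm {50..53} s s' \<and> nmem s' 53 = nopv p ?x ?y)"
  unfolding NRem nopc.simps
 proof (rule runs_Seq2)
  show "runs (seqs [NConst (Dir 50) 0, NConst (Dir 51) 1, NAdd (Dir 52) (Dir 54) (Dir 51)]) s 3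
   (%t. ?J t \<and> nmem t 50 = 0 \<and> nmem t 52 = Suc ?x)"
   by (intro runs_seqs) (auto simp: ram_simps frm_def)
 next
  fix s1 assume s1: "?J s1 \<and> nmem s1 50 = 0 \<and> nmem s1 52 = Suc ?x"
  show "runs (Seq (Cond (NLess (Dir 50) (Dir 55))
    (Loop (NLess (Dir 55) (Dir 52)) (seqs [NSub (Dir 52) (Dir 52) (Dir 55)]))
    (Do (NConst (Dir 50) 0))) (seqs [NSub (Dir 53) (Dir 52) (Dir 51)])) s1 (Suc (Suc (Suc ?x * Suc 1)) + 1)
    (%s'. frm {50..53} s s' \<and> nmem s' 53 = nopv NRem ?x ?y)"
  proof (rule runs_Seq2)
   show "runs (Cond (NLess (Dir 50) (Dir 55))
    (Loop (NLess (Dir 55) (Dir 52)) (seqs [NSub (Dir 52) (Dir 52) (Dir 55)]))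
    (Do (NConst (Dir 50) 0))) s1 (Suc (Suc (Suc ?x * Suc 1))) (%t. ?J t \<and> nmem t 52 - 1 = ?x mod ?y)"
   proof (rule runs_Cond)
    assume "holds (NLess (Dir 50) (Dir 55)) s1"
    then have y0: "?y > 0" using s1 by (auto simp: ram_simps frm_def)
    have "runs (Loop (NLess (Dir 55) (Dir 52)) (seqs [NSub (Dir 52) (Dir 52) (Dir 55)])) s1
      (Suc (nmem s1 52 * Suc 1)) (%t. ?J t \<and> nmem t 52 - 1 = ?x mod ?y)"
    proof (rule runs_Loop[where J = ?J and \<mu> = "%t. nmem t 52"])
     fix t assume t: "?J t" "holds (NLess (Dir 55) (Dir 52)) t"
     have lt: "?y < nmem t 52" using t y[of t] by (simp add: ram_simps)
     have "(nmem t 52 - ?y - 1) mod ?y = (nmem t 52 - 1) mod ?y"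
      using lt le_mod_geq[of ?y "nmem t 52 - 1"] by (simp add: diff_commute)
     then show "runs (seqs [NSub (Dir 52) (Dir 52) (Dir 55)]) t 1
      (%t'. ?J t' \<and> nmem t' 52 < nmem t 52)"
      using t y[of t] y0 lt by (intro runs_seqs) (auto simp: ram_simps frm_def)
    next
     fix t assume t: "?J t" "\<not> holds (NLess (Dir 55) (Dir 52)) t"
     then have "nmem t 52 \<le> ?y" using y[of t] by (simp add: ram_simps)
     then have "nmem t 52 - 1 < ?y" using y0 by linarith
     then have "(nmem t 52 - 1) mod ?y = nmem t 52 - 1" by simp
     then show "?J t \<and> nmem t 52 - 1 = ?x mod ?y" using t by simp
    qed (use s1 in auto)
    then show "runs (Loop (NLess (Dir 55) (Dir 52)) (seqs [NSub (Dir 52) (Dir 52) (Dir 55)])) s1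
      (Suc (Suc ?x * Suc 1)) (%t. ?J t \<and> nmem t 52 - 1 = ?x mod ?y)" using s1 by simp
   next
    assume "\<not> holds (NLess (Dir 50) (Dir 55)) s1"
    then have "?y = 0" using s1 by (auto simp: ram_simps frm_def)
    then show "runs (Do (NConst (Dir 50) 0)) s1 (Suc (Suc ?x * Suc 1)) (%t. ?J t \<and> nmem t 52 - 1 = ?x mod ?y)"
     using s1 by (intro runs_Do) (auto simp: ram_simps frm_def)
   qed
  next
   fix t assume "?J t \<and> nmem t 52 - 1 = ?x mod ?y"
   then show "runs (seqs [NSub (Dir 53) (Dir 52) (Dir 51)]) t 1 (%s'. frm {50..53} s s' \<and> nmem s' 53 = nopv NRem ?x ?y)"
    by (intro runs_seqs) (auto simp: ram_simps frm_def)
  qed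
 qed
 then show ?thesis by (rule runs_weaken) (use bd in auto)
qed

section \<open>Compilation and simulation\<close>

definition loca :: "hst => bool => opd => nat" where
 "loca h re x = (if re then hb h else 0) + cell (oarr x) (orow h x) (ocol h x)"

text \<open>All addresses are computed before anything is written, so the target may coincide with a
  source or with an index.\<close>

definition adrs :: "bool => opd => bool => opd => bool => opd => prog => prog" where
 "adrs rz z rx x ry y P = Seq (adr rz 56 z) (Seq (adr rx 57 x) (Seq (adr ry 58 y) P))"

lemma owf_oarr: "owf x ==> oarr x < 50"
 by (cases x) auto

lemma bnd_index: "bnd X h ==> owf x ==> orow h x \<le> X \<and> ocol h x \<le> X"
 by (cases x) (auto simp: bnd_def)

lemma runs_adrs:
 assumes rel: "rel s h" and X: "bnd X h" and wf: "owf z" "owf x" "owf y"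
  and P: "\<And>s'. rel s' h ==> nmem s' 56 = loca h rz z ==> nmem s' 57 = loca h rx x ==>
   nmem s' 58 = loca h ry y ==> runs P s' T Q"
 shows "runs (adrs rz z rx x ry y P) s (75 + 18 * X + T) Q"
proof -
 have sub: "{r, 59, 60, 61, 62} \<subseteq> {50..<63}" if "r \<in> {56, 57, 58}" for r :: nat using that by auto
 have "runs (adrs rz z rx x ry y P) s ((25 + 6 * X) + ((25 + 6 * X) + ((25 + 6 * X) + T))) Q"
  unfolding adrs_def
 proof (rule runs_Seq2[OF runs_adr[OF rel wf(1)]])
  fix s1 assume "frm {56, 59, 60, 61, 62} s s1 \<and> nmem s1 56 = (if rz then hb h else 0) + cell (oarr z) (orow h z) (ocol h z)"
  then have s1: "rel s1 h" "nmem s1 56 = loca h rz z" using rel_frm[OF rel _ sub[of 56]] by (auto simp: loca_def)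
  show "runs (Seq (adr rx 57 x) (Seq (adr ry 58 y) P)) s1 ((25 + 6 * X) + ((25 + 6 * X) + T)) Q"
  proof (rule runs_Seq2[OF runs_adr[OF s1(1) wf(2)]])
   fix s2 assume f2: "frm {57, 59, 60, 61, 62} s1 s2 \<and> nmem s2 57 = (if rx then hb h else 0) + cell (oarr x) (orow h x) (ocol h x)"
   then have s2: "rel s2 h" "nmem s2 57 = loca h rx x" "nmem s2 56 = loca h rz z"
    using rel_frm[OF s1(1) _ sub[of 57]] s1(2) by (auto simp: loca_def frm_def)
   show "runs (Seq (adr ry 58 y) P) s2 ((25 + 6 * X) + T) Q"
   proof (rule runs_Seq2[OF runs_adr[OF s2(1) wf(3)]])
    fix s3 assume f3: "frm {58, 59, 60, 61, 62} s2 s3 \<and> nmem s3 58 = (if ry then hb h else 0) + cell (oarr y) (orow h y) (ocol h y)"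
    then have "rel s3 h" "nmem s3 58 = loca h ry y" "nmem s3 57 = loca h rx x" "nmem s3 56 = loca h rz z"
     using rel_frm[OF s2(1) _ sub[of 58]] s2(2,3) by (auto simp: loca_def frm_def)
    then show "runs P s3 T Q" using P by blast
   qed (use bnd_index[OF X] wf in auto)
  qed (use bnd_index[OF X] wf in auto)
 qed (use bnd_index[OF X] wf in auto)
 then show ?thesis by (rule runs_weaken) auto
qed

lemma rel_nv: "rel s h ==> owf x ==> nmem s (loca h False x) = nv h x"
 using owf_oarr[of x] by (simp add: rel_def loca_def nv_def)

lemma rel_rv: "rel s h ==> owf x ==> rmem s (loca h True x) = rv h x"
 using owf_oarr[of x] by (simp add: rel_def loca_def rv_def)

lemma loca_temp: "owf x ==> 50 \<le> q ==> q < 64 ==> loca h False x \<noteq> q"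
 using cell_temp owf_oarr by (simp add: loca_def)

lemma loca_scratch: "owf x ==> loca h True x \<noteq> hb h + 50"
 using cell_temp[OF owf_oarr, of x 50] by (simp add: loca_def)

lemma rel_setn:
 assumes rel: "rel s h" and z: "owf z" and "rmem s' = rmem s"
  "\<And>q. q \<notin> {50..<63} ==> q \<noteq> loca h False z ==> nmem s' q = nmem s q" "nmem s' (loca h False z) = v"
 shows "rel s' (setn h z v)"
proof -
 have z50: "oarr z < 50" using owf_oarr[OF z] .
 have "nmem s' 63 = hb h" using assms(4)[of 63] loca_temp[OF z, of 63 h] rel by (auto simp: rel_def)
 moreover have "nmem s' (cell a i j) = hN (setn h z v) a i j" if a: "a < 50" for a i j
 proof (cases "a = oarr z \<and> i = orow h z \<and> j = ocol h z")
  case True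
  then show ?thesis using assms(5) by (simp add: loca_def setn_def upd3_def)
 next
  case False
  then have "cell a i j \<noteq> loca h False z"
   using cell_inj[of a "oarr z" i j] a z50 by (simp add: loca_def)
  moreover have "cell a i j \<notin> {50..<63}" using cell_temp[OF a, of "cell a i j" i j] by auto
  ultimately have "nmem s' (cell a i j) = nmem s (cell a i j)" using assms(4) by blast
  then show ?thesis using False rel a by (auto simp: rel_def setn_def upd3_def)
 qed
 ultimately show ?thesis using rel assms(3) by (simp add: rel_def)
qed

lemma cell_out: "a < 50 ==> cell a i j \<notin> {50..<63}"
 using cell_temp[of a "cell a i j" i j] by auto

lemma rel_setr:
 assumes rel: "rel s h" and z: "owf z" and "\<And>q. q \<notin> {50..<63} ==> nmem s' q = nmem s q"
  "\<And>q. q \<noteq> hb h + 50 ==> q \<noteq> loca h True z ==> rmem s' q = rmem s q" "rmem s' (loca h True z) = v"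
 shows "rel s' (setr h z v)"
proof -
 have z50: "oarr z < 50" using owf_oarr[OF z] .
 have "nmem s' (cell a i j) = hN h a i j" if a: "a < 50" for a i j
  using assms(3)[OF cell_out[OF a]] rel a by (simp add: rel_def)
 moreover have "rmem s' (hb h + cell a i j) = hR (setr h z v) a i j" if a: "a < 50" for a i j
 proof (cases "a = oarr z \<and> i = orow h z \<and> j = ocol h z")
  case True
  then show ?thesis using assms(5) by (simp add: loca_def setr_def upd3_def)
 next
  case False
  then have "hb h + cell a i j \<noteq> loca h True z"
   using cell_inj[of a "oarr z" i j] a z50 by (simp add: loca_def)
  moreover have "hb h + cell a i j \<noteq> hb h + 50" using cell_temp[OF a, of 50 i j] by auto
  ultimately have "rmem s' (hb h + cell a i j) = rmem s (hb h + cell a i j)" using assms(4) by blast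
  then show ?thesis using False rel a by (auto simp: rel_def setr_def upd3_def)
 qed
 moreover have "rmem s' x = hI h x" if "x < hb h" for x
  using assms(4)[of x] that rel by (auto simp: rel_def loca_def)
 moreover have "nmem s' 63 = hb h" using assms(3)[of 63] rel by (simp add: rel_def)
 ultimately show ?thesis by (simp add: rel_def)
qed

lemma rel_low:
 assumes rel: "rel s h" and "\<And>q. q \<notin> {50..<63} ==> nmem s' q = nmem s q"
  "\<And>q. q \<noteq> hb h + 50 ==> q \<noteq> x ==> rmem s' q = rmem s q" "rmem s' x = v" "x < hb h"
 shows "rel s' (h\<lparr>hI := (hI h)(x := v)\<rparr>)"
proof -
 have "nmem s' (cell a i j) = hN h a i j" if a: "a < 50" for a i j
  using assms(2)[OF cell_out[OF a]] rel a by (simp add: rel_def)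
 moreover have "rmem s' (hb h + cell a i j) = hR h a i j" if a: "a < 50" for a i j
  using assms(3)[of "hb h + cell a i j"] cell_temp[OF a, of 50 i j] rel a assms(5) by (auto simp: rel_def)
 moreover have "rmem s' q = ((hI h)(x := v)) q" if "q < hb h" for q
  using assms(3)[of q] assms(4) that rel by (auto simp: rel_def)
 moreover have "nmem s' 63 = hb h" using assms(2)[of 63] rel by (simp add: rel_def)
 ultimately show ?thesis by (simp add: rel_def)
qed

lemma rel_scratch:
 assumes rel: "rel s h" and "\<And>q. q \<notin> {50..<63} ==> nmem s' q = nmem s q"
  "\<And>q. q \<noteq> hb h + 50 ==> rmem s' q = rmem s q"
 shows "rel s' h"
proof -
 have "nmem s' (cell a i j) = hN h a i j" if a: "a < 50" for a i j
  using assms(2)[OF cell_out[OF a]] rel a by (simp add: rel_def)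
 moreover have "rmem s' (hb h + cell a i j) = hR h a i j" if a: "a < 50" for a i j
  using assms(3)[of "hb h + cell a i j"] cell_temp[OF a, of 50 i j] rel a by (auto simp: rel_def)
 moreover have "rmem s' q = hI h q" if "q < hb h" for q
  using assms(3)[of q] that rel by (auto simp: rel_def)
 moreover have "nmem s' 63 = hb h" using assms(2)[of 63] rel by (simp add: rel_def)
 ultimately show ?thesis by (simp add: rel_def)
qed

fun ropi :: "rop => loc => loc => loc => instr" where
 "ropi RPlus = RAdd" | "ropi RMinus = RSub" | "ropi RTimes = RMul" | "ropi RQuot = RDiv"

fun ccomp :: "cond => prog => prog => prog" where
 "ccomp (TN x y) P Q = adrs False x False x False y (Cond (NLess (Ind 57) (Ind 58)) P Q)"
| "ccomp (TR x y) P Q = adrs True x True x True y (Cond (RLess (Ind 57) (Ind 58)) P Q)"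

text \<open>The machine cannot move values: copying adds a scratch 0, and converting a natural
  number adds a scratch 1 repeatedly.\<close>

definition zscr :: "int => instr list" where
 "zscr c = [NConst (Dir 61) 50, NAdd (Dir 58) (Dir 63) (Dir 61), RConst (Ind 58) c]"

definition ld :: "nat => nat => instr list" where
 "ld c r = [NConst (Dir c) 0, NAdd (Dir c) (Dir c) (Ind r)]"

primrec comp :: "hcom => prog" where
 "comp (NC z c) = adrs False z False z False z (seqs [NConst (Ind 56) c])"
| "comp (NM z x) = adrs False z False x False z
   (seqs (ld 54 57 @ [NConst (Dir 55) 0, NAdd (Ind 56) (Dir 54) (Dir 55)]))"
| "comp (NO p z x y) = adrs False z False x False y
   (Seq (seqs (ld 54 57 @ ld 55 58)) (Seq (nopc p) (seqs [NConst (Dir 52) 0, NAdd (Ind 56) (Dir 53) (Dir 52)])))"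
| "comp (RC z c) = adrs True z True z True z (seqs [RConst (Ind 56) c])"
| "comp (RM z x) = adrs True z True x True z (seqs (zscr 0 @ [RAdd (Ind 56) (Ind 57) (Ind 58)]))"
| "comp (RO p z x y) = adrs True z True x True y (seqs [ropi p (Ind 56) (Ind 57) (Ind 58)])"
| "comp (NR z x) = adrs True z False x False x
   (Seq (seqs (ld 54 57 @ zscr 1 @ [RConst (Ind 56) 0, NConst (Dir 50) 0, NConst (Dir 51) 1]))
    (Loop (NLess (Dir 50) (Dir 54)) (seqs [RAdd (Ind 56) (Ind 56) (Ind 58), NAdd (Dir 50) (Dir 50) (Dir 51)])))"
| "comp (RGet z x) = adrs True z False x False x (Seq (seqs (ld 54 57 @ zscr 0))
    (Cond (NLess (Dir 54) (Dir 63)) (Do (RAdd (Ind 56) (Ind 54) (Ind 58))) (Do (NConst (Dir 50) 0))))"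
| "comp (RPut x y) = adrs True y False x False x (Seq (seqs (ld 54 57 @ zscr 0))
    (Cond (NLess (Dir 54) (Dir 63)) (Do (RAdd (Ind 54) (Ind 56) (Ind 58))) (Do (NConst (Dir 50) 0))))"
| "comp (Sq P Q) = Seq (comp P) (comp Q)"
| "comp (If c P Q) = ccomp c (comp P) (comp Q)"
| "comp (For v b P) = Seq (Do (NConst (Dir v) 0)) (Loop (NLess (Dir v) (Dir b))
   (Seq (comp P) (seqs [NConst (Dir 50) 1, NAdd (Dir v) (Dir v) (Dir 50)])))"

text \<open>Generous for every primitive: three addresses cost \<open>75 + 18 * X\<close>, and the
  arithmetic routines are linear in \<open>X\<close>.\<close>

definition prim_time :: "nat => nat" where
 "prim_time X = 200 + 50 * X"

text \<open>Under \<open>safe X\<close> no loop makes more than \<open>X\<close> rounds, so the time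
  can be read off the syntax.\<close>

primrec tm :: "hcom => nat => nat" where
 "tm (NC z c) = prim_time" | "tm (NM z x) = prim_time" | "tm (NO p z x y) = prim_time"
| "tm (RC z c) = prim_time" | "tm (RM z x) = prim_time" | "tm (RO p z x y) = prim_time"
| "tm (NR z x) = prim_time" | "tm (RGet z x) = prim_time" | "tm (RPut x y) = prim_time"
| "tm (Sq P Q) = (%X. tm P X + tm Q X)"
| "tm (If c P Q) = (%X. prim_time X + tm P X + tm Q X)"
| "tm (For v b P) = (%X. 2 + X * (tm P X + 3))"

lemma safe_bnd: "safe X P h ==> bnd X h"
 by (induction P arbitrary: h) auto

lemma hN_setn_S: "hN (setn s (S v) i) v 0 0 = i"
 by (simp add: setn_def upd3_def)

text \<open>Forward simulation by induction on the command; \<open>safe X\<close> bounds the time of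
  addressing, of arithmetic and of loops.\<close>

lemma runs_comp:
 assumes "wf_com P" "rel s h" "safe X P h"
 shows "runs (comp P) s (tm P X) (%s'. rel s' (run P h))"
 using assms
proof (induction P arbitrary: s h)
 case (NC z c)
 have "runs (comp (NC z c)) s (75 + 18 * X + 1) (%s'. rel s' (run (NC z c) h))"
  unfolding comp.simps
 proof (rule runs_adrs[OF NC(2)])
  fix s' assume s': "rel s' h" "nmem s' 56 = loca h False z"
  show "runs (seqs [NConst (Ind 56) c]) s' 1 (%s'. rel s' (run (NC z c) h))"
   using s' NC by (intro runs_seqs) (auto simp: ram_simps intro!: rel_setn[OF s'(1)])
 qed (use NC in auto)
 then show ?case by (rule runs_weaken) (auto simp: prim_time_def)
next
 case (NM z x)
 have "runs (comp (NM z x)) s (75 + 18 * X + 4) (%s'. rel s' (run (NM z x) h))"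
  unfolding comp.simps
 proof (rule runs_adrs[OF NM(2)])
  fix s' assume s': "rel s' h" "nmem s' 56 = loca h False z" "nmem s' 57 = loca h False x"
  have ne: "loca h False z \<noteq> q" "loca h False x \<noteq> q" if "50 \<le> q" "q < 64" for q
   using loca_temp NM that by auto
  show "runs (seqs (ld 54 57 @ [NConst (Dir 55) 0, NAdd (Ind 56) (Dir 54) (Dir 55)])) s' 4 (%s'. rel s' (run (NM z x) h))"
   using s' NM ne[of 54] ne[of 55] rel_nv[OF s'(1), of x] unfolding ld_def
   by (intro runs_seqs) (auto simp: ram_simps intro!: rel_setn[OF s'(1)])
 qed (use NM in auto)
 then show ?case by (rule runs_weaken) (auto simp: prim_time_def)
next
 case (NO p z x y)
 have vx: "nv h x \<le> X" "nv h y \<le> X" using NO bnd_nv safe_bnd[OF NO(3)] by auto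
 have "runs (comp (NO p z x y)) s (75 + 18 * X + (4 + ((20 + 4 * X) + 2))) (%s'. rel s' (run (NO p z x y) h))"
  unfolding comp.simps
 proof (rule runs_adrs[OF NO(2)])
  fix s' assume s': "rel s' h" "nmem s' 56 = loca h False z" "nmem s' 57 = loca h False x" "nmem s' 58 = loca h False y"
  have ne: "loca h False z \<noteq> q" "loca h False x \<noteq> q" "loca h False y \<noteq> q" if "50 \<le> q" "q < 64" for q
   using loca_temp NO that by auto
  show "runs (Seq (seqs (ld 54 57 @ ld 55 58)) (Seq (nopc p) (seqs [NConst (Dir 52) 0, NAdd (Ind 56) (Dir 53) (Dir 52)]))) s'
   (4 + ((20 + 4 * X) + 2)) (%s'. rel s' (run (NO p z x y) h))"
  proof (rule runs_Seq2)
   show "runs (seqs (ld 54 57 @ ld 55 58)) s' 4 (%t. frm {54, 55} s' t \<and> nmem t 54 = nv h x \<and> nmem t 55 = nv h y)"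
    using s' NO ne[of 54] ne[of 55] rel_nv[OF s'(1), of x] rel_nv[OF s'(1), of y] unfolding ld_def
    by (intro runs_seqs) (auto simp: ram_simps frm_def)
  next
   fix t assume t: "frm {54, 55} s' t \<and> nmem t 54 = nv h x \<and> nmem t 55 = nv h y"
   show "runs (Seq (nopc p) (seqs [NConst (Dir 52) 0, NAdd (Ind 56) (Dir 53) (Dir 52)])) t
    ((20 + 4 * X) + 2) (%s'. rel s' (run (NO p z x y) h))"
   proof (rule runs_Seq2[OF runs_nopc])
    fix u assume u: "frm {50..53} t u \<and> nmem u 53 = nopv p (nmem t 54) (nmem t 55)"
    have "rel t h" using rel_frm[OF s'(1), of "{54, 55}" t] t by auto
    moreover have "{50..53} \<subseteq> {50..<63::nat}" by auto
    ultimately have relu: "rel u h" using rel_frm u by blast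
    have u56: "nmem u 56 = loca h False z" using s' t u by (auto simp: frm_def)
    show "runs (seqs [NConst (Dir 52) 0, NAdd (Ind 56) (Dir 53) (Dir 52)]) u 2 (%s'. rel s' (run (NO p z x y) h))"
     using u56 u t ne[of 52] NO(1) by (intro runs_seqs) (auto simp: ram_simps intro!: rel_setn[OF relu])
   qed (use t vx in auto)
  qed
 qed (use NO in auto)
 then show ?case by (rule runs_weaken) (auto simp: prim_time_def)
next
 case (RC z c)
 have "runs (comp (RC z c)) s (75 + 18 * X + 1) (%s'. rel s' (run (RC z c) h))"
  unfolding comp.simps
 proof (rule runs_adrs[OF RC(2)])
  fix s' assume s': "rel s' h" "nmem s' 56 = loca h True z"
  show "runs (seqs [RConst (Ind 56) c]) s' 1 (%s'. rel s' (run (RC z c) h))"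
   using s' RC by (intro runs_seqs) (auto simp: ram_simps intro!: rel_setr[OF s'(1)])
 qed (use RC in auto)
 then show ?case by (rule runs_weaken) (auto simp: prim_time_def)
next
 case (RM z x)
 have "runs (comp (RM z x)) s (75 + 18 * X + 4) (%s'. rel s' (run (RM z x) h))"
  unfolding comp.simps
 proof (rule runs_adrs[OF RM(2)])
  fix s' assume s': "rel s' h" "nmem s' 56 = loca h True z" "nmem s' 57 = loca h True x"
  have b: "nmem s' 63 = hb h" using s' by (simp add: rel_def)
  show "runs (seqs (zscr 0 @ [RAdd (Ind 56) (Ind 57) (Ind 58)])) s' 4 (%s'. rel s' (run (RM z x) h))"
   using s' b RM loca_scratch[of x h] rel_rv[OF s'(1), of x] unfolding zscr_def
   by (intro runs_seqs) (auto simp: ram_simps intro!: rel_setr[OF s'(1)])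
 qed (use RM in auto)
 then show ?case by (rule runs_weaken) (auto simp: prim_time_def)
next
 case (RO p z x y)
 have "runs (comp (RO p z x y)) s (75 + 18 * X + 1) (%s'. rel s' (run (RO p z x y) h))"
  unfolding comp.simps
 proof (rule runs_adrs[OF RO(2)])
  fix s' assume s': "rel s' h" "nmem s' 56 = loca h True z" "nmem s' 57 = loca h True x" "nmem s' 58 = loca h True y"
  show "runs (seqs [ropi p (Ind 56) (Ind 57) (Ind 58)]) s' 1 (%s'. rel s' (run (RO p z x y) h))"
   using s' RO rel_rv[OF s'(1), of x] rel_rv[OF s'(1), of y]
   by (intro runs_seqs; cases p) (auto simp: ram_simps intro!: rel_setr[OF s'(1)])
 qed (use RO in auto)
 then show ?case by (rule runs_weaken) (auto simp: prim_time_def)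
next
 case (NR z x)
 have vx: "nv h x \<le> X" using NR bnd_nv by auto
 have "runs (comp (NR z x)) s (75 + 18 * X + (8 + Suc (nv h x * Suc 2))) (%s'. rel s' (run (NR z x) h))"
  unfolding comp.simps
 proof (rule runs_adrs[OF NR(2)])
  fix s' assume s': "rel s' h" "nmem s' 56 = loca h True z" "nmem s' 57 = loca h False x"
  have b: "nmem s' 63 = hb h" using s' by (simp add: rel_def)
  have ne: "loca h False x \<noteq> q" if "50 \<le> q" "q < 64" for q using loca_temp NR that by auto
  have sc: "loca h True z \<noteq> hb h + 50" using loca_scratch NR by simp
  let ?J = "%t :: ram. (\<forall>q. q \<notin> {50..<63} \<longrightarrow> nmem t q = nmem s' q) \<and>
    (\<forall>q. q \<noteq> hb h + 50 \<longrightarrow> q \<noteq> loca h True z \<longrightarrow> rmem t q = rmem s' q) \<and>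
    nmem t 54 = nv h x \<and> nmem t 56 = loca h True z \<and> nmem t 58 = hb h + 50 \<and> nmem t 51 = 1 \<and> nmem t 50 \<le> nv h x \<and>
    rmem t (hb h + 50) = 1 \<and> rmem t (loca h True z) = real (nmem t 50)"
  show "runs (Seq (seqs (ld 54 57 @ zscr 1 @ [RConst (Ind 56) 0, NConst (Dir 50) 0, NConst (Dir 51) 1]))
    (Loop (NLess (Dir 50) (Dir 54)) (seqs [RAdd (Ind 56) (Ind 56) (Ind 58), NAdd (Dir 50) (Dir 50) (Dir 51)]))) s'
    (8 + Suc (nv h x * Suc 2)) (%s'. rel s' (run (NR z x) h))"
  proof (rule runs_Seq2)
   show "runs (seqs (ld 54 57 @ zscr 1 @ [RConst (Ind 56) 0, NConst (Dir 50) 0, NConst (Dir 51) 1])) s' 8 (%t. ?J t \<and> nmem t 50 = 0)"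
    using s' b NR sc ne[of 54] rel_nv[OF s'(1), of x] unfolding ld_def zscr_def
    by (intro runs_seqs) (auto simp: ram_simps)
  next
   fix t assume t: "?J t \<and> nmem t 50 = 0"
   have "runs (Loop (NLess (Dir 50) (Dir 54)) (seqs [RAdd (Ind 56) (Ind 56) (Ind 58), NAdd (Dir 50) (Dir 50) (Dir 51)])) t
    (Suc ((nv h x - nmem t 50) * Suc 2)) (%s'. rel s' (run (NR z x) h))"
   proof (rule runs_Loop[where J = ?J and \<mu> = "%t. nv h x - nmem t 50"])
    fix u assume u: "?J u" "holds (NLess (Dir 50) (Dir 54)) u"
    show "runs (seqs [RAdd (Ind 56) (Ind 56) (Ind 58), NAdd (Dir 50) (Dir 50) (Dir 51)]) u 2
     (%u'. ?J u' \<and> nv h x - nmem u' 50 < nv h x - nmem u 50)"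
     using u sc by (intro runs_seqs) (auto simp: ram_simps)
   next
    fix u assume u: "?J u" "\<not> holds (NLess (Dir 50) (Dir 54)) u"
    then have "nmem u 50 = nv h x" by (auto simp: ram_simps)
    then show "rel u (run (NR z x) h)" using u NR(1) by (auto intro!: rel_setr[OF s'(1)])
   qed (use t in simp)
   then show "runs (Loop (NLess (Dir 50) (Dir 54)) (seqs [RAdd (Ind 56) (Ind 56) (Ind 58), NAdd (Dir 50) (Dir 50) (Dir 51)])) t
    (Suc (nv h x * Suc 2)) (%s'. rel s' (run (NR z x) h))" using t by simp
  qed
 qed (use NR in auto)
 then show ?case by (rule runs_weaken) (use vx in \<open>auto simp: prim_time_def\<close>)
next
 case (RGet z x)
 have "runs (comp (RGet z x)) s (75 + 18 * X + (5 + Suc 1)) (%s'. rel s' (run (RGet z x) h))"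
  unfolding comp.simps
 proof (rule runs_adrs[OF RGet(2)])
  fix s' assume s': "rel s' h" "nmem s' 56 = loca h True z" "nmem s' 57 = loca h False x"
  have b: "nmem s' 63 = hb h" using s' by (simp add: rel_def)
  have ne: "loca h False x \<noteq> q" if "50 \<le> q" "q < 64" for q using loca_temp RGet that by auto
  let ?J = "%t :: ram. (\<forall>q. q \<notin> {50..<63} \<longrightarrow> nmem t q = nmem s' q) \<and>
    (\<forall>q. q \<noteq> hb h + 50 \<longrightarrow> rmem t q = rmem s' q) \<and> rmem t (hb h + 50) = 0 \<and>
    nmem t 54 = nv h x \<and> nmem t 56 = loca h True z \<and> nmem t 58 = hb h + 50 \<and> nmem t 63 = hb h"
  show "runs (Seq (seqs (ld 54 57 @ zscr 0))
    (Cond (NLess (Dir 54) (Dir 63)) (Do (RAdd (Ind 56) (Ind 54) (Ind 58))) (Do (NConst (Dir 50) 0)))) s'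
    (5 + Suc 1) (%s'. rel s' (run (RGet z x) h))"
  proof (rule runs_Seq2)
   show "runs (seqs (ld 54 57 @ zscr 0)) s' 5 ?J"
    using s' b RGet ne[of 54] rel_nv[OF s'(1), of x] unfolding ld_def zscr_def
    by (intro runs_seqs) (auto simp: ram_simps)
  next
   fix t assume t: "?J t"
   have relt: "rel t h" using t by (intro rel_scratch[OF s'(1)]) blast+
   show "runs (Cond (NLess (Dir 54) (Dir 63)) (Do (RAdd (Ind 56) (Ind 54) (Ind 58))) (Do (NConst (Dir 50) 0))) t (Suc 1) (%s'. rel s' (run (RGet z x) h))"
   proof (rule runs_Cond)
    assume "holds (NLess (Dir 54) (Dir 63)) t"
    then have lt: "nv h x < hb h" using t by (simp add: ram_simps)
    then have "rmem t (nv h x) = hI h (nv h x)" using relt by (simp add: rel_def)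
    then show "runs (Do (RAdd (Ind 56) (Ind 54) (Ind 58))) t 1 (%s'. rel s' (run (RGet z x) h))"
     using t lt RGet(1) by (intro runs_Do) (auto simp: ram_simps intro!: rel_setr[OF relt])
   next
    assume "\<not> holds (NLess (Dir 54) (Dir 63)) t"
    then have "\<not> nv h x < hb h" using t by (simp add: ram_simps)
    then show "runs (Do (NConst (Dir 50) 0)) t 1 (%s'. rel s' (run (RGet z x) h))"
     using rel_frm[OF relt, of "{50}"] by (intro runs_Do) (auto simp: ram_simps frm_def)
   qed
  qed
 qed (use RGet in auto)
 then show ?case by (rule runs_weaken) (auto simp: prim_time_def)
next
 case (RPut x y)
 have "runs (comp (RPut x y)) s (75 + 18 * X + (5 + Suc 1)) (%s'. rel s' (run (RPut x y) h))"
  unfolding comp.simps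
 proof (rule runs_adrs[OF RPut(2)])
  fix s' assume s': "rel s' h" "nmem s' 56 = loca h True y" "nmem s' 57 = loca h False x"
  have b: "nmem s' 63 = hb h" using s' by (simp add: rel_def)
  have ne: "loca h False x \<noteq> q" if "50 \<le> q" "q < 64" for q using loca_temp RPut that by auto
  let ?J = "%t :: ram. (\<forall>q. q \<notin> {50..<63} \<longrightarrow> nmem t q = nmem s' q) \<and>
    (\<forall>q. q \<noteq> hb h + 50 \<longrightarrow> rmem t q = rmem s' q) \<and> rmem t (hb h + 50) = 0 \<and>
    nmem t 54 = nv h x \<and> nmem t 56 = loca h True y \<and> nmem t 58 = hb h + 50 \<and> nmem t 63 = hb h"
  show "runs (Seq (seqs (ld 54 57 @ zscr 0))
    (Cond (NLess (Dir 54) (Dir 63)) (Do (RAdd (Ind 54) (Ind 56) (Ind 58))) (Do (NConst (Dir 50) 0)))) s'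
    (5 + Suc 1) (%s'. rel s' (run (RPut x y) h))"
  proof (rule runs_Seq2)
   show "runs (seqs (ld 54 57 @ zscr 0)) s' 5 ?J"
    using s' b RPut ne[of 54] rel_nv[OF s'(1), of x] unfolding ld_def zscr_def
    by (intro runs_seqs) (auto simp: ram_simps)
  next
   fix t assume t: "?J t"
   have relt: "rel t h" using t by (intro rel_scratch[OF s'(1)]) blast+
   have ry: "rmem t (loca h True y) = rv h y" using t rel_rv[OF s'(1)] loca_scratch RPut by simp
   show "runs (Cond (NLess (Dir 54) (Dir 63)) (Do (RAdd (Ind 54) (Ind 56) (Ind 58))) (Do (NConst (Dir 50) 0))) t (Suc 1) (%s'. rel s' (run (RPut x y) h))"
   proof (rule runs_Cond)
    assume "holds (NLess (Dir 54) (Dir 63)) t"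
    then have lt: "nv h x < hb h" using t by (simp add: ram_simps)
    then show "runs (Do (RAdd (Ind 54) (Ind 56) (Ind 58))) t 1 (%s'. rel s' (run (RPut x y) h))"
     using t ry by (intro runs_Do) (auto simp: ram_simps intro!: rel_low[OF s'(1)])
   next
    assume "\<not> holds (NLess (Dir 54) (Dir 63)) t"
    then have "\<not> nv h x < hb h" using t by (simp add: ram_simps)
    then show "runs (Do (NConst (Dir 50) 0)) t 1 (%s'. rel s' (run (RPut x y) h))"
     using relt rel_frm[OF relt, of "{50}"] by (intro runs_Do) (auto simp: ram_simps frm_def)
   qed
  qed
 qed (use RPut in auto)
 then show ?case by (rule runs_weaken) (auto simp: prim_time_def)
next
 case (Sq P Q)
 have "runs (Seq (comp P) (comp Q)) s (tm P X + tm Q X) (%s'. rel s' (run (Sq P Q) h))"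
 proof (rule runs_Seq2[OF Sq.IH(1)])
  fix s' assume "rel s' (run P h)"
  then show "runs (comp Q) s' (tm Q X) (%s'. rel s' (run (Sq P Q) h))"
   using Sq.IH(2)[of s' "run P h"] Sq.prems by simp
 qed (use Sq.prems in auto)
 then show ?case by simp
next
 case (If c P Q)
 have P: "runs (comp P) s' (tm P X + tm Q X) (%s'. rel s' (run (If c P Q) h))" if "rel s' h" "evc c h" for s'
  by (rule runs_weaken[OF If.IH(1)[of s' h]]) (use If.prems that in auto)
 have Q: "runs (comp Q) s' (tm P X + tm Q X) (%s'. rel s' (run (If c P Q) h))" if "rel s' h" "\<not> evc c h" for s'
  by (rule runs_weaken[OF If.IH(2)[of s' h]]) (use If.prems that in auto)
 have "runs (comp (If c P Q)) s (75 + 18 * X + Suc (tm P X + tm Q X)) (%s'. rel s' (run (If c P Q) h))"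
 proof (cases c)
  case (TN x y)
  have wf: "owf x" "owf y" using If.prems TN by auto
  show ?thesis unfolding TN comp.simps ccomp.simps
  proof (rule runs_adrs[OF If.prems(2)])
   fix s' assume s': "rel s' h" "nmem s' 57 = loca h False x" "nmem s' 58 = loca h False y"
   have "holds (NLess (Ind 57) (Ind 58)) s' \<longleftrightarrow> evc c h"
    using s' rel_nv[OF s'(1)] wf by (simp add: ram_simps TN)
   then show "runs (Cond (NLess (Ind 57) (Ind 58)) (comp P) (comp Q)) s' (Suc (tm P X + tm Q X)) (%s'. rel s' (run (If (TN x y) P Q) h))"
    using P[OF s'(1)] Q[OF s'(1)] unfolding TN by (intro runs_Cond) auto
  qed (use If.prems wf in auto)
 next
  case (TR x y)
  have wf: "owf x" "owf y" using If.prems TR by auto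
  show ?thesis unfolding TR comp.simps ccomp.simps
  proof (rule runs_adrs[OF If.prems(2)])
   fix s' assume s': "rel s' h" "nmem s' 57 = loca h True x" "nmem s' 58 = loca h True y"
   have "holds (RLess (Ind 57) (Ind 58)) s' \<longleftrightarrow> evc c h"
    using s' rel_rv[OF s'(1)] wf by (simp add: ram_simps TR)
   then show "runs (Cond (RLess (Ind 57) (Ind 58)) (comp P) (comp Q)) s' (Suc (tm P X + tm Q X)) (%s'. rel s' (run (If (TR x y) P Q) h))"
    using P[OF s'(1)] Q[OF s'(1)] unfolding TR by (intro runs_Cond) auto
  qed (use If.prems wf in auto)
 qed
 then show ?case by (rule runs_weaken) (auto simp: prim_time_def)
next
 case (For v b P)
 let ?n = "hN h b 0 0"
 have vb: "v < 50" "b < 50" "v \<noteq> b" "v \<notin> nmods P" "b \<notin> nmods P" "wf_com P" using For.prems by auto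
 have n: "?n \<le> X" using safe_bnd[OF For.prems(3)] vb by (simp add: bnd_def)
 have bit: "hN (iter (run P) v i h) b = hN h b" for i using vb by (intro hN_iter hN_run) auto
 let ?st = "%i. setn (iter (run P) v i h) (S v) i"
 \<comment> \<open>After i rounds the machine is related to the state in which the counter has just
   been set to i.\<close>
 let ?J = "%t. \<exists>i\<le>?n. rel t (?st i)"
 have loc: "loca g False (S v) = v" for g by (simp add: loca_def cell_0)
 have cnt: "nmem t v = i" "nmem t b = ?n" if "rel t (?st i)" for t i
  using rel_N0[OF that vb(1)] rel_N0[OF that vb(2)] bit[of i] vb by (auto simp: hN_setn_S hN_setn_other)
 have "runs (comp (For v b P)) s (1 + Suc (?n * Suc (tm P X + 2))) (%s'. rel s' (run (For v b P) h))"
  unfolding comp.simps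
 proof (rule runs_Seq2)
  show "runs (Do (NConst (Dir v) 0)) s 1 (%t. rel t (?st 0))"
   using vb For.prems(2) by (intro runs_Do) (auto simp: ram_simps loc intro!: rel_setn[OF For.prems(2)])
 next
  fix t assume t: "rel t (?st 0)"
  have "runs (Loop (NLess (Dir v) (Dir b)) (Seq (comp P) (seqs [NConst (Dir 50) 1, NAdd (Dir v) (Dir v) (Dir 50)]))) t
   (Suc ((?n - nmem t v) * Suc (tm P X + 2))) (%s'. rel s' (run (For v b P) h))"
  proof (rule runs_Loop[where J = ?J and \<mu> = "%t. ?n - nmem t v"])
   fix u assume u: "?J u" "holds (NLess (Dir v) (Dir b)) u"
   then obtain i where i: "rel u (?st i)" "i \<le> ?n" by blast
   have lt: "i < ?n" using u(2) cnt[OF i(1)] by (simp add: ram_simps)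
   have sf: "safe X P (?st i)" using For.prems(3) lt by simp
   show "runs (Seq (comp P) (seqs [NConst (Dir 50) 1, NAdd (Dir v) (Dir v) (Dir 50)])) u (tm P X + 2)
    (%u'. ?J u' \<and> ?n - nmem u' v < ?n - nmem u v)"
   proof (rule runs_Seq2[OF For.IH[OF vb(6) i(1) sf]])
    fix w assume w: "rel w (run P (?st i))"
    have wv: "nmem w v = i" using rel_N0[OF w vb(1)] vb by (simp add: hN_run hN_setn_S)
    have "rel (step (NAdd (Dir v) (Dir v) (Dir 50)) (step (NConst (Dir 50) 1) w)) (?st (Suc i))"
     unfolding iter.simps by (rule rel_setn[OF w]) (use vb wv in \<open>auto simp: ram_simps loc\<close>)
    then show "runs (seqs [NConst (Dir 50) 1, NAdd (Dir v) (Dir v) (Dir 50)]) w 2 (%u'. ?J u' \<and> ?n - nmem u' v < ?n - nmem u v)"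
    proof (intro runs_seqs)
     let ?u = "fold step [NConst (Dir 50) 1, NAdd (Dir v) (Dir v) (Dir 50)] w"
     assume r: "rel (step (NAdd (Dir v) (Dir v) (Dir 50)) (step (NConst (Dir 50) 1) w)) (?st (Suc i))"
     have "rel ?u (?st (Suc i))" using r by (simp only: fold_simps(2) fold_simps(1))
     moreover have "nmem ?u v = Suc i" using cnt(1)[OF calculation] .
     moreover have "Suc i \<le> ?n" using lt by simp
     ultimately show "?J ?u \<and> ?n - nmem ?u v < ?n - nmem u v"
      using lt cnt(1)[OF i(1)] by (intro conjI exI[of _ "Suc i"]) linarith+
    qed auto
   qed
  next
   fix u assume u: "?J u" "\<not> holds (NLess (Dir v) (Dir b)) u"
   then obtain i where i: "rel u (?st i)" "i \<le> ?n" by blast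
   then have "i = ?n" using u(2) cnt[OF i(1)] by (simp add: ram_simps)
   then show "rel u (run (For v b P) h)" using i by simp
  qed (use t in blast)
  then show "runs (Loop (NLess (Dir v) (Dir b)) (Seq (comp P) (seqs [NConst (Dir 50) 1, NAdd (Dir v) (Dir v) (Dir 50)]))) t
   (Suc (?n * Suc (tm P X + 2))) (%s'. rel s' (run (For v b P) h))" using cnt(1)[OF t] by simp
 qed
 moreover have "1 + Suc (?n * Suc (tm P X + 2)) \<le> tm (For v b P) X"
  using mult_le_mono1[OF n, of "tm P X + 3"] by (simp add: numeral_3_eq_3)
 ultimately show ?case by (rule runs_weaken)
qed

text \<open>The nesting depth of loops is fixed by the program, and each level multiplies by
  \<open>X\<close>. One constant as factor and as exponent keeps the induction uniform.\<close>

lemma tm_poly: "\<exists>c. \<forall>X\<ge>1. tm P X \<le> c * X ^ c"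
proof -
 have prim: "\<exists>c. \<forall>X\<ge>1. prim_time X \<le> c * X ^ c"
 proof (intro exI[of _ 250] allI impI)
  fix X :: nat assume X: "X \<ge> 1"
  have "X ^ 1 \<le> X ^ 250" "1 ^ 250 \<le> X ^ 250" using X by (intro power_increasing power_mono; simp)+
  then show "prim_time X \<le> 250 * X ^ 250" by (simp add: prim_time_def)
 qed
 have add: "\<exists>c. \<forall>X\<ge>1. f X + g X \<le> c * X ^ c"
  if f: "\<exists>c. \<forall>X\<ge>1. f X \<le> c * X ^ c" and g: "\<exists>c. \<forall>X\<ge>1. g X \<le> c * X ^ c" for f g :: "nat => nat"
 proof -
  obtain a b where ab: "\<forall>X\<ge>1. f X \<le> a * X ^ a" "\<forall>X\<ge>1. g X \<le> b * X ^ b" using f g by blast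
  show ?thesis
  proof (intro exI[of _ "a + b"] allI impI)
   fix X :: nat assume X: "X \<ge> 1"
   have "X ^ a \<le> X ^ (a + b)" "X ^ b \<le> X ^ (a + b)" using X by (intro power_increasing; simp)+
   then have "a * X ^ a \<le> a * X ^ (a + b)" "b * X ^ b \<le> b * X ^ (a + b)" by (intro mult_le_mono2; simp)+
   moreover have "f X \<le> a * X ^ a" "g X \<le> b * X ^ b" using ab X by blast+
   ultimately show "f X + g X \<le> (a + b) * X ^ (a + b)" unfolding distrib_right by linarith
  qed
 qed
 show ?thesis
 proof (induction P)
  case (For v b P)
  then obtain c where c: "\<forall>X\<ge>1. tm P X \<le> c * X ^ c" by blast
  show ?case
  proof (intro exI[of _ "c + 5"] allI impI)
   fix X :: nat assume X: "X \<ge> 1"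
   have p: "X ^ Suc c \<le> X ^ (c + 5)" "X ^ 1 \<le> X ^ (c + 5)" "1 ^ (c + 5) \<le> X ^ (c + 5)"
    using X by (intro power_increasing power_mono; simp)+
   have "X * tm P X \<le> c * X ^ Suc c" using mult_le_mono2[OF c[rule_format, OF X], of X] by (simp add: algebra_simps)
   also have "\<dots> \<le> c * X ^ (c + 5)" using p by (intro mult_le_mono2)
   finally have "2 + X * (tm P X + 3) \<le> c * X ^ (c + 5) + 5 * X ^ (c + 5)" using p by (simp add: algebra_simps)
   then show "tm (For v b P) X \<le> (c + 5) * X ^ (c + 5)" by (simp add: algebra_simps)
  qed
 next
  case (Sq P Q)
  show ?case unfolding tm.simps by (rule add[OF Sq.IH])
 next
  case (If c P Q)
  show ?case unfolding tm.simps by (rule add[OF add[OF prim If.IH(1)] If.IH(2)])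
 qed (unfold tm.simps, (rule prim)+)
qed

section \<open>The program\<close>

text \<open>Scalar cells: \<open>n\<close>, \<open>d\<close>, \<open>k\<close> in 0, 1, 2; an integer \<open>e \<ge> 1 / \<epsilon>\<close> in 3; the sample size \<open>m\<close> in 4; the accuracy parameter \<open>Y\<close> in 5.
 A grid consists of the \<open>2 h + 1\<close> multiples of its step with factors from \<open>-h\<close> to \<open>h\<close> (cell 6). A guess is a code below \<open>X\<close> (cell 8), whose digits
 to base \<open>G\<close> (cell 7) are the individual choices. Cell 9 bounds the number of steps of the function that replaces \<open>x powr p\<close>.\<close>

primrec sqs :: "hcom => hcom list => hcom" where
 "sqs P [] = P"
| "sqs P (Q # Qs) = Sq P (sqs Q Qs)"

abbreviation nop0 :: hcom where "nop0 \<equiv> RM (S 14) (S 14)"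

text \<open>Real arrays from here on: 30 holds \<open>A\<close>, 31 the matrix under elimination, 32
  its multipliers, 33 a residual, 34 weights, 39 a right-hand side, 40 the solution of a regression,
  35 and 36 the current factors, 37 and 38 the best ones, 41 the left factor for scale 0. Natural
  arrays: 40 sampled columns, 41 guessed rows, 42 pivot rows.\<close>

definition ABS :: "opd => hcom" where
 "ABS x = Sq (RM (S 10) x) (If (TR (S 10) (S 16)) (RO RMinus (S 10) (S 16) (S 10)) nop0)"

text \<open>Cells 6, 2 and 1 hold the first level, the ratio of levels and the ratio of values. All
  rounds are made, but nothing advances once the level has reached the argument.\<close>

definition POWF :: hcom where
 "POWF = sqs (RM (S 11) (S 6)) [RM (S 12) (S 17),
   For 27 9 (If (TR (S 11) (S 10)) (Sq (RO RTimes (S 11) (S 11) (S 2)) (RO RTimes (S 12) (S 12) (S 1))) nop0)]"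

definition COST :: "nat => hcom" where
 "COST N = Sq (RC (S 13) 0) (For 18 N (sqs (ABS (V 33 18)) [POWF,
   RO RTimes (S 15) (V 34 18) (S 12), RO RPlus (S 13) (S 13) (S 15)]))"

text \<open>Starting from position 0, 0 with a strict test returns a legal position even if the
  matrix vanishes.\<close>

definition PIVOT :: "nat => nat => hcom" where
 "PIVOT N K = sqs (RC (S 22) 0) [NC (S 30) 0, NC (S 31) 0,
   For 18 N (For 19 K (Sq (ABS (M 31 18 19)) (If (TR (S 22) (S 10))
    (sqs (RM (S 22) (S 10)) [NM (S 30) (S 18), NM (S 31) (S 19)]) nop0)))]"

text \<open>The entry of the pivot row is copied before its column is processed, since the pass over
  the column overwrites it.\<close>

definition ESTEP :: "nat => nat => nat => hcom" where
 "ESTEP N L K = sqs (PIVOT N K) [NM (V 42 20) (S 30), RM (S 22) (M 31 30 31),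
   For 18 L (RO RQuot (M 32 20 18) (M 31 18 31) (S 22)),
   For 19 K (Sq (RM (S 14) (M 31 30 19))
    (For 18 L (Sq (RO RTimes (S 15) (S 14) (M 32 20 18)) (RO RMinus (M 31 18 19) (M 31 18 19) (S 15)))))]"

definition ELIM :: "nat => nat => nat => hcom" where
 "ELIM N L K = For 20 2 (ESTEP N L K)"

definition DIGIT :: hcom where
 "DIGIT = Sq (NO NRem (S 29) (S 28) (S 7)) (NO NQuot (S 28) (S 28) (S 7))"

text \<open>Digits are nonnegative; subtracting h (cell 21) before scaling by the step centres the
  grid at 0.\<close>

definition GRID :: hcom where
 "GRID = sqs DIGIT [NR (S 14) (S 29), RO RMinus (S 14) (S 14) (S 21), RO RTimes (S 14) (S 14) (S 4)]"

definition RHO :: "nat => hcom" where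
 "RHO L = sqs (For 18 L (RM (V 33 18) (V 39 18))) [NM (S 28) (S 21),
   For 20 2 (sqs GRID [NM (S 32) (V 42 20), RO RPlus (S 14) (S 14) (V 33 32),
    For 18 L (Sq (RO RTimes (S 15) (S 14) (M 32 20 18)) (RO RMinus (V 33 18) (V 33 18) (S 15)))])]"

text \<open>The k rows from \<open>b\<close> on have right-hand side 0 and a multiple of the
  identity as matrix (the factor is in cell 18). The residual there is minus that multiple of the
  solution, which is thus read off without back substitution.\<close>

definition TAKE :: "nat => nat => hcom" where
 "TAKE L b = Sq (RM (S 7) (S 13)) (For 18 L (If (TN (S 18) (S b)) nop0
   (sqs (NO NMinus (S 32) (S 18) (S b)) [RO RMinus (S 14) (S 16) (V 33 18), RO RQuot (V 40 32) (S 14) (S 18)])))"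

text \<open>Code 0 is always taken, since there is no previous best to compare with and no largest
  real to start from.\<close>

definition REG :: "nat => nat => nat => hcom" where
 "REG N L b = For 21 8 (sqs (RHO L) [COST N,
   If (TN (S 21) (S 12)) (TAKE L b) (If (TR (S 13) (S 7)) (TAKE L b) nop0)])"

definition DECODE :: hcom where
 "DECODE = sqs (NM (S 28) (S 22)) [
   For 20 4 (Sq DIGIT (NO NRem (V 40 20) (S 29) (S 1))),
   NM (S 28) (S 23),
   For 20 4 (sqs DIGIT [NR (S 14) (S 29), RO RQuot (V 34 20) (S 14) (S 20)]),
   For 20 10 (If (TN (S 20) (S 4)) nop0 (RM (V 34 20) (S 17))),
   NM (S 28) (S 24),
   For 20 2 (Sq DIGIT (NO NRem (V 41 20) (S 29) (S 0)))]"

definition BUILD :: hcom where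
 "BUILD = sqs (For 18 10 (For 19 2 (RC (M 31 18 19) 0))) [
   NM (S 28) (S 25),
   For 19 2 (Sq (NM (S 32) (V 41 19))
    (For 18 4 (sqs GRID [NM (S 33) (V 40 18), RO RPlus (M 31 18 19) (S 14) (M 30 32 33)]))),
   For 18 10 (If (TN (S 18) (S 4)) nop0 (Sq (NO NMinus (S 32) (S 18) (S 4)) (RM (M 31 18 32) (S 5))))]"

definition ROWS :: hcom where
 "ROWS = For 26 0 (sqs
   (For 18 10 (If (TN (S 18) (S 4)) (Sq (NM (S 33) (V 40 18)) (RM (V 39 18) (M 30 26 33))) (RC (V 39 18) 0)))
   [REG 10 10 4, For 19 2 (RM (M 35 26 19) (V 40 19))])"

definition PH1 :: hcom where
 "PH1 = sqs DECODE [BUILD, ELIM 10 10 2, RM (S 18) (S 5), ROWS]"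

text \<open>Unit rows are appended below the left factor. In the second phase they get no pivots and
  no cost and only transport the solution.\<close>

definition BUILD2 :: hcom where
 "BUILD2 = sqs (For 18 11 (For 19 2 (RC (M 31 18 19) 0))) [
   For 18 0 (For 19 2 (RM (M 31 18 19) (M 35 18 19))),
   For 18 11 (If (TN (S 18) (S 0)) nop0 (Sq (NO NMinus (S 32) (S 18) (S 0)) (RM (M 31 18 32) (S 17)))),
   For 18 11 (RM (V 34 18) (S 17))]"

definition COLS :: hcom where
 "COLS = For 26 1 (sqs
   (For 18 11 (If (TN (S 18) (S 0)) (RM (V 39 18) (M 30 18 26)) (RC (V 39 18) 0)))
   [REG 0 11 0, For 19 2 (RM (M 36 19 26) (V 40 19)), RO RPlus (S 8) (S 8) (S 7)])"

definition PH2 :: hcom where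
 "PH2 = sqs BUILD2 [ELIM 0 11 2, RM (S 18) (S 17), RC (S 8) 0, COLS]"

definition SAVE :: hcom where
 "SAVE = sqs (RM (S 9) (S 8)) [
   For 18 0 (For 19 2 (RM (M 37 18 19) (M 35 18 19))),
   For 19 2 (For 26 1 (RM (M 38 19 26) (M 36 19 26))), NC (S 34) 1]"

text \<open>At scale 0 all grids degenerate to a point. The multipliers of the elimination then give
  an exact left factor of \<open>A\<close>, which replaces the first phase.\<close>

definition CAND :: hcom where
 "CAND = sqs (If (TR (S 16) (S 3)) PH1 (For 18 0 (For 19 2 (RM (M 35 18 19) (M 41 18 19))))) [PH2,
   If (TN (S 34) (S 12)) SAVE (If (TR (S 8) (S 9)) SAVE nop0)]"

definition SEARCH :: hcom where
 "SEARCH = For 22 8 (For 23 8 (For 24 8 (For 25 8 CAND)))"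

text \<open>Powers of the accuracy parameter are built in real cells, where multiplication is a
  single operation: 20, 23 and 24 receive its powers 3, 8 and 24.\<close>

definition CONSTS :: hcom where
 "CONSTS = sqs (RC (S 16) 0) [RC (S 17) 1, NC (S 29) 0, RGet (S 14) (S 29), NR (S 19) (S 5),
   RO RTimes (S 23) (S 19) (S 19), RO RQuot (S 15) (S 17) (S 23), RO RPlus (S 2) (S 17) (S 15),
   RO RQuot (S 15) (S 14) (S 23), RO RPlus (S 1) (S 17) (S 15), RO RTimes (S 20) (S 23) (S 19),
   NR (S 21) (S 6),
   RO RTimes (S 23) (S 23) (S 23), RO RTimes (S 23) (S 23) (S 23), RO RTimes (S 24) (S 23) (S 23),
   RO RTimes (S 24) (S 24) (S 23)]"

definition LOADA :: hcom where
 "LOADA = For 18 13 (If (TN (S 18) (S 16)) nop0 (sqs (NO NMinus (S 32) (S 18) (S 16))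
   [NO NQuot (S 33) (S 32) (S 1), NO NRem (S 29) (S 32) (S 1), RGet (M 30 33 29) (S 18)]))"

text \<open>The second pivot search runs in the remainder after k elimination steps; the maximum
  that it finds is the scale.\<close>

definition SCALE :: hcom where
 "SCALE = sqs (For 18 0 (For 19 1 (RM (M 31 18 19) (M 30 18 19)))) [ELIM 0 0 1,
   For 18 0 (For 19 2 (RM (M 41 18 19) (M 32 19 18))), PIVOT 0 1, RM (S 3) (S 22),
   RO RQuot (S 5) (S 3) (S 23), RM (S 6) (S 5), RO RQuot (S 4) (S 3) (S 24), NC (S 34) 0]"

definition OUT :: hcom where
 "OUT = For 18 15 (If (TN (S 18) (S 14))
   (sqs (NO NQuot (S 32) (S 18) (S 2)) [NO NRem (S 33) (S 18) (S 2), RPut (S 18) (M 37 32 33)])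
   (sqs (NO NMinus (S 29) (S 18) (S 14)) [NO NQuot (S 32) (S 29) (S 1), NO NRem (S 33) (S 29) (S 1),
    RPut (S 18) (M 38 32 33)]))"

definition MAIN :: hcom where
 "MAIN = sqs CONSTS [LOADA, SCALE, SEARCH, OUT]"

lemmas prog_defs = ABS_def POWF_def COST_def PIVOT_def ESTEP_def ELIM_def DIGIT_def GRID_def RHO_def
 TAKE_def REG_def DECODE_def BUILD_def ROWS_def PH1_def BUILD2_def COLS_def PH2_def SAVE_def CAND_def
 SEARCH_def CONSTS_def LOADA_def SCALE_def OUT_def MAIN_def

lemma MAIN_wf: "wf_com MAIN" by (simp add: prog_defs)
lemma MAIN_nogrow: "nogrow MAIN" by (simp add: prog_defs)

text \<open>The input and output cells are left out, so that the relation also applies around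
  \<open>RPut\<close>.\<close>

definition eqx :: "nat set => nat set => hst => hst => bool" where
 "eqx A B s s' \<longleftrightarrow> (\<forall>a. a \<notin> A \<longrightarrow> hN s' a = hN s a) \<and> (\<forall>a. a \<notin> B \<longrightarrow> hR s' a = hR s a) \<and> hb s' = hb s"

lemma eqx_refl: "eqx A B s s" by (simp add: eqx_def)

lemma eqx_run: "eqx (nmods P) (rmods P) s (run P s)"
 by (simp add: eqx_def hN_run hR_run)

lemma eqx_setn: "eqx A B s s' ==> oarr x \<in> A ==> eqx A B s (setn s' x v)"
 unfolding eqx_def by (metis hN_setn_other hR_setn hb_setn(1))

lemma eqx_trans: "eqx A B s s' ==> eqx A B s' s'' ==> eqx A B s s''"
 by (simp add: eqx_def)

lemma eqx_mono: "eqx A B s s' ==> A \<subseteq> A' ==> B \<subseteq> B' ==> eqx A' B' s s'"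
 unfolding eqx_def by blast

lemma eqxN: "eqx A B s s' ==> a \<notin> A ==> hN s' a = hN s a" by (simp add: eqx_def)
lemma eqxR: "eqx A B s s' ==> a \<notin> B ==> hR s' a = hR s a" by (simp add: eqx_def)

text \<open>What the body cannot assign is available as a frame condition.\<close>

lemma For_rule:
 assumes n: "hN s b 0 0 = n" and J0: "J 0 s"
  and step: "\<And>i s'. i < n ==> eqx (insert v (nmods P)) (rmods P) s s' ==> J i s' ==>
   J (Suc i) (run P (setn s' (S v) i))"
  and fin: "\<And>s'. eqx (insert v (nmods P)) (rmods P) s s' ==> J n s' ==> Q (setn s' (S v) n)"
 shows "Q (run (For v b P) s)"
proof -
 let ?A = "insert v (nmods P)"
 have "eqx ?A (rmods P) s (iter (run P) v i s) \<and> J i (iter (run P) v i s)" if "i \<le> n" for i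
  using that
 proof (induction i)
  case 0
  then show ?case using J0 by (simp add: eqx_refl)
 next
  case (Suc i)
  then have IH: "eqx ?A (rmods P) s (iter (run P) v i s)" "J i (iter (run P) v i s)" by auto
  have "eqx ?A (rmods P) s (setn (iter (run P) v i s) (S v) i)" using IH(1) by (intro eqx_setn) auto
  moreover have "eqx ?A (rmods P) (setn (iter (run P) v i s) (S v) i) (iter (run P) v (Suc i) s)"
   using eqx_mono[OF eqx_run[of P], of ?A "rmods P"] by auto
  ultimately show ?case using eqx_trans step[OF _ IH] Suc.prems by (auto simp: iter.simps)
 qed
 from this[of n] show ?thesis using fin n by simp
qed

lemma ABS_run:
 assumes "hR s 16 0 0 = 0" "oarr x \<noteq> 10"
 shows "hR (run (ABS x) s) 10 0 0 = \<bar>rv s x\<bar>"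
 using assms by (cases x) (auto simp: ABS_def rv_def setr_def upd3_def)

section \<open>Correctness of the program\<close>

lemmas st_simps = nv_def rv_def setn_def setr_def upd3_def

text \<open>Level and value advance together until the level reaches x: a staircase in place of the
  p-th power, computed by multiplications.\<close>

primrec pw :: "real => real => real => real => nat => real \<times> real" where
 "pw z0 g q x 0 = (z0, 1)"
| "pw z0 g q x (Suc i) = (if fst (pw z0 g q x i) < x then (fst (pw z0 g q x i) * g, snd (pw z0 g q x i) * q) else pw z0 g q x i)"

definition powf :: "hst => real => real" where
 "powf s x = snd (pw (hR s 6 0 0) (hR s 2 0 0) (hR s 1 0 0) x (hN s 9 0 0))"

lemma powf_cong: "eqx A B s s' ==> 9 \<notin> A ==> {1, 2, 6} \<inter> B = {} ==> powf s' = powf s"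
 by (auto simp: powf_def eqx_def fun_eq_iff)

lemma POWF_run:
 assumes "hR s 17 0 0 = 1"
 shows "hR (run POWF s) 12 0 0 = powf s (hR s 10 0 0)"
proof -
 let ?s = "run (RM (S 12) (S 17)) (run (RM (S 11) (S 6)) s)"
 let ?pw = "pw (hR s 6 0 0) (hR s 2 0 0) (hR s 1 0 0) (hR s 10 0 0)"
 have "(%s'. hR s' 12 0 0 = snd (?pw (hN s 9 0 0))) (run (For 27 9 (If (TR (S 11) (S 10)) (Sq (RO RTimes (S 11) (S 11) (S 2)) (RO RTimes (S 12) (S 12) (S 1))) nop0)) ?s)"
 proof (rule For_rule[where J = "%i s'. hR s' 11 0 0 = fst (?pw i) \<and> hR s' 12 0 0 = snd (?pw i)"])
  show "hN ?s 9 0 0 = hN s 9 0 0" by (simp add: st_simps)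
  show "hR ?s 11 0 0 = fst (?pw 0) \<and> hR ?s 12 0 0 = snd (?pw 0)" using assms by (simp add: st_simps)
 next
  fix i s' assume e: "eqx (insert 27 (nmods (If (TR (S 11) (S 10)) (Sq (RO RTimes (S 11) (S 11) (S 2)) (RO RTimes (S 12) (S 12) (S 1))) nop0)))
    (rmods (If (TR (S 11) (S 10)) (Sq (RO RTimes (S 11) (S 11) (S 2)) (RO RTimes (S 12) (S 12) (S 1))) nop0)) ?s s'"
   and J: "hR s' 11 0 0 = fst (?pw i) \<and> hR s' 12 0 0 = snd (?pw i)"
  have "hR s' 2 0 0 = hR s 2 0 0" "hR s' 1 0 0 = hR s 1 0 0" "hR s' 10 0 0 = hR s 10 0 0"
   using eqxR[OF e, of 2] eqxR[OF e, of 1] eqxR[OF e, of 10] by (simp_all add: st_simps)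
  then show "hR (run (If (TR (S 11) (S 10)) (Sq (RO RTimes (S 11) (S 11) (S 2)) (RO RTimes (S 12) (S 12) (S 1))) nop0) (setn s' (S 27) i)) 11 0 0 = fst (?pw (Suc i)) \<and>
    hR (run (If (TR (S 11) (S 10)) (Sq (RO RTimes (S 11) (S 11) (S 2)) (RO RTimes (S 12) (S 12) (S 1))) nop0) (setn s' (S 27) i)) 12 0 0 = snd (?pw (Suc i))"
   using J by (auto simp: st_simps)
 qed (simp add: st_simps)
 then show ?thesis by (simp add: POWF_def powf_def)
qed

lemma mods_simps [simp]:
 "nmods (ABS x) = {}" "rmods (ABS x) = {10, 14}" "nmods POWF = {27}" "rmods POWF = {11, 12, 14}"
 "nmods (COST N) = {18, 27}" "rmods (COST N) = {10, 11, 12, 13, 14, 15}"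
 "nmods (PIVOT N K) = {18, 19, 30, 31}" "rmods (PIVOT N K) = {10, 14, 22}"
 "nmods (ESTEP N L K) = {18, 19, 30, 31, 42}" "rmods (ESTEP N L K) = {10, 14, 15, 22, 31, 32}"
 "nmods (ELIM N L K) = {18, 19, 20, 30, 31, 42}" "rmods (ELIM N L K) = {10, 14, 15, 22, 31, 32}"
 "nmods DIGIT = {28, 29}" "rmods DIGIT = {}" "nmods GRID = {28, 29}" "rmods GRID = {14}"
 "nmods (RHO L) = {18, 20, 28, 29, 32}" "rmods (RHO L) = {14, 15, 33}"
 "nmods (TAKE L b) = {18, 32}" "rmods (TAKE L b) = {7, 14, 40}"
 "nmods (REG N L b) = {18, 20, 21, 27, 28, 29, 32}" "rmods (REG N L b) = {7, 10, 11, 12, 13, 14, 15, 33, 40}"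
 by (auto simp: prog_defs)

lemma COST_run:
 assumes s: "hR s 16 0 0 = 0" "hR s 17 0 0 = 1" and N: "N \<in> {0, 10}" "hN s N 0 0 = n"
 shows "hR (run (COST N) s) 13 0 0 = (\<Sum>x<n. hR s 34 x 0 * powf s \<bar>hR s 33 x 0\<bar>)"
proof -
 let ?B = "sqs (ABS (V 33 18)) [POWF, RO RTimes (S 15) (V 34 18) (S 12), RO RPlus (S 13) (S 13) (S 15)]"
 let ?s = "run (RC (S 13) 0) s"
 have "(%s'. hR s' 13 0 0 = (\<Sum>x<n. hR s 34 x 0 * powf s \<bar>hR s 33 x 0\<bar>)) (run (For 18 N ?B) ?s)"
 proof (rule For_rule[where n = n and J = "%i s'. hR s' 13 0 0 = (\<Sum>x<i. hR s 34 x 0 * powf s \<bar>hR s 33 x 0\<bar>)"])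
  fix i s' assume e: "eqx (insert 18 (nmods ?B)) (rmods ?B) ?s s'"
   and J: "hR s' 13 0 0 = (\<Sum>x<i. hR s 34 x 0 * powf s \<bar>hR s 33 x 0\<bar>)"
  let ?s1 = "setn s' (S 18) i"
  let ?s2 = "run (ABS (V 33 18)) ?s1"
  let ?s3 = "run POWF ?s2"
  have e1: "hR s' 33 = hR s 33" "hR s' 34 = hR s 34" "hR s' 16 = hR s 16" "hR s' 17 = hR s 17"
   using eqxR[OF e, of 33] eqxR[OF e, of 34] eqxR[OF e, of 16] eqxR[OF e, of 17] by (simp_all add: hR_setr_other)
  have a: "hR ?s2 10 0 0 = \<bar>hR s 33 i 0\<bar>"
   using ABS_run[of ?s1 "V 33 18"] e1 s by (simp add: st_simps)
  have p2: "powf ?s2 = powf s"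
  proof -
   have "powf s' = powf ?s" by (rule powf_cong[OF e]) auto
   moreover have "powf ?s1 = powf s'" by (auto simp: powf_def fun_eq_iff st_simps)
   moreover have "powf ?s2 = powf ?s1" by (rule powf_cong[OF eqx_run]) auto
   moreover have "powf ?s = powf s" by (rule powf_cong[OF eqx_run]) auto
   ultimately show ?thesis by simp
  qed
  have f: "hR ?s3 12 0 0 = powf s \<bar>hR s 33 i 0\<bar>"
   using POWF_run[of ?s2] a p2 e1 s by (simp add: hR_run)
  have o: "hR ?s3 13 0 0 = hR s' 13 0 0" "hR ?s3 34 i 0 = hR s 34 i 0" "hN ?s3 18 0 0 = i"
   using e1 by (simp_all add: hR_run hN_run) (simp add: st_simps)
  show "hR (run ?B ?s1) 13 0 0 = (\<Sum>x<Suc i. hR s 34 x 0 * powf s \<bar>hR s 33 x 0\<bar>)"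
   using f o J by (simp add: st_simps)
 qed (use N in \<open>auto simp: st_simps\<close>)
 then show ?thesis by (simp add: COST_def)
qed

lemma PIVOT_run:
 assumes s: "hR s 16 0 0 = 0" and N: "N \<in> {0, 10}" "hN s N 0 0 = n" "n \<ge> 1"
  and K: "K \<in> {1, 2}" "hN s K 0 0 = m" "m \<ge> 1"
 defines "s' \<equiv> run (PIVOT N K) s"
 shows "hN s' 30 0 0 < n" "hN s' 31 0 0 < m"
  "\<And>x y. x < n ==> y < m ==> \<bar>hR s 31 x y\<bar> \<le> \<bar>hR s 31 (hN s' 30 0 0) (hN s' 31 0 0)\<bar>"
  "hR s' 22 0 0 = \<bar>hR s 31 (hN s' 30 0 0) (hN s' 31 0 0)\<bar>"
proof -
 let ?s = "run (NC (S 31) 0) (run (NC (S 30) 0) (run (RC (S 22) 0) s))"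
 let ?B = "Sq (ABS (M 31 18 19)) (If (TR (S 22) (S 10)) (sqs (RM (S 22) (S 10)) [NM (S 30) (S 18), NM (S 31) (S 19)]) nop0)"
 let ?H = "hR s 31"
 \<comment> \<open>The alternative with maximum 0 describes the start; it can persist only while all
   entries seen so far vanish.\<close>
 let ?I = "%D (t :: hst). hN t 30 0 0 < n \<and> hN t 31 0 0 < m \<and> 0 \<le> hR t 22 0 0 \<and>
   (hR t 22 0 0 = \<bar>?H (hN t 30 0 0) (hN t 31 0 0)\<bar> \<or> hR t 22 0 0 = 0 \<and> hN t 30 0 0 = 0 \<and> hN t 31 0 0 = 0) \<and>
   (\<forall>x y. D x y \<longrightarrow> \<bar>?H x y\<bar> \<le> hR t 22 0 0)"
 have "(?I (%x y. x < n \<and> y < m)) (run (For 18 N (For 19 K ?B)) ?s)"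
 proof (rule For_rule[where n = n and J = "%i. ?I (%x y. x < i \<and> y < m)"])
  fix i s1 assume i: "i < n" and e: "eqx (insert 18 (nmods (For 19 K ?B))) (rmods (For 19 K ?B)) ?s s1"
   and J: "?I (%x y. x < i \<and> y < m) s1"
  have Hs1: "hR s1 31 = ?H" "hR s1 16 = hR s 16" using eqxR[OF e, of 31] eqxR[OF e, of 16] by (simp_all add: hR_setr_other)
  have Ks1: "hN s1 K 0 0 = m" using eqxN[OF e, of K] K by (auto simp: hN_setn_other)
  show "?I (%x y. x < Suc i \<and> y < m) (run (For 19 K ?B) (setn s1 (S 18) i))"
  proof (rule For_rule[where n = m and J = "%j. ?I (%x y. x < i \<and> y < m \<or> x = i \<and> y < j)"])
   show "hN (setn s1 (S 18) i) K 0 0 = m" using Ks1 K by (auto simp: st_simps)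
   show "?I (%x y. x < i \<and> y < m \<or> x = i \<and> y < 0) (setn s1 (S 18) i)" using J by (simp add: st_simps)
  next
   fix j t assume j: "j < m" and e2: "eqx (insert 19 (nmods ?B)) (rmods ?B) (setn s1 (S 18) i) t"
    and J2: "?I (%x y. x < i \<and> y < m \<or> x = i \<and> y < j) t"
   let ?t1 = "setn t (S 19) j"
   let ?t2 = "run (ABS (M 31 18 19)) ?t1"
   have Ht: "hR t 31 = ?H" "hR t 16 0 0 = 0" using eqxR[OF e2, of 31] eqxR[OF e2, of 16] Hs1 s by simp_all
   have t18: "hN t 18 0 0 = i" using eqxN[OF e2, of 18] by (simp add: st_simps)
   have a: "hR ?t2 10 0 0 = \<bar>?H i j\<bar>" using ABS_run[of ?t1 "M 31 18 19"] Ht t18 by (simp add: st_simps)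
   have o: "hR ?t2 22 = hR t 22" "hN ?t2 30 = hN t 30" "hN ?t2 31 = hN t 31" "hN ?t2 18 0 0 = i" "hN ?t2 19 0 0 = j"
    using t18 by (simp_all add: hR_run hN_run hN_setn_other) (simp add: st_simps)
   show "?I (%x y. x < i \<and> y < m \<or> x = i \<and> y < Suc j) (run ?B ?t1)"
   proof (cases "hR t 22 0 0 < \<bar>?H i j\<bar>")
    case True
    then have "hR (run ?B ?t1) 22 0 0 = \<bar>?H i j\<bar>" "hN (run ?B ?t1) 30 0 0 = i" "hN (run ?B ?t1) 31 0 0 = j"
     using a o by (simp_all add: st_simps)
    moreover have "\<bar>?H x y\<bar> \<le> \<bar>?H i j\<bar>" if "x < i \<and> y < m \<or> x = i \<and> y < Suc j" for x y
    proof -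
     have "x < i \<and> y < m \<or> x = i \<and> y < j \<or> x = i \<and> y = j" using that by (auto simp: less_Suc_eq)
     then have "\<bar>?H x y\<bar> \<le> hR t 22 0 0 \<or> \<bar>?H x y\<bar> = \<bar>?H i j\<bar>" using J2 by blast
     then show ?thesis using True by linarith
    qed
    ultimately show ?thesis using i j by simp
   next
    case False
    then have "hR (run ?B ?t1) 22 0 0 = hR t 22 0 0" "hN (run ?B ?t1) 30 0 0 = hN t 30 0 0" "hN (run ?B ?t1) 31 0 0 = hN t 31 0 0"
     using a o by (simp_all add: st_simps)
    moreover have "\<bar>?H x y\<bar> \<le> hR t 22 0 0" if "x < i \<and> y < m \<or> x = i \<and> y < Suc j" for x y
    proof -
     have "x < i \<and> y < m \<or> x = i \<and> y < j \<or> x = i \<and> y = j" using that by (auto simp: less_Suc_eq)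
     then have "\<bar>?H x y\<bar> \<le> hR t 22 0 0 \<or> \<bar>?H x y\<bar> = \<bar>?H i j\<bar>" using J2 by blast
     then show ?thesis using False by linarith
    qed
    ultimately show ?thesis using J2 by simp
   qed
  next
   fix t :: hst assume J2: "?I (%x y. x < i \<and> y < m \<or> x = i \<and> y < m) t"
   then show "?I (%x y. x < Suc i \<and> y < m) (setn t (S 19) m)"
    by (simp add: st_simps less_Suc_eq conj_disj_distribR)
  qed
 qed (use N K in \<open>auto simp: st_simps\<close>)
 then have I: "?I (%x y. x < n \<and> y < m) s'" unfolding s'_def PIVOT_def by simp
 show "hN s' 30 0 0 < n" "hN s' 31 0 0 < m" using I by auto
 have le: "\<bar>?H x y\<bar> \<le> hR s' 22 0 0" if "x < n" "y < m" for x y using I that by auto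
 show eq: "hR s' 22 0 0 = \<bar>?H (hN s' 30 0 0) (hN s' 31 0 0)\<bar>"
  using I le[of 0 0] N(3) K(3) by auto
 show "\<bar>?H x y\<bar> \<le> \<bar>?H (hN s' 30 0 0) (hN s' 31 0 0)\<bar>" if "x < n" "y < m" for x y
  using le[OF that] eq by simp
qed

lemma ESTEP_run:
 assumes s: "hR s 16 0 0 = 0" and N: "N \<in> {0, 10}" "hN s N 0 0 = n" "n \<ge> 1"
  and K: "K \<in> {1, 2}" "hN s K 0 0 = m" "m \<ge> 1" and L: "L \<in> {0, 10, 11}" "hN s L 0 0 = l"
  and t: "hN s 20 0 0 = t"
 defines "s' \<equiv> run (ESTEP N L K) s"
 shows "\<exists>q<n. \<exists>c<m. (\<forall>x<n. \<forall>y<m. \<bar>hR s 31 x y\<bar> \<le> \<bar>hR s 31 q c\<bar>) \<and>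
  hN s' 42 = (%i j. if i = t \<and> j = 0 then q else hN s 42 i j) \<and>
  hR s' 32 = (%i x. if i = t \<and> x < l then hR s 31 x c / hR s 31 q c else hR s 32 i x) \<and>
  hR s' 31 = (%x y. if x < l \<and> y < m then hR s 31 x y - hR s 31 q y * hR s' 32 t x else hR s 31 x y)"
proof -
 let ?H = "hR s 31"
 define s1 where "s1 = run (PIVOT N K) s"
 define q where "q = hN s1 30 0 0"
 define c where "c = hN s1 31 0 0"
 \<comment> \<open>The search leaves the modulus in cell 22, but division needs the signed
   pivot.\<close>
 define s3 where "s3 = run (RM (S 22) (M 31 30 31)) (run (NM (V 42 20) (S 30)) s1)"
 define s4 where "s4 = run (For 18 L (RO RQuot (M 32 20 18) (M 31 18 31) (S 22))) s3"
 note pv = PIVOT_run[OF s N K, folded s1_def, folded q_def c_def]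
 have e1: "hR s1 31 = ?H" "hR s1 32 = hR s 32" "hN s1 42 = hN s 42" "hN s1 20 0 0 = t" "hN s1 L 0 0 = l" "hN s1 K 0 0 = m" "L \<noteq> 42" "K \<noteq> 42"
  using L K t by (auto simp: s1_def hR_run hN_run)
 have e3: "hR s3 31 = ?H" "hR s3 32 = hR s 32" "hR s3 22 0 0 = ?H q c" "hN s3 20 0 0 = t"
  "hN s3 30 0 0 = q" "hN s3 31 0 0 = c" "hN s3 L 0 0 = l" "hN s3 K 0 0 = m"
  "hN s3 42 = (%i j. if i = t \<and> j = 0 then q else hN s 42 i j)"
  using e1 by (auto simp: s3_def st_simps q_def c_def fun_eq_iff)
 have B4: "hR s4 32 = (%i x. if i = t \<and> x < l then ?H x c / ?H q c else hR s 32 i x)"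
  unfolding s4_def
 proof (rule For_rule[where n = l and J = "%j s'. hR s' 32 = (%i x. if i = t \<and> x < j then ?H x c / ?H q c else hR s 32 i x)"])
  fix j u assume e: "eqx (insert 18 (nmods (RO RQuot (M 32 20 18) (M 31 18 31) (S 22)))) (rmods (RO RQuot (M 32 20 18) (M 31 18 31) (S 22))) s3 u"
   and J: "hR u 32 = (%i x. if i = t \<and> x < j then ?H x c / ?H q c else hR s 32 i x)"
  have "hR u 31 = ?H" "hR u 22 0 0 = ?H q c" "hN u 20 0 0 = t" "hN u 31 0 0 = c"
   using eqxR[OF e, of 31] eqxR[OF e, of 22] eqxN[OF e, of 20] eqxN[OF e, of 31] e3 by simp_all
  then show "hR (run (RO RQuot (M 32 20 18) (M 31 18 31) (S 22)) (setn u (S 18) j)) 32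
    = (%i x. if i = t \<and> x < Suc j then ?H x c / ?H q c else hR s 32 i x)"
   using J by (auto simp: st_simps fun_eq_iff less_Suc_eq)
 qed (use e3 in auto)
 have e4: "hR s4 31 = ?H" "hN s4 20 0 0 = t" "hN s4 30 0 0 = q" "hN s4 L 0 0 = l" "hN s4 K 0 0 = m" "hN s4 42 = hN s3 42"
  using e3 L K by (auto simp: s4_def hR_run hN_run simp del: run.simps)
 let ?b = "hR s4 32 t"
 let ?P1 = "Sq (RO RTimes (S 15) (S 14) (M 32 20 18)) (RO RMinus (M 31 18 19) (M 31 18 19) (S 15))"
 let ?P2 = "Sq (RM (S 14) (M 31 30 19)) (For 18 L ?P1)"
 have s': "s' = run (For 19 K ?P2) s4" by (simp add: s'_def ESTEP_def s4_def s3_def s1_def)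
 have H5: "hR s' 31 = (%x y. if x < l \<and> y < m then ?H x y - ?H q y * ?b x else ?H x y)"
  unfolding s'
 proof (rule For_rule[where n = m and J = "%j s'. hR s' 31 = (%x y. if x < l \<and> y < j then ?H x y - ?H q y * ?b x else ?H x y)"])
  fix j u assume e: "eqx (insert 19 (nmods ?P2)) (rmods ?P2) s4 u"
   and J: "hR u 31 = (%x y. if x < l \<and> y < j then ?H x y - ?H q y * ?b x else ?H x y)"
  have eu: "hR u 32 = hR s4 32" "hN u 20 0 0 = t" "hN u 30 0 0 = q" "hN u L 0 0 = l"
   using eqxR[OF e, of 32] eqxN[OF e, of 20] eqxN[OF e, of 30] eqxN[OF e, of L] e4 L by auto
  let ?u1 = "run (RM (S 14) (M 31 30 19)) (setn u (S 19) j)"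
  have "hR ?u1 14 0 0 = ?H q j" using J eu by (simp add: st_simps)
  moreover have "hN ?u1 19 0 0 = j" "hN ?u1 20 0 0 = t" "hN ?u1 L 0 0 = l" "hR ?u1 32 = hR s4 32" "hR ?u1 31 = hR u 31"
   using eu L by (auto simp: st_simps)
  ultimately have u1: "hR ?u1 14 0 0 = ?H q j" "hN ?u1 19 0 0 = j" "hN ?u1 20 0 0 = t" "hN ?u1 L 0 0 = l" "hR ?u1 32 = hR s4 32" "hR ?u1 31 = hR u 31"
   by auto
  have "hR (run (For 18 L ?P1) ?u1) 31 = (%x y. if x < l \<and> y < Suc j then ?H x y - ?H q y * ?b x else ?H x y)"
  proof (rule For_rule[where n = l and J = "%i s'. hR s' 31 = (%x y. if x < l \<and> y < j \<or> x < i \<and> y = j then ?H x y - ?H q y * ?b x else ?H x y)"])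
   fix i w assume i: "i < l" and e: "eqx (insert 18 (nmods ?P1)) (rmods ?P1) ?u1 w"
    and J2: "hR w 31 = (%x y. if x < l \<and> y < j \<or> x < i \<and> y = j then ?H x y - ?H q y * ?b x else ?H x y)"
   have "hR w 32 = hR s4 32" "hR w 14 0 0 = ?H q j" "hN w 20 0 0 = t" "hN w 19 0 0 = j"
    using eqxR[OF e, of 32] eqxR[OF e, of 14] eqxN[OF e, of 20] eqxN[OF e, of 19] u1 by simp_all
   then show "hR (run ?P1 (setn w (S 18) i)) 31
     = (%x y. if x < l \<and> y < j \<or> x < Suc i \<and> y = j then ?H x y - ?H q y * ?b x else ?H x y)"
    using J2 i by (auto simp: st_simps fun_eq_iff less_Suc_eq)
  next
   fix w :: hst assume "hR w 31 = (%x y. if x < l \<and> y < j \<or> x < l \<and> y = j then ?H x y - ?H q y * ?b x else ?H x y)"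
   then show "hR (setn w (S 18) l) 31 = (%x y. if x < l \<and> y < Suc j then ?H x y - ?H q y * ?b x else ?H x y)"
    by (auto simp: fun_eq_iff less_Suc_eq)
  qed (use u1 J in auto)
  then show "hR (run ?P2 (setn u (S 19) j)) 31 = (%x y. if x < l \<and> y < Suc j then ?H x y - ?H q y * ?b x else ?H x y)"
   by simp
 qed (use e4 in auto)
 have e5: "hR s' 32 = hR s4 32" "hN s' 42 = hN s3 42" using e4 by (simp_all add: s' hR_run hN_run del: run.simps)
 have "(\<forall>x<n. \<forall>y<m. \<bar>?H x y\<bar> \<le> \<bar>?H q c\<bar>) \<and>
  hN s' 42 = (%i j. if i = t \<and> j = 0 then q else hN s 42 i j) \<and>
  hR s' 32 = (%i x. if i = t \<and> x < l then ?H x c / ?H q c else hR s 32 i x) \<and>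
  hR s' 31 = (%x y. if x < l \<and> y < m then ?H x y - ?H q y * hR s' 32 t x else ?H x y)"
  using pv(3) B4 e3(9) unfolding H5[unfolded e5(1)[symmetric]] by (intro conjI refl) (simp_all add: e5)
 then show ?thesis using pv(1,2) by blast
qed

text \<open>The program overwrites its matrix, so the earlier matrices of a trace exist in the proof
  only. The stored multipliers and pivot rows persist, and their agreement on the earlier steps
  suffices to extend the trace.\<close>

lemma elims_Suc:
 assumes el: "elims n l m i Hs b Q" and b: "\<And>t x. t < i ==> x < l ==> b' t x = b t x" "\<And>t. t < i ==> Q' t = Q t"
  and q: "Q' i < n" "c < m" "\<And>x y. x < n ==> y < m ==> \<bar>Hs i x y\<bar> \<le> \<bar>Hs i (Q' i) c\<bar>"
  "\<And>x. x < l ==> b' i x = Hs i x c / Hs i (Q' i) c"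
  "\<And>x y. x < l ==> y < m ==> H x y = Hs i x y - Hs i (Q' i) y * b' i x"
 shows "elims n l m (Suc i) (Hs(Suc i := H)) b' Q'"
 unfolding elims_def
proof (rule allI, rule impI)
 fix t assume "t < Suc i"
 then consider "t = i" | "t < i" by linarith
 then show "Q' t < n \<and> (\<exists>c<m. (\<forall>x<n. \<forall>y<m. \<bar>(Hs(Suc i := H)) t x y\<bar> \<le> \<bar>(Hs(Suc i := H)) t (Q' t) c\<bar>) \<and>
   (\<forall>x<l. b' t x = (Hs(Suc i := H)) t x c / (Hs(Suc i := H)) t (Q' t) c)) \<and>
   (\<forall>x<l. \<forall>y<m. (Hs(Suc i := H)) (Suc t) x y = (Hs(Suc i := H)) t x y - (Hs(Suc i := H)) t (Q' t) y * b' t x)"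
 proof cases
  case 1
  then show ?thesis using q by (simp del: abs_divide) blast
 next
  case 2
  have "Q t < n \<and> (\<exists>c<m. (\<forall>x<n. \<forall>y<m. \<bar>Hs t x y\<bar> \<le> \<bar>Hs t (Q t) c\<bar>) \<and>
   (\<forall>x<l. b t x = Hs t x c / Hs t (Q t) c)) \<and>
   (\<forall>x<l. \<forall>y<m. Hs (Suc t) x y = Hs t x y - Hs t (Q t) y * b t x)"
   by (rule el[unfolded elims_def, THEN spec, THEN mp, OF 2])
  moreover have "(Hs(Suc i := H)) t = Hs t" "(Hs(Suc i := H)) (Suc t) = Hs (Suc t)" using 2 by auto
  moreover have "\<forall>x<l. b' t x = b t x" "Q' t = Q t" using b[OF 2] by auto
  ultimately show ?thesis by (simp only: cong: all_cong1) metis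
 qed
qed

lemma ELIM_run:
 assumes s: "hR s 16 0 0 = 0" and N: "N \<in> {0, 10}" "hN s N 0 0 = n" "n \<ge> 1"
  and K: "K \<in> {1, 2}" "hN s K 0 0 = m" "m \<ge> 1" and L: "L \<in> {0, 10, 11}" "hN s L 0 0 = l"
  and k: "hN s 2 0 0 = k"
 defines "s' \<equiv> run (ELIM N L K) s"
 shows "\<exists>Hs. Hs 0 = hR s 31 \<and> Hs k = hR s' 31 \<and> elims n l m k Hs (hR s' 32) (%t. hN s' 42 t 0)"
 unfolding s'_def ELIM_def
proof (rule For_rule[where n = k and J = "%i s'. \<exists>Hs. Hs 0 = hR s 31 \<and> Hs i = hR s' 31 \<and> elims n l m i Hs (hR s' 32) (%t. hN s' 42 t 0)"])
 show "\<exists>Hs. Hs 0 = hR s 31 \<and> Hs 0 = hR s 31 \<and> elims n l m 0 Hs (hR s 32) (%t. hN s 42 t 0)"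
  by (intro exI[of _ "%_. hR s 31"]) (simp add: elims_def)
next
 fix i u assume i: "i < k" and e: "eqx (insert 20 (nmods (ESTEP N L K))) (rmods (ESTEP N L K)) s u"
  and J: "\<exists>Hs. Hs 0 = hR s 31 \<and> Hs i = hR u 31 \<and> elims n l m i Hs (hR u 32) (%t. hN u 42 t 0)"
 then obtain Hs where Hs: "Hs 0 = hR s 31" "Hs i = hR u 31" "elims n l m i Hs (hR u 32) (%t. hN u 42 t 0)" by blast
 let ?u = "setn u (S 20) i"
 let ?w = "run (ESTEP N L K) ?u"
 have u: "hR ?u 16 0 0 = 0" "hN ?u N 0 0 = n" "hN ?u K 0 0 = m" "hN ?u L 0 0 = l" "hN ?u 20 0 0 = i"
  using eqxR[OF e, of 16] eqxN[OF e, of N] eqxN[OF e, of K] eqxN[OF e, of L] s N K L by (auto simp: st_simps)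
 obtain q c where q: "q < n" "c < m" "\<forall>x<n. \<forall>y<m. \<bar>hR ?u 31 x y\<bar> \<le> \<bar>hR ?u 31 q c\<bar>"
  "hN ?w 42 = (%i' j. if i' = i \<and> j = 0 then q else hN ?u 42 i' j)"
  "hR ?w 32 = (%i' x. if i' = i \<and> x < l then hR ?u 31 x c / hR ?u 31 q c else hR ?u 32 i' x)"
  "hR ?w 31 = (%x y. if x < l \<and> y < m then hR ?u 31 x y - hR ?u 31 q y * hR ?w 32 i x else hR ?u 31 x y)"
  using ESTEP_run[OF u(1) N(1) u(2) N(3) K(1) u(3) K(3) L(1) u(4) u(5)] by blast
 have "elims n l m (Suc i) (Hs(Suc i := hR ?w 31)) (hR ?w 32) (%t. hN ?w 42 t 0)"
 proof (rule elims_Suc[OF Hs(3), where c = c])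
  show "hR ?w 32 t x = hR u 32 t x" if "t < i" for t x using q(5) that by simp
  show "hN ?w 42 t 0 = hN u 42 t 0" if "t < i" for t using q(4) that by (simp add: hN_setn_other)
  have Qi: "hN ?w 42 i 0 = q" using q(4) by simp
  show "hN ?w 42 i 0 < n" using Qi q by simp
  show "\<bar>Hs i x y\<bar> \<le> \<bar>Hs i (hN ?w 42 i 0) c\<bar>" if "x < n" "y < m" for x y
   unfolding Qi Hs(2) using q(3) that by simp
  show "hR ?w 32 i x = Hs i x c / Hs i (hN ?w 42 i 0) c" if "x < l" for x
   unfolding Qi Hs(2) using q(5) that by simp
  show "hR ?w 31 x y = Hs i x y - Hs i (hN ?w 42 i 0) y * hR ?w 32 i x" if "x < l" "y < m" for x y
   unfolding Qi Hs(2) using q(6) that by simp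
 qed (rule q(2))
 then show "\<exists>Hs. Hs 0 = hR s 31 \<and> Hs (Suc i) = hR ?w 31 \<and> elims n l m (Suc i) Hs (hR ?w 32) (%t. hN ?w 42 t 0)"
  using Hs(1) by (intro exI[of _ "Hs(Suc i := hR ?w 31)"]) simp
next
 fix u assume "eqx (insert 20 (nmods (ESTEP N L K))) (rmods (ESTEP N L K)) s u"
  "\<exists>Hs. Hs 0 = hR s 31 \<and> Hs k = hR u 31 \<and> elims n l m k Hs (hR u 32) (%t. hN u 42 t 0)"
 then show "\<exists>Hs. Hs 0 = hR s 31 \<and> Hs k = hR (setn u (S 20) k) 31 \<and>
  elims n l m k Hs (hR (setn u (S 20) k) 32) (%t. hN (setn u (S 20) k) 42 t 0)"
  by (simp add: hN_setn_other)
qed (rule k)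

section \<open>Digit codes and the exhaustive regression\<close>

definition dig :: "nat => nat => nat => nat" where
 "dig G c t = c div G ^ t mod G"

definition gridv :: "hst => nat => real" where
 "gridv s g = (real g - hR s 21 0 0) * hR s 4 0 0"

lemma div_power_div: "(c :: nat) div G ^ t div G = c div (G * G ^ t)"
 by (simp only: div_mult2_eq[symmetric] mult.commute[of G])

lemma GRID_run:
 assumes "hN s 28 0 0 = c div hN s 7 0 0 ^ t"
 shows "hN (run GRID s) 28 0 0 = c div hN s 7 0 0 ^ Suc t"
  "hR (run GRID s) 14 0 0 = gridv s (dig (hN s 7 0 0) c t)"
  "hN (run GRID s) 29 0 0 = dig (hN s 7 0 0) c t"
 using assms by (auto simp: GRID_def DIGIT_def st_simps dig_def gridv_def div_power_div)

lemma DIGIT_run: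
 assumes "hN s 28 0 0 = c div hN s 7 0 0 ^ t"
 shows "hN (run DIGIT s) 28 0 0 = c div hN s 7 0 0 ^ Suc t"
  "hN (run DIGIT s) 29 0 0 = dig (hN s 7 0 0) c t"
 using assms by (auto simp: DIGIT_def st_simps dig_def div_power_div)

definition rho :: "hst => nat => nat => nat => real" where
 "rho s k c = resid (%x. hR s 39 x 0) (hR s 32) (%t. hN s 42 t 0) (%t. gridv s (dig (hN s 7 0 0) c t)) k"

lemma RHO_run:
 assumes L: "L \<in> {0, 10, 11}" "hN s L 0 0 = l" and k: "hN s 2 0 0 = k"
  and Q: "\<And>t. t < k ==> hN s 42 t 0 < l" and x: "x < l"
 shows "hR (run (RHO L) s) 33 x 0 = rho s k (hN s 21 0 0) x"
proof -
 let ?c = "hN s 21 0 0" let ?G = "hN s 7 0 0"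
 let ?P1 = "RM (V 33 18) (V 39 18)"
 define s1 where "s1 = run (For 18 L ?P1) s"
 define s2 where "s2 = run (NM (S 28) (S 21)) s1"
 let ?P2 = "Sq (RO RTimes (S 15) (S 14) (M 32 20 18)) (RO RMinus (V 33 18) (V 33 18) (S 15))"
 let ?P3 = "sqs GRID [NM (S 32) (V 42 20), RO RPlus (S 14) (S 14) (V 33 32), For 18 L ?P2]"
 have T1: "\<forall>x<l. hR s1 33 x 0 = hR s 39 x 0"
  unfolding s1_def
 proof (rule For_rule[where n = l and J = "%i s'. \<forall>x<i. hR s' 33 x 0 = hR s 39 x 0"])
  fix i u assume e: "eqx (insert 18 (nmods ?P1)) (rmods ?P1) s u" and J: "\<forall>x<i. hR u 33 x 0 = hR s 39 x 0"
  have "hR u 39 = hR s 39" using eqxR[OF e, of 39] by simp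
  then show "\<forall>x<Suc i. hR (run ?P1 (setn u (S 18) i)) 33 x 0 = hR s 39 x 0" using J by (simp add: st_simps less_Suc_eq)
 qed (use L in auto)
 have e1: "hR s1 a = hR s a" if "a \<noteq> 33" for a using that by (simp add: s1_def hR_run del: run.simps)
 have e1N: "hN s1 a = hN s a" if "a \<noteq> 18" for a using that by (simp add: s1_def hN_run del: run.simps)
 have e2: "hR s2 a = hR s a" if "a \<noteq> 33" for a using that e1 by (simp add: s2_def)
 have e2N: "hN s2 a = hN s a" if "a \<noteq> 18" "a \<noteq> 28" for a using that e1N by (simp add: s2_def hN_setn_other)
 define r where "r t = gridv s (dig ?G ?c t)" for t
 define R where "R = resid (%x. hR s 39 x 0) (hR s 32) (%t. hN s 42 t 0) r"
 have "\<forall>x<l. hR (run (For 20 2 ?P3) s2) 33 x 0 = R k x"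
 proof (rule For_rule[where n = k and J = "%t s'. (\<forall>x<l. hR s' 33 x 0 = R t x) \<and> hN s' 28 0 0 = ?c div ?G ^ t"])
  show "hN s2 2 0 0 = k" using e2N[of 2] k by simp
  show "(\<forall>x<l. hR s2 33 x 0 = R 0 x) \<and> hN s2 28 0 0 = ?c div ?G ^ 0"
   using T1 e1N[of 21] by (simp add: s2_def R_def) (simp add: st_simps)
 next
  fix t u assume t: "t < k" and e: "eqx (insert 20 (nmods ?P3)) (rmods ?P3) s2 u"
   and J: "(\<forall>x<l. hR u 33 x 0 = R t x) \<and> hN u 28 0 0 = ?c div ?G ^ t"
  have eu: "hR u 32 = hR s 32" "hR u 21 = hR s 21" "hR u 4 = hR s 4" "hN u 42 = hN s 42" "hN u 7 = hN s 7" "hN u L 0 0 = l"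
   using eqxR[OF e, of 32] eqxR[OF e, of 21] eqxR[OF e, of 4] eqxN[OF e, of 42] eqxN[OF e, of 7] eqxN[OF e, of L] e2 e2N L by auto
  define u1 where "u1 = run GRID (setn u (S 20) t)"
  have "hN (setn u (S 20) t) 28 0 0 = ?c div hN (setn u (S 20) t) 7 0 0 ^ t"
   using J eu by (simp add: hN_setn_other)
  from GRID_run[OF this] have u1: "hN u1 28 0 0 = ?c div ?G ^ Suc t" "hR u1 14 0 0 = r t"
   using eu by (simp_all add: u1_def hN_setn_other r_def gridv_def)
  have u1e: "hR u1 33 = hR u 33" "hR u1 32 = hR s 32" "hN u1 42 = hN s 42" "hN u1 20 0 0 = t" "hN u1 L 0 0 = l"
   using eu L by (auto simp: u1_def hR_run hN_run hN_setn_other hN_setn_S)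
  define u2 where "u2 = run (RO RPlus (S 14) (S 14) (V 33 32)) (run (NM (S 32) (V 42 20)) u1)"
  have u2: "hR u2 14 0 0 = R t (hN s 42 t 0) + r t" "hR u2 33 = hR u 33" "hR u2 32 = hR s 32" "hN u2 20 0 0 = t"
    "hN u2 L 0 0 = l" "hN u2 28 0 0 = ?c div ?G ^ Suc t"
   using u1 u1e J Q[OF t] L by (auto simp: u2_def st_simps)
  define u3 where "u3 = run (For 18 L ?P2) u2"
  have "\<forall>x<l. hR u3 33 x 0 = R (Suc t) x"
   unfolding u3_def
  proof (rule For_rule[where n = l and J = "%i s'. \<forall>x<l. hR s' 33 x 0 = (if x < i then R (Suc t) x else R t x)"])
   fix i w assume i: "i < l" and e: "eqx (insert 18 (nmods ?P2)) (rmods ?P2) u2 w"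
    and J2: "\<forall>x<l. hR w 33 x 0 = (if x < i then R (Suc t) x else R t x)"
   have "hR w 32 = hR s 32" "hN w 20 0 0 = t" "hR w 14 0 0 = R t (hN s 42 t 0) + r t"
    using eqxR[OF e, of 32] eqxR[OF e, of 14] eqxN[OF e, of 20] u2 by simp_all
   moreover have "R (Suc t) x = R t x - (R t (hN s 42 t 0) + r t) * hR s 32 t x" for x by (simp add: R_def)
   ultimately show "\<forall>x<l. hR (run ?P2 (setn w (S 18) i)) 33 x 0 = (if x < Suc i then R (Suc t) x else R t x)"
    using J2 i by (auto simp: st_simps less_Suc_eq)
  qed (use u2 J in auto)
  moreover have "hN u3 28 0 0 = ?c div ?G ^ Suc t" using u2 by (simp add: u3_def hN_run del: run.simps)
  moreover have "run ?P3 (setn u (S 20) t) = u3" by (simp add: u3_def u2_def u1_def)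
  ultimately show "(\<forall>x<l. hR (run ?P3 (setn u (S 20) t)) 33 x 0 = R (Suc t) x) \<and> hN (run ?P3 (setn u (S 20) t)) 28 0 0 = ?c div ?G ^ Suc t"
   by simp
 qed auto
 moreover have "run (RHO L) s = run (For 20 2 ?P3) s2" by (simp add: RHO_def s2_def s1_def)
 ultimately show ?thesis using x by (simp add: R_def r_def[abs_def] rho_def)
qed

definition cost :: "hst => nat => (nat => real) => real" where
 "cost s n f = (\<Sum>x<n. hR s 34 x 0 * powf s \<bar>f x\<bar>)"

lemma TAKE_run:
 assumes L: "L \<in> {0, 10, 11}" "hN s L 0 0 = l" and b: "b \<in> {0, 4}" "hN s b 0 0 = b0" "b0 \<le> l" and z: "hR s 16 0 0 = 0"
 shows "hR (run (TAKE L b) s) 7 0 0 = hR s 13 0 0"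
  "\<And>u. b0 + u < l ==> hR (run (TAKE L b) s) 40 u 0 = - hR s 33 (b0 + u) 0 / hR s 18 0 0"
proof -
 let ?B = "If (TN (S 18) (S b)) nop0 (sqs (NO NMinus (S 32) (S 18) (S b)) [RO RMinus (S 14) (S 16) (V 33 18), RO RQuot (V 40 32) (S 14) (S 18)])"
 let ?s = "run (RM (S 7) (S 13)) s"
 have "\<forall>u. b0 + u < l \<longrightarrow> hR (run (For 18 L ?B) ?s) 40 u 0 = - hR s 33 (b0 + u) 0 / hR s 18 0 0"
 proof (rule For_rule[where n = l and J = "%i s'. \<forall>u. b0 + u < i \<longrightarrow> hR s' 40 u 0 = - hR s 33 (b0 + u) 0 / hR s 18 0 0"])
  fix i w assume i: "i < l" and e: "eqx (insert 18 (nmods ?B)) (rmods ?B) ?s w"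
   and J: "\<forall>u. b0 + u < i \<longrightarrow> hR w 40 u 0 = - hR s 33 (b0 + u) 0 / hR s 18 0 0"
  have ew: "hR w 33 = hR s 33" "hR w 18 = hR s 18" "hR w 16 = hR s 16" "hN w b 0 0 = b0"
   using eqxR[OF e, of 33] eqxR[OF e, of 18] eqxR[OF e, of 16] eqxN[OF e, of b] b by (auto simp: hR_setr_other)
  show "\<forall>u. b0 + u < Suc i \<longrightarrow> hR (run ?B (setn w (S 18) i)) 40 u 0 = - hR s 33 (b0 + u) 0 / hR s 18 0 0"
  proof (cases "i < b0")
   case True
   then show ?thesis by simp
  next
   case False
   then show ?thesis using J ew z b by (auto simp: st_simps less_Suc_eq)
  qed
 qed (use L in \<open>auto simp: st_simps\<close>)
 then show "\<And>u. b0 + u < l ==> hR (run (TAKE L b) s) 40 u 0 = - hR s 33 (b0 + u) 0 / hR s 18 0 0"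
  by (simp add: TAKE_def)
 have "hR (run (For 18 L ?B) ?s) 7 = hR ?s 7" by (subst hR_run) auto
 then show "hR (run (TAKE L b) s) 7 0 0 = hR s 13 0 0" by (simp add: TAKE_def st_simps)
qed

lemma cost_cong: "eqx A B s s' ==> 9 \<notin> A ==> {1, 2, 6, 34} \<inter> B = {} ==> cost s' n f = cost s n f"
 using powf_cong[of A B s s'] eqxR[of A B s s' 34] by (simp add: cost_def)

lemma rho_cong: "eqx A B s s' ==> {7, 42} \<inter> A = {} ==> {4, 21, 32, 39} \<inter> B = {} ==> rho s' k c = rho s k c"
 by (simp add: rho_def gridv_def eqx_def)

lemma REG_run:
 assumes s: "hR s 16 0 0 = 0" "hR s 17 0 0 = 1" "hN s 12 0 0 = 1"
  and N: "N \<in> {0, 10}" "hN s N 0 0 = n" and L: "L \<in> {0, 10, 11}" "hN s L 0 0 = l" "n \<le> l"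
  and b: "b \<in> {0, 4}" "hN s b 0 0 = b0" "b0 \<le> l"
  and k: "hN s 2 0 0 = k" and Q: "\<And>t. t < k ==> hN s 42 t 0 < l"
  and X: "hN s 8 0 0 = X" "X \<ge> 1"
 defines "s' \<equiv> run (REG N L b) s"
 shows "\<exists>c<X. hR s' 7 0 0 = cost s n (rho s k c) \<and> (\<forall>c'<X. cost s n (rho s k c) \<le> cost s n (rho s k c')) \<and>
  (\<forall>u. b0 + u < l \<longrightarrow> hR s' 40 u 0 = - rho s k c (b0 + u) / hR s 18 0 0)"
proof -
 let ?B = "sqs (RHO L) [COST N, If (TN (S 21) (S 12)) (TAKE L b) (If (TR (S 13) (S 7)) (TAKE L b) nop0)]"
 let ?C = "%c. cost s n (rho s k c)"
 \<comment> \<open>Before the first round cell 7 and array 40 hold nothing meaningful, so the claim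
   starts at \<open>i > 0\<close>; the test on cell 21 treats code 0 apart.\<close>
 let ?J = "%i (t :: hst). i > 0 \<longrightarrow> (\<exists>c<i. hR t 7 0 0 = ?C c \<and> (\<forall>c'<i. ?C c \<le> ?C c') \<and>
  (\<forall>u. b0 + u < l \<longrightarrow> hR t 40 u 0 = - rho s k c (b0 + u) / hR s 18 0 0))"
 have "?J X (run (For 21 8 ?B) s)"
 proof (rule For_rule[where n = X and J = ?J])
  fix i w assume i: "i < X" and e: "eqx (insert 21 (nmods ?B)) (rmods ?B) s w" and J: "?J i w"
  let ?w = "setn w (S 21) i"
  define w1 where "w1 = run (RHO L) ?w"
  define w2 where "w2 = run (COST N) w1"
  have e0: "eqx {18, 20, 21, 27, 28, 29, 32} {7, 10, 11, 12, 13, 14, 15, 33, 40} s ?w"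
   by (rule eqx_setn[OF eqx_mono[OF e]]) auto
  have ew: "hN ?w L 0 0 = l" "hN ?w 2 0 0 = k" "hN ?w 42 = hN s 42" "hN ?w 21 0 0 = i"
   using eqxN[OF e, of L] eqxN[OF e, of 2] eqxN[OF e, of 42] L k by (auto simp: hN_setn_other hN_setn_S)
  have r: "hR w1 33 x 0 = rho s k i x" if "x < l" for x
  proof -
   have "hR w1 33 x 0 = rho ?w k (hN ?w 21 0 0) x"
    unfolding w1_def using ew Q that by (intro RHO_run[OF L(1)]) auto
   moreover have "rho ?w k i = rho s k i" by (rule rho_cong[OF e0]) auto
   ultimately show ?thesis using ew by simp
  qed
  have e1: "eqx {18, 20, 21, 27, 28, 29, 32} {7, 10, 11, 12, 13, 14, 15, 33, 40} s w1"
   unfolding w1_def by (rule eqx_trans[OF e0], rule eqx_mono[OF eqx_run]) auto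
  have e2: "eqx {18, 20, 21, 27, 28, 29, 32} {7, 10, 11, 12, 13, 14, 15, 33, 40} s w2"
   unfolding w2_def by (rule eqx_trans[OF e1], rule eqx_mono[OF eqx_run]) auto
  have cst: "hR w2 13 0 0 = ?C i"
  proof -
   have "hR w2 13 0 0 = (\<Sum>x<n. hR w1 34 x 0 * powf w1 \<bar>hR w1 33 x 0\<bar>)"
    unfolding w2_def using eqxR[OF e1, of 16] eqxR[OF e1, of 17] eqxN[OF e1, of N] s N
    by (intro COST_run) auto
   also have "\<dots> = cost w1 n (rho s k i)" unfolding cost_def using r L(3) by (intro sum.cong) auto
   also have "\<dots> = ?C i" by (rule cost_cong[OF e1]) auto
   finally show ?thesis .
  qed
  have w2: "hN w2 21 0 0 = i" "hN w2 12 0 0 = 1" "hR w2 33 = hR w1 33" "hR w2 7 = hR w 7" "hR w2 40 = hR w 40" "hR w2 18 = hR s 18"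
   "hN w2 L 0 0 = l" "hN w2 b 0 0 = b0" "hR w2 16 0 0 = 0"
   using ew(4) s eqxN[OF e2, of 12] eqxR[OF e2, of 18] eqxR[OF e2, of 16] eqxN[OF e2, of L] eqxN[OF e2, of b] L b
   by (auto simp: w2_def w1_def hR_run hN_run)
  note tk = TAKE_run[OF L(1) w2(7) b(1) w2(8) b(3) w2(9)]
  have new: "?J (Suc i) (run (TAKE L b) w2)" if lt: "\<forall>c'<i. ?C i \<le> ?C c'"
   using tk cst w2 r lt by (intro impI exI[of _ i]) (auto simp: less_Suc_eq)
  have F: "?J (Suc i) (run (If (TN (S 21) (S 12)) (TAKE L b) (If (TR (S 13) (S 7)) (TAKE L b) nop0)) w2)"
  proof (cases "i = 0")
   case True
   then show ?thesis using new w2 by (simp add: nv_def)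
  next
   case False
   then obtain c where c: "c < i" "hR w 7 0 0 = ?C c" "\<forall>c'<i. ?C c \<le> ?C c'"
    "\<forall>u. b0 + u < l \<longrightarrow> hR w 40 u 0 = - rho s k c (b0 + u) / hR s 18 0 0" using J by auto
   show ?thesis
   proof (cases "?C i < ?C c")
    case True
    then have "\<forall>c'<i. ?C i \<le> ?C c'" using c(3) by force
    then show ?thesis using new w2 cst c True False by (simp add: nv_def rv_def)
   next
    case False2: False
    then have "run (If (TN (S 21) (S 12)) (TAKE L b) (If (TR (S 13) (S 7)) (TAKE L b) nop0)) w2 = run nop0 w2"
     using False w2 cst c by (simp add: nv_def rv_def)
    moreover have "?J (Suc i) (run nop0 w2)"
     using c w2 False2 by (intro impI exI[of _ c]) (auto simp: less_Suc_eq st_simps)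
    ultimately show ?thesis by simp
   qed
  qed
  have eqr: "run ?B ?w = run (If (TN (S 21) (S 12)) (TAKE L b) (If (TR (S 13) (S 7)) (TAKE L b) nop0)) w2"
   by (simp add: w2_def w1_def)
  show "?J (Suc i) (run ?B ?w)" unfolding eqr by (rule F)
 qed (use X in auto)
 then show ?thesis using X by (simp add: s'_def REG_def)
qed

lemma mods_simps2 [simp]:
 "nmods DECODE = {20, 28, 29, 40, 41}" "rmods DECODE = {14, 34}"
 "nmods BUILD = {18, 19, 28, 29, 32, 33}" "rmods BUILD = {14, 31}"
 "nmods ROWS = {18, 19, 20, 21, 26, 27, 28, 29, 32, 33}" "rmods ROWS = {7, 10, 11, 12, 13, 14, 15, 33, 35, 39, 40}"
 "nmods PH1 = {18, 19, 20, 21, 26, 27, 28, 29, 30, 31, 32, 33, 40, 41, 42}"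
 "rmods PH1 = {7, 10, 11, 12, 13, 14, 15, 18, 22, 31, 32, 33, 34, 35, 39, 40}"
 "nmods BUILD2 = {18, 19, 32}" "rmods BUILD2 = {14, 31, 34}"
 "nmods COLS = {18, 19, 20, 21, 26, 27, 28, 29, 32}" "rmods COLS = {7, 8, 10, 11, 12, 13, 14, 15, 33, 36, 39, 40}"
 "nmods PH2 = {18, 19, 20, 21, 26, 27, 28, 29, 30, 31, 32, 42}"
 "rmods PH2 = {7, 8, 10, 11, 12, 13, 14, 15, 18, 22, 31, 32, 33, 34, 36, 39, 40}"
 by (auto simp: DECODE_def BUILD_def ROWS_def PH1_def BUILD2_def COLS_def PH2_def)

text \<open>The contents of the constant cells become parameters, so that the outcome of the phases
  can be stated without machine states.\<close>

locale solver =
 fixes n d k m G X Lp h :: nat and A U0 :: "nat => nat => real"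
  and q g sc stp \<mu> z0 Y3 :: real
 assumes n: "n \<ge> 1" and d: "d \<ge> 1" and k: "k \<ge> 1" and X: "X \<ge> 1"
begin

definition good :: "hst => bool" where
 "good s \<longleftrightarrow> hN s 0 0 0 = n \<and> hN s 1 0 0 = d \<and> hN s 2 0 0 = k \<and> hN s 4 0 0 = m \<and> hN s 7 0 0 = G \<and>
   hN s 8 0 0 = X \<and> hN s 9 0 0 = Lp \<and> hN s 10 0 0 = m + k \<and> hN s 11 0 0 = n + k \<and> hN s 12 0 0 = 1 \<and>
   hR s 1 0 0 = q \<and> hR s 2 0 0 = g \<and> hR s 3 0 0 = sc \<and> hR s 4 0 0 = stp \<and> hR s 5 0 0 = \<mu> \<and> hR s 6 0 0 = z0 \<and>
   hR s 16 0 0 = 0 \<and> hR s 17 0 0 = 1 \<and> hR s 20 0 0 = Y3 \<and> hR s 21 0 0 = real h \<and>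
   (\<forall>i<n. \<forall>j<d. hR s 30 i j = A i j) \<and> (\<forall>i<n. \<forall>u<k. hR s 41 i u = U0 i u)"

lemma good_eqx:
 assumes "good s" "eqx Na Rb s s'" "Na \<inter> {0, 1, 2, 4, 7, 8, 9, 10, 11, 12} = {}"
  "Rb \<inter> {1, 2, 3, 4, 5, 6, 16, 17, 20, 21, 30, 41} = {}"
 shows "good s'"
proof -
 have N: "hN s' a = hN s a" if "a \<in> {0, 1, 2, 4, 7, 8, 9, 10, 11, 12}" for a
  using eqxN[OF assms(2), of a] that assms(3) by blast
 have R: "hR s' a = hR s a" if "a \<in> {1, 2, 3, 4, 5, 6, 16, 17, 20, 21, 30, 41}" for a
  using eqxR[OF assms(2), of a] that assms(4) by blast
 show ?thesis using assms(1) unfolding good_def by (simp add: N R)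
qed

lemma good_setn: "good s ==> oarr x \<notin> {0, 1, 2, 4, 7, 8, 9, 10, 11, 12} ==> good (setn s x v)"
 by (rule good_eqx[OF _ eqx_setn[OF eqx_refl, of _ "{oarr x}" "{}"]]) auto

lemma good_run:
 assumes "good s" "nmods P \<inter> {0, 1, 2, 4, 7, 8, 9, 10, 11, 12} = {}"
  "rmods P \<inter> {1, 2, 3, 4, 5, 6, 16, 17, 20, 21, 30, 41} = {}"
 shows "good (run P s)"
 by (rule good_eqx[OF assms(1) eqx_run assms(2,3)])

definition PF :: "real => real" where "PF x = snd (pw z0 g q x Lp)"
definition gv :: "nat => real" where "gv c = (real c - real h) * stp"

lemma good_powf: "good s ==> powf s = PF"
 by (simp add: fun_eq_iff powf_def PF_def good_def)
lemma good_gridv: "good s ==> gridv s = gv"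
 by (simp add: fun_eq_iff gridv_def gv_def good_def)

text \<open>Remainders make every code decode to legal indices: a guess can be poor, but never out
  of range.\<close>

definition Sf :: "nat => nat => nat" where "Sf c t = dig G c t mod d"
definition wf :: "nat => nat => real" where "wf c t = real (dig G c t) / Y3"
definition Pf :: "nat => nat => nat" where "Pf c u = dig G c u mod n"
definition Zf :: "nat => nat => nat => nat => nat => real" where
 "Zf cS cQ cR u t = gv (dig G cR (u * m + t)) + A (Pf cQ u) (Sf cS t)"

lemma DECODE_run:
 assumes s: "good s" and c: "hN s 22 0 0 = cS" "hN s 23 0 0 = cw" "hN s 24 0 0 = cQ"
 defines "s' \<equiv> run DECODE s"
 shows "\<And>t. t < m ==> hN s' 40 t 0 = Sf cS t" "\<And>x. x < m + k ==> hR s' 34 x 0 = wext m (wf cw) x"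
  "\<And>u. u < k ==> hN s' 41 u 0 = Pf cQ u"
proof -
 let ?P1 = "Sq DIGIT (NO NRem (V 40 20) (S 29) (S 1))"
 let ?P2 = "sqs DIGIT [NR (S 14) (S 29), RO RQuot (V 34 20) (S 14) (S 20)]"
 let ?P3 = "If (TN (S 20) (S 4)) nop0 (RM (V 34 20) (S 17))"
 let ?P4 = "Sq DIGIT (NO NRem (V 41 20) (S 29) (S 0))"
 define s1 where "s1 = run (NM (S 28) (S 22)) s"
 define s2 where "s2 = run (For 20 4 ?P1) s1"
 define s3 where "s3 = run (NM (S 28) (S 23)) s2"
 define s4 where "s4 = run (For 20 4 ?P2) s3"
 define s5 where "s5 = run (For 20 10 ?P3) s4"
 define s6 where "s6 = run (NM (S 28) (S 24)) s5"
 have s': "s' = run (For 20 2 ?P4) s6" by (simp add: s'_def DECODE_def s6_def s5_def s4_def s3_def s2_def s1_def)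
 have g1: "good s1" unfolding s1_def by (rule good_run[OF s]) auto
 have g2: "good s2" unfolding s2_def by (rule good_run[OF g1]) auto
 have g3: "good s3" unfolding s3_def by (rule good_run[OF g2]) auto
 have g4: "good s4" unfolding s4_def by (rule good_run[OF g3]) auto
 have g5: "good s5" unfolding s5_def by (rule good_run[OF g4]) auto
 have g6: "good s6" unfolding s6_def by (rule good_run[OF g5]) auto
 have DG: "hN (run DIGIT (setn u (S 20) t)) 28 0 0 = c div G ^ Suc t" "hN (run DIGIT (setn u (S 20) t)) 29 0 0 = dig G c t"
  "hN (run DIGIT (setn u (S 20) t)) 20 0 0 = t" "good (run DIGIT (setn u (S 20) t))"
  "hN (run DIGIT (setn u (S 20) t)) 40 = hN u 40" "hN (run DIGIT (setn u (S 20) t)) 41 = hN u 41" "hR (run DIGIT (setn u (S 20) t)) = hR u"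
  if u: "good u" "hN u 28 0 0 = c div G ^ t" for u c t
 proof -
  have gu: "good (setn u (S 20) t)" by (rule good_setn[OF u(1)]) auto
  have p: "hN (setn u (S 20) t) 28 0 0 = c div hN (setn u (S 20) t) 7 0 0 ^ t"
   using u gu by (simp add: hN_setn_other good_def)
  show "hN (run DIGIT (setn u (S 20) t)) 28 0 0 = c div G ^ Suc t" "hN (run DIGIT (setn u (S 20) t)) 29 0 0 = dig G c t"
   using DIGIT_run[OF p] gu by (simp_all add: good_def)
  show "hN (run DIGIT (setn u (S 20) t)) 20 0 0 = t" by (simp add: hN_run hN_setn_S)
  show "good (run DIGIT (setn u (S 20) t))" by (rule good_run[OF gu]) auto
  show "hN (run DIGIT (setn u (S 20) t)) 40 = hN u 40" "hN (run DIGIT (setn u (S 20) t)) 41 = hN u 41" "hR (run DIGIT (setn u (S 20) t)) = hR u"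
   by (auto simp: hN_run hN_setn_other hR_run)
 qed
 have r2: "\<forall>t<m. hN s2 40 t 0 = Sf cS t"
  unfolding s2_def
 proof (rule For_rule[where n = m and J = "%i s'. (\<forall>t<i. hN s' 40 t 0 = Sf cS t) \<and> hN s' 28 0 0 = cS div G ^ i"])
  fix i u assume i: "i < m" and e: "eqx (insert 20 (nmods ?P1)) (rmods ?P1) s1 u"
   and J: "(\<forall>t<i. hN u 40 t 0 = Sf cS t) \<and> hN u 28 0 0 = cS div G ^ i"
  have gu: "good u" by (rule good_eqx[OF g1 e]) auto
  note D = DG[OF gu conjunct2[OF J]]
  have "hN (run DIGIT (setn u (S 20) i)) 1 0 0 = d" using D(4) by (simp add: good_def)
  then show "(\<forall>t<Suc i. hN (run ?P1 (setn u (S 20) i)) 40 t 0 = Sf cS t) \<and> hN (run ?P1 (setn u (S 20) i)) 28 0 0 = cS div G ^ Suc i"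
   using D J by (simp add: st_simps Sf_def less_Suc_eq)
 next
  show "(\<forall>t<0. hN s1 40 t 0 = Sf cS t) \<and> hN s1 28 0 0 = cS div G ^ 0" using c by (simp add: s1_def st_simps)
  show "hN s1 4 0 0 = m" using g1 by (simp add: good_def)
 qed (simp add: hN_setn_other)
 have c2: "hN s2 23 0 0 = cw" "hN s2 24 0 0 = cQ"
  using c by (simp_all add: s2_def s1_def hN_run hN_setn_other del: run.simps(12))
 have r4: "\<forall>t<m. hR s4 34 t 0 = wf cw t"
  unfolding s4_def
 proof (rule For_rule[where n = m and J = "%i s'. (\<forall>t<i. hR s' 34 t 0 = wf cw t) \<and> hN s' 28 0 0 = cw div G ^ i"])
  fix i u assume i: "i < m" and e: "eqx (insert 20 (nmods ?P2)) (rmods ?P2) s3 u"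
   and J: "(\<forall>t<i. hR u 34 t 0 = wf cw t) \<and> hN u 28 0 0 = cw div G ^ i"
  have gu: "good u" by (rule good_eqx[OF g3 e]) auto
  note D = DG[OF gu conjunct2[OF J]]
  have "hR (run DIGIT (setn u (S 20) i)) 20 0 0 = Y3" using D(4) by (simp add: good_def)
  then show "(\<forall>t<Suc i. hR (run ?P2 (setn u (S 20) i)) 34 t 0 = wf cw t) \<and> hN (run ?P2 (setn u (S 20) i)) 28 0 0 = cw div G ^ Suc i"
   using D J by (simp add: st_simps wf_def less_Suc_eq)
 next
  show "(\<forall>t<0. hR s3 34 t 0 = wf cw t) \<and> hN s3 28 0 0 = cw div G ^ 0" using c2 by (simp add: s3_def st_simps)
  show "hN s3 4 0 0 = m" using g3 by (simp add: good_def)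
 qed simp
 have r5: "\<forall>x<m + k. hR s5 34 x 0 = wext m (wf cw) x"
  unfolding s5_def
 proof (rule For_rule[where n = "m + k" and J = "%i s'. (\<forall>x<i. hR s' 34 x 0 = wext m (wf cw) x) \<and> (\<forall>x<m. hR s' 34 x 0 = wf cw x)"])
  fix i u assume i: "i < m + k" and e: "eqx (insert 20 (nmods ?P3)) (rmods ?P3) s4 u"
   and J: "(\<forall>x<i. hR u 34 x 0 = wext m (wf cw) x) \<and> (\<forall>x<m. hR u 34 x 0 = wf cw x)"
  have gu: "good u" by (rule good_eqx[OF g4 e]) auto
  have "hN u 4 0 0 = m" "hR u 17 0 0 = 1" using gu by (simp_all add: good_def)
  then show "(\<forall>x<Suc i. hR (run ?P3 (setn u (S 20) i)) 34 x 0 = wext m (wf cw) x) \<and> (\<forall>x<m. hR (run ?P3 (setn u (S 20) i)) 34 x 0 = wf cw x)"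
   using J by (auto simp: st_simps wext_def less_Suc_eq)
 next
  show "hN s4 10 0 0 = m + k" using g4 by (simp add: good_def)
 qed (use r4 in auto)
 have c5: "hN s5 24 0 0 = cQ" "hN s5 40 = hN s2 40"
  using c2 by (simp_all add: s5_def s4_def s3_def hN_run hN_setn_other del: run.simps(12))
 have r7: "\<forall>u<k. hN s' 41 u 0 = Pf cQ u"
  unfolding s'
 proof (rule For_rule[where n = k and J = "%i s'. (\<forall>t<i. hN s' 41 t 0 = Pf cQ t) \<and> hN s' 28 0 0 = cQ div G ^ i"])
  fix i u assume i: "i < k" and e: "eqx (insert 20 (nmods ?P4)) (rmods ?P4) s6 u"
   and J: "(\<forall>t<i. hN u 41 t 0 = Pf cQ t) \<and> hN u 28 0 0 = cQ div G ^ i"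
  have gu: "good u" by (rule good_eqx[OF g6 e]) auto
  note D = DG[OF gu conjunct2[OF J]]
  have "hN (run DIGIT (setn u (S 20) i)) 0 0 0 = n" using D(4) by (simp add: good_def)
  then show "(\<forall>t<Suc i. hN (run ?P4 (setn u (S 20) i)) 41 t 0 = Pf cQ t) \<and> hN (run ?P4 (setn u (S 20) i)) 28 0 0 = cQ div G ^ Suc i"
   using D J by (simp add: st_simps Pf_def less_Suc_eq)
 next
  show "(\<forall>t<0. hN s6 41 t 0 = Pf cQ t) \<and> hN s6 28 0 0 = cQ div G ^ 0" using c5 by (simp add: s6_def st_simps)
  show "hN s6 2 0 0 = k" using g6 by (simp add: good_def)
 qed (simp add: hN_setn_other)
 have "hN s' 40 = hN s5 40" "hR s' 34 = hR s5 34"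
  by (simp_all add: s' s6_def hN_run hR_run hN_setn_other del: run.simps(12))
 then show "\<And>t. t < m ==> hN s' 40 t 0 = Sf cS t" "\<And>x. x < m + k ==> hR s' 34 x 0 = wext m (wf cw) x"
  "\<And>u. u < k ==> hN s' 41 u 0 = Pf cQ u"
  using r2 r5 r7 c5 by simp_all
qed

lemma ZERO_run:
 assumes "L \<in> {10, 11}" "hN s L 0 0 = l" "hN s 2 0 0 = k"
 shows "\<forall>x<l. \<forall>u<k. hR (run (For 18 L (For 19 2 (RC (M 31 18 19) 0))) s) 31 x u = 0"
proof (rule For_rule[where n = l and J = "%i s'. \<forall>x<i. \<forall>u<k. hR s' 31 x u = 0"])
 fix i w assume i: "i < l" and e: "eqx (insert 18 (nmods (For 19 2 (RC (M 31 18 19) 0)))) (rmods (For 19 2 (RC (M 31 18 19) 0))) s w"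
  and J: "\<forall>x<i. \<forall>u<k. hR w 31 x u = 0"
 show "\<forall>x<Suc i. \<forall>u<k. hR (run (For 19 2 (RC (M 31 18 19) 0)) (setn w (S 18) i)) 31 x u = 0"
 proof (rule For_rule[where n = k and J = "%j s'. (\<forall>x<i. \<forall>u<k. hR s' 31 x u = 0) \<and> (\<forall>u<j. hR s' 31 i u = 0)"])
  show "hN (setn w (S 18) i) 2 0 0 = k" using eqxN[OF e, of 2] assms by (simp add: hN_setn_other)
 next
  fix j v assume j: "j < k" and e2: "eqx (insert 19 (nmods (RC (M 31 18 19) 0))) (rmods (RC (M 31 18 19) 0)) (setn w (S 18) i) v"
   and J2: "(\<forall>x<i. \<forall>u<k. hR v 31 x u = 0) \<and> (\<forall>u<j. hR v 31 i u = 0)"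
  have "hN v 18 0 0 = i" using eqxN[OF e2, of 18] by (simp add: hN_setn_S)
  then show "(\<forall>x<i. \<forall>u<k. hR (run (RC (M 31 18 19) 0) (setn v (S 19) j)) 31 x u = 0) \<and>
    (\<forall>u<Suc j. hR (run (RC (M 31 18 19) 0) (setn v (S 19) j)) 31 i u = 0)"
   using J2 by (auto simp: st_simps less_Suc_eq)
 qed (use J in \<open>auto simp: less_Suc_eq\<close>)
qed (use assms in auto)

text \<open>The guessed part of \<open>V\<close>, transposed, with one row per sampled column, above
  \<mu> times the identity.\<close>

definition H1 :: "nat => nat => nat => nat => nat => real" where
 "H1 cS cQ cR x u = (if x < m then Zf cS cQ cR u x else if x = m + u then \<mu> else 0)"

lemma BUILD_run:
 assumes s: "good s" and c: "hN s 25 0 0 = cR" and S: "\<And>t. t < m ==> hN s 40 t 0 = Sf cS t"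
  and P: "\<And>u. u < k ==> hN s 41 u 0 = Pf cQ u" and x: "x < m + k" "u < k"
 shows "hR (run BUILD s) 31 x u = H1 cS cQ cR x u"
proof -
 let ?P1 = "For 18 10 (For 19 2 (RC (M 31 18 19) 0))"
 let ?P2 = "sqs GRID [NM (S 33) (V 40 18), RO RPlus (M 31 18 19) (S 14) (M 30 32 33)]"
 let ?P3 = "Sq (NM (S 32) (V 41 19)) (For 18 4 ?P2)"
 let ?P4 = "If (TN (S 18) (S 4)) nop0 (Sq (NO NMinus (S 32) (S 18) (S 4)) (RM (M 31 18 32) (S 5)))"
 define s1 where "s1 = run ?P1 s"
 define s2 where "s2 = run (NM (S 28) (S 25)) s1"
 define s3 where "s3 = run (For 19 2 ?P3) s2"
 have s': "run BUILD s = run (For 18 10 ?P4) s3" by (simp add: BUILD_def s3_def s2_def s1_def)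
 have g1: "good s1" unfolding s1_def by (rule good_run[OF s]) auto
 have g2: "good s2" unfolding s2_def by (rule good_run[OF g1]) auto
 have g3: "good s3" unfolding s3_def by (rule good_run[OF g2]) auto
 have z1: "\<forall>x<m + k. \<forall>u<k. hR s1 31 x u = 0"
  unfolding s1_def by (rule ZERO_run) (use s in \<open>auto simp: good_def\<close>)
 have f2: "hN s2 40 = hN s 40" "hN s2 41 = hN s 41" "hN s2 28 0 0 = cR" "hR s2 31 = hR s1 31"
  using c by (simp_all add: s2_def s1_def hN_run hN_setn_other del: run.simps(12)) (simp add: st_simps hN_run del: run.simps(12))
 let ?Z = "Zf cS cQ cR"
 have r3: "\<forall>x<m + k. \<forall>u<k. hR s3 31 x u = (if x < m then ?Z u x else 0)"
  unfolding s3_def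
 proof (rule For_rule[where n = k and J = "%u s'. (\<forall>x<m + k. \<forall>v<k. hR s' 31 x v = (if x < m \<and> v < u then ?Z v x else 0)) \<and> hN s' 28 0 0 = cR div G ^ (u * m)"])
  fix u w assume u: "u < k" and e: "eqx (insert 19 (nmods ?P3)) (rmods ?P3) s2 w"
   and J: "(\<forall>x<m + k. \<forall>v<k. hR w 31 x v = (if x < m \<and> v < u then ?Z v x else 0)) \<and> hN w 28 0 0 = cR div G ^ (u * m)"
  have gw: "good w" by (rule good_eqx[OF g2 e]) auto
  define w1 where "w1 = run (NM (S 32) (V 41 19)) (setn w (S 19) u)"
  have gw1: "good w1" unfolding w1_def by (rule good_run[OF good_setn[OF gw]]) auto
  have fw: "hN w 40 = hN s 40" "hN w 41 = hN s 41" using eqxN[OF e, of 40] eqxN[OF e, of 41] f2 by simp_all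
  have f1: "hN w1 32 0 0 = Pf cQ u" "hN w1 40 = hN s 40" "hN w1 19 0 0 = u" "hN w1 28 0 0 = cR div G ^ (u * m)" "hR w1 31 = hR w 31"
   using fw P[OF u] J by (simp_all add: w1_def st_simps)
  have "(\<forall>x<m + k. \<forall>v<k. hR (run (For 18 4 ?P2) w1) 31 x v = (if x < m \<and> v < Suc u then ?Z v x else 0)) \<and>
    hN (run (For 18 4 ?P2) w1) 28 0 0 = cR div G ^ (Suc u * m)"
  proof (rule For_rule[where n = m and J = "%t s'. (\<forall>x<m + k. \<forall>v<k. hR s' 31 x v = (if x < m \<and> (v < u \<or> v = u \<and> x < t) then ?Z v x else 0)) \<and> hN s' 28 0 0 = cR div G ^ (u * m + t)"])
   fix t v assume t: "t < m" and e2: "eqx (insert 18 (nmods ?P2)) (rmods ?P2) w1 v"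
    and J2: "(\<forall>x<m + k. \<forall>v'<k. hR v 31 x v' = (if x < m \<and> (v' < u \<or> v' = u \<and> x < t) then ?Z v' x else 0)) \<and> hN v 28 0 0 = cR div G ^ (u * m + t)"
   have gvv: "good v" by (rule good_eqx[OF gw1 e2]) auto
   let ?v = "setn v (S 18) t"
   define v1 where "v1 = run GRID ?v"
   have gv1: "good ?v" by (rule good_setn[OF gvv]) auto
   have gv2: "good v1" unfolding v1_def by (rule good_run[OF gv1]) auto
   have "hN ?v 28 0 0 = cR div hN ?v 7 0 0 ^ (u * m + t)" using J2 gv1 by (simp add: hN_setn_other good_def)
   from GRID_run[OF this] have G1: "hN v1 28 0 0 = cR div G ^ (u * m + Suc t)" "hR v1 14 0 0 = gv (dig G cR (u * m + t))"
    using gv1 good_gridv[OF gv1] by (simp_all add: v1_def good_def)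
   have fv: "hN v1 40 = hN s 40" "hN v1 32 0 0 = Pf cQ u" "hN v1 18 0 0 = t" "hN v1 19 0 0 = u" "hR v1 31 = hR v 31"
    using eqxN[OF e2, of 40] eqxN[OF e2, of 32] eqxN[OF e2, of 19] f1 by (simp_all add: v1_def hN_run hR_run hN_setn_other hN_setn_S)
   have Ain: "hR v1 30 (Pf cQ u) (Sf cS t) = A (Pf cQ u) (Sf cS t)"
    using gv2 n d by (simp add: good_def Pf_def Sf_def)
   have st: "run ?P2 ?v = run (RO RPlus (M 31 18 19) (S 14) (M 30 32 33)) (run (NM (S 33) (V 40 18)) v1)"
    by (simp add: v1_def)
   have zz: "hR (run ?P2 ?v) 31 = (%x v'. if x = t \<and> v' = u then ?Z u t else hR v 31 x v')"
    unfolding st using fv G1 Ain S[OF t] by (simp add: st_simps Zf_def fun_eq_iff)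
   have "hN (run ?P2 ?v) 28 0 0 = cR div G ^ (u * m + Suc t)"
    unfolding st using G1 by (simp add: st_simps)
   then show "(\<forall>x<m + k. \<forall>v'<k. hR (run ?P2 ?v) 31 x v' = (if x < m \<and> (v' < u \<or> v' = u \<and> x < Suc t) then ?Z v' x else 0)) \<and> hN (run ?P2 ?v) 28 0 0 = cR div G ^ (u * m + Suc t)"
    using J2 t unfolding zz by (auto simp: less_Suc_eq)
  next
   show "(\<forall>x<m + k. \<forall>v<k. hR w1 31 x v = (if x < m \<and> (v < u \<or> v = u \<and> x < 0) then ?Z v x else 0)) \<and> hN w1 28 0 0 = cR div G ^ (u * m + 0)"
    using J f1 by simp
   show "hN w1 4 0 0 = m" using gw1 by (simp add: good_def)
  next
   fix v :: hst assume "(\<forall>x<m + k. \<forall>v'<k. hR v 31 x v' = (if x < m \<and> (v' < u \<or> v' = u \<and> x < m) then ?Z v' x else 0)) \<and> hN v 28 0 0 = cR div G ^ (u * m + m)"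
   then show "(\<forall>x<m + k. \<forall>v'<k. hR (setn v (S 18) m) 31 x v' = (if x < m \<and> v' < Suc u then ?Z v' x else 0)) \<and>
    hN (setn v (S 18) m) 28 0 0 = cR div G ^ (Suc u * m)"
    by (auto simp: less_Suc_eq hN_setn_other add.commute)
  qed
  then show "(\<forall>x<m + k. \<forall>v<k. hR (run ?P3 (setn w (S 19) u)) 31 x v = (if x < m \<and> v < Suc u then ?Z v x else 0)) \<and> hN (run ?P3 (setn w (S 19) u)) 28 0 0 = cR div G ^ (Suc u * m)"
   by (simp add: w1_def)
 next
  show "hN s2 2 0 0 = k" using g2 by (simp add: good_def)
 qed (use z1 f2 in auto)
 have "\<forall>x<m + k. \<forall>u<k. hR (run (For 18 10 ?P4) s3) 31 x u = H1 cS cQ cR x u"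
 proof (rule For_rule[where n = "m + k" and J = "%i s'. \<forall>x<m + k. \<forall>u<k. hR s' 31 x u = (if x < i then H1 cS cQ cR x u else hR s3 31 x u)"])
  fix i w assume i: "i < m + k" and e: "eqx (insert 18 (nmods ?P4)) (rmods ?P4) s3 w"
   and J: "\<forall>x<m + k. \<forall>u<k. hR w 31 x u = (if x < i then H1 cS cQ cR x u else hR s3 31 x u)"
  have gw: "good w" by (rule good_eqx[OF g3 e]) auto
  have "hN w 4 0 0 = m" "hR w 5 0 0 = \<mu>" using gw by (simp_all add: good_def)
  then show "\<forall>x<m + k. \<forall>u<k. hR (run ?P4 (setn w (S 18) i)) 31 x u = (if x < Suc i then H1 cS cQ cR x u else hR s3 31 x u)"
   using J r3 by (auto simp: st_simps less_Suc_eq H1_def)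
 next
  show "hN s3 10 0 0 = m + k" using g3 by (simp add: good_def)
 qed auto
 then show ?thesis using x by (simp add: s')
qed

end

section \<open>The two regression phases and the search over guesses\<close>

lemma mods_simps3 [simp]:
 "nmods SAVE = {18, 19, 26, 34}" "rmods SAVE = {9, 37, 38}"
 "nmods CAND = {18, 19, 20, 21, 26, 27, 28, 29, 30, 31, 32, 33, 34, 40, 41, 42}"
 "rmods CAND = {7, 8, 9, 10, 11, 12, 13, 14, 15, 18, 22, 31, 32, 33, 34, 35, 36, 37, 38, 39, 40}"
 by (auto simp: SAVE_def CAND_def)

lemma COPY_run:
 assumes "hN s p 0 0 = n" "hN s 2 0 0 = k" "p \<notin> {18, 19}" "z \<noteq> y"
 shows "\<forall>x<n. \<forall>u<k. hR (run (For 18 p (For 19 2 (RM (M z 18 19) (M y 18 19)))) s) z x u = hR s y x u"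
proof (rule For_rule[where n = n and J = "%i s'. \<forall>x<i. \<forall>u<k. hR s' z x u = hR s y x u"])
 let ?P = "RM (M z 18 19) (M y 18 19)"
 fix i w assume i: "i < n" and e: "eqx (insert 18 (nmods (For 19 2 ?P))) (rmods (For 19 2 ?P)) s w"
  and J: "\<forall>x<i. \<forall>u<k. hR w z x u = hR s y x u"
 have w: "hR w y = hR s y" "hN w 2 0 0 = k" using eqxR[OF e, of y] eqxN[OF e, of 2] assms by auto
 show "\<forall>x<Suc i. \<forall>u<k. hR (run (For 19 2 ?P) (setn w (S 18) i)) z x u = hR s y x u"
 proof (rule For_rule[where n = k and J = "%j s'. (\<forall>x<i. \<forall>u<k. hR s' z x u = hR s y x u) \<and> (\<forall>u<j. hR s' z i u = hR s y i u)"])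
  fix j v assume j: "j < k" and e2: "eqx (insert 19 (nmods ?P)) (rmods ?P) (setn w (S 18) i) v"
   and J2: "(\<forall>x<i. \<forall>u<k. hR v z x u = hR s y x u) \<and> (\<forall>u<j. hR v z i u = hR s y i u)"
  have "hN v 18 0 0 = i" "hR v y = hR s y"
   using eqxN[OF e2, of 18] eqxR[OF e2, of y] w assms by (simp_all add: hN_setn_S)
  then show "(\<forall>x<i. \<forall>u<k. hR (run ?P (setn v (S 19) j)) z x u = hR s y x u) \<and>
    (\<forall>u<Suc j. hR (run ?P (setn v (S 19) j)) z i u = hR s y i u)"
   using J2 by (simp add: st_simps less_Suc_eq)
 qed (use J w in \<open>auto simp: less_Suc_eq hN_setn_other\<close>)
qed (use assms in auto)

context solver
begin

definition C :: "(nat => real) => nat => (nat => real) => real" where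
 "C w N f = (\<Sum>x<N. w x * PF \<bar>f x\<bar>)"

definition R :: "(nat => real) => (nat => nat => real) => (nat => nat) => nat => nat => real" where
 "R a b Q c = resid a b Q (%t. gv (dig G c t)) k"

text \<open>Which minimal code was found stays open. The analysis relies on minimality among the
  codes below \<open>X\<close> and on the way the solution is read off.\<close>

definition regopt :: "nat => (nat => real) => (nat => nat => real) => (nat => nat) => (nat => real) => nat => real
  => (nat => real) => real => bool" where
 "regopt N w b Q a base mm xs val \<longleftrightarrow> (\<exists>c<X. val = C w N (R a b Q c) \<and> (\<forall>c'<X. C w N (R a b Q c) \<le> C w N (R a b Q c')) \<and>
   (\<forall>u<k. xs u = - R a b Q c (base + u) / mm))"

lemma regopt_cong: "regopt N w b Q a base mm xs val ==> (\<And>u. u < k ==> xs' u = xs u) ==> regopt N w b Q a base mm xs' val"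
 unfolding regopt_def by (metis (no_types, lifting))

lemma REG_good:
 assumes s: "good s" and N: "N \<in> {0, 10}" "hN s N 0 0 = N'" and L: "L \<in> {10, 11}" "hN s L 0 0 = b0 + k" "N' \<le> b0 + k"
  and b: "b \<in> {0, 4}" "hN s b 0 0 = b0" and Q: "\<And>t. t < k ==> hN s 42 t 0 < b0 + k"
 shows "regopt N' (%x. hR s 34 x 0) (hR s 32) (%t. hN s 42 t 0) (%x. hR s 39 x 0) b0 (hR s 18 0 0)
  (%u. hR (run (REG N L b) s) 40 u 0) (hR (run (REG N L b) s) 7 0 0)"
proof -
 have c: "cost s N' f = C (%x. hR s 34 x 0) N' f" for f
  using good_powf[OF s] by (simp add: cost_def C_def)
 have r: "rho s k c = R (%x. hR s 39 x 0) (hR s 32) (%t. hN s 42 t 0) c" for c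
  using good_gridv[OF s] s by (simp add: rho_def R_def good_def)
 have "\<exists>c<X. hR (run (REG N L b) s) 7 0 0 = cost s N' (rho s k c) \<and> (\<forall>c'<X. cost s N' (rho s k c) \<le> cost s N' (rho s k c')) \<and>
  (\<forall>u. b0 + u < b0 + k \<longrightarrow> hR (run (REG N L b) s) 40 u 0 = - rho s k c (b0 + u) / hR s 18 0 0)"
  by (rule REG_run) (use s N L b Q X in \<open>auto simp: good_def\<close>)
 then show ?thesis unfolding regopt_def c r by simp
qed

lemma ROWS_run:
 assumes s: "good s" and S: "\<And>t. t < m ==> hN s 40 t 0 = Sf cS t" and Q: "\<And>t. t < k ==> hN s 42 t 0 < m + k"
 defines "s' \<equiv> run ROWS s"
 shows "\<forall>i<n. \<exists>a val. (\<forall>x<m + k. a x = (if x < m then A i (Sf cS x) else 0)) \<and>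
   regopt (m + k) (%x. hR s 34 x 0) (hR s 32) (%t. hN s 42 t 0) a m (hR s 18 0 0) (hR s' 35 i) val"
 unfolding s'_def ROWS_def
proof (rule For_rule[where n = n and J = "%i s'. \<forall>i'<i. \<exists>a val. (\<forall>x<m + k. a x = (if x < m then A i' (Sf cS x) else 0)) \<and>
   regopt (m + k) (%x. hR s 34 x 0) (hR s 32) (%t. hN s 42 t 0) a m (hR s 18 0 0) (hR s' 35 i') val"])
 let ?P1 = "If (TN (S 18) (S 4)) (Sq (NM (S 33) (V 40 18)) (RM (V 39 18) (M 30 26 33))) (RC (V 39 18) 0)"
 let ?P2 = "RM (M 35 26 19) (V 40 19)"
 let ?B = "sqs (For 18 10 ?P1) [REG 10 10 4, For 19 2 ?P2]"
 fix i w assume i: "i < n" and e: "eqx (insert 26 (nmods ?B)) (rmods ?B) s w"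
  and J: "\<forall>i'<i. \<exists>a val. (\<forall>x<m + k. a x = (if x < m then A i' (Sf cS x) else 0)) \<and>
   regopt (m + k) (%x. hR s 34 x 0) (hR s 32) (%t. hN s 42 t 0) a m (hR s 18 0 0) (hR w 35 i') val"
 have gw: "good w" by (rule good_eqx[OF s e]) auto
 define w0 where "w0 = setn w (S 26) i"
 define w1 where "w1 = run (For 18 10 ?P1) w0"
 define w2 where "w2 = run (REG 10 10 4) w1"
 define w3 where "w3 = run (For 19 2 ?P2) w2"
 have g0: "good w0" unfolding w0_def by (rule good_setn[OF gw]) auto
 have g1: "good w1" unfolding w1_def by (rule good_run[OF g0]) auto
 have g2: "good w2" unfolding w2_def by (rule good_run[OF g1]) auto
 have f0: "hN w0 40 = hN s 40" "hN w0 42 = hN s 42" "hR w0 34 = hR s 34" "hR w0 32 = hR s 32" "hR w0 18 = hR s 18" "hN w0 26 0 0 = i" "hR w0 35 = hR w 35"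
  using eqxN[OF e, of 40] eqxN[OF e, of 42] eqxR[OF e, of 34] eqxR[OF e, of 32] eqxR[OF e, of 18]
  by (simp_all add: w0_def hN_setn_other hN_setn_S)
 have r1: "\<forall>x<m + k. hR w1 39 x 0 = (if x < m then A i (Sf cS x) else 0)"
  unfolding w1_def
 proof (rule For_rule[where n = "m + k" and J = "%j s'. \<forall>x<j. hR s' 39 x 0 = (if x < m then A i (Sf cS x) else 0)"])
  fix j v assume j: "j < m + k" and e2: "eqx (insert 18 (nmods ?P1)) (rmods ?P1) w0 v"
   and J2: "\<forall>x<j. hR v 39 x 0 = (if x < m then A i (Sf cS x) else 0)"
  have gv: "good v" by (rule good_eqx[OF g0 e2]) auto
  have "hN v 4 0 0 = m" "hN v 26 0 0 = i" "hN v 40 = hN s 40"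
   using gv eqxN[OF e2, of 26] eqxN[OF e2, of 40] f0 by (simp_all add: good_def)
  moreover have "hR v 30 i (Sf cS j) = A i (Sf cS j)" using gv i d by (simp add: good_def Sf_def)
  ultimately show "\<forall>x<Suc j. hR (run ?P1 (setn v (S 18) j)) 39 x 0 = (if x < m then A i (Sf cS x) else 0)"
   using J2 S by (simp add: st_simps less_Suc_eq)
 next
  show "hN w0 10 0 0 = m + k" using g0 by (simp add: good_def)
 qed auto
 have f1: "hN w1 42 = hN s 42" "hR w1 34 = hR s 34" "hR w1 32 = hR s 32" "hR w1 18 = hR s 18" "hN w1 26 0 0 = i" "hR w1 35 = hR w 35"
  using f0 by (simp_all add: w1_def hN_run hR_run del: run.simps)
 have rg: "regopt (m + k) (%x. hR w1 34 x 0) (hR w1 32) (%t. hN w1 42 t 0) (%x. hR w1 39 x 0) m (hR w1 18 0 0)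
  (%u. hR w2 40 u 0) (hR w2 7 0 0)"
  unfolding w2_def by (rule REG_good[OF g1]) (use g1 f1 Q in \<open>auto simp: good_def\<close>)
 have f2: "hN w2 26 0 0 = i" "hR w2 35 = hR w 35" using f1 by (simp_all add: w2_def hN_run hR_run)
 have r3: "hR w3 35 = (%i' u. if i' = i \<and> u < k then hR w2 40 u 0 else hR w 35 i' u)"
  unfolding w3_def
 proof (rule For_rule[where n = k and J = "%j s'. hR s' 35 = (%i' u. if i' = i \<and> u < j then hR w2 40 u 0 else hR w 35 i' u)"])
  fix j v assume "j < k" and e2: "eqx (insert 19 (nmods ?P2)) (rmods ?P2) w2 v"
   and J2: "hR v 35 = (%i' u. if i' = i \<and> u < j then hR w2 40 u 0 else hR w 35 i' u)"
  have "hN v 26 0 0 = i" "hR v 40 = hR w2 40" using eqxN[OF e2, of 26] eqxR[OF e2, of 40] f2 by simp_all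
  then show "hR (run ?P2 (setn v (S 19) j)) 35 = (%i' u. if i' = i \<and> u < Suc j then hR w2 40 u 0 else hR w 35 i' u)"
   using J2 by (simp add: st_simps fun_eq_iff less_Suc_eq)
 next
  show "hN w2 2 0 0 = k" using g2 by (simp add: good_def)
 qed (use f2 in auto)
 have eq: "run ?B (setn w (S 26) i) = w3" by (simp add: w3_def w2_def w1_def w0_def)
 have new: "\<exists>a val. (\<forall>x<m + k. a x = (if x < m then A i (Sf cS x) else 0)) \<and>
   regopt (m + k) (%x. hR s 34 x 0) (hR s 32) (%t. hN s 42 t 0) a m (hR s 18 0 0) (hR w3 35 i) val"
  using r1 regopt_cong[OF rg[unfolded f1], of "hR w3 35 i"] r3
  by (intro exI[of _ "%x. hR w1 39 x 0"] exI[of _ "hR w2 7 0 0"]) simp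
 show "\<forall>i'<Suc i. \<exists>a val. (\<forall>x<m + k. a x = (if x < m then A i' (Sf cS x) else 0)) \<and>
   regopt (m + k) (%x. hR s 34 x 0) (hR s 32) (%t. hN s 42 t 0) a m (hR s 18 0 0) (hR (run ?B (setn w (S 26) i)) 35 i') val"
 proof (intro allI impI)
  fix i' assume "i' < Suc i"
  then consider "i' = i" | "i' < i" by linarith
  then show "\<exists>a val. (\<forall>x<m + k. a x = (if x < m then A i' (Sf cS x) else 0)) \<and>
   regopt (m + k) (%x. hR s 34 x 0) (hR s 32) (%t. hN s 42 t 0) a m (hR s 18 0 0) (hR (run ?B (setn w (S 26) i)) 35 i') val"
  proof cases
   case 1
   show ?thesis unfolding eq 1 by (rule new)
  next
   case 2
   then have e35: "hR w3 35 i' = hR w 35 i'" using r3 by (simp add: fun_eq_iff)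
   show ?thesis unfolding eq e35 using J 2 by blast
  qed
 qed
next
 show "hN s 0 0 0 = n" using s by (simp add: good_def)
qed auto

lemma COLS_run:
 assumes s: "good s" and Q: "\<And>t. t < k ==> hN s 42 t 0 < n"
 defines "s' \<equiv> run COLS s"
 shows "\<exists>vals. (\<forall>j<d. \<exists>a. (\<forall>x<n + k. a x = (if x < n then A x j else 0)) \<and>
   regopt n (%x. hR s 34 x 0) (hR s 32) (%t. hN s 42 t 0) a n (hR s 18 0 0) (%u. hR s' 36 u j) (vals j)) \<and>
   hR s' 8 0 0 = hR s 8 0 0 + (\<Sum>j<d. vals j)"
 unfolding s'_def COLS_def
proof (rule For_rule[where n = d and J = "%i s'. \<exists>vals. (\<forall>j<i. \<exists>a. (\<forall>x<n + k. a x = (if x < n then A x j else 0)) \<and>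
   regopt n (%x. hR s 34 x 0) (hR s 32) (%t. hN s 42 t 0) a n (hR s 18 0 0) (%u. hR s' 36 u j) (vals j)) \<and>
   hR s' 8 0 0 = hR s 8 0 0 + (\<Sum>j<i. vals j)"])
 let ?P1 = "If (TN (S 18) (S 0)) (RM (V 39 18) (M 30 18 26)) (RC (V 39 18) 0)"
 let ?P2 = "RM (M 36 19 26) (V 40 19)"
 let ?P3 = "RO RPlus (S 8) (S 8) (S 7)"
 let ?B = "sqs (For 18 11 ?P1) [REG 0 11 0, For 19 2 ?P2, ?P3]"
 fix i w assume i: "i < d" and e: "eqx (insert 26 (nmods ?B)) (rmods ?B) s w"
  and J: "\<exists>vals. (\<forall>j<i. \<exists>a. (\<forall>x<n + k. a x = (if x < n then A x j else 0)) \<and>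
   regopt n (%x. hR s 34 x 0) (hR s 32) (%t. hN s 42 t 0) a n (hR s 18 0 0) (%u. hR w 36 u j) (vals j)) \<and>
   hR w 8 0 0 = hR s 8 0 0 + (\<Sum>j<i. vals j)"
 have gw: "good w" by (rule good_eqx[OF s e]) auto
 define w0 where "w0 = setn w (S 26) i"
 define w1 where "w1 = run (For 18 11 ?P1) w0"
 define w2 where "w2 = run (REG 0 11 0) w1"
 define w3 where "w3 = run (For 19 2 ?P2) w2"
 define w4 where "w4 = run ?P3 w3"
 have g0: "good w0" unfolding w0_def by (rule good_setn[OF gw]) auto
 have g1: "good w1" unfolding w1_def by (rule good_run[OF g0]) auto
 have g2: "good w2" unfolding w2_def by (rule good_run[OF g1]) auto
 have f0: "hN w0 42 = hN s 42" "hR w0 34 = hR s 34" "hR w0 32 = hR s 32" "hR w0 18 = hR s 18" "hN w0 26 0 0 = i" "hR w0 36 = hR w 36" "hR w0 8 = hR w 8"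
  using eqxN[OF e, of 42] eqxR[OF e, of 34] eqxR[OF e, of 32] eqxR[OF e, of 18]
  by (simp_all add: w0_def hN_setn_other hN_setn_S)
 have r1: "\<forall>x<n + k. hR w1 39 x 0 = (if x < n then A x i else 0)"
  unfolding w1_def
 proof (rule For_rule[where n = "n + k" and J = "%j s'. \<forall>x<j. hR s' 39 x 0 = (if x < n then A x i else 0)"])
  fix j v assume j: "j < n + k" and e2: "eqx (insert 18 (nmods ?P1)) (rmods ?P1) w0 v"
   and J2: "\<forall>x<j. hR v 39 x 0 = (if x < n then A x i else 0)"
  have gv: "good v" by (rule good_eqx[OF g0 e2]) auto
  have "hN v 0 0 0 = n" "hN v 26 0 0 = i" using gv eqxN[OF e2, of 26] f0 by (simp_all add: good_def)
  moreover have "j < n ==> hR v 30 j i = A j i" using gv i by (simp add: good_def)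
  ultimately show "\<forall>x<Suc j. hR (run ?P1 (setn v (S 18) j)) 39 x 0 = (if x < n then A x i else 0)"
   using J2 by (simp add: st_simps less_Suc_eq)
 next
  show "hN w0 11 0 0 = n + k" using g0 by (simp add: good_def)
 qed auto
 have f1: "hN w1 42 = hN s 42" "hR w1 34 = hR s 34" "hR w1 32 = hR s 32" "hR w1 18 = hR s 18" "hN w1 26 0 0 = i" "hR w1 36 = hR w 36" "hR w1 8 = hR w 8"
  using f0 by (simp_all add: w1_def hN_run hR_run del: run.simps)
 have rg: "regopt n (%x. hR w1 34 x 0) (hR w1 32) (%t. hN w1 42 t 0) (%x. hR w1 39 x 0) n (hR w1 18 0 0)
  (%u. hR w2 40 u 0) (hR w2 7 0 0)"
  unfolding w2_def by (rule REG_good[OF g1]) (use g1 f1 Q in \<open>auto simp: good_def trans_less_add1\<close>)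
 have f2: "hN w2 26 0 0 = i" "hR w2 36 = hR w 36" "hR w2 8 = hR w 8" using f1 by (simp_all add: w2_def hN_run hR_run)
 have r3: "hR w3 36 = (%u i'. if i' = i \<and> u < k then hR w2 40 u 0 else hR w 36 u i')"
  unfolding w3_def
 proof (rule For_rule[where n = k and J = "%j s'. hR s' 36 = (%u i'. if i' = i \<and> u < j then hR w2 40 u 0 else hR w 36 u i')"])
  fix j v assume "j < k" and e2: "eqx (insert 19 (nmods ?P2)) (rmods ?P2) w2 v"
   and J2: "hR v 36 = (%u i'. if i' = i \<and> u < j then hR w2 40 u 0 else hR w 36 u i')"
  have "hN v 26 0 0 = i" "hR v 40 = hR w2 40" using eqxN[OF e2, of 26] eqxR[OF e2, of 40] f2 by simp_all
  then show "hR (run ?P2 (setn v (S 19) j)) 36 = (%u i'. if i' = i \<and> u < Suc j then hR w2 40 u 0 else hR w 36 u i')"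
   using J2 by (simp add: st_simps fun_eq_iff less_Suc_eq)
 next
  show "hN w2 2 0 0 = k" using g2 by (simp add: good_def)
 qed (use f2 in auto)
 have f3: "hR w3 8 = hR w 8" "hR w3 7 = hR w2 7" using f2 by (simp_all add: w3_def hR_run del: run.simps)
 have f4: "hR w4 8 0 0 = hR w 8 0 0 + hR w2 7 0 0" "hR w4 36 = hR w3 36"
  using f3 by (simp_all add: w4_def st_simps)
 have eq: "run ?B (setn w (S 26) i) = w4" by (simp add: w4_def w3_def w2_def w1_def w0_def)
 obtain vals where v: "\<forall>j<i. \<exists>a. (\<forall>x<n + k. a x = (if x < n then A x j else 0)) \<and>
   regopt n (%x. hR s 34 x 0) (hR s 32) (%t. hN s 42 t 0) a n (hR s 18 0 0) (%u. hR w 36 u j) (vals j)"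
   "hR w 8 0 0 = hR s 8 0 0 + (\<Sum>j<i. vals j)" using J by blast
 define vals' where "vals' = vals(i := hR w2 7 0 0)"
 have new: "\<exists>a. (\<forall>x<n + k. a x = (if x < n then A x i else 0)) \<and>
   regopt n (%x. hR s 34 x 0) (hR s 32) (%t. hN s 42 t 0) a n (hR s 18 0 0) (%u. hR w4 36 u i) (vals' i)"
  using r1 regopt_cong[OF rg[unfolded f1], of "%u. hR w4 36 u i"] r3 f4
  by (intro exI[of _ "%x. hR w1 39 x 0"]) (simp add: vals'_def)
 have "\<exists>a. (\<forall>x<n + k. a x = (if x < n then A x j else 0)) \<and>
   regopt n (%x. hR s 34 x 0) (hR s 32) (%t. hN s 42 t 0) a n (hR s 18 0 0) (%u. hR w4 36 u j) (vals' j)" if jl: "j < Suc i" for j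
 proof (cases "j = i")
  case True
  show ?thesis unfolding True by (rule new)
 next
  case False
  then have j: "j < i" using jl by simp
  then have ej: "(%u. hR w4 36 u j) = (%u. hR w 36 u j)" "vals' j = vals j" using r3 f4 by (simp_all add: fun_eq_iff vals'_def)
  show ?thesis unfolding ej using v(1) j by blast
 qed
 moreover have "hR w4 8 0 0 = hR s 8 0 0 + (\<Sum>j<Suc i. vals' j)"
 proof -
  have "(\<Sum>j<i. vals' j) = (\<Sum>j<i. vals j)" by (intro sum.cong) (auto simp: vals'_def)
  then show ?thesis using f4 v(2) by (simp add: vals'_def)
 qed
 ultimately show "\<exists>vals. (\<forall>j<Suc i. \<exists>a. (\<forall>x<n + k. a x = (if x < n then A x j else 0)) \<and>
   regopt n (%x. hR s 34 x 0) (hR s 32) (%t. hN s 42 t 0) a n (hR s 18 0 0) (%u. hR (run ?B (setn w (S 26) i)) 36 u j) (vals j)) \<and>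
   hR (run ?B (setn w (S 26) i)) 8 0 0 = hR s 8 0 0 + (\<Sum>j<Suc i. vals j)"
  unfolding eq by blast
next
 show "hN s 1 0 0 = d" using s by (simp add: good_def)
qed auto

text \<open>A state-free description of the outcome. The trace is existentially quantified, as its
  pivots depend on the order of the search, so \<open>W\<close> is not determined; later claims are
  made for every such \<open>W\<close>.\<close>

definition ph1 :: "nat => nat => nat => nat => (nat => nat => real) => bool" where
 "ph1 cS cw cQ cR W \<longleftrightarrow> (\<exists>Hs b Q w. (\<forall>x<m + k. \<forall>u<k. Hs 0 x u = H1 cS cQ cR x u) \<and> elims (m + k) (m + k) k k Hs b Q \<and>
   (\<forall>x<m + k. w x = wext m (wf cw) x) \<and>
   (\<forall>i<n. \<exists>a val. (\<forall>x<m + k. a x = (if x < m then A i (Sf cS x) else 0)) \<and> regopt (m + k) w b Q a m \<mu> (W i) val))"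

definition ph2 :: "(nat => nat => real) => (nat => nat => real) => real => bool" where
 "ph2 W V' tot \<longleftrightarrow> (\<exists>Hs b Q w vals. (\<forall>x<n + k. \<forall>u<k. Hs 0 x u = (if x < n then W x u else if x = n + u then 1 else 0)) \<and>
   elims n (n + k) k k Hs b Q \<and> (\<forall>x<n + k. w x = 1) \<and>
   (\<forall>j<d. \<exists>a. (\<forall>x<n + k. a x = (if x < n then A x j else 0)) \<and> regopt n w b Q a n 1 (%u. V' u j) (vals j)) \<and>
   tot = (\<Sum>j<d. vals j))"

lemma PH1_run:
 assumes s: "good s" and c: "hN s 22 0 0 = cS" "hN s 23 0 0 = cw" "hN s 24 0 0 = cQ" "hN s 25 0 0 = cR"
 shows "ph1 cS cw cQ cR (hR (run PH1 s) 35)"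
proof -
 define s1 where "s1 = run DECODE s"
 define s2 where "s2 = run BUILD s1"
 define s3 where "s3 = run (ELIM 10 10 2) s2"
 define s4 where "s4 = run (RM (S 18) (S 5)) s3"
 have g1: "good s1" unfolding s1_def by (rule good_run[OF s]) auto
 have g2: "good s2" unfolding s2_def by (rule good_run[OF g1]) auto
 have g3: "good s3" unfolding s3_def by (rule good_run[OF g2]) auto
 have g4: "good s4" unfolding s4_def by (rule good_run[OF g3]) auto
 note D = DECODE_run[OF s c(1-3), folded s1_def]
 have B: "hR s2 31 x u = H1 cS cQ cR x u" if "x < m + k" "u < k" for x u
  unfolding s2_def by (rule BUILD_run[OF g1]) (use D that c in \<open>auto simp: s1_def hN_run\<close>)
 have "\<exists>Hs. Hs 0 = hR s2 31 \<and> Hs k = hR s3 31 \<and> elims (m + k) (m + k) k k Hs (hR s3 32) (%t. hN s3 42 t 0)"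
  unfolding s3_def by (rule ELIM_run) (use g2 k in \<open>auto simp: good_def\<close>)
 then obtain Hs where Hs: "Hs 0 = hR s2 31" "elims (m + k) (m + k) k k Hs (hR s3 32) (%t. hN s3 42 t 0)" by blast
 have f4: "hR s4 32 = hR s3 32" "hN s4 42 = hN s3 42" "hR s4 34 = hR s1 34" "hN s4 40 = hN s1 40"
  by (simp_all add: s4_def s3_def s2_def hR_run hN_run hR_setr_other)
 have mu: "hR s4 18 0 0 = \<mu>" using g3 by (simp add: s4_def st_simps good_def)
 have Qb: "hN s4 42 t 0 < m + k" if "t < k" for t using elims_row[OF Hs(2) order.refl that] f4 by simp
 have "\<forall>i<n. \<exists>a val. (\<forall>x<m + k. a x = (if x < m then A i (Sf cS x) else 0)) \<and>
   regopt (m + k) (%x. hR s4 34 x 0) (hR s4 32) (%t. hN s4 42 t 0) a m (hR s4 18 0 0) (hR (run ROWS s4) 35 i) val"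
  by (rule ROWS_run[OF g4]) (use Qb D f4 in auto)
 moreover have "run PH1 s = run ROWS s4" by (simp add: PH1_def s4_def s3_def s2_def s1_def)
 ultimately show ?thesis unfolding ph1_def using Hs B D(2) mu f4
  by (intro exI[of _ Hs] exI[of _ "hR s3 32"] exI[of _ "%t. hN s3 42 t 0"] exI[of _ "%x. hR s1 34 x 0"] conjI) simp_all
qed

lemma PH2_run:
 assumes s: "good s"
 shows "ph2 (hR s 35) (hR (run PH2 s) 36) (hR (run PH2 s) 8 0 0)"
proof -
 let ?P1 = "For 18 11 (For 19 2 (RC (M 31 18 19) 0))"
 let ?P2 = "For 18 0 (For 19 2 (RM (M 31 18 19) (M 35 18 19)))"
 let ?P3 = "If (TN (S 18) (S 0)) nop0 (Sq (NO NMinus (S 32) (S 18) (S 0)) (RM (M 31 18 32) (S 17)))"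
 let ?P4 = "RM (V 34 18) (S 17)"
 define s1 where "s1 = run ?P1 s"
 define s2 where "s2 = run ?P2 s1"
 define s3 where "s3 = run (For 18 11 ?P3) s2"
 define s4 where "s4 = run (For 18 11 ?P4) s3"
 define s5 where "s5 = run (ELIM 0 11 2) s4"
 define s6 where "s6 = run (RC (S 8) 0) (run (RM (S 18) (S 17)) s5)"
 have g1: "good s1" unfolding s1_def by (rule good_run[OF s]) auto
 have g2: "good s2" unfolding s2_def by (rule good_run[OF g1]) auto
 have g3: "good s3" unfolding s3_def by (rule good_run[OF g2]) auto
 have g4: "good s4" unfolding s4_def by (rule good_run[OF g3]) auto
 have g5: "good s5" unfolding s5_def by (rule good_run[OF g4]) auto
 have g6: "good s6" unfolding s6_def by (rule good_run[OF good_run[OF g5]]) auto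
 have z1: "\<forall>x<n + k. \<forall>u<k. hR s1 31 x u = 0"
  unfolding s1_def by (rule ZERO_run) (use s in \<open>auto simp: good_def\<close>)
 have W1: "hR s1 35 = hR s 35" by (simp add: s1_def hR_run del: run.simps)
 have c2: "\<forall>x<n. \<forall>u<k. hR s2 31 x u = hR s 35 x u"
  unfolding s2_def W1[symmetric] by (rule COPY_run) (use g1 in \<open>auto simp: good_def\<close>)
 have z2: "\<forall>x. n \<le> x \<longrightarrow> x < n + k \<longrightarrow> (\<forall>u<k. hR s2 31 x u = 0)"
  unfolding s2_def
 proof (rule For_rule[where n = n and J = "%i s'. \<forall>x. n \<le> x \<longrightarrow> x < n + k \<longrightarrow> (\<forall>u<k. hR s' 31 x u = 0)"])
  let ?B = "RM (M 31 18 19) (M 35 18 19)"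
  fix i w assume i: "i < n" and e: "eqx (insert 18 (nmods (For 19 2 ?B))) (rmods (For 19 2 ?B)) s1 w"
   and J: "\<forall>x. n \<le> x \<longrightarrow> x < n + k \<longrightarrow> (\<forall>u<k. hR w 31 x u = 0)"
  show "\<forall>x. n \<le> x \<longrightarrow> x < n + k \<longrightarrow> (\<forall>u<k. hR (run (For 19 2 ?B) (setn w (S 18) i)) 31 x u = 0)"
  proof (rule For_rule[where n = k and J = "%i s'. \<forall>x. n \<le> x \<longrightarrow> x < n + k \<longrightarrow> (\<forall>u<k. hR s' 31 x u = 0)"])
   fix j v assume e2: "eqx (insert 19 (nmods ?B)) (rmods ?B) (setn w (S 18) i) v"
    and J2: "\<forall>x. n \<le> x \<longrightarrow> x < n + k \<longrightarrow> (\<forall>u<k. hR v 31 x u = 0)"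
   have "hN v 18 0 0 = i" using eqxN[OF e2, of 18] by (simp add: hN_setn_S)
   then show "\<forall>x. n \<le> x \<longrightarrow> x < n + k \<longrightarrow> (\<forall>u<k. hR (run ?B (setn v (S 19) j)) 31 x u = 0)"
    using J2 i by (simp add: st_simps)
  next
   show "hN (setn w (S 18) i) 2 0 0 = k" using eqxN[OF e, of 2] g1 by (simp add: good_def hN_setn_other)
  qed (use J in auto)
 next
  show "hN s1 0 0 0 = n" using g1 by (simp add: good_def)
 qed (use z1 in auto)
 let ?H = "%x u. if x < n then hR s 35 x u else if x = n + u then 1 else 0"
 have r3: "\<forall>x<n + k. \<forall>u<k. hR s3 31 x u = ?H x u"
  unfolding s3_def
 proof (rule For_rule[where n = "n + k" and J = "%i s'. \<forall>x<n + k. \<forall>u<k. hR s' 31 x u = (if x < i then ?H x u else hR s2 31 x u)"])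
  fix i w assume i: "i < n + k" and e: "eqx (insert 18 (nmods ?P3)) (rmods ?P3) s2 w"
   and J: "\<forall>x<n + k. \<forall>u<k. hR w 31 x u = (if x < i then ?H x u else hR s2 31 x u)"
  have gw: "good w" by (rule good_eqx[OF g2 e]) auto
  have "hN w 0 0 0 = n" "hR w 17 0 0 = 1" using gw by (simp_all add: good_def)
  then show "\<forall>x<n + k. \<forall>u<k. hR (run ?P3 (setn w (S 18) i)) 31 x u = (if x < Suc i then ?H x u else hR s2 31 x u)"
   using J c2 z2 by (auto simp: st_simps less_Suc_eq)
 next
  show "hN s2 11 0 0 = n + k" using g2 by (simp add: good_def)
 qed auto
 have r4: "\<forall>x<n + k. hR s4 34 x 0 = 1"
  unfolding s4_def
 proof (rule For_rule[where n = "n + k" and J = "%i s'. \<forall>x<i. hR s' 34 x 0 = 1"])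
  fix i w assume e: "eqx (insert 18 (nmods ?P4)) (rmods ?P4) s3 w" and J: "\<forall>x<i. hR w 34 x 0 = 1"
  have gw: "good w" by (rule good_eqx[OF g3 e]) auto
  then show "\<forall>x<Suc i. hR (run ?P4 (setn w (S 18) i)) 34 x 0 = 1"
   using J by (simp add: good_def st_simps less_Suc_eq)
 next
  show "hN s3 11 0 0 = n + k" using g3 by (simp add: good_def)
 qed auto
 have H4: "hR s4 31 = hR s3 31" by (simp add: s4_def hR_run del: run.simps)
 have "\<exists>Hs. Hs 0 = hR s4 31 \<and> Hs k = hR s5 31 \<and> elims n (n + k) k k Hs (hR s5 32) (%t. hN s5 42 t 0)"
  unfolding s5_def by (rule ELIM_run) (use g4 n k in \<open>auto simp: good_def\<close>)
 then obtain Hs where Hs: "Hs 0 = hR s4 31" "elims n (n + k) k k Hs (hR s5 32) (%t. hN s5 42 t 0)" by blast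
 have f6: "hR s6 32 = hR s5 32" "hN s6 42 = hN s5 42" "hR s6 34 = hR s4 34" "hR s6 8 0 0 = 0" "hR s6 18 0 0 = 1"
  using g5 by (simp_all add: s6_def s5_def hR_run hN_run hR_setr_other) (simp_all add: st_simps good_def)
 have Qb: "hN s6 42 t 0 < n" if "t < k" for t using elims_row[OF Hs(2) _ that] f6 by simp
 have eq: "run PH2 s = run COLS s6" by (simp add: PH2_def BUILD2_def s6_def s5_def s4_def s3_def s2_def s1_def)
 obtain vals where vals: "\<forall>j<d. \<exists>a. (\<forall>x<n + k. a x = (if x < n then A x j else 0)) \<and>
   regopt n (%x. hR s6 34 x 0) (hR s6 32) (%t. hN s6 42 t 0) a n (hR s6 18 0 0) (%u. hR (run COLS s6) 36 u j) (vals j)"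
   "hR (run COLS s6) 8 0 0 = hR s6 8 0 0 + (\<Sum>j<d. vals j)"
  using COLS_run[OF g6 Qb] by blast
 show ?thesis unfolding ph2_def eq using Hs H4 r3 r4 vals f6
  by (intro exI[of _ Hs] exI[of _ "hR s5 32"] exI[of _ "%t. hN s5 42 t 0"] exI[of _ "%x. hR s4 34 x 0"] exI[of _ vals] conjI) simp_all
qed

definition cand :: "nat => nat => nat => nat => (nat => nat => real) => (nat => nat => real) => real => bool" where
 "cand cS cw cQ cR W V' tot \<longleftrightarrow> (if 0 < sc then ph1 cS cw cQ cR W else (\<forall>i<n. \<forall>u<k. W i u = U0 i u)) \<and> ph2 W V' tot"

definition best :: "hst => bool" where
 "best s \<longleftrightarrow> (\<exists>cS cw cQ cR W V'. cand cS cw cQ cR W V' (hR s 9 0 0) \<and> (\<forall>i<n. \<forall>u<k. hR s 37 i u = W i u) \<and>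
   (\<forall>u<k. \<forall>j<d. hR s 38 u j = V' u j))"

text \<open>\<open>D\<close> describes the guesses tried so far. As outcomes are described by a
  relation only, what is recorded for a guess is that some outcome of it is no cheaper than the
  stored one.\<close>

definition invr :: "(nat => nat => nat => nat => bool) => hst => bool" where
 "invr D s \<longleftrightarrow> good s \<and> ((hN s 34 0 0 = 0 \<and> (\<forall>cS cw cQ cR. \<not> D cS cw cQ cR)) \<or>
   (hN s 34 0 0 = 1 \<and> best s \<and> (\<forall>cS cw cQ cR. D cS cw cQ cR \<longrightarrow> (\<exists>W V' tot. cand cS cw cQ cR W V' tot \<and> hR s 9 0 0 \<le> tot))))"

lemma SAVE_run:
 assumes s: "good s"
 shows "hR (run SAVE s) 9 0 0 = hR s 8 0 0" "hN (run SAVE s) 34 0 0 = 1"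
  "\<forall>i<n. \<forall>u<k. hR (run SAVE s) 37 i u = hR s 35 i u" "\<forall>u<k. \<forall>j<d. hR (run SAVE s) 38 u j = hR s 36 u j"
proof -
 let ?P2 = "RM (M 38 19 26) (M 36 19 26)"
 define s1 where "s1 = run (RM (S 9) (S 8)) s"
 define s2 where "s2 = run (For 18 0 (For 19 2 (RM (M 37 18 19) (M 35 18 19)))) s1"
 define s3 where "s3 = run (For 19 2 (For 26 1 ?P2)) s2"
 have eq: "run SAVE s = run (NC (S 34) 1) s3" by (simp add: SAVE_def s3_def s2_def s1_def)
 have g1: "good s1" unfolding s1_def by (rule good_run[OF s]) auto
 have g2: "good s2" unfolding s2_def by (rule good_run[OF g1]) auto
 have c2: "\<forall>i<n. \<forall>u<k. hR s2 37 i u = hR s1 35 i u"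
  unfolding s2_def by (rule COPY_run) (use g1 in \<open>auto simp: good_def\<close>)
 have f: "hR s3 9 = hR s1 9" "hR s3 37 = hR s2 37" "hR s2 36 = hR s 36" "hR s1 35 = hR s 35" "hR s1 9 0 0 = hR s 8 0 0"
  by (simp_all add: s3_def s2_def s1_def hR_run hR_setr_other st_simps del: run.simps(12))
 have c3: "\<forall>u<k. \<forall>j<d. hR s3 38 u j = hR s 36 u j"
  unfolding s3_def
 proof (rule For_rule[where n = k and J = "%i s'. \<forall>u<i. \<forall>j<d. hR s' 38 u j = hR s 36 u j"])
  fix i w assume i: "i < k" and e: "eqx (insert 19 (nmods (For 26 1 ?P2))) (rmods (For 26 1 ?P2)) s2 w"
   and J: "\<forall>u<i. \<forall>j<d. hR w 38 u j = hR s 36 u j"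
  have w: "hR w 36 = hR s 36" "hN w 1 0 0 = d" using eqxR[OF e, of 36] eqxN[OF e, of 1] f g2 by (auto simp: good_def)
  show "\<forall>u<Suc i. \<forall>j<d. hR (run (For 26 1 ?P2) (setn w (S 19) i)) 38 u j = hR s 36 u j"
  proof (rule For_rule[where n = d and J = "%j s'. (\<forall>u<i. \<forall>j<d. hR s' 38 u j = hR s 36 u j) \<and> (\<forall>j'<j. hR s' 38 i j' = hR s 36 i j')"])
   fix j v assume j: "j < d" and e2: "eqx (insert 26 (nmods ?P2)) (rmods ?P2) (setn w (S 19) i) v"
    and J2: "(\<forall>u<i. \<forall>j<d. hR v 38 u j = hR s 36 u j) \<and> (\<forall>j'<j. hR v 38 i j' = hR s 36 i j')"
   have "hN v 19 0 0 = i" "hR v 36 = hR s 36"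
    using eqxN[OF e2, of 19] eqxR[OF e2, of 36] w by (simp_all add: hN_setn_S)
   then show "(\<forall>u<i. \<forall>j2<d. hR (run ?P2 (setn v (S 26) j)) 38 u j2 = hR s 36 u j2) \<and>
     (\<forall>j'<Suc j. hR (run ?P2 (setn v (S 26) j)) 38 i j' = hR s 36 i j')"
    using J2 by (simp add: st_simps less_Suc_eq)
  qed (use J w in \<open>auto simp: less_Suc_eq hN_setn_other\<close>)
 next
  show "hN s2 2 0 0 = k" using g2 by (simp add: good_def)
 qed auto
 show "hR (run SAVE s) 9 0 0 = hR s 8 0 0" "hN (run SAVE s) 34 0 0 = 1"
  "\<forall>i<n. \<forall>u<k. hR (run SAVE s) 37 i u = hR s 35 i u" "\<forall>u<k. \<forall>j<d. hR (run SAVE s) 38 u j = hR s 36 u j"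
  unfolding eq using c2 c3 f by (simp_all add: st_simps)
qed

lemma CAND_run:
 assumes I: "invr D s" and c: "hN s 22 0 0 = cS" "hN s 23 0 0 = cw" "hN s 24 0 0 = cQ" "hN s 25 0 0 = cR"
 shows "invr (%a b c e. D a b c e \<or> a = cS \<and> b = cw \<and> c = cQ \<and> e = cR) (run CAND s)"
proof -
 have s: "good s" using I by (simp add: invr_def)
 let ?P0 = "For 18 0 (For 19 2 (RM (M 35 18 19) (M 41 18 19)))"
 define s1 where "s1 = run (If (TR (S 16) (S 3)) PH1 ?P0) s"
 define s2 where "s2 = run PH2 s1"
 have g1: "good s1" unfolding s1_def by (rule good_run[OF s]) auto
 have g2: "good s2" unfolding s2_def by (rule good_run[OF g1]) auto
 have c1: "evc (TR (S 16) (S 3)) s \<longleftrightarrow> 0 < sc" using s by (simp add: good_def rv_def)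
 have W: "if 0 < sc then ph1 cS cw cQ cR (hR s1 35) else (\<forall>i<n. \<forall>u<k. hR s1 35 i u = U0 i u)"
 proof (cases "0 < sc")
  case True
  then have "s1 = run PH1 s" unfolding s1_def using c1 by simp
  then show ?thesis using PH1_run[OF s c] True by simp
 next
  case False
  then have "s1 = run ?P0 s" unfolding s1_def using c1 by simp
  moreover have "\<forall>i<n. \<forall>u<k. hR (run ?P0 s) 35 i u = hR s 41 i u"
   by (rule COPY_run) (use s in \<open>auto simp: good_def\<close>)
  moreover have "\<forall>i<n. \<forall>u<k. hR s 41 i u = U0 i u" using s by (simp add: good_def)
  ultimately show ?thesis using False by simp
 qed
 have P2: "ph2 (hR s1 35) (hR s2 36) (hR s2 8 0 0)" unfolding s2_def by (rule PH2_run[OF g1])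
 have cd: "cand cS cw cQ cR (hR s1 35) (hR s2 36) (hR s2 8 0 0)" using W P2 by (simp add: cand_def)
 have f: "hR s2 35 = hR s1 35" "hN s2 34 = hN s 34" "hR s2 9 = hR s 9" "hR s2 37 = hR s 37" "hR s2 38 = hR s 38"
  by (simp_all add: s2_def s1_def hR_run hN_run del: run.simps)
 note sv = SAVE_run[OF g2]
 have new: "good (run SAVE s2) \<and> hN (run SAVE s2) 34 0 0 = 1 \<and> best (run SAVE s2) \<and> hR (run SAVE s2) 9 0 0 = hR s2 8 0 0"
 proof -
  have "good (run SAVE s2)" by (rule good_run[OF g2]) auto
  moreover have "best (run SAVE s2)" unfolding best_def
   using cd sv f by (intro exI[of _ cS] exI[of _ cw] exI[of _ cQ] exI[of _ cR] exI[of _ "hR s1 35"] exI[of _ "hR s2 36"]) simp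
  ultimately show ?thesis using sv by simp
 qed
 have eq: "run CAND s = run (If (TN (S 34) (S 12)) SAVE (If (TR (S 8) (S 9)) SAVE nop0)) s2"
  by (simp add: CAND_def s2_def s1_def)
 have g12: "hN s2 12 0 0 = 1" using g2 by (simp add: good_def)
 from I have "(hN s 34 0 0 = 0 \<and> (\<forall>cS cw cQ cR. \<not> D cS cw cQ cR)) \<or>
   (hN s 34 0 0 = 1 \<and> best s \<and> (\<forall>cS cw cQ cR. D cS cw cQ cR \<longrightarrow> (\<exists>W V' tot. cand cS cw cQ cR W V' tot \<and> hR s 9 0 0 \<le> tot)))"
  by (simp add: invr_def)
 then show ?thesis
 proof
  assume a: "hN s 34 0 0 = 0 \<and> (\<forall>cS cw cQ cR. \<not> D cS cw cQ cR)"
  then have "run CAND s = run SAVE s2" unfolding eq using f g12 by (simp add: nv_def)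
  note e = this
  have "\<exists>W V' tot. cand x y z w W V' tot \<and> hR s2 8 0 0 \<le> tot"
   if D: "D x y z w \<or> x = cS \<and> y = cw \<and> z = cQ \<and> w = cR" for x y z w
  proof -
   have "x = cS" "y = cw" "z = cQ" "w = cR" using D a by blast+
   then show ?thesis using cd by blast
  qed
  then show ?thesis unfolding invr_def e using new by simp
 next
  assume a: "hN s 34 0 0 = 1 \<and> best s \<and> (\<forall>cS cw cQ cR. D cS cw cQ cR \<longrightarrow> (\<exists>W V' tot. cand cS cw cQ cR W V' tot \<and> hR s 9 0 0 \<le> tot))"
  show ?thesis
  proof (cases "hR s2 8 0 0 < hR s 9 0 0")
   case True
   then have e: "run CAND s = run SAVE s2" unfolding eq using f g12 a by (simp add: nv_def rv_def)
   have "\<exists>W V' tot. cand x y z w W V' tot \<and> hR s2 8 0 0 \<le> tot"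
    if D: "D x y z w \<or> x = cS \<and> y = cw \<and> z = cQ \<and> w = cR" for x y z w
    using D
   proof
    assume "D x y z w"
    then obtain W V' tot where "cand x y z w W V' tot" "hR s 9 0 0 \<le> tot" using a by blast
    then show ?thesis using True by (intro exI[of _ W] exI[of _ V'] exI[of _ tot]) simp
   qed (use cd in blast)
   then show ?thesis unfolding invr_def e using new by simp
  next
   case False
   then have e: "run CAND s = run nop0 s2" unfolding eq using f g12 a by (simp add: nv_def rv_def)
   have h: "hN (run nop0 s2) 34 0 0 = 1" "hR (run nop0 s2) 9 0 0 = hR s 9 0 0" "hR (run nop0 s2) 37 = hR s 37" "hR (run nop0 s2) 38 = hR s 38"
    using f a by (simp_all add: hR_setr_other)
   have "good (run nop0 s2)" by (rule good_run[OF g2]) auto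
   moreover have "best (run nop0 s2) = best s" unfolding best_def h by (rule refl)
   moreover have "\<exists>W V' tot. cand x y z w W V' tot \<and> hR s 9 0 0 \<le> tot"
    if D: "D x y z w \<or> x = cS \<and> y = cw \<and> z = cQ \<and> w = cR" for x y z w
    using D
   proof
    assume "x = cS \<and> y = cw \<and> z = cQ \<and> w = cR"
    then show ?thesis using cd False by (intro exI[of _ "hR s1 35"] exI[of _ "hR s2 36"] exI[of _ "hR s2 8 0 0"]) simp
   qed (use a in blast)
   ultimately show ?thesis unfolding invr_def e h using a by simp
  qed
 qed
qed

lemma invr_mono: "invr D s ==> (\<And>a b c e. D' a b c e = D a b c e) ==> invr D' s"
 unfolding invr_def by simp

lemma invr_setn:
 assumes "invr D s" "v \<in> {22, 23, 24, 25}"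
 shows "invr D (setn s (S v) i)"
proof -
 have "good (setn s (S v) i)" using assms by (intro good_setn) (auto simp: invr_def)
 moreover have "hN (setn s (S v) i) 34 = hN s 34" using assms(2) by (auto simp: hN_setn_other)
 moreover have "best (setn s (S v) i) = best s" by (simp add: best_def)
 ultimately show ?thesis using assms(1) unfolding invr_def by simp
qed

text \<open>Each loop level adds to the guesses tried the slice with the outer indices fixed, in
  lexicographic order.\<close>

lemma SEARCH_run:
 assumes s: "good s" "hN s 34 0 0 = 0"
 shows "invr (%a b c e. a < X \<and> b < X \<and> c < X \<and> e < X) (run SEARCH s)"
proof -
 have Xv: "hN w 8 0 0 = X" if "invr D w" for w D using that by (simp add: invr_def good_def)
 have L4: "invr (%x y z w. D x y z w \<or> x = a \<and> y = b \<and> z = c \<and> w < X) (run (For 25 8 CAND) t)"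
  if "invr D t" "hN t 22 0 0 = a" "hN t 23 0 0 = b" "hN t 24 0 0 = c" for D t a b c
 proof (rule For_rule[where n = X and J = "%i. invr (%x y z w. D x y z w \<or> x = a \<and> y = b \<and> z = c \<and> w < i)"])
  fix i u assume e: "eqx (insert 25 (nmods CAND)) (rmods CAND) t u" and J: "invr (%x y z w. D x y z w \<or> x = a \<and> y = b \<and> z = c \<and> w < i) u"
  have "hN u 22 0 0 = a" "hN u 23 0 0 = b" "hN u 24 0 0 = c"
   using eqxN[OF e, of 22] eqxN[OF e, of 23] eqxN[OF e, of 24] that by simp_all
  then have "invr (%x y z w. (D x y z w \<or> x = a \<and> y = b \<and> z = c \<and> w < i) \<or> x = a \<and> y = b \<and> z = c \<and> w = i) (run CAND (setn u (S 25) i))"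
   using CAND_run[OF invr_setn[OF J, of 25 i], of a b c i] by (simp add: hN_setn_other hN_setn_S)
  then show "invr (%x y z w. D x y z w \<or> x = a \<and> y = b \<and> z = c \<and> w < Suc i) (run CAND (setn u (S 25) i))"
   by (rule invr_mono) (auto simp: less_Suc_eq)
 next
  show "invr (%x y z w. D x y z w \<or> x = a \<and> y = b \<and> z = c \<and> w < 0) t" by (rule invr_mono[OF that(1)]) simp
 qed (use Xv[OF that(1)] invr_setn in auto)
 have L3: "invr (%x y z w. D x y z w \<or> x = a \<and> y = b \<and> z < X \<and> w < X) (run (For 24 8 (For 25 8 CAND)) t)"
  if "invr D t" "hN t 22 0 0 = a" "hN t 23 0 0 = b" for D t a b
 proof (rule For_rule[where n = X and J = "%i. invr (%x y z w. D x y z w \<or> x = a \<and> y = b \<and> z < i \<and> w < X)"])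
  fix i u assume e: "eqx (insert 24 (nmods (For 25 8 CAND))) (rmods (For 25 8 CAND)) t u" and J: "invr (%x y z w. D x y z w \<or> x = a \<and> y = b \<and> z < i \<and> w < X) u"
  have "hN u 22 0 0 = a" "hN u 23 0 0 = b" using eqxN[OF e, of 22] eqxN[OF e, of 23] that by simp_all
  then have "invr (%x y z w. (D x y z w \<or> x = a \<and> y = b \<and> z < i \<and> w < X) \<or> x = a \<and> y = b \<and> z = i \<and> w < X) (run (For 25 8 CAND) (setn u (S 24) i))"
   by (intro L4 invr_setn J) (auto simp: hN_setn_other hN_setn_S)
  then show "invr (%x y z w. D x y z w \<or> x = a \<and> y = b \<and> z < Suc i \<and> w < X) (run (For 25 8 CAND) (setn u (S 24) i))"
   by (rule invr_mono) (auto simp: less_Suc_eq)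
 next
  show "invr (%x y z w. D x y z w \<or> x = a \<and> y = b \<and> z < 0 \<and> w < X) t" by (rule invr_mono[OF that(1)]) simp
 qed (use Xv[OF that(1)] invr_setn in auto)
 have L2: "invr (%x y z w. D x y z w \<or> x = a \<and> y < X \<and> z < X \<and> w < X) (run (For 23 8 (For 24 8 (For 25 8 CAND))) t)"
  if "invr D t" "hN t 22 0 0 = a" for D t a
 proof (rule For_rule[where n = X and J = "%i. invr (%x y z w. D x y z w \<or> x = a \<and> y < i \<and> z < X \<and> w < X)"])
  let ?B = "For 24 8 (For 25 8 CAND)"
  fix i u assume e: "eqx (insert 23 (nmods ?B)) (rmods ?B) t u" and J: "invr (%x y z w. D x y z w \<or> x = a \<and> y < i \<and> z < X \<and> w < X) u"
  have "hN u 22 0 0 = a" using eqxN[OF e, of 22] that by simp_all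
  then have "invr (%x y z w. (D x y z w \<or> x = a \<and> y < i \<and> z < X \<and> w < X) \<or> x = a \<and> y = i \<and> z < X \<and> w < X) (run ?B (setn u (S 23) i))"
   by (intro L3 invr_setn J) (auto simp: hN_setn_other hN_setn_S)
  then show "invr (%x y z w. D x y z w \<or> x = a \<and> y < Suc i \<and> z < X \<and> w < X) (run ?B (setn u (S 23) i))"
   by (rule invr_mono) (auto simp: less_Suc_eq)
 next
  show "invr (%x y z w. D x y z w \<or> x = a \<and> y < 0 \<and> z < X \<and> w < X) t" by (rule invr_mono[OF that(1)]) simp
 qed (use Xv[OF that(1)] invr_setn in auto)
 have I0: "invr (%_ _ _ _. False) s" using s by (simp add: invr_def)
 show ?thesis unfolding SEARCH_def
 proof (rule For_rule[where n = X and J = "%i. invr (%x y z w. x < i \<and> y < X \<and> z < X \<and> w < X)"])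
  let ?B = "For 23 8 (For 24 8 (For 25 8 CAND))"
  fix i u assume J: "invr (%x y z w. x < i \<and> y < X \<and> z < X \<and> w < X) u"
  have "invr (%x y z w. (x < i \<and> y < X \<and> z < X \<and> w < X) \<or> x = i \<and> y < X \<and> z < X \<and> w < X) (run ?B (setn u (S 22) i))"
   by (intro L2 invr_setn J) (auto simp: hN_setn_other hN_setn_S)
  then show "invr (%x y z w. x < Suc i \<and> y < X \<and> z < X \<and> w < X) (run ?B (setn u (S 22) i))"
   by (rule invr_mono) (auto simp: less_Suc_eq)
 next
  show "invr (%x y z w. x < 0 \<and> y < X \<and> z < X \<and> w < X) s" by (rule invr_mono[OF I0]) simp
 qed (use Xv[OF I0] invr_setn in auto)
qed

end

section \<open>Constants, input, scale and output\<close>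

lemma mods_simps4 [simp]:
 "nmods CONSTS = {29}" "rmods CONSTS = {1, 2, 14, 15, 16, 17, 19, 20, 21, 23, 24}"
 "nmods LOADA = {18, 29, 32, 33}" "rmods LOADA = {14, 30}"
 "nmods SCALE = {18, 19, 20, 30, 31, 34, 42}" "rmods SCALE = {3, 4, 5, 6, 10, 14, 15, 22, 31, 32, 41}"
 "nmods SEARCH = {18, 19, 20, 21, 22, 23, 24, 25, 26, 27, 28, 29, 30, 31, 32, 33, 34, 40, 41, 42}"
 by (auto simp: CONSTS_def LOADA_def SCALE_def SEARCH_def)

lemma puts_simps [simp]:
 "\<not> puts CONSTS" "\<not> puts LOADA" "\<not> puts SCALE" "\<not> puts SEARCH"
 by (auto simp: prog_defs)

text \<open>Rules for scalar instructions that never unfold the state; unfolding repeated squaring would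
 duplicate it exponentially often.\<close>

lemma scalar_run:
 "hR (run (RC (S z) c) s) a 0 0 = (if a = z then of_int c else hR s a 0 0)"
 "hR (run (RO p (S z) (S x) (S y)) s) a 0 0 = (if a = z then ropv p (hR s x 0 0) (hR s y 0 0) else hR s a 0 0)"
 "hR (run (NR (S z) (S x)) s) a 0 0 = (if a = z then real (hN s x 0 0) else hR s a 0 0)"
 "hR (run (RGet (S z) (S x)) s) a 0 0 = (if a = z \<and> hN s x 0 0 < hb s then hI s (hN s x 0 0) else hR s a 0 0)"
 "hR (run (NC (S z) i) s) a 0 0 = hR s a 0 0"
 "hN (run (RC (S z) c) s) = hN s" "hN (run (RO p (S z) (S x) (S y)) s) = hN s" "hN (run (NR (S z) (S x)) s) = hN s"
 "hN (run (RGet (S z) (S x)) s) = hN s"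
 "hN (run (NC (S z) i) s) a 0 0 = (if a = z then i else hN s a 0 0)"
 "hI (run (RC (S z) c) s) = hI s" "hI (run (NC (S z) i) s) = hI s"
 by (auto simp: st_simps)

lemma CONSTS_run:
 assumes b: "0 < hb s"
 defines "s' \<equiv> run CONSTS s" and "y \<equiv> real (hN s 5 0 0)"
 shows "hR s' 16 0 0 = 0" "hR s' 17 0 0 = 1" "hR s' 2 0 0 = 1 + 1 / y ^ 2" "hR s' 1 0 0 = 1 + hI s 0 / y ^ 2"
  "hR s' 20 0 0 = y ^ 3" "hR s' 21 0 0 = real (hN s 6 0 0)" "hR s' 23 0 0 = y ^ 8" "hR s' 24 0 0 = y ^ 24"
proof -
 have pw: "y ^ 8 = ((y * y) * (y * y)) * ((y * y) * (y * y))" "y ^ 24 = (y ^ 8 * y ^ 8) * y ^ 8"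
  by (simp_all add: eval_nat_numeral)
 have e: "hR s' 16 0 0 = 0" "hR s' 17 0 0 = 1" "hR s' 2 0 0 = 1 + 1 / (y * y)" "hR s' 1 0 0 = 1 + hI s 0 / (y * y)"
  "hR s' 20 0 0 = (y * y) * y" "hR s' 21 0 0 = real (hN s 6 0 0)"
  "hR s' 23 0 0 = ((y * y) * (y * y)) * ((y * y) * (y * y))"
  "hR s' 24 0 0 = (((y * y) * (y * y)) * ((y * y) * (y * y)) * (((y * y) * (y * y)) * ((y * y) * (y * y)))) * (((y * y) * (y * y)) * ((y * y) * (y * y)))"
  using b by (simp_all add: s'_def y_def CONSTS_def scalar_run del: run.simps(1-9))
 show "hR s' 16 0 0 = 0" "hR s' 17 0 0 = 1" "hR s' 2 0 0 = 1 + 1 / y ^ 2" "hR s' 1 0 0 = 1 + hI s 0 / y ^ 2"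
  "hR s' 20 0 0 = y ^ 3" "hR s' 21 0 0 = real (hN s 6 0 0)" "hR s' 23 0 0 = y ^ 8" "hR s' 24 0 0 = y ^ 24"
  unfolding e pw by (simp_all add: power2_eq_square power3_eq_cube)
qed

lemma LOADA_run:
 assumes s: "hN s 1 0 0 = d" "d \<ge> 1" "hN s 13 0 0 = n * d + 2" "hN s 16 0 0 = 2" "n * d + 2 \<le> hb s"
  and ij: "i < n" "j < d"
 shows "hR (run LOADA s) 30 i j = hI s (2 + i * d + j)"
proof -
 let ?B = "If (TN (S 18) (S 16)) nop0 (sqs (NO NMinus (S 32) (S 18) (S 16))
   [NO NQuot (S 33) (S 32) (S 1), NO NRem (S 29) (S 32) (S 1), RGet (M 30 33 29) (S 18)])"
 have "\<forall>a. a < n * d \<longrightarrow> hR (run (For 18 13 ?B) s) 30 (a div d) (a mod d) = hI s (2 + a)"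
 proof (rule For_rule[where n = "n * d + 2" and J = "%t s'. hI s' = hI s \<and> (\<forall>a. a + 2 < t \<longrightarrow> hR s' 30 (a div d) (a mod d) = hI s (2 + a))"])
  fix t w assume t: "t < n * d + 2" and e: "eqx (insert 18 (nmods ?B)) (rmods ?B) s w"
   and J: "hI w = hI s \<and> (\<forall>a. a + 2 < t \<longrightarrow> hR w 30 (a div d) (a mod d) = hI s (2 + a))"
  have w: "hN w 16 0 0 = 2" "hN w 1 0 0 = d" "hb w = hb s"
   using eqxN[OF e, of 16] eqxN[OF e, of 1] s e by (simp_all add: eqx_def)
  show "hI (run ?B (setn w (S 18) t)) = hI s \<and>
   (\<forall>a. a + 2 < Suc t \<longrightarrow> hR (run ?B (setn w (S 18) t)) 30 (a div d) (a mod d) = hI s (2 + a))"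
  proof (cases "t < 2")
   case True
   then show ?thesis using J w by (simp add: st_simps)
  next
   case False
   \<comment> \<open>Cells 0 and 1 hold p and \<epsilon>, so entry c of the matrix stands at address
     c + 2.\<close>
   then obtain c where c: "t = c + 2" by (metis add.commute le_Suc_ex not_less)
   have H: "hR (run ?B (setn w (S 18) t)) 30 = (%x y. if x = c div d \<and> y = c mod d then hI s t else hR w 30 x y)"
    using w J s t by (simp add: st_simps fun_eq_iff c)
   have I: "hI (run ?B (setn w (S 18) t)) = hI s" using J by (subst hI_run) auto
   have "hR (run ?B (setn w (S 18) t)) 30 (a div d) (a mod d) = hI s (2 + a)" if "a + 2 < Suc t" for a
   proof (cases "a = c")
    case True
    then show ?thesis unfolding H by (simp add: c)
   next
    case False
    have "\<not> (a div d = c div d \<and> a mod d = c mod d)" using False by (metis div_mult_mod_eq)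
    moreover have "a + 2 < t" using that False c by simp
    ultimately show ?thesis unfolding H using J by auto
   qed
   then show ?thesis using I by blast
  qed
 qed (use s in auto)
 moreover have "i * d + j < n * d"
 proof -
  have "i * d + j < Suc i * d" using ij by simp
  also have "\<dots> \<le> n * d" using ij by (intro mult_le_mono1) simp
  finally show ?thesis .
 qed
 ultimately have "hR (run LOADA s) 30 ((i * d + j) div d) ((i * d + j) mod d) = hI s (2 + (i * d + j))"
  unfolding LOADA_def by blast
 then show ?thesis using ij by (simp add: add.assoc)
qed

text \<open>Elimination writes \<open>A\<close> as multipliers times pivot rows plus a remainder.
  The multipliers are kept as a left factor for the case of remainder 0.\<close>

lemma SCALE_run:
 assumes z: "hR s 16 0 0 = 0" and s: "hN s 0 0 0 = n" "n \<ge> 1" "hN s 1 0 0 = d" "d \<ge> 1" "hN s 2 0 0 = k"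
 defines "s' \<equiv> run SCALE s"
 shows "\<exists>Hs b Q. (\<forall>x<n. \<forall>y<d. Hs 0 x y = hR s 30 x y) \<and> elims n n d k Hs b Q \<and>
  (\<forall>i<n. \<forall>u<k. hR s' 41 i u = b u i) \<and> (\<forall>x<n. \<forall>y<d. \<bar>Hs k x y\<bar> \<le> hR s' 3 0 0) \<and>
  (\<exists>x<n. \<exists>y<d. hR s' 3 0 0 = \<bar>Hs k x y\<bar>)"
  "hR s' 5 0 0 = hR s' 3 0 0 / hR s 23 0 0" "hR s' 6 0 0 = hR s' 5 0 0" "hR s' 4 0 0 = hR s' 3 0 0 / hR s 24 0 0"
  "hN s' 34 0 0 = 0"
proof -
 let ?P1 = "RM (M 31 18 19) (M 30 18 19)"
 let ?P2 = "RM (M 41 18 19) (M 32 19 18)"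
 define s1 where "s1 = run (For 18 0 (For 19 1 ?P1)) s"
 define s2 where "s2 = run (ELIM 0 0 1) s1"
 define s3 where "s3 = run (For 18 0 (For 19 2 ?P2)) s2"
 define s4 where "s4 = run (PIVOT 0 1) s3"
 have eq: "s' = run (sqs (RM (S 3) (S 22)) [RO RQuot (S 5) (S 3) (S 23), RM (S 6) (S 5), RO RQuot (S 4) (S 3) (S 24), NC (S 34) 0]) s4"
  by (simp add: s'_def SCALE_def s4_def s3_def s2_def s1_def)
 have c1: "\<forall>x<n. \<forall>y<d. hR s1 31 x y = hR s 30 x y"
  unfolding s1_def
 proof (rule For_rule[where n = n and J = "%i s'. \<forall>x<i. \<forall>u<d. hR s' 31 x u = hR s 30 x u"])
  fix i w assume i: "i < n" and e: "eqx (insert 18 (nmods (For 19 1 ?P1))) (rmods (For 19 1 ?P1)) s w"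
   and J: "\<forall>x<i. \<forall>u<d. hR w 31 x u = hR s 30 x u"
  have w: "hR w 30 = hR s 30" "hN w 1 0 0 = d" using eqxR[OF e, of 30] eqxN[OF e, of 1] s by auto
  show "\<forall>x<Suc i. \<forall>u<d. hR (run (For 19 1 ?P1) (setn w (S 18) i)) 31 x u = hR s 30 x u"
  proof (rule For_rule[where n = d and J = "%j s'. (\<forall>x<i. \<forall>u<d. hR s' 31 x u = hR s 30 x u) \<and> (\<forall>u<j. hR s' 31 i u = hR s 30 i u)"])
   fix j v assume j: "j < d" and e2: "eqx (insert 19 (nmods ?P1)) (rmods ?P1) (setn w (S 18) i) v"
    and J2: "(\<forall>x<i. \<forall>u<d. hR v 31 x u = hR s 30 x u) \<and> (\<forall>u<j. hR v 31 i u = hR s 30 i u)"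
   have "hN v 18 0 0 = i" "hR v 30 = hR s 30"
    using eqxN[OF e2, of 18] eqxR[OF e2, of 30] w by (simp_all add: hN_setn_S)
   then show "(\<forall>x<i. \<forall>u<d. hR (run ?P1 (setn v (S 19) j)) 31 x u = hR s 30 x u) \<and>
     (\<forall>u<Suc j. hR (run ?P1 (setn v (S 19) j)) 31 i u = hR s 30 i u)"
    using J2 by (simp add: st_simps less_Suc_eq)
  qed (use J w in \<open>auto simp: less_Suc_eq hN_setn_other\<close>)
 qed (use s in auto)
 have f1: "hN s1 0 0 0 = n" "hN s1 1 0 0 = d" "hN s1 2 0 0 = k" "hR s1 16 0 0 = 0"
  using s z by (simp_all add: s1_def hN_run hR_run del: run.simps)
 have "\<exists>Hs. Hs 0 = hR s1 31 \<and> Hs k = hR s2 31 \<and> elims n n d k Hs (hR s2 32) (%t. hN s2 42 t 0)"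
  unfolding s2_def by (rule ELIM_run) (use f1 s in auto)
 then obtain Hs where Hs: "Hs 0 = hR s1 31" "Hs k = hR s2 31" "elims n n d k Hs (hR s2 32) (%t. hN s2 42 t 0)" by blast
 have f2: "hN s2 0 0 0 = n" "hN s2 1 0 0 = d" "hN s2 2 0 0 = k" "hR s2 16 0 0 = 0"
  using f1 by (simp_all add: s2_def hN_run hR_run)
 have c3: "\<forall>i<n. \<forall>u<k. hR s3 41 i u = hR s2 32 u i"
  unfolding s3_def
 proof (rule For_rule[where n = n and J = "%i s'. \<forall>x<i. \<forall>u<k. hR s' 41 x u = hR s2 32 u x"])
  fix i w assume i: "i < n" and e: "eqx (insert 18 (nmods (For 19 2 ?P2))) (rmods (For 19 2 ?P2)) s2 w"
   and J: "\<forall>x<i. \<forall>u<k. hR w 41 x u = hR s2 32 u x"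
  have w: "hR w 32 = hR s2 32" "hN w 2 0 0 = k" using eqxR[OF e, of 32] eqxN[OF e, of 2] f2 by auto
  show "\<forall>x<Suc i. \<forall>u<k. hR (run (For 19 2 ?P2) (setn w (S 18) i)) 41 x u = hR s2 32 u x"
  proof (rule For_rule[where n = k and J = "%j s'. (\<forall>x<i. \<forall>u<k. hR s' 41 x u = hR s2 32 u x) \<and> (\<forall>u<j. hR s' 41 i u = hR s2 32 u i)"])
   fix j v assume j: "j < k" and e2: "eqx (insert 19 (nmods ?P2)) (rmods ?P2) (setn w (S 18) i) v"
    and J2: "(\<forall>x<i. \<forall>u<k. hR v 41 x u = hR s2 32 u x) \<and> (\<forall>u<j. hR v 41 i u = hR s2 32 u i)"
   have "hN v 18 0 0 = i" "hR v 32 = hR s2 32"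
    using eqxN[OF e2, of 18] eqxR[OF e2, of 32] w by (simp_all add: hN_setn_S)
   then show "(\<forall>x<i. \<forall>u<k. hR (run ?P2 (setn v (S 19) j)) 41 x u = hR s2 32 u x) \<and>
     (\<forall>u<Suc j. hR (run ?P2 (setn v (S 19) j)) 41 i u = hR s2 32 u i)"
    using J2 by (simp add: st_simps less_Suc_eq)
  qed (use J w in \<open>auto simp: less_Suc_eq hN_setn_other\<close>)
 qed (use f2 in auto)
 have f3: "hN s3 0 0 0 = n" "hN s3 1 0 0 = d" "hR s3 16 0 0 = 0" "hR s3 31 = hR s2 31"
  using f2 by (simp_all add: s3_def hN_run hR_run del: run.simps)
 have "hR s3 16 0 0 = 0" "(0::nat) \<in> {0, 10}" "hN s3 0 0 0 = n" "1 \<le> n" "(1::nat) \<in> {1, 2}" "hN s3 1 0 0 = d" "1 \<le> d"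
  using f3 s by auto
 note pv = PIVOT_run[OF this, folded s4_def]
 have f4: "hR s4 41 = hR s3 41" "hR s4 23 = hR s 23" "hR s4 24 = hR s 24"
  by (simp_all add: s4_def s3_def s2_def s1_def hR_run del: run.simps)
 have e: "hR s' 3 0 0 = hR s4 22 0 0" "hR s' 41 = hR s4 41" "hR s' 5 0 0 = hR s4 22 0 0 / hR s4 23 0 0"
  "hR s' 6 0 0 = hR s4 22 0 0 / hR s4 23 0 0" "hR s' 4 0 0 = hR s4 22 0 0 / hR s4 24 0 0" "hN s' 34 0 0 = 0"
  unfolding eq by (simp_all add: st_simps)
 show "hR s' 5 0 0 = hR s' 3 0 0 / hR s 23 0 0" "hR s' 6 0 0 = hR s' 5 0 0" "hR s' 4 0 0 = hR s' 3 0 0 / hR s 24 0 0"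
  "hN s' 34 0 0 = 0" using e f4 by simp_all
 have m1: "\<forall>x<n. \<forall>y<d. \<bar>Hs k x y\<bar> \<le> hR s' 3 0 0"
  unfolding Hs(2) e(1) f3(4)[symmetric] pv(4) by (intro allI impI pv(3))
 have m2: "\<exists>x<n. \<exists>y<d. hR s' 3 0 0 = \<bar>Hs k x y\<bar>"
  unfolding Hs(2) e(1) f3(4)[symmetric] pv(4)
  by (rule exI[of _ "hN s4 30 0 0"], rule conjI[OF pv(1)], rule exI[of _ "hN s4 31 0 0"], rule conjI[OF pv(2) refl])
 have m3: "\<forall>i<n. \<forall>u<k. hR s' 41 i u = hR s2 32 u i" using e c3 f4 by simp
 have m4: "\<forall>x<n. \<forall>y<d. Hs 0 x y = hR s 30 x y" using Hs(1) c1 by simp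
 show "\<exists>Hs b Q. (\<forall>x<n. \<forall>y<d. Hs 0 x y = hR s 30 x y) \<and> elims n n d k Hs b Q \<and>
  (\<forall>i<n. \<forall>u<k. hR s' 41 i u = b u i) \<and> (\<forall>x<n. \<forall>y<d. \<bar>Hs k x y\<bar> \<le> hR s' 3 0 0) \<and>
  (\<exists>x<n. \<exists>y<d. hR s' 3 0 0 = \<bar>Hs k x y\<bar>)"
  by (rule exI[of _ Hs], rule exI[of _ "hR s2 32"], rule exI[of _ "%t. hN s2 42 t 0"], intro conjI m1 m2 m3 m4 Hs(3))
qed

lemma OUT_run:
 assumes s: "hN s 1 0 0 = d" "hN s 2 0 0 = k" "hN s 14 0 0 = n * k" "hN s 15 0 0 = n * k + k * d"
  "n * k + k * d \<le> hb s"
 shows "\<And>i u. i < n ==> u < k ==> hI (run OUT s) (i * k + u) = hR s 37 i u"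
  "\<And>u j. u < k ==> j < d ==> hI (run OUT s) (n * k + u * d + j) = hR s 38 u j"
proof -
 let ?B = "If (TN (S 18) (S 14))
   (sqs (NO NQuot (S 32) (S 18) (S 2)) [NO NRem (S 33) (S 18) (S 2), RPut (S 18) (M 37 32 33)])
   (sqs (NO NMinus (S 29) (S 18) (S 14)) [NO NQuot (S 32) (S 29) (S 1), NO NRem (S 33) (S 29) (S 1),
    RPut (S 18) (M 38 32 33)])"
 define ov where "ov a = (if a < n * k then hR s 37 (a div k) (a mod k) else hR s 38 ((a - n * k) div d) ((a - n * k) mod d))" for a
 have all: "\<forall>a<n * k + k * d. hI (run OUT s) a = ov a"
  unfolding OUT_def
 proof (rule For_rule[where n = "n * k + k * d" and J = "%t s'. \<forall>a<t. hI s' a = ov a"])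
  fix t w assume t: "t < n * k + k * d" and e: "eqx (insert 18 (nmods ?B)) (rmods ?B) s w" and J: "\<forall>a<t. hI w a = ov a"
  have w: "hN w 14 0 0 = n * k" "hN w 1 0 0 = d" "hN w 2 0 0 = k" "hb w = hb s" "hR w 37 = hR s 37" "hR w 38 = hR s 38"
   using eqxN[OF e, of 14] eqxN[OF e, of 1] eqxN[OF e, of 2] eqxR[OF e, of 37] eqxR[OF e, of 38] s e by (simp_all add: eqx_def)
  have "hI (run ?B (setn w (S 18) t)) = (hI w)(t := ov t)"
   using w t s(5) by (simp add: st_simps ov_def)
  then show "\<forall>a<Suc t. hI (run ?B (setn w (S 18) t)) a = ov a" using J by (auto simp: less_Suc_eq)
 qed (use s in auto)
 have lt: "i * b + u < a * b" if "i < a" "u < b" for i u a b :: nat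
 proof -
  have "i * b + u < Suc i * b" using that by simp
  also have "\<dots> \<le> a * b" using that by (intro mult_le_mono1) simp
  finally show ?thesis .
 qed
 show "hI (run OUT s) (i * k + u) = hR s 37 i u" if "i < n" "u < k" for i u
  using all lt[OF that] that by (simp add: ov_def trans_less_add1)
 show "hI (run OUT s) (n * k + u * d + j) = hR s 38 u j" if "u < k" "j < d" for u j
  using all lt[OF that] that by (simp add: ov_def add.assoc)
qed

text \<open>The interface between machine and analysis: from here on the argument is about
  \<open>cand\<close>, the elimination trace and the minimality of \<open>gb\<close>.\<close>

lemma MAIN_run:
 assumes s: "hN s 0 0 0 = n" "hN s 1 0 0 = d" "hN s 2 0 0 = k" "hN s 4 0 0 = m" "hN s 5 0 0 = Y" "hN s 6 0 0 = h"
  "hN s 7 0 0 = G" "hN s 8 0 0 = X" "hN s 9 0 0 = Lp" "hN s 10 0 0 = m + k" "hN s 11 0 0 = n + k" "hN s 12 0 0 = 1"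
  "hN s 13 0 0 = n * d + 2" "hN s 14 0 0 = n * k" "hN s 15 0 0 = n * k + k * d" "hN s 16 0 0 = 2"
  and b: "n * d + 2 \<le> hb s" "n * k + k * d \<le> hb s" and I: "hI s 0 = p" "\<And>i j. i < n ==> j < d ==> hI s (2 + i * d + j) = A i j"
  and pos: "n \<ge> 1" "d \<ge> 1" "k \<ge> 1" "X \<ge> 1"
 defines "s' \<equiv> run MAIN s" and "y \<equiv> real Y"
 shows "\<exists>sc U0 Hs b Q W V' gb cS cw cQ cR. (\<forall>x<n. \<forall>y<d. Hs 0 x y = A x y) \<and> elims n n d k Hs b Q \<and>
  (\<forall>i<n. \<forall>u<k. U0 i u = b u i) \<and> (\<forall>x<n. \<forall>y<d. \<bar>Hs k x y\<bar> \<le> sc) \<and> (\<exists>x<n. \<exists>y<d. sc = \<bar>Hs k x y\<bar>) \<and>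
  solver.cand n d k m G X Lp h A U0 (1 + p / y ^ 2) (1 + 1 / y ^ 2) sc (sc / y ^ 24) (sc / y ^ 8) (sc / y ^ 8) (y ^ 3) cS cw cQ cR W V' gb \<and>
  (\<forall>cS<X. \<forall>cw<X. \<forall>cQ<X. \<forall>cR<X. \<exists>W V' tot.
   solver.cand n d k m G X Lp h A U0 (1 + p / y ^ 2) (1 + 1 / y ^ 2) sc (sc / y ^ 24) (sc / y ^ 8) (sc / y ^ 8) (y ^ 3) cS cw cQ cR W V' tot \<and> gb \<le> tot) \<and>
  (\<forall>i<n. \<forall>u<k. hI s' (i * k + u) = W i u) \<and> (\<forall>u<k. \<forall>j<d. hI s' (n * k + u * d + j) = V' u j)"
proof -
 define s1 where "s1 = run CONSTS s"
 define s2 where "s2 = run LOADA s1"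
 define s3 where "s3 = run SCALE s2"
 define s4 where "s4 = run SEARCH s3"
 have eq: "s' = run OUT s4" by (simp add: s'_def MAIN_def s4_def s3_def s2_def s1_def)
 have C: "hR s1 16 0 0 = 0" "hR s1 17 0 0 = 1" "hR s1 2 0 0 = 1 + 1 / y ^ 2" "hR s1 1 0 0 = 1 + p / y ^ 2"
  "hR s1 20 0 0 = y ^ 3" "hR s1 21 0 0 = real h" "hR s1 23 0 0 = y ^ 8" "hR s1 24 0 0 = y ^ 24"
  using CONSTS_run[of s] b s I by (simp_all add: s1_def y_def)
 have N1: "hN s1 a = hN s a" if "a \<noteq> 29" for a using that by (simp add: s1_def hN_run)
 have h1: "hI s1 = hI s" "hb s1 = hb s" by (simp_all add: s1_def hI_run)
 have A2: "hR s2 30 i j = A i j" if "i < n" "j < d" for i j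
  unfolding s2_def using that s b pos N1 h1 I by (subst LOADA_run[where n = n and d = d]) auto
 have N2: "hN s2 a = hN s a" if "a \<notin> {18, 29, 32, 33}" for a using that N1 by (simp add: s2_def hN_run)
 have R2: "hR s2 a = hR s1 a" if "a \<notin> {14, 30}" for a using that by (simp add: s2_def hR_run)
 have sc1: "hR s2 16 0 0 = 0" "hN s2 0 0 0 = n" "1 \<le> n" "hN s2 1 0 0 = d" "1 \<le> d" "hN s2 2 0 0 = k"
  using R2 N2 C s pos by auto
 note SC = SCALE_run[OF sc1, folded s3_def]
 obtain Hs bv Q where H: "\<forall>x<n. \<forall>y<d. Hs 0 x y = hR s2 30 x y" "elims n n d k Hs bv Q"
  "\<forall>i<n. \<forall>u<k. hR s3 41 i u = bv u i" "\<forall>x<n. \<forall>y<d. \<bar>Hs k x y\<bar> \<le> hR s3 3 0 0"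
  "\<exists>x<n. \<exists>y<d. hR s3 3 0 0 = \<bar>Hs k x y\<bar>" using SC(1) by blast
 have N3: "hN s3 a = hN s a" if "a \<notin> {18, 19, 20, 29, 30, 31, 32, 33, 34, 42}" for a using that N2 by (simp add: s3_def hN_run)
 have R3: "hR s3 a = hR s2 a" if "a \<notin> {3, 4, 5, 6, 10, 14, 15, 22, 31, 32, 41}" for a using that by (simp add: s3_def hR_run)
 let ?sc = "hR s3 3 0 0"
 interpret sv: solver n d k m G X Lp h A "hR s3 41" "1 + p / y ^ 2" "1 + 1 / y ^ 2" ?sc "?sc / y ^ 24" "?sc / y ^ 8" "?sc / y ^ 8" "y ^ 3"
  by unfold_locales (use pos in auto)
 have good: "sv.good s3"
  unfolding sv.good_def using N3 R3 R2 C SC A2 s by simp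
 have "sv.invr (%a b c e. a < X \<and> b < X \<and> c < X \<and> e < X) s4"
  unfolding s4_def by (rule sv.SEARCH_run[OF good SC(5)])
 then have iv: "(hN s4 34 0 0 = 0 \<and> (\<forall>a b c e. \<not> (a < X \<and> b < X \<and> c < X \<and> e < X))) \<or>
   (hN s4 34 0 0 = 1 \<and> sv.best s4 \<and> (\<forall>a b c e. a < X \<and> b < X \<and> c < X \<and> e < X \<longrightarrow>
    (\<exists>W V' tot. sv.cand a b c e W V' tot \<and> hR s4 9 0 0 \<le> tot)))"
  unfolding sv.invr_def by (rule conjunct2)
 have "0 < X" using pos by simp
 with iv have iv2: "sv.best s4 \<and> (\<forall>a b c e. a < X \<and> b < X \<and> c < X \<and> e < X \<longrightarrow>
    (\<exists>W V' tot. sv.cand a b c e W V' tot \<and> hR s4 9 0 0 \<le> tot))" by metis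
 have I4: "sv.best s4" "\<And>a b c e. a < X ==> b < X ==> c < X ==> e < X ==> \<exists>W V' tot. sv.cand a b c e W V' tot \<and> hR s4 9 0 0 \<le> tot"
  using iv2 by simp_all
 obtain cS cw cQ cR W V' where B: "sv.cand cS cw cQ cR W V' (hR s4 9 0 0)" "\<forall>i<n. \<forall>u<k. hR s4 37 i u = W i u"
   "\<forall>u<k. \<forall>j<d. hR s4 38 u j = V' u j" using I4(1) unfolding sv.best_def by blast
 have N4: "hN s4 1 0 0 = d" "hN s4 2 0 0 = k" "hN s4 14 0 0 = n * k" "hN s4 15 0 0 = n * k + k * d"
  using N3 s by (simp_all add: s4_def hN_run)
 have hb4: "n * k + k * d \<le> hb s4" using b by (simp add: s4_def s3_def s2_def s1_def)
 note O = OUT_run[OF N4 hb4, folded eq]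
 show ?thesis
 proof (rule exI[of _ ?sc], rule exI[of _ "hR s3 41"], rule exI[of _ Hs], rule exI[of _ bv], rule exI[of _ Q], rule exI[of _ W],
   rule exI[of _ V'], rule exI[of _ "hR s4 9 0 0"], rule exI[of _ cS], rule exI[of _ cw], rule exI[of _ cQ], rule exI[of _ cR], intro conjI)
  show "\<forall>x<n. \<forall>y<d. Hs 0 x y = A x y" using H(1) A2 by simp
  show "\<forall>i<n. \<forall>u<k. hI s' (i * k + u) = W i u" using O(1) B(2) by simp
  show "\<forall>u<k. \<forall>j<d. hI s' (n * k + u * d + j) = V' u j" using O(2) B(3) by simp
  show "\<forall>cS<X. \<forall>cw<X. \<forall>cQ<X. \<forall>cR<X. \<exists>W V' tot. sv.cand cS cw cQ cR W V' tot \<and> hR s4 9 0 0 \<le> tot"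
   by (intro allI impI I4(2))
 qed (rule H(2) H(3) H(4) H(5) B(1))+
qed

section \<open>Quality of the approximation\<close>

text \<open>The staircase reaches at least \<open>2 ^ Y\<close> times its first level; this turns
  its reach into a power of \<open>y\<close>. At 128 the claim compares the exponents 112 and 128 of
  2, and from there on \<open>(1 + 1 / y) ^ 16 \<le> 2\<close>.\<close>

lemma two_power_ge: "128 \<le> y ==> y ^ 16 \<le> 2 ^ (y :: nat)"
proof (induction y rule: dec_induct)
 case base
 have "(128 :: nat) ^ 16 = 2 ^ (7 * 16)" by (simp only: power_mult) simp
 also have "\<dots> \<le> 2 ^ 128" by (intro power_increasing) auto
 finally show ?case .
next
 case (step y)
 have y: "real y > 0" using step by simp
 have "(1 + 1 / real y) ^ 16 \<le> exp (1 / real y) ^ 16"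
  by (intro power_mono exp_ge_add_one_self) simp
 also have "\<dots> = exp (16 / real y)" by (simp add: exp_of_nat_mult[symmetric])
 also have "\<dots> \<le> 1 + 16 / real y + (16 / real y)\<^sup>2"
  using step by (intro exp_bound) (auto simp: field_simps)
 also have "\<dots> \<le> 2"
 proof -
  have "16 / real y \<le> 1 / 8" using step by (simp add: field_simps)
  moreover have "(16 / real y)\<^sup>2 \<le> (1 / 8)\<^sup>2" using calculation y by (intro power_mono) auto
  ultimately show ?thesis by (simp add: power2_eq_square)
 qed
 finally have "(1 + 1 / real y) ^ 16 * real y ^ 16 \<le> 2 * real y ^ 16" by (intro mult_right_mono) auto
 moreover have "(1 + 1 / real y) ^ 16 * real y ^ 16 = real (Suc y) ^ 16"
  using y by (simp add: power_mult_distrib[symmetric] distrib_right add.commute)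
 ultimately have "real (Suc y ^ 16) \<le> real (2 * y ^ 16)" by simp
 then have "Suc y ^ 16 \<le> 2 * y ^ 16" by (simp only: of_nat_le_iff)
 then show ?case using step by simp
qed

text \<open>It yields \<open>1 + p / y ^ 2 \<le> ka powr p\<close>: the values of the staircase
  never overtake the p-th powers of its levels.\<close>

lemma bernoulli_powr_plus:
 fixes x p :: real
 assumes "0 \<le> x" "1 \<le> p"
 shows "1 + p * x \<le> (1 + x) powr p"
proof -
 define f where "f y = (1 + y) powr p - p * y" for y :: real
 have "f 0 \<le> f x"
 proof (rule DERIV_nonneg_imp_nondecreasing[OF assms(1)])
  fix y assume y: "0 \<le> y" "y \<le> x"
  have "(f has_real_derivative p * (1 + y) powr (p - 1) - p) (at y)"
   unfolding f_def using y by (auto intro!: derivative_eq_intros)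
  moreover have "1 \<le> (1 + y) powr (p - 1)" using y assms by (intro ge_one_powr_ge_zero) auto
  then have "0 \<le> p * (1 + y) powr (p - 1) - p" using assms by simp
  ultimately show "\<exists>z. (f has_real_derivative z) (at y) \<and> 0 \<le> z" by blast
 qed
 then show ?thesis by (simp add: f_def)
qed

lemma digits_exist:
 assumes "\<And>t. t < l ==> f t < G"
 shows "\<exists>c<G ^ l. \<forall>t<l. dig G c t = f t"
 using assms
proof (induction l arbitrary: f)
 case (Suc l)
 obtain c where c: "c < G ^ l" "\<forall>t<l. dig G c t = f (Suc t)"
  using Suc.IH[of "%t. f (Suc t)"] Suc.prems by auto
 have f0: "f 0 < G" using Suc.prems by simp
 let ?c = "f 0 + G * c"
 have "?c < G + G * c" using f0 by simp
 also have "\<dots> = G * Suc c" by simp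
 also have "\<dots> \<le> G * G ^ l" using c by (intro mult_le_mono2) simp
 finally have "?c < G ^ Suc l" by simp
 moreover have "dig G ?c t = f t" if "t < Suc l" for t
 proof (cases t)
  case 0
  then show ?thesis using f0 by (simp add: dig_def)
 next
  case (Suc t')
  have "?c div G = c" using f0 by simp
  then have "?c div G ^ t = c div G ^ t'" by (simp add: Suc div_mult2_eq)
  then show ?thesis using c that Suc by (simp add: dig_def)
 qed
 ultimately show ?case by blast
qed simp

text \<open>The two disjunctions feed the upper and the lower estimate of the staircase: at most one
  level too high, and too low only beyond the last level.\<close>

lemma pw_shape:
 assumes "z0 > 0" "g > 1"
 shows "\<exists>t\<le>L. pw z0 g q x L = (z0 * g ^ t, q ^ t) \<and> (t = 0 \<or> z0 * g ^ (t - 1) < x) \<and> (t = L \<or> x \<le> z0 * g ^ t)"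
proof (induction L)
 case (Suc L)
 then obtain t where t: "t \<le> L" "pw z0 g q x L = (z0 * g ^ t, q ^ t)" "t = 0 \<or> z0 * g ^ (t - 1) < x" "t = L \<or> x \<le> z0 * g ^ t"
  by blast
 show ?case
 proof (cases "z0 * g ^ t < x")
  case True
  then have "t = L" using t by auto
  then show ?thesis using True t by (intro exI[of _ "Suc L"]) (simp add: mult_ac)
 next
  case False
  then show ?thesis using t by (intro exI[of _ t]) auto
 qed
qed simp

text \<open>The grid range \<open>Y ^ 28 * (sc / Y ^ 24) = Y ^ 4 * sc\<close> covers residuals up to
  \<open>64 * Y ^ 3 * sc\<close>, and a digit up to \<open>2 * Y ^ 28\<close> fits into base
  \<open>Y ^ 29\<close>. The level ratio \<open>1 + 1 / Y ^ 2\<close> over \<open>Y ^ 3\<close>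
  rounds multiplies levels by at least \<open>2 ^ Y\<close>. Weights are multiples of
  \<open>1 / Y ^ 3\<close>, which is fine enough for true weights of at least
  \<open>1 / Y\<close>.\<close>

locale solver_y = solver n d k m "Y ^ 29" X "Y ^ 3" "Y ^ 28" A U0 "1 + p / real Y ^ 2" "1 + 1 / real Y ^ 2" sc
  "sc / real Y ^ 24" "sc / real Y ^ 8" "sc / real Y ^ 8" "real Y ^ 3"
 for n d k m Y X :: nat and A U0 :: "nat => nat => real" and p sc :: real +
 fixes \<gamma> :: real
 assumes Y: "128 \<le> Y" "n \<le> Y" "d \<le> Y" "k \<le> Y" "m \<le> Y" "(k + 1) ^ k \<le> Y" "8 ^ k \<le> Y" and m: "1 \<le> m"
  and p: "1 \<le> p" and \<gamma>: "0 < \<gamma>" "\<gamma> \<le> 1 / 64" "1 / real Y \<le> \<gamma>"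
  and rate: "exp (p / real Y) * (1 + 1 / real Y ^ 2) \<le> 1 + \<gamma>"
  and Xb: "(Y ^ 29) ^ m \<le> X" "(Y ^ 29) ^ k \<le> X" "(Y ^ 29) ^ (k * m) \<le> X"
begin

abbreviation y :: real where "y \<equiv> real Y"

text \<open>\<open>ka\<close> is the ratio of successive levels. \<open>kb\<close>, defined next, is
  the loss of \<open>1 + p / y ^ 2\<close> against \<open>ka powr p\<close>, accumulated over all
  levels, after a p-th root.\<close>

definition ka :: real where "ka = 1 + 1 / y ^ 2"
definition kb :: real where "kb = exp (p / y)"
definition z :: real where "z = sc / y ^ 8"
definition \<eta> :: real where "\<eta> = sc / y ^ 24"
definition cap :: real where "cap = z * ka ^ (Y ^ 3)"

lemma y128: "128 \<le> y" using Y(1) by simp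
lemma ka1: "1 < ka" using y128 by (simp add: ka_def)
lemma kb1: "1 \<le> kb" using y128 p by (simp add: kb_def)
lemma kab: "kb * ka \<le> 1 + \<gamma>" using rate by (simp add: ka_def kb_def)
lemma ka2: "ka \<le> 1 + \<gamma>"
proof -
 have "1 * ka \<le> kb * ka" using kb1 ka1 by (intro mult_right_mono) auto
 then show ?thesis using kab by simp
qed

lemma PF_eq: "PF x = snd (pw z ka (1 + p / y ^ 2) x (Y ^ 3))"
 by (simp add: PF_def z_def ka_def)

text \<open>The level reached is at most a factor \<open>ka\<close> above x, unless it is the first
  level z, which the summand z covers.\<close>

lemma PF_upper:
 assumes "sc > 0" "0 \<le> x"
 shows "PF x * z powr p \<le> (ka * (x + z)) powr p"
proof -
 have z: "z > 0" using assms y128 by (simp add: z_def)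
 obtain t where t: "pw z ka (1 + p / y ^ 2) x (Y ^ 3) = (z * ka ^ t, (1 + p / y ^ 2) ^ t)" "t = 0 \<or> z * ka ^ (t - 1) < x"
  using pw_shape[OF z ka1] by blast
 have "1 + p / y ^ 2 \<le> ka powr p" using bernoulli_powr_plus[of "1 / y ^ 2" p] p by (simp add: ka_def)
 then have "(1 + p / y ^ 2) ^ t \<le> (ka powr p) ^ t" using p by (intro power_mono) (auto simp: add_nonneg_nonneg)
 also have "\<dots> = (ka ^ t) powr p" using ka1 by (simp add: powr_powr powr_realpow[symmetric] mult.commute)
 finally have "PF x * z powr p \<le> (ka ^ t) powr p * z powr p" unfolding PF_eq t by (intro mult_right_mono) auto
 also have "\<dots> = (z * ka ^ t) powr p" using z ka1 by (simp add: powr_mult)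
 also have "\<dots> \<le> (ka * (x + z)) powr p"
 proof (intro powr_mono2)
  show "z * ka ^ t \<le> ka * (x + z)"
  proof (cases "t = 0")
   case True
   have "z \<le> x + z" using assms by simp
   also have "\<dots> \<le> ka * (x + z)" using ka1 assms z by (simp add: mult_le_cancel_right1)
   finally show ?thesis using True by simp
  next
   case False
   then obtain t' where "t = Suc t'" by (cases t) auto
   then have "z * ka ^ t = ka * (z * ka ^ t')" "z * ka ^ t' < x" using t by simp_all
   then show ?thesis using ka1 z by (auto intro!: mult_left_mono)
  qed
 qed (use p z ka1 in auto)
 finally show ?thesis .
qed

text \<open>With \<open>u = p / y ^ 2\<close> one has
  \<open>ka powr p \<le> exp u \<le> (1 + u) * exp (u\<^sup>2)\<close>. Over at most
  \<open>y ^ 3\<close> levels the excess is at most \<open>exp (y ^ 3 * u\<^sup>2)\<close>, which is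
  \<open>kb powr p\<close>. Beyond the last level nothing is known, hence the minimum with
  \<open>cap\<close>.\<close>

lemma PF_lower:
 assumes "sc > 0" "0 \<le> x"
 shows "min x cap powr p \<le> kb powr p * (PF x * z powr p)"
proof -
 have z: "z > 0" using assms y128 by (simp add: z_def)
 obtain t where t: "t \<le> Y ^ 3" "pw z ka (1 + p / y ^ 2) x (Y ^ 3) = (z * ka ^ t, (1 + p / y ^ 2) ^ t)" "t = Y ^ 3 \<or> x \<le> z * ka ^ t"
  using pw_shape[OF z ka1] by blast
 have "kb \<le> 1 + \<gamma>" using kab ka1 kb1 mult_left_mono[of 1 ka kb] by linarith
 \<comment> \<open>\<open>p \<le> y\<close> is hidden in \<open>rate\<close>: otherwise
   \<open>kb\<close> would be at least 2.\<close>
 have pY: "p \<le> y"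
 proof (rule ccontr)
  assume "\<not> p \<le> y"
  then have "1 \<le> p / y" using y128 by simp
  then have "exp 1 \<le> kb" by (simp add: kb_def)
  moreover have "2 \<le> exp (1 :: real)" using exp_ge_add_one_self[of 1] by simp
  ultimately show False using \<open>kb \<le> 1 + \<gamma>\<close> \<gamma> by linarith
 qed
 let ?u = "p / y ^ 2"
 have u: "0 \<le> ?u" "?u \<le> 1" using p pY y128 by (auto simp: power2_eq_square field_simps intro: order_trans[of p y] mult_mono)
 have "exp (?u - ?u\<^sup>2) \<le> exp (ln (1 + ?u))" using ln_one_plus_pos_lower_bound[OF u] by simp
 then have q: "exp (?u - ?u\<^sup>2) \<le> 1 + ?u" using u by simp
 have "min x cap \<le> z * ka ^ t" using t(3) by (auto simp: cap_def)
 then have "min x cap powr p \<le> (z * ka ^ t) powr p"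
  using p assms z ka1 by (intro powr_mono2) (auto simp: cap_def)
 also have "\<dots> = (ka powr p) ^ t * z powr p"
  using z ka1 by (simp add: powr_mult powr_powr powr_realpow[symmetric] mult.commute)
 also have "\<dots> \<le> (kb powr p * (1 + ?u) ^ t) * z powr p"
 proof (intro mult_right_mono)
  have "ka powr p \<le> exp (1 / y ^ 2) powr p"
   unfolding ka_def using p by (intro powr_mono2 exp_ge_add_one_self) auto
  also have "\<dots> = exp (?u - ?u\<^sup>2) * exp (?u\<^sup>2)" by (simp add: exp_powr_real exp_add[symmetric])
  also have "\<dots> \<le> (1 + ?u) * exp (?u\<^sup>2)" using q by (intro mult_right_mono) auto
  finally have "(ka powr p) ^ t \<le> ((1 + ?u) * exp (?u\<^sup>2)) ^ t" by (intro power_mono) auto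
  also have "\<dots> = (1 + ?u) ^ t * exp (real t * ?u\<^sup>2)" by (simp add: power_mult_distrib exp_of_nat_mult)
  also have "\<dots> \<le> (1 + ?u) ^ t * kb powr p"
  proof (intro mult_left_mono)
   have "real t * ?u\<^sup>2 \<le> y ^ 3 * ?u\<^sup>2" using t(1) by (intro mult_right_mono) (simp_all flip: of_nat_power)
   also have "\<dots> = p / y * p" using y128 by (simp add: power2_eq_square power3_eq_cube field_simps)
   finally show "exp (real t * ?u\<^sup>2) \<le> kb powr p" by (simp add: kb_def exp_powr_real)
  qed (use u in auto)
  finally show "(ka powr p) ^ t \<le> kb powr p * (1 + ?u) ^ t" by (simp add: mult.commute)
 qed simp
 finally show ?thesis unfolding PF_eq t by (simp add: mult.assoc)
qed

text \<open>By Bernoulli's inequality \<open>Y ^ 2\<close> rounds at least double the level, so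
  \<open>Y ^ 3\<close> rounds give a factor \<open>2 ^ Y\<close>, at least \<open>y ^ 16\<close>,
  over the first level \<open>sc / y ^ 8\<close>.\<close>

lemma cap_large: "sc > 0 ==> y ^ 8 * sc \<le> cap"
proof -
 assume sc: "sc > 0"
 have Y2: "0 < Y ^ 2" using Y(1) by simp
 have "2 \<le> ka ^ (Y ^ 2)"
 proof -
  have "1 + real (Y ^ 2) * (1 / y ^ 2) \<le> ka ^ (Y ^ 2)"
   unfolding ka_def by (rule Bernoulli_inequality) (simp add: order_trans[of "-1" 0])
  then show ?thesis using y128 by simp
 qed
 then have "2 ^ Y \<le> (ka ^ (Y ^ 2)) ^ Y" by (intro power_mono) auto
 also have "\<dots> = ka ^ (Y ^ 3)" by (simp add: power_mult[symmetric] power2_eq_square power3_eq_cube)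
 finally have "2 ^ Y \<le> ka ^ (Y ^ 3)" .
 moreover have "y ^ 16 \<le> 2 ^ Y"
  using two_power_ge[OF Y(1)] by (metis of_nat_le_iff of_nat_numeral of_nat_power)
 ultimately have "z * y ^ 16 \<le> cap" unfolding cap_def using sc by (intro mult_left_mono) (auto simp: z_def)
 moreover have "z * y ^ 16 = y ^ 8 * sc"
 proof -
  have "sc / b * (b * b) = b * sc" if "b \<noteq> 0" for b :: real using that by simp
  from this[of "y ^ 8"] have "sc / y ^ 8 * (y ^ 8 * y ^ 8) = y ^ 8 * sc" using y128 by simp
  moreover have "y ^ 16 = y ^ 8 * y ^ 8" by (simp flip: power_add)
  ultimately show ?thesis by (simp only: z_def)
 qed
 ultimately show ?thesis by simp
qed

lemma gv_eq: "gv c = (real c - real (Y ^ 28)) * \<eta>"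
 by (simp add: gv_def \<eta>_def)

lemma h_bound: "2 * Y ^ 28 < Y ^ 29"
proof -
 have "2 * Y ^ 28 < Y * Y ^ 28" using Y(1) by (intro mult_strict_right_mono) auto
 also have "Y * Y ^ 28 = Y ^ 29" by (simp flip: power_Suc)
 finally show ?thesis .
qed

lemma regopt_code:
 assumes "regopt N w b Q a base mm xs val" "elims N L k k Hs b Q" "N \<le> L"
 shows "\<exists>v \<rho>. val = C w N \<rho> \<and> (\<forall>x<L. \<rho> x = a x - (\<Sum>u<k. Hs 0 x u * v u)) \<and> (\<forall>u<k. xs u = - \<rho> (base + u) / mm)"
proof -
 obtain c where c: "val = C w N (R a b Q c)" "\<forall>u<k. xs u = - R a b Q c (base + u) / mm"
  using assms(1) unfolding regopt_def by blast
 obtain v where "\<forall>x<L. R a b Q c x = a x - (\<Sum>u<k. Hs 0 x u * v u)"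
  unfolding R_def using resid_span[OF assms(2,3) order.refl] by blast
 then show ?thesis using c by blast
qed

text \<open>The minimum cannot exceed the cost of the code whose grid values round the residual of
  \<open>v\<close>.\<close>

lemma regopt_le:
 assumes rg: "regopt N w b Q a base mm xs val" and el: "elims N L k k Hs b Q" "N \<le> L"
  and sc: "0 \<le> sc" and rng: "\<Gamma> + real k * \<eta> \<le> y ^ 28 * \<eta>"
  and xs: "\<And>x. x < N ==> \<bar>a x - (\<Sum>u<k. Hs 0 x u * v u)\<bar> \<le> \<Gamma>"
 shows "\<exists>\<rho>. val \<le> C w N \<rho> \<and> (\<forall>x<N. \<bar>\<rho> x - (a x - (\<Sum>u<k. Hs 0 x u * v u))\<bar> \<le> real k * \<eta>)"
proof -
 have "0 \<le> \<eta>" using sc by (simp add: \<eta>_def)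
 moreover have "\<Gamma> + real k * \<eta> \<le> real (Y ^ 28) * \<eta>" using rng by simp
 ultimately obtain f where f: "\<forall>t. f t \<le> 2 * Y ^ 28" "\<forall>x<N.
  \<bar>resid a b Q (%t. (real (f t) - real (Y ^ 28)) * \<eta>) k x - (a x - (\<Sum>u<k. Hs 0 x u * v u))\<bar> \<le> real k * \<eta>"
  using resid_approx[OF el, of \<eta> \<Gamma> "Y ^ 28" a v] xs by blast
 have "f t < Y ^ 29" for t using f(1)[rule_format, of t] h_bound by linarith
 then obtain c where c: "c < (Y ^ 29) ^ k" "\<forall>t<k. dig (Y ^ 29) c t = f t" using digits_exist by blast
 have "R a b Q c = resid a b Q (%t. (real (f t) - real (Y ^ 28)) * \<eta>) k"
  unfolding R_def using c(2) by (intro resid_cong) (simp add: gv_eq)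
 moreover have "val \<le> C w N (R a b Q c)" using rg c(1) Xb(2) unfolding regopt_def by fastforce
 ultimately show ?thesis using f(2) by (intro exI[of _ "R a b Q c"]) simp
qed

lemma C_upper:
 assumes "sc > 0" and w: "\<And>x. x < N ==> 0 \<le> w x"
 shows "C w N f * z powr p \<le> (ka * lpn p {..<N} w (%x. \<bar>f x\<bar> + z)) powr p"
proof -
 have z: "z > 0" using assms y128 by (simp add: z_def)
 have "C w N f * z powr p = (\<Sum>x<N. w x * (PF \<bar>f x\<bar> * z powr p))"
  by (simp add: C_def sum_distrib_right mult.assoc)
 also have "\<dots> \<le> (\<Sum>x<N. w x * (ka * (\<bar>f x\<bar> + z)) powr p)"
  using w PF_upper[OF assms(1)] by (intro sum_mono mult_left_mono) auto
 also have "\<dots> = ka powr p * (\<Sum>x<N. w x * \<bar>\<bar>f x\<bar> + z\<bar> powr p)"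
  using ka1 z by (simp add: powr_mult sum_distrib_left mult_ac)
 also have "\<dots> = ka powr p * lpn p {..<N} w (%x. \<bar>f x\<bar> + z) powr p"
  using p w by (subst lpn_powr) auto
 also have "\<dots> = (ka * lpn p {..<N} w (%x. \<bar>f x\<bar> + z)) powr p"
  using ka1 by (simp add: powr_mult)
 finally show ?thesis .
qed

lemma C_lower:
 assumes "sc > 0" and w: "\<And>x. x < N ==> 0 \<le> w x"
 shows "lpn p {..<N} w (%x. min \<bar>f x\<bar> cap) powr p \<le> kb powr p * (C w N f * z powr p)"
proof -
 have z: "z > 0" using assms y128 by (simp add: z_def)
 have cap0: "cap \<ge> 0" using z ka1 by (simp add: cap_def)
 have "lpn p {..<N} w (%x. min \<bar>f x\<bar> cap) powr p = (\<Sum>x<N. w x * min \<bar>f x\<bar> cap powr p)"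
  using p w cap0 by (subst lpn_powr) (auto simp: abs_of_nonneg)
 also have "\<dots> \<le> (\<Sum>x<N. w x * (kb powr p * (PF \<bar>f x\<bar> * z powr p)))"
  using w PF_lower[OF assms(1)] by (intro sum_mono mult_left_mono) auto
 also have "\<dots> = kb powr p * (C w N f * z powr p)"
  by (simp add: C_def sum_distrib_left sum_distrib_right mult_ac)
 finally show ?thesis .
qed

lemma powr_cancel:
 assumes "0 \<le> a" "0 \<le> b" "a powr p \<le> b powr p"
 shows "a \<le> b"
proof (rule ccontr)
 assume "\<not> ?thesis"
 then have "b powr p < a powr p" using assms p by (intro powr_less_mono2) auto
 then show False using assms by simp
qed

text \<open>A single clipped entry would contribute at least \<open>cap powr p / y\<close>, which
  exceeds \<open>r powr p\<close>; so a small clipped norm means that nothing was clipped.\<close>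

lemma unclip:
 assumes w: "\<And>x. x \<in> I ==> 1 / y \<le> w x" and I: "finite I"
  and le: "lpn p I w (%x. min \<bar>f x\<bar> cap) \<le> r" "y * r < cap" "0 \<le> r"
 shows "lpn p I w f \<le> r"
proof -
 have w0: "0 \<le> w x" if "x \<in> I" for x using order_trans[OF _ w[OF that], of 0] by simp
 have cap0: "cap \<ge> 0" using le y128 mult_nonneg_nonneg[of y r] by linarith
 have "\<bar>f x\<bar> \<le> cap" if x: "x \<in> I" for x
 proof (rule ccontr)
  assume "\<not> ?thesis"
  then have mn: "min \<bar>f x\<bar> cap = cap" by simp
  have "w x * \<bar>min \<bar>f x\<bar> cap\<bar> powr p \<le> r powr p"
   using p w0 I x le(1) by (intro lpn_entry) auto
  then have "w x * cap powr p \<le> r powr p" using mn cap0 by simp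
  moreover have "1 / y * cap powr p \<le> w x * cap powr p" using w[OF x] by (intro mult_right_mono) auto
  ultimately have "1 / y * cap powr p \<le> r powr p" by linarith
  then have "cap powr p \<le> y * r powr p" using y128 by (simp add: field_simps)
  also have "\<dots> \<le> y powr p * r powr p" using y128 p powr_mono[of 1 p y] by (intro mult_right_mono) auto
  also have "\<dots> = (y * r) powr p" by (simp add: powr_mult)
  finally have "cap \<le> y * r" using powr_cancel cap0 le(3) y128 by simp
  then show False using le by simp
 qed
 then have "lpn p I w f = lpn p I w (%x. min \<bar>f x\<bar> cap)" by (intro lpn_cong) auto
 then show ?thesis using le by simp
qed

end

lemma lpn_swap:
 "lpn p (I \<times> J) (%_. 1) (%(i, j). f i j) = lpn p (J \<times> I) (%_. 1) (%(j, i). f i j)"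
 by (simp add: lpn_def case_prod_beta sum.cartesian_product[symmetric, of "%i j. \<bar>f i j\<bar> powr p", unfolded case_prod_beta]
  sum.cartesian_product[symmetric, of "%j i. \<bar>f i j\<bar> powr p", unfolded case_prod_beta] sum.swap[of _ J I])

lemma lpn_pairs:
 assumes "p > 0" "finite I" "finite J"
 shows "lpn p I (%_. 1) (%i. lpn p J (%_. 1) (f i)) = lpn p (I \<times> J) (%_. 1) (%(i, j). f i j)"
 using lpn_Sigma[OF assms, of "%_. 1" f] by (simp add: split_def)

lemma lpn_mono_weight:
 assumes "p > 0" "\<And>i. i \<in> I ==> 0 \<le> w i" "\<And>i. i \<in> I ==> w i \<le> w' i"
 shows "lpn p I w f \<le> lpn p I w' f"
 unfolding lpn_def using assms by (intro powr_mono2 sum_mono mult_right_mono lpn_sum_nonneg) auto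

lemma lpn_shift:
 assumes p: "1 \<le> p" and fin: "finite I" and w: "\<And>i. i \<in> I ==> 0 \<le> w i"
  and f: "\<And>i. i \<in> I ==> \<bar>f i\<bar> \<le> \<bar>g i\<bar> + c" and c: "0 \<le> c" and W: "sum w I \<le> W" "1 \<le> W"
 shows "lpn p I w f \<le> lpn p I w g + W * c"
proof -
 have "lpn p I w f \<le> lpn p I w (%i. \<bar>g i\<bar> + c)"
  using p w f c by (intro lpn_mono) (auto intro: order_trans)
 also have "\<dots> \<le> lpn p I w (%i. \<bar>g i\<bar>) + lpn p I w (%_. c)" by (rule lpn_triangle[OF p fin w])
 also have "lpn p I w (%i. \<bar>g i\<bar>) = lpn p I w g" by (intro lpn_cong) auto
 also have "lpn p I w (%_. c) \<le> W * c" using c by (intro lpn_bounded[OF p fin w _ c W]) auto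
 finally show ?thesis by simp
qed

section \<open>Error bounds for the two phases\<close>

context solver_y
begin

definition NN :: "(nat => nat => real) => real" where
 "NN f = lpn p ({..<n} \<times> {..<d}) (%_. 1) (%(i, j). f i j)"

definition MN :: "(nat => nat => real) => (nat => nat => real) => nat => nat => real" where
 "MN W V' i j = (\<Sum>u<k. W i u * V' u j)"

text \<open>The scale of lower-order errors: multiplication by \<open>y\<close> lowers the index by
  one, so an error budget is a subtraction of indices.\<close>

definition qs :: "nat => real" where "qs a = sc / y ^ a"

lemma p0: "p > 0" using p by simp

lemma qs_mult: "y * qs (Suc a) = qs a"
 using y128 by (simp add: qs_def)
lemma qs_mult2: "y ^ 2 * qs (Suc (Suc a)) = qs a"
 using y128 by (simp add: qs_def power2_eq_square)
lemma qs_nonneg: "sc > 0 ==> 0 \<le> qs a"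
 by (simp add: qs_def)
lemma qs_small: "sc > 0 ==> 128 * qs (Suc a) \<le> qs a"
 using mult_right_mono[OF y128 qs_nonneg[of "Suc a"]] qs_mult[of a] by simp
lemma qs_anti: "sc > 0 ==> a \<le> b ==> qs b \<le> qs a"
 unfolding qs_def using y128 by (intro divide_left_mono power_increasing mult_pos_pos) auto
lemma qs_0: "qs 0 = sc" by (simp add: qs_def)
lemma z_qs: "z = qs 8" by (simp add: z_def qs_def)
lemma \<eta>_qs: "\<eta> = qs 24" by (simp add: \<eta>_def qs_def)
lemma k\<eta>: "sc > 0 ==> real k * \<eta> \<le> qs 23"
 using mult_right_mono[of "real k" y "qs 24"] qs_nonneg[of 24] Y qs_mult[of 23] by (simp add: \<eta>_qs)
lemma y28\<eta>: "y ^ 28 * \<eta> = y ^ 4 * sc"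
proof -
 have "a * b * (sc / b) = a * sc" if "b \<noteq> 0" for a b :: real using that by simp
 from this[of "y ^ 24" "y ^ 4"] have "y ^ 4 * y ^ 24 * (sc / y ^ 24) = y ^ 4 * sc" using y128 by simp
 moreover have "y ^ 28 = y ^ 4 * y ^ 24" by (simp flip: power_add)
 ultimately show ?thesis by (simp only: \<eta>_def)
qed

lemma ypow: "a \<le> b ==> y ^ a \<le> y ^ b" using y128 by (intro power_increasing) auto
lemma ypow128: "128 * y ^ a \<le> y ^ Suc a" using y128 by (simp add: mult_right_mono)

lemma range_ok:
 assumes "sc > 0" "\<Gamma> \<le> 64 * (y ^ 3 * sc)"
 shows "\<Gamma> + real k * \<eta> \<le> y ^ 28 * \<eta>"
proof -
 have "qs 23 \<le> sc" using qs_anti[OF assms(1), of 0 23] by (simp add: qs_0)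
 moreover have "1 \<le> y ^ 3" using y128 by (intro one_le_power) simp
 then have "1 * sc \<le> y ^ 3 * sc" using assms by (intro mult_right_mono) auto
 moreover have "128 * y ^ 3 * sc \<le> y ^ 4 * sc" using ypow128[of 3] assms by (intro mult_right_mono) auto
 ultimately show ?thesis using k\<eta>[OF assms(1)] assms y28\<eta> by linarith
qed

lemma NN_cols: "NN f = lpn p {..<d} (%_. 1) (%j. lpn p {..<n} (%_. 1) (%i. f i j))"
 unfolding NN_def using lpn_pairs[OF p0, of "{..<d}" "{..<n}" "%j i. f i j"] lpn_swap by simp

lemma NN_rows: "NN f = lpn p {..<n} (%_. 1) (%i. lpn p {..<d} (%_. 1) (f i))"
 unfolding NN_def using lpn_pairs[OF p0, of "{..<n}" "{..<d}" f] by simp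

lemma NN_nonneg: "0 \<le> NN f" by (simp add: NN_def lpn_nonneg)

lemma NN_entry: "i < n ==> j < d ==> \<bar>f i j\<bar> \<le> NN f"
 unfolding NN_def using lpn_entry1[OF p0, of "{..<n} \<times> {..<d}" "%_. 1" "(i, j)" "%(i, j). f i j"] by auto

lemma NN_cong: "(\<And>i j. i < n ==> j < d ==> \<bar>f i j\<bar> = \<bar>f' i j\<bar>) ==> NN f = NN f'"
 unfolding NN_def by (intro lpn_cong) auto

lemma NN_triangle: "NN (%i j. f i j + f' i j) \<le> NN f + NN f'"
 using lpn_triangle[OF p, of "{..<n} \<times> {..<d}" "%_. 1" "%(i, j). f i j" "%(i, j). f' i j"]
 by (simp add: NN_def split_def)

lemma NN_shift:
 assumes "\<And>i j. i < n ==> j < d ==> \<bar>f i j\<bar> \<le> \<bar>f' i j\<bar> + c" "0 \<le> c"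
 shows "NN f \<le> NN f' + y ^ 2 * c"
proof -
 have "real (n * d) \<le> y * y" using Y by (simp add: mult_mono)
 then have s: "sum (%_. 1) ({..<n} \<times> {..<d}) \<le> y ^ 2" by (simp add: power2_eq_square)
 show ?thesis unfolding NN_def
  by (rule lpn_shift[OF p _ _ _ assms(2) s]) (use assms(1) y128 in \<open>auto simp: one_le_power\<close>)
qed

text \<open>Any \<open>V0\<close> gives an upper bound because each column regression is a minimum
  over a grid. Rounding and the first level of the staircase cost at most \<open>qs 7\<close> per
  entry, hence at most \<open>y ^ 2 * qs 7 = qs 5\<close> in the norm.\<close>

lemma ph2_bound:
 assumes sc: "sc > 0" and ph: "ph2 W V' tot" and T: "NN (%i j. MN W V0 i j - A i j) \<le> T" "T \<le> 64 * (y ^ 3 * sc)"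
 shows "tot * z powr p \<le> (ka * (T + qs 5)) powr p"
proof -
 obtain Hs b Q w vals where H0: "\<forall>x<n + k. \<forall>u<k. Hs 0 x u = (if x < n then W x u else if x = n + u then 1 else 0)"
  "elims n (n + k) k k Hs b Q" "\<forall>x<n + k. w x = 1"
  "\<forall>j<d. \<exists>a. (\<forall>x<n + k. a x = (if x < n then A x j else 0)) \<and> regopt n w b Q a n 1 (%u. V' u j) (vals j)"
  "tot = (\<Sum>j<d. vals j)" using ph unfolding ph2_def by (elim exE conjE) (rule that; assumption)
 note H = H0(1)[rule_format] H0(2) H0(3)[rule_format] H0(4)[rule_format] H0(5)
 let ?f = "%i j. MN W V0 i j - A i j"
 let ?c = "real k * \<eta> + z"
 have c0: "0 \<le> ?c" "0 \<le> z" using qs_nonneg[OF sc] by (auto simp: \<eta>_qs z_qs)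
 have vj: "vals j * z powr p \<le> (ka * lpn p {..<n} (%_. 1) (%i. \<bar>?f i j\<bar> + ?c)) powr p" if j: "j < d" for j
 proof -
  obtain a where a: "\<forall>x<n + k. a x = (if x < n then A x j else 0)" "regopt n w b Q a n 1 (%u. V' u j) (vals j)"
   using H(4)[OF j] by blast
  have res: "a x - (\<Sum>u<k. Hs 0 x u * V0 u j) = - ?f x j" if "x < n" for x
   using that H(1) a(1) by (simp add: MN_def)
  obtain \<rho> where \<rho>: "vals j \<le> C w n \<rho>" "\<forall>x<n. \<bar>\<rho> x - (a x - (\<Sum>u<k. Hs 0 x u * V0 u j))\<bar> \<le> real k * \<eta>"
  proof -
   have "\<exists>\<rho>. vals j \<le> C w n \<rho> \<and> (\<forall>x<n. \<bar>\<rho> x - (a x - (\<Sum>u<k. Hs 0 x u * V0 u j))\<bar> \<le> real k * \<eta>)"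
   proof (rule regopt_le[OF a(2) H(2)])
    fix x assume x: "x < n"
    have "\<bar>?f x j\<bar> \<le> T" using NN_entry[OF x j, of ?f] T(1) by linarith
    then show "\<bar>a x - (\<Sum>u<k. Hs 0 x u * V0 u j)\<bar> \<le> T" using res[OF x] by simp
   qed (use sc range_ok[OF sc T(2)] in auto)
   then show ?thesis using that by blast
  qed
  have "vals j * z powr p \<le> C w n \<rho> * z powr p" using \<rho>(1) by (intro mult_right_mono) auto
  also have "\<dots> \<le> (ka * lpn p {..<n} w (%x. \<bar>\<rho> x\<bar> + z)) powr p"
   by (rule C_upper[OF sc]) (use H(3) in auto)
  also have "\<dots> \<le> (ka * lpn p {..<n} (%_. 1) (%i. \<bar>?f i j\<bar> + ?c)) powr p"
  proof (intro powr_mono2 mult_left_mono)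
   have "lpn p {..<n} w (%x. \<bar>\<rho> x\<bar> + z) = lpn p {..<n} (%_. 1) (%x. \<bar>\<rho> x\<bar> + z)"
    using H(3) by (intro lpn_cong) auto
   also have "\<dots> \<le> lpn p {..<n} (%_. 1) (%i. \<bar>?f i j\<bar> + ?c)"
   proof (intro lpn_mono)
    fix i assume i: "i \<in> {..<n}"
    have "\<bar>\<rho> i\<bar> \<le> \<bar>?f i j\<bar> + real k * \<eta>" using \<rho>(2)[rule_format, of i] res[of i] i by auto
    then show "\<bar>\<bar>\<rho> i\<bar> + z\<bar> \<le> \<bar>\<bar>?f i j\<bar> + ?c\<bar>" using c0 by auto
   qed (use p in auto)
   finally show "lpn p {..<n} w (%x. \<bar>\<rho> x\<bar> + z) \<le> lpn p {..<n} (%_. 1) (%i. \<bar>?f i j\<bar> + ?c)" .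
  qed (use p ka1 in \<open>auto intro!: mult_nonneg_nonneg lpn_nonneg\<close>)
  finally show ?thesis .
 qed
 have "tot * z powr p = (\<Sum>j<d. vals j * z powr p)" using H(5) by (simp add: sum_distrib_right)
 also have "\<dots> \<le> (\<Sum>j<d. (ka * lpn p {..<n} (%_. 1) (%i. \<bar>?f i j\<bar> + ?c)) powr p)"
  by (intro sum_mono) (use vj in auto)
 also have "\<dots> = ka powr p * (\<Sum>j<d. 1 * \<bar>lpn p {..<n} (%_. 1) (%i. \<bar>?f i j\<bar> + ?c)\<bar> powr p)"
  using ka1 lpn_nonneg[of p "{..<n}" "%_. 1"] by (simp add: powr_mult sum_distrib_left)
 also have "\<dots> = ka powr p * NN (%i j. \<bar>?f i j\<bar> + ?c) powr p"
  unfolding NN_cols using p0 by (subst lpn_powr) auto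
 also have "\<dots> = (ka * NN (%i j. \<bar>?f i j\<bar> + ?c)) powr p" using ka1 NN_nonneg by (simp add: powr_mult)
 also have "\<dots> \<le> (ka * (T + qs 5)) powr p"
 proof (intro powr_mono2 mult_left_mono)
  have "NN (%i j. \<bar>?f i j\<bar> + ?c) \<le> NN ?f + y ^ 2 * ?c" by (rule NN_shift) (use c0 in auto)
  also have "y ^ 2 * ?c \<le> y ^ 2 * (qs 7)"
  proof (intro mult_left_mono)
   show "?c \<le> qs 7" using k\<eta>[OF sc] qs_anti[OF sc, of 8 23] qs_small[OF sc, of 7] qs_nonneg[OF sc, of 8] by (simp add: z_qs)
  qed simp
  also have "y ^ 2 * qs 7 = qs 5" using qs_mult2[of 5] by simp
  finally show "NN (%i j. \<bar>?f i j\<bar> + ?c) \<le> T + qs 5" using T(1) by simp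
 qed (use p ka1 NN_nonneg in auto)
 finally show ?thesis .
qed

lemma ph2_cols:
 assumes ph: "ph2 W V' tot"
 shows "\<exists>\<rho> w. (\<forall>x<n. w x = 1) \<and> tot = (\<Sum>j<d. C w n (\<rho> j)) \<and> (\<forall>j<d. \<forall>i<n. \<bar>\<rho> j i\<bar> = \<bar>MN W V' i j - A i j\<bar>)"
proof -
 obtain Hs b Q w vals where H0: "\<forall>x<n + k. \<forall>u<k. Hs 0 x u = (if x < n then W x u else if x = n + u then 1 else 0)"
  "elims n (n + k) k k Hs b Q" "\<forall>x<n + k. w x = 1"
  "\<forall>j<d. \<exists>a. (\<forall>x<n + k. a x = (if x < n then A x j else 0)) \<and> regopt n w b Q a n 1 (%u. V' u j) (vals j)"
  "tot = (\<Sum>j<d. vals j)" using ph unfolding ph2_def by (elim exE conjE) (rule that; assumption)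
 note H = H0(1)[rule_format] H0(2) H0(3)[rule_format] H0(4)[rule_format] H0(5)
 have "\<exists>\<rho>. vals j = C w n \<rho> \<and> (\<forall>i<n. \<bar>\<rho> i\<bar> = \<bar>MN W V' i j - A i j\<bar>)" if j: "j < d" for j
 proof -
  obtain a where a: "\<forall>x<n + k. a x = (if x < n then A x j else 0)" "regopt n w b Q a n 1 (%u. V' u j) (vals j)"
   using H(4)[OF j] by blast
  obtain v \<rho> where \<rho>: "vals j = C w n \<rho>" "\<forall>x<n + k. \<rho> x = a x - (\<Sum>u<k. Hs 0 x u * v u)" "\<forall>u<k. V' u j = - \<rho> (n + u) / 1"
   using regopt_code[OF a(2) H(2) le_add1] by (elim exE conjE) (rule that; assumption)
  \<comment> \<open>In the unit row n + u the right-hand side is 0, so the residual is minus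
    \<open>v u\<close>.\<close>
  have v: "V' u j = v u" if u: "u < k" for u
  proof -
   have "(\<Sum>u'<k. Hs 0 (n + u) u' * v u') = (\<Sum>u'<k. if u' = u then v u else 0)"
    using H(1)[of "n + u"] u by (intro sum.cong) auto
   then show ?thesis using \<rho>(2,3) a(1) u by simp
  qed
  have "\<bar>\<rho> i\<bar> = \<bar>MN W V' i j - A i j\<bar>" if "i < n" for i
  proof -
   have "\<rho> i = - (MN W V' i j - A i j)" using \<rho>(2) a(1) H(1)[of i] v that by (simp add: MN_def)
   then show ?thesis by simp
  qed
  then show ?thesis using \<rho>(1) by blast
 qed
 then obtain \<rho> where r: "\<And>j. j < d ==> vals j = C w n (\<rho> j)" "\<And>j i. j < d ==> i < n ==> \<bar>\<rho> j i\<bar> = \<bar>MN W V' i j - A i j\<bar>"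
  by metis
 show ?thesis
  by (rule exI[of _ \<rho>], rule exI[of _ w]) (use r H(3,5) in auto)
qed

text \<open>The lower staircase estimate turns the total cost into a clipped norm, and
  \<open>cap\<close> is large enough to remove the clipping.\<close>

lemma ph2_quality:
 assumes sc: "sc > 0" and ph: "ph2 W V' tot" and r: "tot * z powr p \<le> r powr p" "0 \<le> r" "y * (kb * r) < cap"
 shows "NN (%i j. MN W V' i j - A i j) \<le> kb * r"
proof -
 obtain \<rho> w where \<rho>: "\<forall>x<n. w x = 1" "tot = (\<Sum>j<d. C w n (\<rho> j))" "\<forall>j<d. \<forall>i<n. \<bar>\<rho> j i\<bar> = \<bar>MN W V' i j - A i j\<bar>"
  using ph2_cols[OF ph] by (elim exE conjE) (rule that; assumption)
 let ?f = "%i j. MN W V' i j - A i j"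
 have "0 \<le> y * (kb * r)" using r kb1 by simp
 then have cap0: "0 \<le> cap" using r by linarith
 have vj: "lpn p {..<n} (%_. 1) (%i. min \<bar>?f i j\<bar> cap) powr p \<le> kb powr p * (C w n (\<rho> j) * z powr p)" if j: "j < d" for j
 proof -
  have "lpn p {..<n} (%_. 1) (%i. min \<bar>?f i j\<bar> cap) = lpn p {..<n} w (%i. min \<bar>\<rho> j i\<bar> cap)"
   using \<rho>(1,3) j by (intro lpn_cong) auto
  then show ?thesis using C_lower[OF sc, of n w "\<rho> j"] \<rho>(1) by simp
 qed
 have "NN (%i j. min \<bar>?f i j\<bar> cap) powr p = (\<Sum>j<d. 1 * \<bar>lpn p {..<n} (%_. 1) (%i. min \<bar>?f i j\<bar> cap)\<bar> powr p)"
  unfolding NN_cols using p0 by (subst lpn_powr) auto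
 also have "\<dots> \<le> (\<Sum>j<d. kb powr p * (C w n (\<rho> j) * z powr p))"
  using vj lpn_nonneg[of p "{..<n}" "%_. 1"] by (intro sum_mono) simp
 also have "\<dots> = kb powr p * (tot * z powr p)" using \<rho>(2) by (simp add: sum_distrib_left sum_distrib_right)
 also have "\<dots> \<le> kb powr p * r powr p" using r by (intro mult_left_mono) auto
 also have "\<dots> = (kb * r) powr p" using kb1 r by (simp add: powr_mult)
 finally have pp: "NN (%i j. min \<bar>?f i j\<bar> cap) powr p \<le> (kb * r) powr p" .
 have kr: "0 \<le> kb * r" using kb1 r(2) by simp
 have le: "NN (%i j. min \<bar>?f i j\<bar> cap) \<le> kb * r" by (rule powr_cancel[OF NN_nonneg kr pp])
 show ?thesis unfolding NN_def
 proof (rule unclip)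
  show "lpn p ({..<n} \<times> {..<d}) (%_. 1) (%x. min \<bar>(%(i, j). ?f i j) x\<bar> cap) \<le> kb * r"
   using le by (simp add: NN_def split_def)
  show "y * (kb * r) < cap" "0 \<le> kb * r" by (fact r kr)+
 qed (use y128 in auto)
qed

lemma \<mu>_pos: "sc > 0 ==> 0 < qs 8" using y128 by (simp add: qs_def)

text \<open>On the sampled columns \<open>(xs - v) Vr\<close> is a difference of two residuals, that
  of \<open>v\<close> and that of the minimiser \<open>xs\<close>. The minimiser is almost as good
  as \<open>v\<close>, so each contributes about F: this is the factor 2. Rounding, regularisation
  and the error of the guessed entries end up in \<open>qs 4\<close>.\<close>

lemma row_opt:
 assumes sc: "sc > 0" and w: "\<And>t. t < m ==> 1 / y \<le> w0 t" "(\<Sum>t<m. w0 t) \<le> 4 * y"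
  and Z: "\<And>u t. u < k ==> t < m ==> \<bar>Z u t - Vr u t\<bar> \<le> \<eta>"
  and v: "\<And>u. u < k ==> \<bar>v u\<bar> \<le> y"
  and F: "lpn p {..<m} w0 (%t. (\<Sum>u<k. v u * Vr u t) - \<alpha> t) \<le> F" "F \<le> 2 * y ^ 2 * sc"
  and H: "\<And>x u. x < m + k ==> u < k ==> Hs 0 x u = (if x < m then Z u x else if x = m + u then qs 8 else 0)"
  and el: "elims (m + k) (m + k) k k Hs b Q" and wx: "\<And>x. x < m + k ==> w x = wext m w0 x"
  and a: "\<And>x. x < m + k ==> a x = (if x < m then \<alpha> x else 0)"
  and rg: "regopt (m + k) w b Q a m (qs 8) xs val"
 shows "lpn p {..<m + k} (wext m w0) (aug Vr (qs 8) k m (%u. xs u - v u)) \<le> (2 + \<gamma>) * (F + qs 4)"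
proof -
 let ?I = "{..<m + k}" and ?w = "wext m w0"
 define f where "f x = (if x < m then (\<Sum>u<k. v u * Vr u x) - \<alpha> x else 0)" for x
 note q0 = qs_nonneg[OF sc]
 have y1: "1 \<le> y" "0 < y" using y128 by auto
 have w1: "1 / y \<le> ?w x" for x using w(1) y1 by (simp add: wext_def)
 have w0: "0 \<le> ?w x" for x using order_trans[OF _ w1[of x], of 0] by simp
 have ww: "lpn p ?I w g = lpn p ?I ?w g" for g using wx by (intro lpn_cong) auto
 have sumw: "sum ?w ?I \<le> y ^ 2" "1 \<le> y ^ 2"
 proof -
  have "sum ?w ?I = (\<Sum>t<m. w0 t) + real k"
   by (simp add: sum_split_add wext_def)
  also have "\<dots> \<le> 4 * y + y" using w(2) Y by (intro add_mono) auto
  also have "\<dots> \<le> y * y" using y128 mult_right_mono[of 5 y y] by simp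
  finally show "sum ?w ?I \<le> y ^ 2" by (simp add: power2_eq_square)
 qed (use y1 in \<open>simp add: one_le_power\<close>)
 have F0: "0 \<le> F" using F(1) lpn_nonneg order_trans by blast
 have lf: "lpn p ?I ?w f \<le> F"
 proof -
  have "(\<Sum>x<m + k. ?w x * \<bar>f x\<bar> powr p) = (\<Sum>t<m. w0 t * \<bar>(\<Sum>u<k. v u * Vr u t) - \<alpha> t\<bar> powr p)"
   using p0 by (simp add: sum_split_add wext_def f_def)
  then show ?thesis using F(1) by (simp add: lpn_def)
 qed
 define e where "e x = a x - (\<Sum>u<k. Hs 0 x u * v u)" for x
 have diag: "(\<Sum>u'<k. Hs 0 (m + u) u' * v' u') = qs 8 * v' u" if u: "u < k" for u v'
 proof -
  have "(\<Sum>u'<k. Hs 0 (m + u) u' * v' u') = (\<Sum>u'<k. if u' = u then qs 8 * v' u else 0)"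
   using H[of "m + u"] u by (intro sum.cong) auto
  then show ?thesis using u by simp
 qed
 have vq: "\<bar>qs 8 * v u\<bar> \<le> qs 7" if "u < k" for u
  using mult_left_mono[OF v[OF that] q0[of 8]] q0[of 8] qs_mult[of 7] by (simp add: abs_mult mult.commute)
 \<comment> \<open>The effect of using the guessed entries \<open>Z\<close> in place of
   \<open>Vr\<close>, for coefficients of modulus at most M.\<close>
 have pert: "\<bar>\<Sum>u<k. c u * (Z u x - Vr u x)\<bar> \<le> real k * (M * \<eta>)"
  if "x < m" "\<And>u. u < k ==> \<bar>c u\<bar> \<le> M" "0 \<le> M" for c x M
 proof -
  have "\<bar>\<Sum>u<k. c u * (Z u x - Vr u x)\<bar> \<le> (\<Sum>u<k. M * \<eta>)"
   using that Z by (intro order_trans[OF sum_abs] sum_mono) (auto simp: abs_mult intro!: mult_mono)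
  then show ?thesis by simp
 qed
 have e: "\<bar>e x\<bar> \<le> \<bar>f x\<bar> + 2 * qs 7" if x: "x < m + k" for x
 proof (cases "x < m")
  case True
  have "e x = - f x - (\<Sum>u<k. v u * (Z u x - Vr u x))"
   using True a[OF x] H[OF x] by (simp add: e_def f_def right_diff_distrib sum_subtractf mult.commute)
  moreover have "\<bar>\<Sum>u<k. v u * (Z u x - Vr u x)\<bar> \<le> real k * (y * \<eta>)" using True v y1 by (intro pert) auto
  moreover have "real k * (y * \<eta>) = y * (real k * \<eta>)" by simp
  moreover have "y * (real k * \<eta>) \<le> y * qs 23" using k\<eta>[OF sc] y1 by (intro mult_left_mono) auto
  moreover have "y * qs 23 = qs 22" using qs_mult[of 22] by simp
  ultimately show ?thesis using qs_anti[OF sc, of 7 22] q0[of 7] by simp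
 next
  case False
  then obtain u where u: "x = m + u" "u < k" using x by (metis add_less_cancel_left le_Suc_ex linorder_not_less)
  then have "e x = - (qs 8 * v u)" using a[OF x] diag[OF u(2)] by (simp add: e_def)
  then show ?thesis using vq[OF u(2)] q0[of 7] by simp
 qed
 \<comment> \<open>A weight of at least \<open>1 / y\<close> turns the norm bound into a bound for
   entries, which places the residual within the range of the grid.\<close>
 have fe: "\<bar>f x\<bar> \<le> 2 * (y ^ 3 * sc)" if x: "x < m + k" for x
 proof -
  have "?w x * \<bar>f x\<bar> powr p \<le> F powr p" using lf x w0 by (intro lpn_entry[OF p0]) auto
  moreover have "1 / y * \<bar>f x\<bar> powr p \<le> ?w x * \<bar>f x\<bar> powr p" using w1 by (intro mult_right_mono) auto
  ultimately have "1 / y * \<bar>f x\<bar> powr p \<le> F powr p" by linarith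
  then have "\<bar>f x\<bar> powr p \<le> y * F powr p" using y1 by (simp add: field_simps)
  also have "\<dots> \<le> y powr p * F powr p" using powr_mono[of 1 p y] p y1 by (intro mult_right_mono) auto
  also have "\<dots> = (y * F) powr p" by (simp add: powr_mult)
  finally have pp: "\<bar>f x\<bar> powr p \<le> (y * F) powr p" .
  have "0 \<le> y * F" using F0 by simp
  then have "\<bar>f x\<bar> \<le> y * F" by (rule powr_cancel[OF abs_ge_zero _ pp])
  also have "\<dots> \<le> y * (2 * y ^ 2 * sc)" using F(2) y1 by (intro mult_left_mono) auto
  finally show ?thesis by (simp add: power2_eq_square power3_eq_cube)
 qed
 have big: "1 \<le> y ^ 3" using y1 by (intro one_le_power)
 have sy: "sc \<le> y ^ 3 * sc" using mult_right_mono[OF big, of sc] sc by simp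
 have qsc: "qs a \<le> sc" for a using qs_anti[OF sc, of 0 a] by (simp add: qs_0)
 have "2 * (y ^ 3 * sc) + 2 * qs 7 \<le> 64 * (y ^ 3 * sc)" using sy qsc[of 7] sc by linarith
 from regopt_le[OF rg el order.refl less_imp_le[OF sc] range_ok[OF sc this], of v]
 obtain \<rho>0 where \<rho>0: "val \<le> C w (m + k) \<rho>0" "\<And>x. x < m + k ==> \<bar>\<rho>0 x - e x\<bar> \<le> real k * \<eta>"
  using e fe unfolding e_def by (meson add_mono_thms_linordered_semiring(3) order_trans)
 define r where "r = (1 + \<gamma>) * (F + qs 4)"
 have r0: "0 \<le> r" using F0 q0[of 4] \<gamma> by (simp add: r_def)
 have wn: "\<And>x. x < m + k ==> 0 \<le> w x" using wx w0 by simp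
 have "val * z powr p \<le> C w (m + k) \<rho>0 * z powr p" using \<rho>0(1) by (intro mult_right_mono) auto
 also have "\<dots> \<le> (ka * lpn p ?I w (%x. \<bar>\<rho>0 x\<bar> + z)) powr p" by (rule C_upper[OF sc wn])
 also have "\<dots> \<le> (ka * (F + qs 4)) powr p"
 proof (intro powr_mono2 mult_left_mono)
  have "lpn p ?I w (%x. \<bar>\<rho>0 x\<bar> + z) = lpn p ?I ?w (%x. \<bar>\<rho>0 x\<bar> + z)" by (rule ww)
  also have "\<dots> \<le> lpn p ?I ?w f + y ^ 2 * qs 6"
  proof (rule lpn_shift[OF p _ w0 _ q0 sumw])
   fix x assume x: "x \<in> ?I"
   have "\<bar>\<rho>0 x\<bar> + z \<le> \<bar>f x\<bar> + (2 * qs 7 + qs 23 + qs 8)"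
    using \<rho>0(2)[of x] e[of x] k\<eta>[OF sc] x by (simp add: z_qs)
   moreover have "2 * qs 7 + qs 23 + qs 8 \<le> qs 6"
    using qs_anti[OF sc, of 7 23] qs_anti[OF sc, of 7 8] qs_small[OF sc, of 6] q0[of 7] by simp
   ultimately show "\<bar>\<bar>\<rho>0 x\<bar> + z\<bar> \<le> \<bar>f x\<bar> + qs 6" using q0[of 8] by (simp add: z_qs)
  qed auto
  also have "y ^ 2 * qs 6 = qs 4" using qs_mult2[of 4] by simp
  finally show "lpn p ?I w (%x. \<bar>\<rho>0 x\<bar> + z) \<le> F + qs 4" using lf by simp
 qed (use p ka1 in \<open>auto intro!: mult_nonneg_nonneg lpn_nonneg\<close>)
 finally have val: "val * z powr p \<le> (ka * (F + qs 4)) powr p" .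
 obtain v' \<rho> where \<rho>: "val = C w (m + k) \<rho>" "\<forall>x<m + k. \<rho> x = a x - (\<Sum>u<k. Hs 0 x u * v' u)"
  "\<forall>u<k. xs u = - \<rho> (m + u) / qs 8"
  using regopt_code[OF rg el order.refl] by (elim exE conjE) (rule that; assumption)
 have xs: "xs u = v' u" if "u < k" for u
  using \<rho>(2,3) a[of "m + u"] diag[OF that] \<mu>_pos[OF sc] that by simp
 have "lpn p ?I w (%x. min \<bar>\<rho> x\<bar> cap) powr p \<le> kb powr p * (val * z powr p)"
  unfolding \<rho>(1) by (rule C_lower[OF sc wn])
 also have "\<dots> \<le> kb powr p * (ka * (F + qs 4)) powr p" using val by (intro mult_left_mono) auto
 also have "\<dots> = (kb * ka * (F + qs 4)) powr p" using kb1 ka1 F0 q0[of 4] by (simp add: powr_mult)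
 also have "\<dots> \<le> r powr p"
  unfolding r_def using p kab kb1 ka1 F0 q0[of 4] by (intro powr_mono2 mult_right_mono) auto
 finally have "lpn p ?I ?w (%x. min \<bar>\<rho> x\<bar> cap) powr p \<le> r powr p" unfolding ww .
 then have cl: "lpn p ?I ?w (%x. min \<bar>\<rho> x\<bar> cap) \<le> r" by (rule powr_cancel[OF lpn_nonneg r0])
 have y2: "1 \<le> y ^ 2" by (rule sumw)
 have y2sc: "sc \<le> y ^ 2 * sc" using mult_right_mono[OF y2, of sc] sc by simp
 have r6: "r \<le> 6 * (y ^ 2 * sc)"
 proof -
  have "r \<le> 2 * (2 * y ^ 2 * sc + sc)" unfolding r_def using \<gamma> F qsc[of 4] F0 q0[of 4] by (intro mult_mono) auto
  then show ?thesis using y2sc by simp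
 qed
 have yr: "y * r < cap"
 proof -
  have "y * r \<le> y * (6 * (y ^ 2 * sc))" using r6 y1 by (intro mult_left_mono) auto
  also have "\<dots> = 6 * y ^ 3 * sc" by (simp add: power2_eq_square power3_eq_cube)
  also have "\<dots> < y ^ 8 * sc"
  proof (intro mult_strict_right_mono sc)
   have "6 * y ^ 3 < 128 * y ^ 3" using y1 by simp
   also have "\<dots> \<le> y ^ Suc 3" by (rule ypow128)
   also have "\<dots> \<le> y ^ 8" by (rule ypow) simp
   finally show "6 * y ^ 3 < y ^ 8" .
  qed
  also have "\<dots> \<le> cap" by (rule cap_large[OF sc])
  finally show ?thesis .
 qed
 have l\<rho>: "lpn p ?I ?w \<rho> \<le> r" by (rule unclip[OF w1 _ cl yr r0]) simp
 \<comment> \<open>Here the regularising rows pay off: a residual of at most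
   \<open>6 * y ^ 2 * sc\<close>, divided by \<mu> = \<open>qs 8\<close>, bounds the solution by
   \<open>y ^ 11\<close>, and \<open>y ^ 11\<close> times the total rounding error
   \<open>k * \<eta>\<close> is still only \<open>qs 12\<close>.\<close>
 have xb: "\<bar>xs u\<bar> \<le> y ^ 11" if u: "u < k" for u
 proof -
  have "\<bar>\<rho> (m + u)\<bar> \<le> lpn p ?I ?w \<rho>" using u w0 by (intro lpn_entry1[OF p0]) (auto simp: wext_def)
  then have "\<bar>\<rho> (m + u)\<bar> \<le> 6 * (y ^ 2 * sc)" using l\<rho> r6 by linarith
  also have "\<dots> = 6 * y ^ 10 * qs 8"
  proof -
   have "y2 * s = y2 * b * (s / b)" if "b \<noteq> 0" for y2 s b :: real using that by simp
   from this[of "y ^ 8" "y ^ 2" sc] have "y ^ 2 * sc = y ^ 2 * y ^ 8 * qs 8" using y1 by (simp add: qs_def)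
   moreover have "y ^ 10 = y ^ 2 * y ^ 8" by (simp flip: power_add)
   ultimately have "y ^ 10 * qs 8 = y ^ 2 * sc" by (simp only:)
   then show ?thesis by (simp only: mult.assoc)
  qed
  finally have "\<bar>xs u\<bar> \<le> 6 * y ^ 10"
   using \<rho>(3) u \<mu>_pos[OF sc] by (simp add: abs_divide pos_divide_le_eq)
  also have "\<dots> \<le> 128 * y ^ 10" by simp
  also have "\<dots> \<le> y ^ Suc 10" by (rule ypow128)
  finally show ?thesis by simp
 qed
 have "lpn p ?I ?w (aug Vr (qs 8) k m (%u. xs u - v u)) \<le> lpn p ?I ?w (%x. \<bar>\<rho> x\<bar> + \<bar>f x\<bar>) + y ^ 2 * qs 6"
 proof (rule lpn_shift[OF p _ w0 _ q0 sumw])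
  fix x assume x: "x \<in> ?I"
  show "\<bar>aug Vr (qs 8) k m (%u. xs u - v u) x\<bar> \<le> \<bar>\<bar>\<rho> x\<bar> + \<bar>f x\<bar>\<bar> + qs 6"
  proof (cases "x < m")
   case True
   have "\<rho> x = \<alpha> x - (\<Sum>u<k. xs u * Z u x)"
    using \<rho>(2) x True a[of x] H[of x] xs by (simp add: mult.commute)
   then have "aug Vr (qs 8) k m (%u. xs u - v u) x = - \<rho> x - f x - (\<Sum>u<k. xs u * (Z u x - Vr u x))"
    using True by (simp add: aug_def f_def left_diff_distrib right_diff_distrib sum_subtractf)
   moreover have "\<bar>\<Sum>u<k. xs u * (Z u x - Vr u x)\<bar> \<le> real k * (y ^ 11 * \<eta>)" using True xb by (intro pert) auto
   moreover have "real k * (y ^ 11 * \<eta>) = y ^ 11 * (real k * \<eta>)" by simp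
   moreover have "y ^ 11 * (real k * \<eta>) \<le> y ^ 11 * qs 23" using k\<eta>[OF sc] by (intro mult_left_mono) auto
   moreover have "y ^ 11 * qs 23 = qs 12"
   proof -
    have "b * (s / (b * c)) = s / c" if "b \<noteq> 0" for b c s :: real using that by simp
    from this[of "y ^ 11" sc "y ^ 12"] have "y ^ 11 * (sc / (y ^ 11 * y ^ 12)) = sc / y ^ 12" using y1 by simp
    moreover have "y ^ 23 = y ^ 11 * y ^ 12" by (simp flip: power_add)
    ultimately show ?thesis by (simp only: qs_def)
   qed
   ultimately show ?thesis using qs_anti[OF sc, of 6 12] by simp
  next
   case False
   then obtain u where u: "x = m + u" "u < k" using x by (metis add_less_cancel_left le_Suc_ex lessThan_iff linorder_not_less)
   have "\<rho> x = - (qs 8 * xs u)" using \<rho>(2) a[of x] diag[OF u(2)] xs u by simp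
   then have "aug Vr (qs 8) k m (%u. xs u - v u) x = - \<rho> x - qs 8 * v u"
    using u by (simp add: aug_def algebra_simps)
   then show ?thesis using vq[OF u(2)] qs_anti[OF sc, of 6 7] by simp
  qed
 qed auto
 also have "y ^ 2 * qs 6 = qs 4" using qs_mult2[of 4] by simp
 also have "lpn p ?I ?w (%x. \<bar>\<rho> x\<bar> + \<bar>f x\<bar>) \<le> lpn p ?I ?w (%x. \<bar>\<rho> x\<bar>) + lpn p ?I ?w (%x. \<bar>f x\<bar>)"
  by (rule lpn_triangle[OF p _ w0]) auto
 also have "\<dots> = lpn p ?I ?w \<rho> + lpn p ?I ?w f" by (simp add: lpn_def)
 also have "\<dots> \<le> r + F" using l\<rho> lf by simp
 finally show ?thesis using q0[of 4] F0 by (simp add: r_def algebra_simps)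
qed

text \<open>For the right guess the row estimates, carried over from the sampled columns to all
  columns, add up to a distance of at most \<open>(2 + 13 * \<gamma>) * Opt\<close> from
  \<open>B\<close>, and \<open>B\<close> is \<open>Opt\<close> away from \<open>A\<close>. The claim
  is made for all \<open>W\<close>, as the minimisers are not unique.\<close>

lemma phase1:
 assumes sc: "sc > 0" and B: "lowrank k n d B" and Od: "Opt = NN (%i j. B i j - A i j)"
  and O: "Opt \<le> y ^ 2 * sc" "sc \<le> y * Opt"
  and smp: "8 * real k * (p + 2 * ((2 * real k) powr p * real k) + 1) \<le> real G0 * \<gamma>"
   "(2 * real G0 + 1) ^ k * exp (- (\<gamma>\<^sup>2 * real m / (128 * 4 powr p * ((2 * real k) powr p * real k)))) < \<gamma> / (1 + \<gamma>)"
 shows "\<exists>cS<X. \<exists>cw<X. \<exists>cQ<X. \<exists>cR<X. \<forall>W. ph1 cS cw cQ cR W \<longrightarrow>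
  (\<exists>V0. NN (%i j. MN W V0 i j - A i j) \<le> (3 + 13 * \<gamma>) * Opt)"
proof -
 note q0 = qs_nonneg[OF sc]
 have y1: "1 \<le> y" "0 < y" using y128 by auto
 have m0: "0 < real m" using m by simp
 have Op: "0 < Opt"
 proof (rule ccontr)
  assume "\<not> 0 < Opt"
  then have "y * Opt \<le> 0" using y1 by (intro mult_nonneg_nonpos) auto
  then show False using O(2) sc by linarith
 qed
 have "0 < n" using n by simp
 from lowrank_rows[OF B this] obtain Q Ws where Q: "\<forall>u<k. Q u < n" and Ws: "\<forall>i<n. \<forall>u<k. \<bar>Ws i u\<bar> \<le> (real k + 1) ^ k"
  and BW: "\<forall>i<n. \<forall>j<d. B i j = (\<Sum>u<k. Ws i u * B (Q u) j)"
  by (elim exE conjE) (rule that; assumption)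
 define V0 where "V0 u j = B (Q u) j" for u j
 define E where "E i j = B i j - A i j" for i j
 have Eb: "\<bar>E i j\<bar> \<le> Opt" if "i < n" "j < d" for i j unfolding Od E_def by (rule NN_entry[OF that])
 have Wy: "\<bar>Ws i u\<bar> \<le> y" if "i < n" "u < k" for i u
 proof -
  have "real ((k + 1) ^ k) \<le> y" using Y by (simp only: of_nat_le_iff)
  moreover have "real ((k + 1) ^ k) = (real k + 1) ^ k" by (simp add: add.commute)
  moreover have "\<bar>Ws i u\<bar> \<le> (real k + 1) ^ k" using Ws that by blast
  ultimately show ?thesis by linarith
 qed
 \<comment> \<open>The share of a column in \<open>Opt powr p\<close>; this is what the sample must
   not inflate.\<close>
 define c where "c j = (\<Sum>i<n. \<bar>E i j\<bar> powr p)" for j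
 have "Opt powr p = (\<Sum>i<n. \<Sum>j<d. \<bar>E i j\<bar> powr p)"
  unfolding Od NN_def E_def using p0 by (subst lpn_powr) (auto simp: sum.cartesian_product split_def)
 also have "\<dots> = (\<Sum>j<d. c j)" unfolding c_def by (rule sum.swap)
 finally have cO: "(\<Sum>j<d. c j) = Opt powr p" by simp
 have c0: "0 \<le> c j" for j by (simp add: c_def sum_nonneg)
 have \<gamma>1: "\<gamma> \<le> 1" using \<gamma> by simp
 obtain S w where Sw: "\<forall>t<m. S t < d \<and> 1 / real m \<le> w t \<and> w t \<le> 2 * real d / real m"
  and nu: "\<forall>x. lpn p {..<d + k} (wext d (%_. 1)) (aug V0 (qs 8) k d x)
   \<le> (1 + \<gamma>) * lpn p {..<m + k} (wext m w) (aug (%u t. V0 u (S t)) (qs 8) k m x)"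
  and cs: "(\<Sum>t<m. w t * c (S t)) \<le> (1 + \<gamma>) * (\<Sum>j<d. c j)"
 proof -
  have "0 < (\<Sum>j<d. c j)" using cO Op by simp
  from sampling_norm[OF p k d m \<mu>_pos[OF sc] \<gamma>(1) \<gamma>1 c0 this refl smp, of V0] show thesis
   by (elim exE conjE) (rule that; assumption)
 qed
 \<comment> \<open>Rounding up keeps each weight above the sampled one; as these are at least
   \<open>1 / y\<close>, the factor lost is at most \<open>ka\<close>.\<close>
 define g where "g t = nat \<lceil>w t * y ^ 3\<rceil>" for t
 have w0: "0 < w t" if "t < m" for t using Sw that m0 order.strict_trans2[of 0 "1 / real m"] by simp
 have y3: "0 < y ^ 3" using y1 by simp
 have wm: "1 / y \<le> w t" if "t < m" for t
 proof -
  have "1 / y \<le> 1 / real m" using Y m0 by (intro divide_left_mono) auto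
  then show ?thesis using Sw that by fastforce
 qed
 have gl: "w t * y ^ 3 \<le> real (g t)" "real (g t) \<le> w t * y ^ 3 + 1" if "t < m" for t
  using w0[OF that] y3 unfolding g_def by (simp_all add: of_nat_nat less_imp_le ceiling_le_iff le_of_int_ceiling)
 define wh where "wh t = real (g t) / y ^ 3" for t
 have wl: "w t \<le> wh t" if "t < m" for t using gl(1)[OF that] y3 by (simp add: wh_def pos_le_divide_eq)
 have wu: "wh t \<le> ka * w t" if "t < m" for t
 proof -
  have "wh t \<le> w t + 1 / y ^ 3" using gl(2)[OF that] y3 by (simp add: wh_def field_simps)
  also have "1 / y ^ 3 = 1 / y ^ 2 * (1 / y)" by (simp add: power2_eq_square power3_eq_cube)
  also have "\<dots> \<le> 1 / y ^ 2 * w t" using wm[OF that] by (intro mult_left_mono) auto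
  finally show ?thesis by (simp add: ka_def algebra_simps)
 qed
 have ka2': "ka \<le> 2" using ka2 \<gamma> by simp
 have wd: "w t \<le> 2 * y" if "t < m" for t
 proof -
  have "2 * real d / real m \<le> 2 * y" using Y m0 m mult_mono[of "real d" y 1 "real m"] by (simp add: field_simps)
  then show ?thesis using Sw that by fastforce
 qed
 have gG: "g t < Y ^ 29" if "t < m" for t
 proof -
  have "real (g t) \<le> 2 * y * y ^ 3 + 1" using gl(2)[OF that] wd[OF that] y3 mult_right_mono[of "w t" "2 * y" "y ^ 3"] by linarith
  also have "\<dots> = 2 * y ^ 4 + 1" by (simp add: power3_eq_cube power4_eq_xxxx)
  also have "\<dots> < 128 * y ^ 4" using one_le_power[OF y1(1), of 4] by linarith
  also have "\<dots> \<le> y ^ Suc 4" by (rule ypow128)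
  also have "\<dots> \<le> y ^ 29" by (rule ypow) simp
  finally show ?thesis by (metis of_nat_less_iff of_nat_power)
 qed
 have YG: "x < Y ^ 29" if "x < Y" for x using that Y(1) self_le_power[of Y 29] by linarith
 have St: "S t < d" if "t < m" for t using Sw that by blast
 have "\<exists>cS<(Y ^ 29) ^ m. \<forall>t<m. dig (Y ^ 29) cS t = S t"
  by (rule digits_exist) (use St Y YG in \<open>meson less_le_trans\<close>)
 then obtain cS where cS: "cS < X" "\<forall>t<m. dig (Y ^ 29) cS t = S t" using Xb less_le_trans by blast
 have "\<exists>c<(Y ^ 29) ^ m. \<forall>t<m. dig (Y ^ 29) c t = g t" by (rule digits_exist) (use gG in auto)
 then obtain cw where cw: "cw < X" "\<forall>t<m. dig (Y ^ 29) cw t = g t" using Xb less_le_trans by blast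
 have "\<exists>c<(Y ^ 29) ^ k. \<forall>t<k. dig (Y ^ 29) c t = Q t"
  by (rule digits_exist) (use Q Y YG in \<open>meson less_le_trans\<close>)
 then obtain cQ where cQ: "cQ < X" "\<forall>t<k. dig (Y ^ 29) cQ t = Q t" using Xb less_le_trans by blast
 \<comment> \<open>The guess is for the difference to \<open>A\<close>, whose entries are bounded by
   \<open>Opt\<close>, while those of \<open>B\<close> are not bounded in terms of the
   scale.\<close>
 have "\<exists>x\<le>2 * Y ^ 28. u < k \<longrightarrow> t < m \<longrightarrow> \<bar>(real x - real (Y ^ 28)) * \<eta> - E (Q u) (S t)\<bar> \<le> \<eta>" for u t
 proof (cases "u < k \<and> t < m")
  case True
  have "\<bar>E (Q u) (S t)\<bar> \<le> y ^ 2 * sc" using Eb[of "Q u" "S t"] Q St True O by auto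
  also have "\<dots> \<le> y ^ 4 * sc" using ypow[of 2 4] sc by (intro mult_right_mono) auto
  also have "\<dots> = real (Y ^ 28) * \<eta>" using y28\<eta> by simp
  finally show ?thesis using grid_point[of \<eta> "E (Q u) (S t)" "Y ^ 28"] q0[of 24] unfolding \<eta>_qs by blast
 qed auto
 then obtain f where f: "\<And>u t. f u t \<le> 2 * Y ^ 28"
  "\<And>u t. u < k ==> t < m ==> \<bar>(real (f u t) - real (Y ^ 28)) * \<eta> - E (Q u) (S t)\<bar> \<le> \<eta>"
  by metis
 have "\<exists>c<(Y ^ 29) ^ (k * m). \<forall>t<k * m. dig (Y ^ 29) c t = f (t div m) (t mod m)"
  by (rule digits_exist) (use f(1) h_bound in \<open>meson le_less_trans\<close>)
 then obtain cR where cR: "cR < X" "\<forall>t<k * m. dig (Y ^ 29) cR t = f (t div m) (t mod m)"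
  using Xb less_le_trans by blast
 have cRf: "dig (Y ^ 29) cR (u * m + t) = f u t" if "u < k" "t < m" for u t
 proof -
  have "u * m + t < (u + 1) * m" using that by simp
  also have "\<dots> \<le> k * m" using that by (intro mult_le_mono1) simp
  finally show ?thesis using cR that by simp
 qed
 have Sf: "Sf cS t = S t" if "t < m" for t using cS that St by (simp add: Sf_def)
 have wfe: "wf cw t = wh t" if "t < m" for t using cw that by (simp add: wf_def wh_def)
 have Pfe: "Pf cQ u = Q u" if "u < k" for u using cQ that Q by (simp add: Pf_def)
 have Zb: "\<bar>Zf cS cQ cR u t - V0 u (S t)\<bar> \<le> \<eta>" if "u < k" "t < m" for u t
 proof -
  have "Zf cS cQ cR u t = gv (f u t) + A (Q u) (S t)" by (simp only: Zf_def cRf[OF that] Sf[OF that(2)] Pfe[OF that(1)])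
  then show ?thesis using f(2)[OF that] by (simp add: gv_eq V0_def E_def algebra_simps)
 qed
 define F where "F i = lpn p {..<m} wh (%t. E i (S t))" for i
 have wh0: "0 \<le> wh t" for t by (simp add: wh_def)
 \<comment> \<open>Exchanging the sums turns the row errors on the sample into weighted column
   costs, which sampling has controlled.\<close>
 have sumF: "lpn p {..<n} (%_. 1) F \<le> (1 + \<gamma>) ^ 2 * Opt"
 proof (rule lpn_leI[OF p0])
  have "(\<Sum>i<n. 1 * \<bar>F i\<bar> powr p) = (\<Sum>i<n. \<Sum>t<m. wh t * \<bar>E i (S t)\<bar> powr p)"
   using lpn_powr[OF p0, of "{..<m}" wh, OF wh0] lpn_nonneg[of p "{..<m}" wh] by (simp add: F_def)
  also have "\<dots> = (\<Sum>t<m. wh t * c (S t))"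
   by (subst sum.swap) (simp add: c_def sum_distrib_left)
  also have "\<dots> \<le> (\<Sum>t<m. ka * w t * c (S t))" using wu c0 by (intro sum_mono mult_right_mono) auto
  also have "\<dots> = ka * (\<Sum>t<m. w t * c (S t))" by (simp add: sum_distrib_left mult.assoc)
  also have "\<dots> \<le> (1 + \<gamma>) * ((1 + \<gamma>) * (\<Sum>j<d. c j))"
   using ka2 cs ka1 c0 \<gamma> w0 by (intro mult_mono sum_nonneg mult_nonneg_nonneg) (auto intro: less_imp_le)
  also have "\<dots> = (1 + \<gamma>) ^ 2 * Opt powr p" by (simp add: cO power2_eq_square)
  also have "\<dots> \<le> ((1 + \<gamma>) ^ 2) powr p * Opt powr p"
   using powr_mono[of 1 p "(1 + \<gamma>) ^ 2"] p \<gamma> by (intro mult_right_mono) (auto simp: one_le_power)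
  also have "\<dots> = ((1 + \<gamma>) ^ 2 * Opt) powr p" by (simp add: powr_mult)
  finally show "(\<Sum>i<n. 1 * \<bar>F i\<bar> powr p) \<le> ((1 + \<gamma>) ^ 2 * Opt) powr p" .
 qed (use Op \<gamma> in auto)
 have g2: "(1 + \<gamma>) ^ 2 \<le> 1 + 3 * \<gamma>"
  using \<gamma> mult_left_mono[of \<gamma> 1 \<gamma>] by (simp add: power2_eq_square algebra_simps)
 have FO: "F i \<le> 2 * y ^ 2 * sc" if "i < n" for i
 proof -
  have "\<bar>F i\<bar> \<le> lpn p {..<n} (%_. 1) F" using that by (intro lpn_entry1[OF p0]) auto
  then have "F i \<le> (1 + \<gamma>) ^ 2 * Opt" using sumF by linarith
  also have "\<dots> \<le> 2 * (y ^ 2 * sc)" using g2 \<gamma> O Op by (intro mult_mono) auto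
  finally show ?thesis by simp
 qed
 have sumwh: "(\<Sum>t<m. wh t) \<le> 4 * y"
 proof -
  have "(\<Sum>t<m. wh t) \<le> (\<Sum>t<m. 2 * (2 * real d / real m))"
  proof (intro sum_mono)
   fix t assume "t \<in> {..<m}"
   then have t: "t < m" by simp
   have "wh t \<le> ka * w t" by (rule wu[OF t])
   also have "\<dots> \<le> 2 * (2 * real d / real m)" using ka2' Sw t ka1 w0[OF t] by (intro mult_mono) auto
   finally show "wh t \<le> 2 * (2 * real d / real m)" .
  qed
  also have "\<dots> = 4 * real d" using m0 by simp
  also have "\<dots> \<le> 4 * y" using Y by simp
  finally show ?thesis .
 qed
 have main: "NN (%i j. MN W V0 i j - A i j) \<le> (3 + 13 * \<gamma>) * Opt" if ph: "ph1 cS cw cQ cR W" for W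
 proof -
  obtain Hs b P wx where H: "\<forall>x<m + k. \<forall>u<k. Hs 0 x u = H1 cS cQ cR x u" "elims (m + k) (m + k) k k Hs b P"
   "\<forall>x<m + k. wx x = wext m (wf cw) x"
   "\<forall>i<n. \<exists>a val. (\<forall>x<m + k. a x = (if x < m then A i (Sf cS x) else 0)) \<and> regopt (m + k) wx b P a m (sc / y ^ 8) (W i) val"
   using ph unfolding ph1_def by (elim exE conjE) (rule that; assumption)
  have row: "lpn p {..<d} (%_. 1) (%j. \<Sum>u<k. (W i u - Ws i u) * V0 u j) \<le> (1 + \<gamma>) * (2 + \<gamma>) * (F i + qs 4)" if i: "i < n" for i
  proof -
   obtain a val where a: "\<forall>x<m + k. a x = (if x < m then A i (Sf cS x) else 0)" "regopt (m + k) wx b P a m (qs 8) (W i) val"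
    using H(4) i unfolding qs_def by blast
   let ?x = "%u. W i u - Ws i u" and ?V = "%u t. V0 u (S t)"
   have "lpn p {..<m + k} (wext m wh) (aug ?V (qs 8) k m ?x) \<le> (2 + \<gamma>) * (F i + qs 4)"
   proof (rule row_opt[OF sc _ sumwh _ _ _ FO[OF i] _ H(2) _ _ a(2)])
    show "1 / y \<le> wh t" if "t < m" for t using wm[OF that] wl[OF that] by simp
    show "\<bar>Zf cS cQ cR u t - ?V u t\<bar> \<le> \<eta>" if "u < k" "t < m" for u t by (rule Zb[OF that])
    show "\<bar>Ws i u\<bar> \<le> y" if "u < k" for u by (rule Wy[OF i that])
    show "Hs 0 x u = (if x < m then Zf cS cQ cR u x else if x = m + u then qs 8 else 0)" if "x < m + k" "u < k" for x u
     using H(1) that by (simp add: H1_def qs_def)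
    show "wx x = wext m wh x" if "x < m + k" for x using H(3) that wfe by (simp add: wext_def)
    show "a x = (if x < m then A i (S x) else 0)" if "x < m + k" for x using a(1) that Sf by simp
    have "(\<Sum>u<k. Ws i u * V0 u (S t)) - A i (S t) = E i (S t)" if "t < m" for t
     using BW i St[OF that] by (simp add: V0_def E_def)
    then show "lpn p {..<m} wh (%t. (\<Sum>u<k. Ws i u * ?V u t) - A i (S t)) \<le> F i"
     unfolding F_def by (intro eq_refl lpn_cong) auto
   qed
   moreover have "lpn p {..<m + k} (wext m w) (aug ?V (qs 8) k m ?x) \<le> lpn p {..<m + k} (wext m wh) (aug ?V (qs 8) k m ?x)"
    using w0 wl by (intro lpn_mono_weight[OF p0]) (auto simp: wext_def less_imp_le)
   ultimately have "(1 + \<gamma>) * lpn p {..<m + k} (wext m w) (aug ?V (qs 8) k m ?x) \<le> (1 + \<gamma>) * ((2 + \<gamma>) * (F i + qs 4))"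
    using \<gamma> by (intro mult_left_mono) auto
   then have "lpn p {..<d + k} (wext d (%_. 1)) (aug V0 (qs 8) k d ?x) \<le> (1 + \<gamma>) * ((2 + \<gamma>) * (F i + qs 4))"
    using nu[rule_format, of ?x] by linarith
   moreover have "lpn p {..<d} (%_. 1) (%j. \<Sum>u<k. ?x u * V0 u j) \<le> lpn p {..<d + k} (wext d (%_. 1)) (aug V0 (qs 8) k d ?x)"
   proof (rule lpn_leI[OF p0 lpn_nonneg])
    show "(\<Sum>j<d. 1 * \<bar>\<Sum>u<k. ?x u * V0 u j\<bar> powr p) \<le> lpn p {..<d + k} (wext d (%_. 1)) (aug V0 (qs 8) k d ?x) powr p"
     by (subst lpn_aug_powr[OF p0]) (auto simp: sum_nonneg)
   qed simp
   ultimately show ?thesis by simp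
  qed
  let ?c = "(1 + \<gamma>) * (2 + \<gamma>)"
  have c2: "0 \<le> ?c" using \<gamma> by simp
  have sn: "sum (%_. 1) {..<n} \<le> y ^ 2" "1 \<le> y ^ 2"
  proof -
   have "real n \<le> y ^ 2" using Y y1 mult_mono[of "real n" y 1 y] by (simp add: power2_eq_square)
   then show "sum (%_. 1) {..<n} \<le> y ^ 2" by simp
  qed (use y1 in \<open>simp add: one_le_power\<close>)
  have "NN (%i j. \<Sum>u<k. (W i u - Ws i u) * V0 u j)
    \<le> lpn p {..<n} (%_. 1) (%i. ?c * (F i + qs 4))"
   unfolding NN_rows using row lpn_nonneg[of p "{..<d}" "%_. 1"]
   by (intro lpn_mono[OF p0]) (auto intro: order_trans[OF _ abs_ge_self])
  also have "\<dots> = ?c * lpn p {..<n} (%_. 1) (%i. F i + qs 4)" using c2 by (subst lpn_cmult[OF p0]) auto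
  also have "\<dots> \<le> ?c * ((1 + 4 * \<gamma>) * Opt)"
  proof (intro mult_left_mono c2)
   have "lpn p {..<n} (%_. 1) (%i. F i + qs 4) \<le> lpn p {..<n} (%_. 1) F + y ^ 2 * qs 4"
    by (rule lpn_shift[OF p _ _ _ q0 sn]) (use q0[of 4] in auto)
   also have "y ^ 2 * qs 4 = qs 2" using qs_mult2[of 2] by (simp add: numeral_eq_Suc)
   \<comment> \<open>One factor \<open>1 / y\<close> is at most \<gamma>, the other is absorbed by
     \<open>sc \<le> y * Opt\<close>.\<close>
   also have "qs 2 \<le> \<gamma> * Opt"
   proof -
    have "qs 2 = 1 / y * (sc / y)" by (simp add: qs_def power2_eq_square)
    also have "\<dots> \<le> \<gamma> * Opt" using \<gamma> O y1 sc by (intro mult_mono) (auto simp: field_simps)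
    finally show ?thesis .
   qed
   finally have "lpn p {..<n} (%_. 1) (%i. F i + qs 4) \<le> (1 + \<gamma>) ^ 2 * Opt + \<gamma> * Opt" using sumF by linarith
   also have "\<dots> \<le> (1 + 3 * \<gamma>) * Opt + \<gamma> * Opt" using g2 Op by (intro add_right_mono mult_right_mono) auto
   finally show "lpn p {..<n} (%_. 1) (%i. F i + qs 4) \<le> (1 + 4 * \<gamma>) * Opt" by (simp add: algebra_simps)
  qed
  also have "\<dots> = (?c * (1 + 4 * \<gamma>)) * Opt" by simp
  also have "\<dots> \<le> (2 + 13 * \<gamma>) * Opt"
  proof (intro mult_right_mono)
   have g2': "\<gamma> * \<gamma> \<le> \<gamma> * (1 / 64)" "\<gamma> * \<gamma> * \<gamma> \<le> \<gamma> * \<gamma> * 1"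
    using \<gamma> by (intro mult_left_mono; simp)+
   \<comment> \<open>The two extra multiples of \<gamma> pay for the higher powers, because \<gamma>
     is at most 1 / 64.\<close>
   have "?c * (1 + 4 * \<gamma>) = 2 + 11 * \<gamma> + 13 * (\<gamma> * \<gamma>) + 4 * (\<gamma> * \<gamma> * \<gamma>)" by (simp add: algebra_simps)
   then show "?c * (1 + 4 * \<gamma>) \<le> 2 + 13 * \<gamma>" using g2' \<gamma>(1) by linarith
  qed (use Op in simp)
  finally have d1: "NN (%i j. \<Sum>u<k. (W i u - Ws i u) * V0 u j) \<le> (2 + 13 * \<gamma>) * Opt" .
  have EO: "NN E = Opt" unfolding Od by (intro NN_cong) (simp add: E_def)
  have "NN (%i j. MN W V0 i j - A i j) = NN (%i j. (\<Sum>u<k. (W i u - Ws i u) * V0 u j) + E i j)"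
   using BW by (intro NN_cong) (simp add: MN_def E_def V0_def left_diff_distrib sum_subtractf)
  also have "\<dots> \<le> (2 + 13 * \<gamma>) * Opt + Opt" using NN_triangle[of "%i j. \<Sum>u<k. (W i u - Ws i u) * V0 u j" E] d1 EO by linarith
  finally show ?thesis by (simp add: algebra_simps)
 qed
 show ?thesis using cS(1) cw(1) cQ(1) cR(1) main by blast
qed

text \<open>The stored candidate may stem from a different guess, but it costs no more than that of
  the right one, and costs determine norms up to the factor \<open>kb * ka\<close>. This and the
  rounding give \<open>(1 + \<gamma>) * (3 + 14 * \<gamma>)\<close>, at most
  \<open>3 + 18 * \<gamma>\<close>.\<close>

lemma combine:
 assumes sc: "sc > 0" and B: "lowrank k n d B" and Od: "Opt = NN (%i j. B i j - A i j)"
  and O: "Opt \<le> y ^ 2 * sc" "sc \<le> y * Opt"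
  and smp: "8 * real k * (p + 2 * ((2 * real k) powr p * real k) + 1) \<le> real G0 * \<gamma>"
   "(2 * real G0 + 1) ^ k * exp (- (\<gamma>\<^sup>2 * real m / (128 * 4 powr p * ((2 * real k) powr p * real k)))) < \<gamma> / (1 + \<gamma>)"
  and cand: "cand cS' cw' cQ' cR' W V' gb"
   "\<forall>cS<X. \<forall>cw<X. \<forall>cQ<X. \<forall>cR<X. \<exists>W V' tot. cand cS cw cQ cR W V' tot \<and> gb \<le> tot"
 shows "NN (%i j. MN W V' i j - A i j) \<le> (3 + 18 * \<gamma>) * Opt"
proof -
 have y1: "1 \<le> y" "0 < y" using y128 by auto
 have Op: "0 < Opt"
 proof (rule ccontr)
  assume "\<not> 0 < Opt"
  then have "y * Opt \<le> 0" using y1 by (intro mult_nonneg_nonpos) auto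
  then show False using O(2) sc by linarith
 qed
 obtain cS cw cQ cR where c: "cS < X" "cw < X" "cQ < X" "cR < X"
  "\<forall>W. ph1 cS cw cQ cR W \<longrightarrow> (\<exists>V0. NN (%i j. MN W V0 i j - A i j) \<le> (3 + 13 * \<gamma>) * Opt)"
  using phase1[OF sc B Od O smp] by blast
 obtain W1 V1 tot where t: "cand cS cw cQ cR W1 V1 tot" "gb \<le> tot" using cand(2) c by blast
 obtain V0 where V0: "NN (%i j. MN W1 V0 i j - A i j) \<le> (3 + 13 * \<gamma>) * Opt"
  using c(5) t(1) sc unfolding cand_def by auto
 let ?T = "(3 + 13 * \<gamma>) * Opt"
 have T4: "?T \<le> 4 * (y ^ 2 * sc)" using \<gamma> O Op by (intro mult_mono) auto
 have y23: "y ^ 2 * sc \<le> y ^ 3 * sc" using ypow[of 2 3] sc by (intro mult_right_mono) auto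
 have y2: "sc \<le> y ^ 2 * sc" using one_le_power[OF y1(1), of 2] sc by simp
 have T64: "?T \<le> 64 * (y ^ 3 * sc)" using T4 y23 y2 sc by linarith
 define r where "r = ka * (?T + qs 5)"
 have q5: "0 \<le> qs 5" "qs 5 \<le> sc" "qs 5 \<le> \<gamma> * Opt"
 proof -
  have "qs 2 = 1 / y * (sc / y)" by (simp add: qs_def power2_eq_square)
  also have "\<dots> \<le> \<gamma> * Opt" using \<gamma> O y1 sc by (intro mult_mono) (auto simp: field_simps)
  finally show "qs 5 \<le> \<gamma> * Opt" using qs_anti[OF sc, of 2 5] by simp
 qed (use qs_nonneg[OF sc] qs_anti[OF sc, of 0 5] in \<open>simp_all add: qs_0\<close>)
 have T0: "0 \<le> ?T" using Op \<gamma> by simp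
 have r0: "0 \<le> r" using T0 q5 ka1 by (simp add: r_def)
 have kr: "kb * r \<le> (1 + \<gamma>) * (?T + qs 5)"
  using kab T0 q5 mult_right_mono[of "kb * ka" "1 + \<gamma>" "?T + qs 5"] by (simp add: r_def mult.assoc)
 have "tot * z powr p \<le> r powr p" unfolding r_def
  by (rule ph2_bound[OF sc _ V0 T64]) (use t(1) in \<open>auto simp: cand_def\<close>)
 moreover have "gb * z powr p \<le> tot * z powr p" using t(2) by (intro mult_right_mono) auto
 ultimately have "gb * z powr p \<le> r powr p" by linarith
 moreover have "y * (kb * r) < cap"
 proof -
  have "kb * r \<le> 2 * (4 * (y ^ 2 * sc) + y ^ 2 * sc)"
   by (rule order_trans[OF kr]) (rule mult_mono; use \<gamma> T4 T0 q5 y2 sc in linarith)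
  moreover have "2 * (4 * a + a) = 10 * a" for a :: real by simp
  ultimately have "kb * r \<le> 10 * (y ^ 2 * sc)" by (simp only:)
  then have "y * (kb * r) \<le> y * (10 * (y ^ 2 * sc))" using y1(2) by (rule mult_left_mono[OF _ less_imp_le])
  also have "\<dots> = 10 * y ^ 3 * sc" by (simp add: power2_eq_square power3_eq_cube)
  also have "\<dots> < y ^ 8 * sc"
  proof (intro mult_strict_right_mono sc)
   have "10 * y ^ 3 < 128 * y ^ 3" using y1 by simp
   also have "\<dots> \<le> y ^ Suc 3" by (rule ypow128)
   also have "\<dots> \<le> y ^ 8" by (rule ypow) simp
   finally show "10 * y ^ 3 < y ^ 8" .
  qed
  also have "\<dots> \<le> cap" by (rule cap_large[OF sc])
  finally show ?thesis .
 qed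
 ultimately have "NN (%i j. MN W V' i j - A i j) \<le> kb * r"
  using ph2_quality[OF sc _ _ r0] cand(1) by (auto simp: cand_def)
 also have "\<dots> \<le> (1 + \<gamma>) * ((3 + 14 * \<gamma>) * Opt)"
  by (rule order_trans[OF kr]) (use \<gamma> q5 in \<open>intro mult_left_mono; simp add: algebra_simps\<close>)
 also have "\<dots> = ((1 + \<gamma>) * (3 + 14 * \<gamma>)) * Opt" by simp
 also have "\<dots> \<le> (3 + 18 * \<gamma>) * Opt"
 proof (intro mult_right_mono)
  have "\<gamma> * \<gamma> \<le> \<gamma> * (1 / 64)" using \<gamma> by (intro mult_left_mono) auto
  moreover have "(1 + \<gamma>) * (3 + 14 * \<gamma>) = 3 + 17 * \<gamma> + 14 * (\<gamma> * \<gamma>)" by (simp add: algebra_simps)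
  ultimately show "(1 + \<gamma>) * (3 + 14 * \<gamma>) \<le> 3 + 18 * \<gamma>" using \<gamma>(1) by linarith
 qed (use Op in simp)
 finally show ?thesis .
qed

end

lemma pw_zero: "pw 0 g q x L = (0, if 0 < x then q ^ L else 1)"
 by (induction L) auto

context solver_y
begin

text \<open>With scale 0 the staircase is 1 at 0 and one fixed larger value at positive arguments,
  so the cost of a residual matrix is at least its number of entries, with equality for the zero
  matrix only. Equality is attained: each grid is the point 0 and \<open>U0\<close> is an exact left
  factor.\<close>

lemma exact_case:
 assumes sc: "sc = 0" and ph: "ph2 W V' gb" "ph2 W1 V1 tot" "gb \<le> tot"
  and W: "\<And>i u. i < n ==> u < k ==> W1 i u = U0 i u" and A: "\<And>i j. i < n ==> j < d ==> A i j = (\<Sum>u<k. U0 i u * v u j)"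
 shows "NN (%i j. MN W V' i j - A i j) = 0"
proof -
 have e0: "\<eta> = 0" unfolding \<eta>_def using sc by simp
 have q1: "1 < 1 + p / y ^ 2" using p y128 by simp
 have PF1: "PF x = (if 0 < x then (1 + p / y ^ 2) ^ (Y ^ 3) else 1)" for x
  unfolding PF_def using sc by (simp add: pw_zero)
 have ql: "1 < (1 + p / y ^ 2) ^ (Y ^ 3)" using q1 Y(1) by (intro one_less_power) auto
 obtain Hs b Q w vals where H0: "\<forall>x<n + k. \<forall>u<k. Hs 0 x u = (if x < n then W1 x u else if x = n + u then 1 else 0)"
  "elims n (n + k) k k Hs b Q" "\<forall>x<n + k. w x = 1"
  "\<forall>j<d. \<exists>a. (\<forall>x<n + k. a x = (if x < n then A x j else 0)) \<and> regopt n w b Q a n 1 (%u. V1 u j) (vals j)"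
  "tot = (\<Sum>j<d. vals j)" using ph(2) unfolding ph2_def by (elim exE conjE) (rule that; assumption)
 have "vals j \<le> real n" if j: "j < d" for j
 proof -
  obtain a where a: "\<forall>x<n + k. a x = (if x < n then A x j else 0)" "regopt n w b Q a n 1 (%u. V1 u j) (vals j)"
   using H0(4) j by blast
  have r: "a x - (\<Sum>u<k. Hs 0 x u * v u j) = 0" if "x < n" for x
   using that a(1) H0(1) A[OF that j] W by simp
  have "\<exists>\<rho>. vals j \<le> C w n \<rho> \<and> (\<forall>x<n. \<bar>\<rho> x - (a x - (\<Sum>u<k. Hs 0 x u * v u j))\<bar> \<le> real k * \<eta>)"
   by (rule regopt_le[OF a(2) H0(2), of 0]) (use r e0 sc in auto)
  then obtain \<rho> where \<rho>: "vals j \<le> C w n \<rho>" "\<forall>x<n. \<rho> x = 0" using r e0 by auto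
  then show ?thesis using H0(3) by (simp add: C_def PF1)
 qed
 then have "tot \<le> (\<Sum>j<d. \<Sum>i<n. 1)" unfolding H0(5) by (intro sum_mono) auto
 then have gb: "gb \<le> (\<Sum>j<d. \<Sum>i<n. 1)" using ph(3) by linarith
 obtain \<rho> w' where \<rho>: "\<forall>x<n. w' x = 1" "gb = (\<Sum>j<d. C w' n (\<rho> j))" "\<forall>j<d. \<forall>i<n. \<bar>\<rho> j i\<bar> = \<bar>MN W V' i j - A i j\<bar>"
  using ph2_cols[OF ph(1)] by (elim exE conjE) (rule that; assumption)
 have "(\<Sum>j<d. \<Sum>i<n. PF \<bar>\<rho> j i\<bar> - 1) = gb - (\<Sum>j<d. \<Sum>i<n. 1)"
  using \<rho>(1) unfolding \<rho>(2) by (simp add: C_def sum_subtractf)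
 then have "(\<Sum>j<d. \<Sum>i<n. PF \<bar>\<rho> j i\<bar> - 1) \<le> 0" using gb by linarith
 moreover have nn: "0 \<le> PF x - 1" for x using ql by (simp add: PF1 less_imp_le)
 ultimately have "(\<Sum>j<d. \<Sum>i<n. PF \<bar>\<rho> j i\<bar> - 1) = 0" by (meson order.antisym sum_nonneg)
 then have "\<forall>j<d. (\<Sum>i<n. PF \<bar>\<rho> j i\<bar> - 1) = 0"
  using sum_nonneg_eq_0_iff[of "{..<d}" "%j. \<Sum>i<n. PF \<bar>\<rho> j i\<bar> - 1"] nn by (simp add: sum_nonneg)
 then have "PF \<bar>\<rho> j i\<bar> = 1" if "j < d" "i < n" for i j
  using that sum_nonneg_eq_0_iff[of "{..<n}" "%i. PF \<bar>\<rho> j i\<bar> - 1"] nn by auto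
 then have "\<bar>MN W V' i j - A i j\<bar> = \<bar>0 :: real\<bar>" if "i < n" "j < d" for i j
  using that \<rho>(3) ql unfolding PF1 by (metis abs_zero less_irrefl zero_less_abs_iff)
 then have "NN (%i j. MN W V' i j - A i j) = NN (%i j. 0)" by (intro NN_cong) auto
 then show ?thesis using p0 by (simp add: NN_def lpn_def split_def)
qed

text \<open>The analysis needs a reference matrix with error at most \<open>y ^ 2 * sc\<close>. If
  \<open>B\<close> is worse than that, the approximation left by the elimination takes its place:
  its remainder has entries at most \<open>sc\<close>. The other bound,
  \<open>sc \<le> y * Opt\<close>, holds for every matrix of rank at most k, by
  \<open>elims_residual\<close> and \<open>8 ^ k \<le> Y\<close>.\<close>

lemma quality:
 assumes B: "lowrank k n d B"
  and el: "elims n n d k Hs b Q" and H0: "\<forall>x<n. \<forall>y<d. Hs 0 x y = A x y" and U0: "\<forall>i<n. \<forall>u<k. U0 i u = b u i"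
  and scb: "\<forall>x<n. \<forall>y<d. \<bar>Hs k x y\<bar> \<le> sc" "\<exists>x<n. \<exists>y<d. sc = \<bar>Hs k x y\<bar>"
  and smp: "8 * real k * (p + 2 * ((2 * real k) powr p * real k) + 1) \<le> real G0 * \<gamma>"
   "(2 * real G0 + 1) ^ k * exp (- (\<gamma>\<^sup>2 * real m / (128 * 4 powr p * ((2 * real k) powr p * real k)))) < \<gamma> / (1 + \<gamma>)"
  and cand: "cand cS' cw' cQ' cR' W V' gb"
   "\<forall>cS<X. \<forall>cw<X. \<forall>cQ<X. \<forall>cR<X. \<exists>W V' tot. cand cS cw cQ cR W V' tot \<and> gb \<le> tot"
 shows "NN (%i j. MN W V' i j - A i j) \<le> (3 + 18 * \<gamma>) * NN (%i j. B i j - A i j)"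
proof (cases "0 < sc")
 case True
 have low: "sc \<le> y * NN (%i j. B' i j - A i j)" if "lowrank k n d B'" for B'
 proof -
  obtain x0 y0 where x: "x0 < n" "y0 < d" "sc = \<bar>Hs k x0 y0\<bar>" using scb by blast
  have "sc \<le> 8 ^ k * NN (%i j. B' i j - A i j)" unfolding x(3)
  proof (rule elims_residual[OF el order.refl that NN_nonneg _ x(1,2)])
   show "\<bar>Hs 0 i j - B' i j\<bar> \<le> NN (%i j. B' i j - A i j)" if "i < n" "j < d" for i j
    using NN_entry[OF that, of "%i j. B' i j - A i j"] H0 that by (simp add: abs_minus_commute)
  qed
  also have "(8 :: real) ^ k = real (8 ^ k)" by simp
  also have "real (8 ^ k) * NN (%i j. B' i j - A i j) \<le> y * NN (%i j. B' i j - A i j)"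
   using Y NN_nonneg by (intro mult_right_mono) (simp_all only: of_nat_le_iff)
  finally show ?thesis .
 qed
 note comb = combine[OF True _ refl _ low smp cand]
 let ?O = "NN (%i j. B i j - A i j)"
 show ?thesis
 proof (cases "?O \<le> y ^ 2 * sc")
  case True
  then show ?thesis by (rule comb[OF B _ B])
 next
  case False
  let ?B = "%i j. A i j - Hs k i j"
  have B0: "lowrank k n d ?B" unfolding lowrank_def
   by (rule exI[of _ "%x t. b t x"], rule exI[of _ "%t y. Hs t (Q t) y"])
    (use elims_expand[OF el order.refl order.refl] H0 in \<open>auto simp: mult.commute\<close>)
  have "NN (%i j. ?B i j - A i j) \<le> NN (%i j. 0) + y ^ 2 * sc"
   by (rule NN_shift) (use scb True in auto)
  then have le: "NN (%i j. ?B i j - A i j) \<le> y ^ 2 * sc" using p0 by (simp add: NN_def lpn_def split_def)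
  have "NN (%i j. MN W V' i j - A i j) \<le> (3 + 18 * \<gamma>) * NN (%i j. ?B i j - A i j)" by (rule comb[OF B0 le B0])
  also have "\<dots> \<le> (3 + 18 * \<gamma>) * ?O" using le False \<gamma> by (intro mult_left_mono) auto
  finally show ?thesis .
 qed
next
 case False
 have "n \<noteq> 0" "d \<noteq> 0" using n d by auto
 then have sc: "sc = 0" using False scb by force
 have "0 < X" using X by simp
 then obtain W1 V1 tot where t: "cand 0 0 0 0 W1 V1 tot" "gb \<le> tot" using cand(2) by blast
 have Ae: "A i j = (\<Sum>u<k. U0 i u * Hs u (Q u) j)" if "i < n" "j < d" for i j
  using elims_expand[OF el order.refl order.refl that] H0 U0 scb that sc by (auto simp: mult.commute)
 have ph: "ph2 W V' gb" "ph2 W1 V1 tot" and W1: "\<And>i u. i < n ==> u < k ==> W1 i u = U0 i u"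
  using cand(1)[unfolded cand_def] t(1)[unfolded cand_def] False by auto
 have "NN (%i j. MN W V' i j - A i j) = 0" by (rule exact_case[OF sc ph t(2) W1 Ae])
 then show ?thesis using NN_nonneg \<gamma> by simp
qed

end

lemma entrywise_norm_lpn:
 assumes "T \<in> carrier_mat n d"
 shows "entrywise_norm p T = lpn p ({..<n} \<times> {..<d}) (%_. 1) (%(i, j). T $$ (i, j))"
 using assms by (auto simp: entrywise_norm_def lpn_def sum.cartesian_product split_def)

text \<open>Comparing with every factored matrix and passing to the infimum makes it unnecessary to
  attain the minimum.\<close>

lemma lowrank_opt_bound:
 assumes A: "A \<in> carrier_mat n d" and c: "0 < c"
  and v: "\<And>B. lowrank k n d B ==> v \<le> c * lpn p ({..<n} \<times> {..<d}) (%_. 1) (%(i, j). B i j - A $$ (i, j))"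
 shows "v \<le> c * lowrank_opt p k A" "0 \<le> lowrank_opt p k A"
proof -
 let ?S = "{entrywise_norm p (U * V' - A) | U V'. U \<in> carrier_mat (dim_row A) k \<and> V' \<in> carrier_mat k (dim_col A)}"
 have ne: "?S \<noteq> {}"
 proof -
  have "entrywise_norm p (0\<^sub>m (dim_row A) k * 0\<^sub>m k (dim_col A) - A) \<in> ?S"
   by (rule CollectI, rule exI, rule exI, rule conjI, rule refl) simp
  then show ?thesis by blast
 qed
 have "v / c \<le> Inf ?S"
 proof (rule cInf_greatest[OF ne])
  fix x assume "x \<in> ?S"
  then obtain U V' where UV: "x = entrywise_norm p (U * V' - A)" "U \<in> carrier_mat n k" "V' \<in> carrier_mat k d"
   using A by auto
  have "lowrank k n d (%i j. (U * V') $$ (i, j))" unfolding lowrank_def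
   by (rule exI[of _ "%i t. U $$ (i, t)"], rule exI[of _ "%t j. V' $$ (t, j)"])
    (use UV(2,3) in \<open>auto simp: scalar_prod_def atLeast0LessThan\<close>)
  from v[OF this] have "v \<le> c * lpn p ({..<n} \<times> {..<d}) (%_. 1) (%(i, j). (U * V') $$ (i, j) - A $$ (i, j))" .
  also have "lpn p ({..<n} \<times> {..<d}) (%_. 1) (%(i, j). (U * V') $$ (i, j) - A $$ (i, j)) = x"
   unfolding UV(1) by (subst entrywise_norm_lpn[of _ n d]) (use A UV(2,3) in \<open>auto intro!: lpn_cong\<close>)
  finally show "v / c \<le> x" using c by (simp add: field_simps)
 qed
 then show "v \<le> c * lowrank_opt p k A" using c by (simp add: lowrank_opt_def field_simps)
 show "0 \<le> lowrank_opt p k A" unfolding lowrank_opt_def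
  by (rule cInf_greatest[OF ne]) (auto simp: entrywise_norm_def)
qed

section \<open>Parameters and running time\<close>

text \<open>The logarithm of \<open>(2 * G0 + 1) ^ k\<close> is at most
  \<open>k * (2 * G0 + 1)\<close>; with \<open>64 * e + 1\<close> for the failure probability this
  is the exponent \<open>?L\<close> for which \<open>m\<close> must be large enough. With p replaced
  by the integer \<open>P\<close> above it, all bounds are polynomials in \<open>k * e\<close>, so
  one exponent serves all k and e.\<close>

lemma sampling_parameters:
 assumes p: "1 \<le> p"
 shows "\<exists>C A :: nat. 1 \<le> A \<and> A \<le> C \<and> (\<forall>k e. 1 \<le> k \<longrightarrow> 1 \<le> e \<longrightarrow> (\<exists>G0 :: nat.
  8 * real k * (p + 2 * ((2 * real k) powr p * real k) + 1) \<le> real G0 * (1 / (64 * real e)) \<and>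
  (2 * real G0 + 1) ^ k * exp (- ((1 / (64 * real e))\<^sup>2 * real (C * (k * e) ^ A) / (128 * 4 powr p * ((2 * real k) powr p * real k))))
   < 1 / (64 * real e) / (1 + 1 / (64 * real e))))"
proof -
 define P where "P = nat \<lceil>p\<rceil>"
 have P: "p \<le> real P" using p by (simp add: P_def)
 \<comment> \<open>\<open>512 = 8 * 64\<close>; the bracket times \<open>K ^ (P + 1)\<close> bounds
   \<open>p + 2 * \<kappa> + 1\<close>.\<close>
 define c where "c = 512 * (P + 1 + 2 ^ (P + 1))"
 define a where "a = P + 2"
 \<comment> \<open>\<open>P + 1\<close> comes from \<kappa>, 2 from the square of
   \<open>64 * e\<close>, and \<open>a + 1\<close> from \<open>k * G0\<close>.\<close>
 define A where "A = P + 1 + 2 + (a + 1)"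
 \<comment> \<open>\<open>4096\<close> is the square of 64. The summand \<open>A\<close> ensures
   \<open>A \<le> C\<close>, so that the exponent, too, is bounded by the accuracy parameter when
   the program computes with it.\<close>
 define C where "C = 128 * 4 ^ P * 2 ^ P * 4096 * (3 * c + 66) + A"
 show ?thesis
 proof (rule exI[of _ C], rule exI[of _ A], intro conjI allI impI)
  show "1 \<le> A" "A \<le> C" by (simp_all add: A_def C_def)
  fix k e :: nat assume k: "1 \<le> k" and e: "1 \<le> e"
  define K where "K = real k * real e"
  have k1: "1 \<le> real k" and e1: "1 \<le> real e" using k e by auto
  have kK: "real k \<le> K" "real e \<le> K" using mult_left_mono[OF e1, of "real k"] mult_right_mono[OF k1, of "real e"] by (auto simp: K_def)
  have K1: "1 \<le> K" using kK k1 by linarith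
  have Kp: "K ^ i \<le> K ^ j" if "i \<le> j" for i j using that K1 by (intro power_increasing)
  define \<kappa> where "\<kappa> = (2 * real k) powr p * real k"
  have \<kappa>0: "0 < \<kappa>" using k1 by (simp add: \<kappa>_def)
  have \<kappa>: "\<kappa> \<le> 2 ^ P * K ^ (P + 1)"
  proof -
   have "(2 * real k) powr p \<le> (2 * real k) powr real P" using P k1 by (intro powr_mono) auto
   also have "\<dots> = (2 * real k) ^ P" using k1 by (intro powr_realpow) simp
   also have "\<dots> \<le> (2 * K) ^ P" using kK by (intro power_mono) auto
   finally have "\<kappa> \<le> (2 * K) ^ P * K" unfolding \<kappa>_def using kK K1 by (intro mult_mono) auto
   then show ?thesis by (simp add: power_mult_distrib mult_ac)
  qed
  define G0 where "G0 = c * (k * e) ^ a"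
  have G0: "real G0 = real c * K ^ a" by (simp add: G0_def K_def)
  have c0: "1 \<le> real c" by (simp add: c_def)
  define g where "g = 1 / (64 * real e)"
  have g0: "0 < g" using e1 by (simp add: g_def)
  show "\<exists>G0 :: nat. 8 * real k * (p + 2 * ((2 * real k) powr p * real k) + 1) \<le> real G0 * (1 / (64 * real e)) \<and>
   (2 * real G0 + 1) ^ k * exp (- ((1 / (64 * real e))\<^sup>2 * real (C * (k * e) ^ A) / (128 * 4 powr p * ((2 * real k) powr p * real k))))
    < 1 / (64 * real e) / (1 + 1 / (64 * real e))"
   unfolding \<kappa>_def[symmetric] g_def[symmetric]
  proof (intro exI[of _ G0] conjI)
   have "8 * real k * (p + 2 * \<kappa> + 1) * (64 * real e) = 512 * (K * (p + 2 * \<kappa> + 1))" by (simp add: K_def)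
   also have "\<dots> \<le> 512 * (K * (real (P + 1 + 2 ^ (P + 1)) * K ^ (P + 1)))"
   proof (intro mult_left_mono)
    have "1 \<le> K ^ (P + 1)" using K1 by (rule one_le_power)
    then have "real (P + 1) * 1 \<le> real (P + 1) * K ^ (P + 1)" by (intro mult_left_mono) auto
    moreover have "p + 1 \<le> real (P + 1) * 1" using P by simp
    ultimately have "p + 2 * \<kappa> + 1 \<le> real (P + 1) * K ^ (P + 1) + 2 * (2 ^ P * K ^ (P + 1))" using \<kappa> by linarith
    then show "p + 2 * \<kappa> + 1 \<le> real (P + 1 + 2 ^ (P + 1)) * K ^ (P + 1)" by (simp add: algebra_simps)
   qed (use K1 in auto)
   also have "\<dots> = real G0" by (simp add: G0 c_def a_def)
   finally show "8 * real k * (p + 2 * \<kappa> + 1) \<le> real G0 * g" using e1 by (simp add: g_def field_simps)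
  next
   let ?L = "real k * (2 * real G0 + 1) + (64 * real e + 1)"
   let ?D = "128 * 4 powr p * \<kappa>"
   have D0: "0 < ?D" using \<kappa>0 by simp
   have G1: "1 \<le> real G0" using c0 one_le_power[OF K1, of a] mult_mono[of 1 "real c" 1 "K ^ a"] by (simp add: G0)
   have "?L < real k * (3 * real G0) + 66 * K"
    using mult_left_mono[of "2 * real G0 + 1" "3 * real G0" "real k"] G1 kK K1 by simp
   also have "\<dots> \<le> K * (3 * (real c * K ^ a)) + 66 * K ^ (a + 1)"
    using kK K1 c0 Kp[of 1 "a + 1"] unfolding G0 by (intro add_mono mult_right_mono) auto
   also have "\<dots> = real (3 * c + 66) * K ^ (a + 1)" by (simp add: algebra_simps)
   finally have L: "?L < real (3 * c + 66) * K ^ (a + 1)" .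
   have D: "?D \<le> 128 * 4 ^ P * (2 ^ P * K ^ (P + 1))"
   proof (rule mult_mono[OF _ \<kappa>])
    have "(4 :: real) powr p \<le> 4 powr real P" using P by (intro powr_mono) auto
    then show "128 * 4 powr p \<le> 128 * (4 :: real) ^ P" by (simp add: powr_realpow)
   qed (use \<kappa>0 in auto)
   have L0: "0 \<le> ?L" by simp
   have "?L * ?D * (4096 * (real e)\<^sup>2) < real (3 * c + 66) * K ^ (a + 1) * (128 * 4 ^ P * (2 ^ P * K ^ (P + 1))) * (4096 * K\<^sup>2)"
   proof (rule mult_less_le_imp_less)
    show "?L * ?D < real (3 * c + 66) * K ^ (a + 1) * (128 * 4 ^ P * (2 ^ P * K ^ (P + 1)))"
     by (rule mult_less_le_imp_less[OF L D L0 D0])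
    show "4096 * (real e)\<^sup>2 \<le> 4096 * K\<^sup>2" using kK by (simp add: power_mono)
    show "0 \<le> ?L * ?D" using L0 D0 by (simp only: mult_nonneg_nonneg less_imp_le)
    show "0 < 4096 * (real e)\<^sup>2" using e1 by simp
   qed
   also have "\<dots> = real (128 * 4 ^ P * 2 ^ P * 4096 * (3 * c + 66)) * K ^ A"
    by (simp add: A_def power_add power2_eq_square mult_ac)
   also have "\<dots> \<le> real C * K ^ A" using K1 by (intro mult_right_mono) (simp_all only: C_def of_nat_le_iff le_add1, simp)
   also have "real C * K ^ A = real (C * (k * e) ^ A)" by (simp add: K_def)
   finally have m: "?L * ?D * (4096 * (real e)\<^sup>2) < real (C * (k * e) ^ A)" .
   define M where "M = real (C * (k * e) ^ A)"
   have "?L < g\<^sup>2 * M / ?D"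
   proof -
    have "g\<^sup>2 * M = M / (4096 * (real e)\<^sup>2)" by (simp add: g_def power2_eq_square)
    moreover have "?L * ?D < M / (4096 * (real e)\<^sup>2)" using m e1 unfolding M_def by (subst pos_less_divide_eq) auto
    ultimately show ?thesis using D0 by (simp only: pos_less_divide_eq)
   qed
   then have "exp (- (g\<^sup>2 * M / ?D)) < exp (- ?L)" by simp
   also have "\<dots> = exp (- (real k * (2 * real G0 + 1))) * exp (- (64 * real e + 1))" by (simp add: exp_add[symmetric])
   finally have ex: "exp (- (g\<^sup>2 * M / ?D)) < exp (- (real k * (2 * real G0 + 1))) * exp (- (64 * real e + 1))" .
   have "(2 * real G0 + 1) ^ k \<le> exp (2 * real G0 + 1) ^ k" by (intro power_mono order_trans[OF _ exp_ge_add_one_self]) auto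
   also have "\<dots> = exp (real k * (2 * real G0 + 1))" by (simp add: exp_of_nat_mult)
   finally have "(2 * real G0 + 1) ^ k * exp (- (g\<^sup>2 * M / ?D))
     < exp (real k * (2 * real G0 + 1)) * (exp (- (real k * (2 * real G0 + 1))) * exp (- (64 * real e + 1)))"
    using ex by (intro mult_le_less_imp_less) auto
   also have "\<dots> = exp (- (64 * real e + 1))" by (simp add: exp_add[symmetric])
   also have "\<dots> \<le> 1 / (64 * real e + 1)"
    unfolding exp_minus inverse_eq_divide using e1 exp_ge_add_one_self[of "64 * real e + 1"] by (intro divide_left_mono) auto
   also have "\<dots> = g / (1 + g)" using e1 by (simp add: g_def field_simps)
   finally show "(2 * real G0 + 1) ^ k * exp (- (g\<^sup>2 * real (C * (k * e) ^ A) / ?D)) < g / (1 + g)" by (simp only: M_def)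
  qed
 qed
qed

text \<open>For \<open>p \<le> y\<close> the exponential is at most \<open>1 + 2 * p / y\<close>,
  and the second factor adds at most \<open>(1 + 2 * p) / y\<close>.\<close>

lemma rate_bound:
 fixes p y \<gamma> :: real
 assumes "1 \<le> p" "1 \<le> y" "(4 * p + 1) \<le> \<gamma> * y" "\<gamma> \<le> 1"
 shows "exp (p / y) * (1 + 1 / y ^ 2) \<le> 1 + \<gamma>"
proof -
 have "\<gamma> * y \<le> 1 * y" using assms by (intro mult_right_mono) auto
 then have "p \<le> y" using assms by linarith
 then have py: "0 \<le> p / y" "p / y \<le> 1" using assms by (simp_all add: divide_le_eq_1)
 have "exp (p / y) \<le> 1 + p / y + (p / y)\<^sup>2" using py by (rule exp_bound)
 also have "\<dots> \<le> 1 + 2 * (p / y)" using mult_left_mono[OF py(2,1)] by (simp add: power2_eq_square)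
 finally have "exp (p / y) * (1 + 1 / y ^ 2) \<le> (1 + 2 * (p / y)) * (1 + 1 / y ^ 2)" by (intro mult_right_mono) auto
 also have "\<dots> \<le> 1 + 2 * (p / y) + (1 + 2 * (p / y)) * (1 / y ^ 2)" by (simp add: algebra_simps)
 also have "(1 + 2 * (p / y)) * (1 / y ^ 2) \<le> (1 + 2 * p) * (1 / y)"
 proof (rule mult_mono)
  have "p / y \<le> p / 1" using assms by (intro divide_left_mono) auto
  then show "1 + 2 * (p / y) \<le> 1 + 2 * p" by simp
  show "1 / y ^ 2 \<le> 1 / y" using assms by (intro divide_left_mono self_le_power) auto
 qed (use assms in auto)
 also have "1 + 2 * (p / y) + (1 + 2 * p) * (1 / y) = 1 + (4 * p + 1) / y" by (simp add: add_divide_distrib algebra_simps)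
 also have "(4 * p + 1) / y \<le> \<gamma>" using assms by (subst pos_divide_le_eq) auto
 finally show ?thesis by simp
qed

section \<open>Computing the parameters with bounded intermediate values\<close>

definition POW :: "nat => nat => nat => hcom" where
 "POW z x b = Sq (NC (S z) 1) (For 18 b (NO NTimes (S z) (S z) (S x)))"

text \<open>Exact values of all scalars are tracked: this part of the program does let numbers grow,
  so each intermediate value has to be compared with \<open>X\<close>.\<close>

definition triple :: "nat => (nat => nat) => hcom => (nat => nat) => bool" where
 "triple X f P g \<longleftrightarrow> (\<forall>s. bnd X s \<longrightarrow> (\<forall>a. hN s a 0 0 = f a) \<longrightarrow>
   safe X P s \<and> bnd X (run P s) \<and> (\<forall>a. hN (run P s) a 0 0 = g a))"

lemma hN_setn_scalar: "hN (setn s (S z) v) a 0 0 = (if a = z then v else hN s a 0 0)"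
 by (simp add: setn_def upd3_def)

lemma nv_S: "nv s (S z) = hN s z 0 0" by (simp add: nv_def)

lemma triple_NC: "c \<le> X ==> triple X f (NC (S z) c) (f(z := c))"
 by (simp add: triple_def bnd_setn hN_setn_scalar)

lemma triple_NO: "nopv q (f x) (f y) \<le> X ==> triple X f (NO q (S z) (S x) (S y)) (f(z := nopv q (f x) (f y)))"
 by (simp add: triple_def bnd_setn hN_setn_scalar nv_S)

lemma triple_Sq: "triple X f P g ==> triple X g Q h ==> triple X f (Sq P Q) h"
 by (simp add: triple_def)

lemma triple_POW:
 assumes "z \<noteq> x" "z \<noteq> b" "z \<noteq> 18" "x \<noteq> 18" "b \<noteq> 18" "1 \<le> f x" "f x ^ f b \<le> X" "f b \<le> X" "1 \<le> X"
 shows "triple X f (POW z x b) (f(z := f x ^ f b, 18 := f b))"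
 unfolding triple_def
proof (intro allI impI)
 fix s assume s: "bnd X s" "\<forall>a. hN s a 0 0 = f a"
 define s0 where "s0 = setn s (S z) 1"
 let ?P = "NO NTimes (S z) (S z) (S x)"
 have it: "bnd X (iter (run ?P) 18 i s0) \<and>
  (\<forall>a. a \<noteq> 18 \<longrightarrow> hN (iter (run ?P) 18 i s0) a 0 0 = (if a = z then f x ^ i else f a))" if "i \<le> f b" for i
  using that
 proof (induction i)
  case 0
  then show ?case using s assms by (simp add: s0_def bnd_setn hN_setn_scalar)
 next
  case (Suc i)
  let ?t = "setn (iter (run ?P) 18 i s0) (S 18) i"
  have IH: "bnd X ?t" "\<And>a. a \<noteq> 18 ==> hN ?t a 0 0 = (if a = z then f x ^ i else f a)"
   using Suc assms by (auto intro!: bnd_setn simp: hN_setn_scalar)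
  have "f x ^ Suc i \<le> f x ^ f b" using Suc.prems assms by (intro power_increasing) auto
  then have "nv ?t (S z) * nv ?t (S x) \<le> X" using IH(2) assms by (simp add: nv_S mult.commute)
  moreover have "nv ?t (S z) * nv ?t (S x) = f x ^ Suc i" using IH(2) assms by (simp add: nv_S mult.commute)
  ultimately show ?case using IH by (simp add: bnd_setn hN_setn_scalar)
 qed
 have sf: "safe X ?P (setn (iter (run ?P) 18 i s0) (S 18) i)" if "i < f b" for i
 proof -
  have "bnd X (setn (iter (run ?P) 18 i s0) (S 18) i)" using it[of i] that assms by (intro bnd_setn) auto
  then show ?thesis using it[of "Suc i"] that by simp
 qed
 have b: "hN s0 b 0 0 = f b" using s assms by (simp add: s0_def hN_setn_scalar)
 have b0: "bnd X s0" using s assms by (simp add: s0_def bnd_setn)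
 have r: "run (POW z x b) s = setn (iter (run ?P) 18 (f b) s0) (S 18) (f b)"
  using b by (simp add: POW_def s0_def)
 show "safe X (POW z x b) s \<and> bnd X (run (POW z x b) s) \<and> (\<forall>a. hN (run (POW z x b) s) a 0 0 = (f(z := f x ^ f b, 18 := f b)) a)"
 proof (intro conjI)
  show "safe X (POW z x b) s" unfolding POW_def using s(1) b0 b sf by (simp add: s0_def)
  show "bnd X (run (POW z x b) s)" unfolding r using it[of "f b"] assms by (intro bnd_setn) auto
  show "\<forall>a. hN (run (POW z x b) s) a 0 0 = (f(z := f x ^ f b, 18 := f b)) a"
   unfolding r using it[of "f b"] by (simp add: hN_setn_scalar)
 qed
qed

definition SETUP :: "nat => nat => nat => hcom" where
 "SETUP a c c' = foldr Sq
  [NO NTimes (S 17) (S 2) (S 3), NC (S 19) a, POW 4 17 19, NC (S 19) c, NO NTimes (S 4) (S 4) (S 19),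
   NO NPlus (S 5) (S 0) (S 1), NO NPlus (S 5) (S 5) (S 4), NO NPlus (S 5) (S 5) (S 17), NC (S 19) c', NO NTimes (S 5) (S 5) (S 19),
   NC (S 12) 1, NO NPlus (S 19) (S 2) (S 12), NC (S 21) 8, NO NTimes (S 19) (S 19) (S 21), POW 21 19 2, NO NTimes (S 5) (S 5) (S 21),
   NC (S 19) 28, POW 6 5 19, NO NTimes (S 7) (S 6) (S 5), NC (S 19) 3, POW 9 5 19,
   NO NTimes (S 19) (S 2) (S 4), NO NPlus (S 19) (S 19) (S 4), NO NPlus (S 19) (S 19) (S 2), POW 8 7 19,
   NO NPlus (S 10) (S 4) (S 2), NO NPlus (S 11) (S 0) (S 2), NC (S 16) 2, NO NTimes (S 13) (S 0) (S 1), NO NPlus (S 13) (S 13) (S 16),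
   NO NTimes (S 14) (S 0) (S 2), NO NTimes (S 15) (S 2) (S 1)] (NO NPlus (S 15) (S 15) (S 14))"

definition mm :: "nat => nat => nat => nat => nat" where "mm a c k e = c * (k * e) ^ a"
text \<open>One number above all quantities of the analysis: the sum covers n, d, m, k and e, the
  power covers \<open>8 ^ k\<close> and \<open>(k + 1) ^ k\<close>, and \<open>c'\<close> makes
  \<open>1 / Y\<close> and \<open>p / Y\<close> small against \<gamma> =
  \<open>1 / (64 * e)\<close>.\<close>

definition YY :: "nat => nat => nat => nat => nat => nat => nat => nat" where
 "YY a c c' n d k e = c' * (n + d + mm a c k e + k * e) * (8 * (k + 1)) ^ k"
text \<open>The exponent is the sum of the lengths of the codes: m digits for columns or weights, k
  for rows and for a regression, \<open>k * m\<close> for entries.\<close>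

definition XX :: "nat => nat => nat => nat => nat => nat => nat => nat" where
 "XX a c c' n d k e = (YY a c c' n d k e ^ 29) ^ (k * mm a c k e + mm a c k e + k)"

lemma SETUP_wf: "wf_com (SETUP a c c')" by (simp add: SETUP_def POW_def)
lemma SETUP_puts: "\<not> puts (SETUP a c c')" by (simp add: SETUP_def POW_def)

lemma YY_bounds:
 assumes "1 \<le> n" "1 \<le> d" "1 \<le> k" "1 \<le> e" "1 \<le> a" "a \<le> c" "128 \<le> c'"
 defines "Y \<equiv> YY a c c' n d k e" and "m \<equiv> mm a c k e"
 shows "128 \<le> Y" "n \<le> Y" "d \<le> Y" "k \<le> Y" "m \<le> Y" "1 \<le> m" "(k + 1) ^ k \<le> Y" "8 ^ k \<le> Y" "e \<le> Y" "c' \<le> Y" "c' * e \<le> Y" "c \<le> Y" "a \<le> Y"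
  "(8 * (k + 1)) ^ k \<le> Y" "8 * (k + 1) \<le> Y" "k * e \<le> Y" "(k * e) ^ a \<le> Y" "n + d + m + k * e \<le> Y" "c' * (n + d + m + k * e) \<le> Y"
proof -
 let ?s = "n + d + m + k * e" and ?t = "(8 * (k + 1)) ^ k"
 have Y: "Y = c' * ?s * ?t" by (simp add: Y_def YY_def m_def)
 have ke: "1 \<le> k * e" "1 \<le> (k * e) ^ a" using assms by (auto simp: Suc_le_eq)
 have t: "1 \<le> ?t" by simp
 show st: "c' * ?s \<le> Y" using t unfolding Y by (metis mult.right_neutral mult_le_mono2)
 have c1: "1 \<le> c'" using assms by simp
 have "1 * ?s \<le> c' * ?s" using c1 by (intro mult_le_mono1)
 then have "?s \<le> c' * ?s" by (simp only: mult_1)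
 then show s: "?s \<le> Y" using st by (rule order_trans)
 have "c' * (k * e) \<le> c' * ?s" "c' * n \<le> c' * ?s" by (simp_all add: mult_le_mono2)
 moreover have "c' * e \<le> c' * (k * e)" "c' * 1 \<le> c' * n" using assms by (intro mult_le_mono2; simp)+
 ultimately show "c' * e \<le> Y" and cY: "c' \<le> Y" using st by linarith+
 show "128 \<le> Y" using cY assms by simp
 show "n \<le> Y" "d \<le> Y" "m \<le> Y" "k * e \<le> Y" using s by simp_all
 have "k * 1 \<le> k * e" "1 * e \<le> k * e" using assms by (intro mult_le_mono; simp)+
 then show "k \<le> Y" "e \<le> Y" using s by linarith+
 have "1 * ?t \<le> c' * ?s * ?t" using c1 assms by (intro mult_le_mono1) (simp add: Suc_le_eq)
 then show t': "?t \<le> Y" by (simp add: Y)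
 have "(k + 1) ^ k \<le> ?t" "8 ^ k \<le> ?t" by (intro power_mono; simp)+
 then show "(k + 1) ^ k \<le> Y" "8 ^ k \<le> Y" using t' by simp_all
 have "8 * (k + 1) \<le> ?t" using assms by (intro self_le_power) auto
 then show "8 * (k + 1) \<le> Y" using t' by simp
 have c0: "1 \<le> c" using assms by simp
 have "c * 1 \<le> m" "1 * (k * e) ^ a \<le> m" unfolding m_def mm_def using ke c0 by (intro mult_le_mono; simp)+
 then show "c \<le> Y" "(k * e) ^ a \<le> Y" "1 \<le> m" using s c0 by linarith+
 then show "a \<le> Y" using assms by simp
qed

lemma triple_NO':
 "nopv q (f x) (f y) = w ==> w \<le> X ==> triple X f (NO q (S z) (S x) (S y)) (f(z := w))"
 using triple_NO[of q f x y X z] by simp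

lemma triple_POW':
 assumes "f b = v" "f x ^ v = w" "1 \<le> f x" "w \<le> X" "v \<le> X" "z \<noteq> x \<and> z \<noteq> b \<and> z \<noteq> 18 \<and> x \<noteq> 18 \<and> b \<noteq> 18" "1 \<le> X"
 shows "triple X f (POW z x b) (f(z := w, 18 := v))"
 using triple_POW[of z x b f X] assms by simp

lemma SETUP_triple:
 assumes "1 \<le> n" "1 \<le> d" "1 \<le> k" "1 \<le> e" "1 \<le> a" "a \<le> c" "128 \<le> c'"
  and f: "f 0 = n" "f 1 = d" "f 2 = k" "f 3 = e"
 defines "Y \<equiv> YY a c c' n d k e" and "m \<equiv> mm a c k e" and "X \<equiv> XX a c c' n d k e"
 shows "\<exists>g. triple X f (SETUP a c c') g \<and> g 0 = n \<and> g 1 = d \<and> g 2 = k \<and> g 4 = m \<and> g 5 = Y \<and> g 6 = Y ^ 28 \<and> g 7 = Y ^ 29 \<and> g 8 = X \<and>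
  g 9 = Y ^ 3 \<and> g 10 = m + k \<and> g 11 = n + k \<and> g 12 = 1 \<and> g 13 = n * d + 2 \<and> g 14 = n * k \<and> g 15 = n * k + k * d \<and> g 16 = 2"
  and "Y ^ 29 \<le> X"
proof -
 note Yb = YY_bounds[OF assms(1-7), folded Y_def m_def]
 have Xeq: "X = (Y ^ 29) ^ (k * m + m + k)" by (simp add: X_def XX_def Y_def m_def)
 have Y1: "1 \<le> Y" using Yb(1) by simp
 have Yp: "Y ^ i \<le> Y ^ j" if "i \<le> j" for i j using that Y1 by (intro power_increasing)
 have "(Y ^ 29) ^ 1 \<le> X" unfolding Xeq using Y1 assms(3) by (intro power_increasing) auto
 then show YX: "Y ^ 29 \<le> X" by simp
 have YiX: "v \<le> X" if "v \<le> Y ^ i" "i \<le> 29" for v i using that Yp[of i 29] YX by linarith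
 have X1: "v \<le> X" if "v \<le> Y" for v using YiX[of v 1] that by simp
 have c3: "3 * (Y * Y) \<le> Y * (Y * Y)" using Yb(1) by (intro mult_le_mono1) simp
 have X3: "u * v + w \<le> X" if "u \<le> Y" "v \<le> Y" "w \<le> Y" for u v w
 proof (rule YiX[of _ 3])
  have "u * v + w \<le> Y * Y + Y" using that by (intro add_mono mult_le_mono)
  also have "\<dots> \<le> Y * Y + Y * Y" using Y1 by simp
  also have "\<dots> \<le> Y * (Y * Y)" using c3 by linarith
  finally show "u * v + w \<le> Y ^ 3" by (simp add: power3_eq_cube)
 qed simp
 have X4: "u * v + w + w' \<le> X" if "u \<le> Y" "v \<le> Y" "w \<le> Y" "w' \<le> Y" for u v w w'
 proof (rule YiX[of _ 3])
  have "u * v + w + w' \<le> Y * Y + Y + Y" using that by (intro add_mono mult_le_mono)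
  also have "\<dots> \<le> Y * Y + Y * Y + Y * Y" using Y1 by (intro add_mono) auto
  also have "\<dots> \<le> Y * (Y * Y)" using c3 by linarith
  finally show "u * v + w + w' \<le> Y ^ 3" by (simp add: power3_eq_cube)
 qed simp
 have sm: "28 \<le> Y" "8 \<le> Y" "3 \<le> Y" "2 \<le> Y" using Yb(1) by auto
 have xs: "k * e \<le> X" "a \<le> X" "(k * e) ^ a \<le> X" "c \<le> X" "m \<le> X" "n + d \<le> X" "n + d + m \<le> X" "n + d + m + k * e \<le> X" "c' \<le> X"
  "c' * (n + d + m + k * e) \<le> X" "1 \<le> X" "k + 1 \<le> X" "8 \<le> X" "8 * (k + 1) \<le> X" "(8 * (k + 1)) ^ k \<le> X" "k \<le> X" "Y \<le> X" "28 \<le> X" "Y ^ 28 \<le> X"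
  "3 \<le> X" "Y ^ 3 \<le> X" "2 \<le> X"
  using Yb Y1 sm YiX[of "Y ^ 28" 28] YiX[of "Y ^ 3" 3] by (auto intro!: X1)
 have xt: "k * m \<le> X" "k * m + m \<le> X" "k * m + m + k \<le> X" "m + k \<le> X" "n + k \<le> X" "n * d \<le> X" "n * d + 2 \<le> X" "n * k \<le> X" "k * d \<le> X"
  using X3[of k m 0] X3[of k m m] X4[of k m m k] X3[of m 1 k] X3[of n 1 k] X3[of n d 0] X3[of n d 2] X3[of n k 0] X3[of k d 0] Yb sm Y1 by auto
 have "n * k + k * d \<le> X"
 proof (rule YiX[of _ 3])
  have "n * k + k * d \<le> Y * Y + Y * Y" using Yb by (intro add_mono mult_le_mono) auto
  also have "\<dots> \<le> Y * (Y * Y)" using c3 by linarith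
  finally show "n * k + k * d \<le> Y ^ 3" by (simp add: power3_eq_cube)
 qed simp
 note xs = xs xt this
 \<comment> \<open>Opaque names keep the simplifier from expanding the powers while the
   straight-line program is traced.\<close>
 define KE where "KE = k * e"
 define K8 where "K8 = 8 * (k + 1)"
 define B where "B = K8 ^ k"
 define S1 where "S1 = n + d + m + KE"
 define S2 where "S2 = c' * S1"
 define H where "H = Y ^ 28"
 define G where "G = Y ^ 29"
 define L where "L = Y ^ 3"
 define E1 where "E1 = k * m + m + k"
 define R where "R = KE ^ a"
 note xs = xs[folded KE_def, folded S1_def E1_def R_def H_def G_def L_def, folded S2_def, folded K8_def, folded B_def] YX[folded G_def] order.refl[of X]
 have eqs: "R * c = m" "S2 * B = Y" "H * Y = G" "G ^ E1 = X" "Y ^ 28 = H" "Y ^ 3 = L" "KE ^ a = R" "k * e = KE" "S1 * c' = S2" "K8 ^ k = B"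
  by (simp_all add: KE_def R_def m_def mm_def S2_def S1_def B_def K8_def Y_def YY_def E1_def G_def H_def L_def X_def XX_def mult_ac flip: power_Suc)
 have pos: "Suc 0 \<le> KE" "Suc 0 \<le> Y" "Suc 0 \<le> G" "Suc 0 \<le> K8" using assms Y1 by (simp_all add: Suc_le_eq G_def K8_def KE_def)
 have gr: "Y ^ 29 = G" by (simp add: G_def)
 show "\<exists>g. triple X f (SETUP a c c') g \<and> g 0 = n \<and> g 1 = d \<and> g 2 = k \<and> g 4 = m \<and> g 5 = Y \<and> g 6 = Y ^ 28 \<and> g 7 = Y ^ 29 \<and> g 8 = X \<and>
  g 9 = Y ^ 3 \<and> g 10 = m + k \<and> g 11 = n + k \<and> g 12 = 1 \<and> g 13 = n * d + 2 \<and> g 14 = n * k \<and> g 15 = n * k + k * d \<and> g 16 = 2"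
  unfolding SETUP_def foldr.simps o_apply id_apply gr eqs(5,6)
  apply (rule exI, rule conjI)
  apply (rule triple_Sq, rule triple_NO'[where w = KE], simp add: f f[simplified] eqs, rule xs)
  apply (rule triple_Sq, rule triple_NC, rule xs)
  apply (rule triple_Sq, rule triple_POW'[where v = "a" and w = "R"], simp add: f f[simplified], simp add: f f[simplified] eqs, simp add: f f[simplified] pos, rule xs, rule xs, simp, rule xs)
  apply (rule triple_Sq, rule triple_NC, rule xs)
  apply (rule triple_Sq, rule triple_NO'[where w = "m"], simp add: f f[simplified] eqs, rule xs)
  apply (rule triple_Sq, rule triple_NO'[where w = "n + d"], simp add: f f[simplified] eqs, rule xs)
  apply (rule triple_Sq, rule triple_NO'[where w = "n + d + m"], simp add: f f[simplified] eqs, rule xs)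
  apply (rule triple_Sq, rule triple_NO'[where w = "S1"], simp add: f f[simplified] eqs S1_def, rule xs)
  apply (rule triple_Sq, rule triple_NC, rule xs)
  apply (rule triple_Sq, rule triple_NO'[where w = "S2"], simp add: f f[simplified] eqs, rule xs)
  apply (rule triple_Sq, rule triple_NC, rule xs)
  apply (rule triple_Sq, rule triple_NO'[where w = "k + 1"], simp add: f f[simplified] eqs, rule xs)
  apply (rule triple_Sq, rule triple_NC, rule xs)
  apply (rule triple_Sq, rule triple_NO'[where w = "K8"], simp add: f f[simplified] eqs K8_def, rule xs)
  apply (rule triple_Sq, rule triple_POW'[where v = "k" and w = "B"], simp add: f f[simplified], simp add: f f[simplified] eqs, simp add: f f[simplified] pos, rule xs, rule xs, simp, rule xs)
  apply (rule triple_Sq, rule triple_NO'[where w = "Y"], simp add: f f[simplified] eqs, rule xs)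
  apply (rule triple_Sq, rule triple_NC, rule xs)
  apply (rule triple_Sq, rule triple_POW'[where v = "28" and w = "H"], simp add: f f[simplified], simp add: f f[simplified] eqs, simp add: f f[simplified] pos, rule xs, rule xs, simp, rule xs)
  apply (rule triple_Sq, rule triple_NO'[where w = "G"], simp add: f f[simplified] eqs, rule xs)
  apply (rule triple_Sq, rule triple_NC, rule xs)
  apply (rule triple_Sq, rule triple_POW'[where v = "3" and w = "L"], simp add: f f[simplified], simp add: f f[simplified] eqs, simp add: f f[simplified] pos, rule xs, rule xs, simp, rule xs)
  apply (rule triple_Sq, rule triple_NO'[where w = "k * m"], simp add: f f[simplified] eqs, rule xs)
  apply (rule triple_Sq, rule triple_NO'[where w = "k * m + m"], simp add: f f[simplified] eqs, rule xs)
  apply (rule triple_Sq, rule triple_NO'[where w = "E1"], simp add: f f[simplified] eqs E1_def, rule xs)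
  apply (rule triple_Sq, rule triple_POW'[where v = E1 and w = X])
  apply (simp add: f)
  apply (simp add: eqs)
  apply (simp add: pos)
  apply (rule order.refl)
  apply (rule xs)
  apply simp
  apply (rule xs)
  apply (rule triple_Sq, rule triple_NO'[where w = "m + k"], simp add: f f[simplified] eqs, rule xs)
  apply (rule triple_Sq, rule triple_NO'[where w = "n + k"], simp add: f f[simplified] eqs, rule xs)
  apply (rule triple_Sq, rule triple_NC, rule xs)
  apply (rule triple_Sq, rule triple_NO'[where w = "n * d"], simp add: f f[simplified] eqs, rule xs)
  apply (rule triple_Sq, rule triple_NO'[where w = "n * d + 2"], simp add: f f[simplified] eqs, rule xs)
  apply (rule triple_Sq, rule triple_NO'[where w = "n * k"], simp add: f f[simplified] eqs, rule xs)
  apply (rule triple_Sq, rule triple_NO'[where w = "k * d"], simp add: f f[simplified] eqs, rule xs)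
  apply (rule triple_NO'[where w = "n * k + k * d"], simp add: f f[simplified] eqs, rule xs)
  by (simp add: f f[simplified])
qed

text \<open>This prologue precedes the structured language because it provides the base address:
  \<open>t * t\<close> with \<open>t = n + d + k + 2\<close> leaves room for input and output. As
  reals cannot be converted to naturals, the ceiling of 1 / \<epsilon> is found by adding up
  \<epsilon> until 1 is reached.\<close>

definition PRE :: prog where
 "PRE = Seq (seqs [NAdd (Dir 50) (Dir 0) (Dir 1), NAdd (Dir 50) (Dir 50) (Dir 2), NConst (Dir 52) 1, NConst (Dir 51) 2,
   NAdd (Dir 50) (Dir 50) (Dir 51), NConst (Dir 51) 0])
  (Seq (Loop (NLess (Dir 51) (Dir 50)) (seqs [NAdd (Dir 63) (Dir 63) (Dir 50), NAdd (Dir 51) (Dir 51) (Dir 52)]))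
  (Seq (seqs [NConst (Dir 53) 50, NAdd (Dir 53) (Dir 53) (Dir 63), NAdd (Dir 54) (Dir 53) (Dir 52), RConst (Ind 53) 0, RConst (Ind 54) 1])
  (Loop (RLess (Ind 53) (Ind 54)) (seqs [RAdd (Ind 53) (Ind 53) (Dir 1), NAdd (Dir 3) (Dir 3) (Dir 52)]))))"

lemma PRE_run:
 assumes s0: "nmem s0 = (%a. if a = 0 then n else if a = 1 then d else if a = 2 then k else 0)"
  and \<epsilon>: "rmem s0 1 = \<epsilon>" "0 < \<epsilon>"
 defines "e \<equiv> nat \<lceil>1 / \<epsilon>\<rceil>" and "t \<equiv> n + d + k + 2"
 shows "runs PRE s0 (6 + (Suc (t * Suc 2) + (5 + Suc (e * Suc 2)))) (%s. nmem s 63 = t * t \<and> nmem s 0 = n \<and> nmem s 1 = d \<and> nmem s 2 = k \<and>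
  nmem s 3 = e \<and> (\<forall>q. 4 \<le> q \<longrightarrow> q < 50 \<or> 63 < q \<longrightarrow> nmem s q = 0) \<and> (\<forall>x<t * t. rmem s x = rmem s0 x))"
proof -
 define Z where "Z s \<longleftrightarrow> nmem s 0 = n \<and> nmem s 1 = d \<and> nmem s 2 = k \<and> (\<forall>q. 4 \<le> q \<longrightarrow> q < 50 \<or> 63 < q \<longrightarrow> nmem s q = 0)" for s :: ram
 define J1 where "J1 s \<longleftrightarrow> Z s \<and> nmem s 3 = 0 \<and> nmem s 50 = t \<and> nmem s 52 = 1 \<and> nmem s 51 \<le> t \<and> nmem s 63 = nmem s 51 * t \<and> rmem s = rmem s0" for s :: ram
 define J2 where "J2 s \<longleftrightarrow> Z s \<and> nmem s 3 \<le> e \<and> nmem s 52 = 1 \<and> nmem s 53 = t * t + 50 \<and> nmem s 54 = t * t + 51 \<and> nmem s 63 = t * t \<and>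
  rmem s (t * t + 50) = real (nmem s 3) * \<epsilon> \<and> rmem s (t * t + 51) = 1 \<and> (\<forall>x<t * t. rmem s x = rmem s0 x)" for s :: ram
 have t1: "1 < t * t" using mult_le_mono[of 2 t 2 t] by (simp add: t_def)
 have e: "i < e" if "real i * \<epsilon> < 1" for i
 proof -
  have "real i < 1 / \<epsilon>" using that \<epsilon> by (simp add: field_simps)
  then show ?thesis unfolding e_def by linarith
 qed
 have e': "e \<le> i" if "\<not> real i * \<epsilon> < 1" for i
 proof -
  have "1 / \<epsilon> \<le> real i" using that \<epsilon> by (simp add: field_simps)
  then show ?thesis unfolding e_def by linarith
 qed
 show ?thesis unfolding PRE_def
 proof (rule runs_Seq2)
  show "runs (seqs [NAdd (Dir 50) (Dir 0) (Dir 1), NAdd (Dir 50) (Dir 50) (Dir 2), NConst (Dir 52) 1, NConst (Dir 51) 2,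
   NAdd (Dir 50) (Dir 50) (Dir 51), NConst (Dir 51) 0]) s0 6 (%s. J1 s \<and> nmem s 51 = 0)"
   by (intro runs_seqs) (auto simp: ram_simps J1_def Z_def t_def s0)
 next
  fix s1 assume s1: "J1 s1 \<and> nmem s1 51 = 0"
  show "runs (Seq (Loop (NLess (Dir 51) (Dir 50)) (seqs [NAdd (Dir 63) (Dir 63) (Dir 50), NAdd (Dir 51) (Dir 51) (Dir 52)]))
   (Seq (seqs [NConst (Dir 53) 50, NAdd (Dir 53) (Dir 53) (Dir 63), NAdd (Dir 54) (Dir 53) (Dir 52), RConst (Ind 53) 0, RConst (Ind 54) 1])
   (Loop (RLess (Ind 53) (Ind 54)) (seqs [RAdd (Ind 53) (Ind 53) (Dir 1), NAdd (Dir 3) (Dir 3) (Dir 52)])))) s1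
   (Suc (t * Suc 2) + (5 + Suc (e * Suc 2))) (%s. nmem s 63 = t * t \<and> nmem s 0 = n \<and> nmem s 1 = d \<and> nmem s 2 = k \<and>
  nmem s 3 = e \<and> (\<forall>q. 4 \<le> q \<longrightarrow> q < 50 \<or> 63 < q \<longrightarrow> nmem s q = 0) \<and> (\<forall>x<t * t. rmem s x = rmem s0 x))"
  proof (rule runs_Seq2)
   have "runs (Loop (NLess (Dir 51) (Dir 50)) (seqs [NAdd (Dir 63) (Dir 63) (Dir 50), NAdd (Dir 51) (Dir 51) (Dir 52)])) s1
    (Suc ((t - nmem s1 51) * Suc 2)) (%s. J1 s \<and> nmem s 51 = t)"
   proof (rule runs_Loop[where J = J1 and \<mu> = "%s. t - nmem s 51"])
    show "J1 s1" using s1 by simp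
   next
    fix s assume s: "J1 s" "holds (NLess (Dir 51) (Dir 50)) s"
    then show "runs (seqs [NAdd (Dir 63) (Dir 63) (Dir 50), NAdd (Dir 51) (Dir 51) (Dir 52)]) s 2
     (%s'. J1 s' \<and> t - nmem s' 51 < t - nmem s 51)"
     by (intro runs_seqs) (auto simp: ram_simps J1_def Z_def)
   next
    fix s assume "J1 s" "\<not> holds (NLess (Dir 51) (Dir 50)) s"
    then show "J1 s \<and> nmem s 51 = t" by (auto simp: ram_simps J1_def)
   qed
   then show "runs (Loop (NLess (Dir 51) (Dir 50)) (seqs [NAdd (Dir 63) (Dir 63) (Dir 50), NAdd (Dir 51) (Dir 51) (Dir 52)])) s1
    (Suc (t * Suc 2)) (%s. J1 s \<and> nmem s 51 = t)" using s1 by simp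
  next
   fix s2 assume s2: "J1 s2 \<and> nmem s2 51 = t"
   show "runs (Seq (seqs [NConst (Dir 53) 50, NAdd (Dir 53) (Dir 53) (Dir 63), NAdd (Dir 54) (Dir 53) (Dir 52), RConst (Ind 53) 0, RConst (Ind 54) 1])
   (Loop (RLess (Ind 53) (Ind 54)) (seqs [RAdd (Ind 53) (Ind 53) (Dir 1), NAdd (Dir 3) (Dir 3) (Dir 52)]))) s2
   (5 + Suc (e * Suc 2)) (%s. nmem s 63 = t * t \<and> nmem s 0 = n \<and> nmem s 1 = d \<and> nmem s 2 = k \<and>
  nmem s 3 = e \<and> (\<forall>q. 4 \<le> q \<longrightarrow> q < 50 \<or> 63 < q \<longrightarrow> nmem s q = 0) \<and> (\<forall>x<t * t. rmem s x = rmem s0 x))"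
   proof (rule runs_Seq2)
    show "runs (seqs [NConst (Dir 53) 50, NAdd (Dir 53) (Dir 53) (Dir 63), NAdd (Dir 54) (Dir 53) (Dir 52), RConst (Ind 53) 0, RConst (Ind 54) 1]) s2 5
     (%s. J2 s \<and> nmem s 3 = 0)"
     using s2 by (intro runs_seqs) (auto simp: ram_simps J1_def J2_def Z_def)
   next
    fix s3 assume s3: "J2 s3 \<and> nmem s3 3 = 0"
    have "runs (Loop (RLess (Ind 53) (Ind 54)) (seqs [RAdd (Ind 53) (Ind 53) (Dir 1), NAdd (Dir 3) (Dir 3) (Dir 52)])) s3
     (Suc ((e - nmem s3 3) * Suc 2)) (%s. J2 s \<and> nmem s 3 = e)"
    proof (rule runs_Loop[where J = J2 and \<mu> = "%s. e - nmem s 3"])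
     show "J2 s3" using s3 by simp
    next
     fix s assume s: "J2 s" "holds (RLess (Ind 53) (Ind 54)) s"
     then have "nmem s 3 < e" by (intro e) (simp add: ram_simps J2_def)
     then show "runs (seqs [RAdd (Ind 53) (Ind 53) (Dir 1), NAdd (Dir 3) (Dir 3) (Dir 52)]) s 2
      (%s'. J2 s' \<and> e - nmem s' 3 < e - nmem s 3)"
      using s t1 \<epsilon> by (intro runs_seqs) (auto simp: ram_simps J2_def Z_def algebra_simps)
    next
     fix s assume s: "J2 s" "\<not> holds (RLess (Ind 53) (Ind 54)) s"
     then have "e \<le> nmem s 3" by (intro e') (simp add: ram_simps J2_def)
     then show "J2 s \<and> nmem s 3 = e" using s by (auto simp: J2_def)
    qed
    then show "runs (Loop (RLess (Ind 53) (Ind 54)) (seqs [RAdd (Ind 53) (Ind 53) (Dir 1), NAdd (Dir 3) (Dir 3) (Dir 52)])) s3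
     (Suc (e * Suc 2)) (%s. nmem s 63 = t * t \<and> nmem s 0 = n \<and> nmem s 1 = d \<and> nmem s 2 = k \<and>
  nmem s 3 = e \<and> (\<forall>q. 4 \<le> q \<longrightarrow> q < 50 \<or> 63 < q \<longrightarrow> nmem s q = 0) \<and> (\<forall>x<t * t. rmem s x = rmem s0 x))"
     by (rule runs_weaken) (use s3 in \<open>auto simp: J2_def Z_def\<close>)
   qed
  qed
 qed
qed

text \<open>The choice \<gamma> = \<open>1 / (64 * e)\<close> with
  \<open>1 / \<epsilon> \<le> e\<close> keeps the excess \<open>18 * \<gamma>\<close> below
  \<epsilon> and meets the requirement \<open>\<gamma> \<le> 1 / 64\<close> of the analysis.\<close>

lemma correct:
 assumes p: "1 \<le> p" and nd: "1 \<le> n" "1 \<le> d" "1 \<le> k" and \<epsilon>: "0 < \<epsilon>" and A: "A \<in> carrier_mat n d"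
  and ac: "1 \<le> a" "a \<le> c" and par: "\<And>k e. 1 \<le> k ==> 1 \<le> e ==> \<exists>G0 :: nat.
  8 * real k * (p + 2 * ((2 * real k) powr p * real k) + 1) \<le> real G0 * (1 / (64 * real e)) \<and>
  (2 * real G0 + 1) ^ k * exp (- ((1 / (64 * real e))\<^sup>2 * real (c * (k * e) ^ a) / (128 * 4 powr p * ((2 * real k) powr p * real k))))
   < 1 / (64 * real e) / (1 + 1 / (64 * real e))"
  and c': "128 \<le> c'" "64 * (4 * p + 1) \<le> real c'"
 defines "e \<equiv> nat \<lceil>1 / \<epsilon>\<rceil>"
 defines "X \<equiv> XX a c c' n d k e" and "t \<equiv> n + d + k + 2"
 shows "runs (Seq PRE (Seq (comp (SETUP a c c')) (comp MAIN))) (input_state p \<epsilon> k A)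
  (6 + (Suc (t * Suc 2) + (5 + Suc (e * Suc 2))) + (tm (SETUP a c c') X + tm MAIN X))
  (%s. entrywise_norm p (output_U n k s * output_V n d k s - A) \<le> (3 + \<epsilon>) * lowrank_opt p k A)"
proof -
 let ?s0 = "input_state p \<epsilon> k A"
 define Y where "Y = YY a c c' n d k e"
 define m where "m = mm a c k e"
 define \<gamma> where "\<gamma> = 1 / (64 * real e)"
 have e1: "1 \<le> e" using \<epsilon> by (simp add: e_def Suc_le_eq)
 have ee: "1 / \<epsilon> \<le> real e" unfolding e_def by linarith
 have s0: "nmem ?s0 = (%a. if a = 0 then n else if a = 1 then d else if a = 2 then k else 0)"
  using A by (simp add: input_state_def fun_eq_iff Let_def)
 have r0: "rmem ?s0 1 = \<epsilon>" "rmem ?s0 0 = p" by (simp_all add: input_state_def Let_def)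
 have Yb: "128 \<le> Y" "n \<le> Y" "d \<le> Y" "k \<le> Y" "m \<le> Y" "1 \<le> m" "(k + 1) ^ k \<le> Y" "8 ^ k \<le> Y" "e \<le> Y" "c' \<le> Y" "c' * e \<le> Y"
  using YY_bounds(1-11)[OF nd e1 ac c'(1)] unfolding Y_def m_def by auto
 have Xeq: "X = (Y ^ 29) ^ (k * m + m + k)" by (simp add: X_def XX_def Y_def m_def)
 have XY: "Y \<le> X"
 proof -
  have "Y ^ 1 \<le> Y ^ 29" using Yb by (intro power_increasing) auto
  then show ?thesis using SETUP_triple(2)[OF nd e1 ac c'(1), of "(%_. 0)(0 := n, 1 := d, 2 := k, 3 := e)"] by (simp add: X_def Y_def)
 qed
 have X1: "1 \<le> X" using XY Yb by simp
 let ?Q = "%s. entrywise_norm p (output_U n k s * output_V n d k s - A) \<le> (3 + \<epsilon>) * lowrank_opt p k A"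
 show ?thesis
 proof (rule runs_Seq2[OF PRE_run[OF s0 r0(1) \<epsilon>, folded e_def t_def]])
  fix s1 :: ram assume s1: "nmem s1 63 = t * t \<and> nmem s1 0 = n \<and> nmem s1 1 = d \<and> nmem s1 2 = k \<and>
   nmem s1 3 = e \<and> (\<forall>q. 4 \<le> q \<longrightarrow> q < 50 \<or> 63 < q \<longrightarrow> nmem s1 q = 0) \<and> (\<forall>x<t * t. rmem s1 x = rmem ?s0 x)"
  \<comment> \<open>The machine state is reread as a state of the structured language; its natural
    arrays are 0 except for the scalars 0 to 3.\<close>
  define h1 where "h1 = \<lparr>hN = %a i j. nmem s1 (cell a i j), hR = %a i j. rmem s1 (t * t + cell a i j), hI = rmem s1, hb = t * t\<rparr>"
  have rel1: "rel s1 h1" using s1 by (simp add: rel_def h1_def)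
  have bnd1: "bnd X h1" unfolding bnd_def
  proof (intro allI impI)
   fix a' i j :: nat assume a': "a' < 50"
   define r where "r = cell a' i j"
   have r: "r < 50 \<or> 63 < r" using cell_temp[OF a', of r i j] unfolding r_def by linarith
   have "nmem s1 r \<le> X"
   proof (cases "r < 4")
    case True
    then have "r = 0 \<or> r = 1 \<or> r = 2 \<or> r = 3" by linarith
    moreover have "nmem s1 0 \<le> X" "nmem s1 1 \<le> X" "nmem s1 2 \<le> X" "nmem s1 3 \<le> X" using s1 Yb XY by auto
    ultimately show ?thesis by metis
   next
    case False
    then have "nmem s1 r = 0" using s1 r by (metis not_less)
    then show ?thesis by simp
   qed
   then show "hN h1 a' i j \<le> X" by (simp add: h1_def r_def)
  qed
  have f: "hN h1 0 0 0 = n" "hN h1 1 0 0 = d" "hN h1 2 0 0 = k" "hN h1 3 0 0 = e" using s1 by (simp_all add: h1_def cell_0)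
  define h2 where "h2 = run (SETUP a c c') h1"
  obtain g where tr: "triple X (%a. hN h1 a 0 0) (SETUP a c c') g" and g: "g 0 = n" "g 1 = d" "g 2 = k" "g 4 = m" "g 5 = Y" "g 6 = Y ^ 28"
   "g 7 = Y ^ 29" "g 8 = X" "g 9 = Y ^ 3" "g 10 = m + k" "g 11 = n + k" "g 12 = 1" "g 13 = n * d + 2" "g 14 = n * k" "g 15 = n * k + k * d" "g 16 = 2"
   using SETUP_triple(1)[OF nd e1 ac c'(1), of "%a. hN h1 a 0 0", OF f, folded X_def Y_def m_def] by (elim exE conjE) (rule that; assumption)
  have safe1: "safe X (SETUP a c c') h1" and bnd2: "bnd X h2" and hg: "\<And>a. hN h2 a 0 0 = g a"
   using tr bnd1 unfolding triple_def h2_def by auto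
  have I2: "hI h2 = rmem s1" unfolding h2_def by (simp add: hI_run[OF SETUP_puts]) (simp add: h1_def)
  have b2: "hb h2 = t * t" unfolding h2_def by simp (simp add: h1_def)
  show "runs (Seq (comp (SETUP a c c')) (comp MAIN)) s1 (tm (SETUP a c c') X + tm MAIN X) ?Q"
  proof (rule runs_Seq2[OF runs_comp[OF SETUP_wf rel1 safe1, folded h2_def]])
   fix s2 :: ram assume rel2: "rel s2 h2"
   have safe2: "safe X MAIN h2" using nogrow_safe[OF MAIN_nogrow MAIN_wf bnd2 X1] by blast
   show "runs (comp MAIN) s2 (tm MAIN X) ?Q"
   proof (rule runs_weaken[OF runs_comp[OF MAIN_wf rel2 safe2] order.refl])
    fix s3 :: ram assume rel3: "rel s3 (run MAIN h2)"
    \<comment> \<open>The reserved area holds the input with its two leading parameters as well as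
      the output.\<close>
    have tt: "n * d + 2 \<le> t * t" "n * k + k * d \<le> t * t" by (simp_all add: t_def algebra_simps)
    have Iin: "hI h2 (2 + i * d + j) = A $$ (i, j)" if "i < n" "j < d" for i j
    proof -
     have "i * d + j < (i + 1) * d" using that by simp
     also have "\<dots> \<le> n * d" using that by (intro mult_le_mono1) simp
     finally have "i * d + j < n * d" .
     then show ?thesis using s1 tt that A by (simp add: I2 input_state_def Let_def)
    qed
    have Ip: "hI h2 0 = p"
    proof -
     have "0 < t * t" using tt by linarith
     then show ?thesis using s1 r0 by (simp add: I2)
    qed
    have b: "n * d + 2 \<le> hb h2" "n * k + k * d \<le> hb h2" using tt b2 by auto
    note hs = hg[of 0, unfolded g] hg[of 1, unfolded g] hg[of 2, unfolded g] hg[of 4, unfolded g] hg[of 5, unfolded g] hg[of 6, unfolded g]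
     hg[of 7, unfolded g] hg[of 8, unfolded g] hg[of 9, unfolded g] hg[of 10, unfolded g] hg[of 11, unfolded g] hg[of 12, unfolded g]
     hg[of 13, unfolded g] hg[of 14, unfolded g] hg[of 15, unfolded g] hg[of 16, unfolded g]
    let ?A = "%i j. A $$ (i, j)"
    let ?h3 = "run MAIN h2"
    obtain sc U0 Hs bb QQ W V' gb cS cw cQ cR where M:
     "\<forall>x<n. \<forall>y<d. Hs 0 x y = A $$ (x, y)" "elims n n d k Hs bb QQ" "\<forall>i<n. \<forall>u<k. U0 i u = bb u i"
     "\<forall>x<n. \<forall>y<d. \<bar>Hs k x y\<bar> \<le> sc" "\<exists>x<n. \<exists>y<d. sc = \<bar>Hs k x y\<bar>"
     "solver.cand n d k m (Y ^ 29) X (Y ^ 3) (Y ^ 28) ?A U0 (1 + p / real Y ^ 2) (1 + 1 / real Y ^ 2) sc (sc / real Y ^ 24) (sc / real Y ^ 8)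
       (sc / real Y ^ 8) (real Y ^ 3) cS cw cQ cR W V' gb"
     "\<forall>cS<X. \<forall>cw<X. \<forall>cQ<X. \<forall>cR<X. \<exists>W V' tot.
       solver.cand n d k m (Y ^ 29) X (Y ^ 3) (Y ^ 28) ?A U0 (1 + p / real Y ^ 2) (1 + 1 / real Y ^ 2) sc (sc / real Y ^ 24) (sc / real Y ^ 8)
        (sc / real Y ^ 8) (real Y ^ 3) cS cw cQ cR W V' tot \<and> gb \<le> tot"
     "\<forall>i<n. \<forall>u<k. hI ?h3 (i * k + u) = W i u" "\<forall>u<k. \<forall>j<d. hI ?h3 (n * k + u * d + j) = V' u j"
     using MAIN_run[OF hs b Ip Iin nd X1, simplified triv_forall_equality implies_True_equals True_implies_equals] by (elim exE conjE) (rule that; (assumption | (rule exI, rule conjI, assumption, rule exI, rule conjI; assumption)))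
    have Xb: "(Y ^ 29) ^ m \<le> X" "(Y ^ 29) ^ k \<le> X" "(Y ^ 29) ^ (k * m) \<le> X"
     unfolding Xeq using Yb by (intro power_increasing; simp)+
    have e0: "0 < real e" using e1 by simp
    have y64: "64 * real e \<le> real Y" "64 * (4 * p + 1) * real e \<le> real Y"
    proof -
     have ce: "real c' * real e \<le> real Y" using Yb(11) by (simp only: of_nat_mult[symmetric] of_nat_le_iff)
     have "64 * real e \<le> real c' * real e" using c' by (intro mult_right_mono) auto
     then show "64 * real e \<le> real Y" using ce by linarith
     have "64 * (4 * p + 1) * real e \<le> real c' * real e" using c' by (intro mult_right_mono) auto
     then show "64 * (4 * p + 1) * real e \<le> real Y" using ce by linarith
    qed
    have Y0: "0 < real Y" using Yb by simp
    have \<gamma>: "0 < \<gamma>" "\<gamma> \<le> 1 / 64" "1 / real Y \<le> \<gamma>"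
    proof -
     show "0 < \<gamma>" using e0 by (simp add: \<gamma>_def)
     show "\<gamma> \<le> 1 / 64" unfolding \<gamma>_def using e1 by (intro divide_left_mono) auto
     show "1 / real Y \<le> \<gamma>" unfolding \<gamma>_def using y64 e0 Y0 by (intro divide_left_mono) auto
    qed
    have rate: "exp (p / real Y) * (1 + 1 / real Y ^ 2) \<le> 1 + \<gamma>"
    proof (rule rate_bound[OF p])
     show "1 \<le> real Y" using Yb by simp
     show "4 * p + 1 \<le> \<gamma> * real Y" using y64(2) e0 by (simp add: \<gamma>_def field_simps)
    qed (use \<gamma> in simp)
    have sv: "solver_y n d k m Y X p \<gamma>" using nd X1 Yb(1-8) p \<gamma> rate Xb by unfold_locales
    interpret solver_y n d k m Y X ?A U0 p sc \<gamma> by (rule sv)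
    obtain G0 :: nat where G0: "8 * real k * (p + 2 * ((2 * real k) powr p * real k) + 1) \<le> real G0 * \<gamma>"
     "(2 * real G0 + 1) ^ k * exp (- (\<gamma>\<^sup>2 * real m / (128 * 4 powr p * ((2 * real k) powr p * real k)))) < \<gamma> / (1 + \<gamma>)"
     using par[OF nd(3) e1, folded mm_def, folded m_def \<gamma>_def] by blast
    let ?U = "output_U n k s3" and ?V = "output_V n d k s3"
    have mem: "rmem s3 x = hI ?h3 x" if "x < t * t" for x using rel3 b2 that by (simp add: rel_def)
    have Ue: "?U $$ (i, u) = W i u" if "i < n" "u < k" for i u
    proof -
     have "i * k + u < (i + 1) * k" using that by simp
     also have "\<dots> \<le> n * k" using that by (intro mult_le_mono1) simp
     finally have "i * k + u < t * t" using tt by linarith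
     then show ?thesis using M(8) that mem by (simp add: output_U_def)
    qed
    have Ve: "?V $$ (u, j) = V' u j" if "u < k" "j < d" for u j
    proof -
     have "u * d + j < (u + 1) * d" using that by simp
     also have "\<dots> \<le> k * d" using that by (intro mult_le_mono1) simp
     finally have "n * k + u * d + j < t * t" using tt by linarith
     then show ?thesis using M(9) that mem by (simp add: output_V_def)
    qed
    have car: "?U \<in> carrier_mat n k" "?V \<in> carrier_mat k d" by (simp_all add: output_U_def output_V_def)
    have prod: "(?U * ?V - A) $$ (i, j) = MN W V' i j - A $$ (i, j)" if "i < n" "j < d" for i j
    proof -
     have "(?U * ?V) $$ (i, j) = (\<Sum>u<k. ?U $$ (i, u) * ?V $$ (u, j))"
      using car that by (simp add: scalar_prod_def atLeast0LessThan)
     also have "\<dots> = MN W V' i j" unfolding MN_def using Ue Ve that by (intro sum.cong) auto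
     finally show ?thesis using A car that by simp
    qed
    have "?U * ?V - A \<in> carrier_mat n d" by (rule minus_carrier_mat[OF A])
    then have nrm: "entrywise_norm p (?U * ?V - A) = NN (%i j. MN W V' i j - A $$ (i, j))"
     unfolding NN_def by (subst entrywise_norm_lpn) (auto intro!: lpn_cong simp: prod)
    have q: "entrywise_norm p (?U * ?V - A) \<le> (3 + 18 * \<gamma>) * lpn p ({..<n} \<times> {..<d}) (%_. 1) (%(i, j). B i j - A $$ (i, j))"
     if "lowrank k n d B" for B
     using quality[OF that M(2,1,3,4,5) G0 M(6,7)] unfolding nrm NN_def by simp
    have c0: "0 < 3 + 18 * \<gamma>" using \<gamma> by simp
    have "entrywise_norm p (?U * ?V - A) \<le> (3 + 18 * \<gamma>) * lowrank_opt p k A" by (rule lowrank_opt_bound(1)[OF A c0 q])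
    also have "\<dots> \<le> (3 + \<epsilon>) * lowrank_opt p k A"
    proof (intro mult_right_mono)
     have "18 * \<gamma> \<le> 1 / real e" using e0 by (simp add: \<gamma>_def field_simps)
     also have "\<dots> \<le> \<epsilon>" using ee e0 \<epsilon> by (simp add: field_simps)
     finally show "3 + 18 * \<gamma> \<le> 3 + \<epsilon>" by simp
    qed (rule lowrank_opt_bound(2)[OF A c0 q])
    finally show "?Q s3" .
   qed
  qed
 qed
qed

text \<open>The base \<open>max n 2\<close> absorbs the constant factor as well, which n = 1 could
  not.\<close>

lemma poly_le_power:
 "\<exists>c. \<forall>n d :: nat. 1 \<le> n \<longrightarrow> real d \<le> poly D (real n) \<longrightarrow> d \<le> max n 2 ^ c"
proof -
 define C where "C = nat \<lceil>\<Sum>i\<le>degree D. \<bar>coeff D i\<bar>\<rceil>"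
 show ?thesis
 proof (intro exI[of _ "C + degree D"] allI impI)
  fix n d :: nat assume n: "1 \<le> n" and d: "real d \<le> poly D (real n)"
  have "poly D (real n) \<le> (\<Sum>i\<le>degree D. \<bar>coeff D i\<bar> * real n ^ degree D)"
   unfolding poly_altdef
  proof (intro sum_mono)
   fix i assume "i \<in> {..degree D}"
   then have "real n ^ i \<le> real n ^ degree D" using n by (intro power_increasing) auto
   then show "coeff D i * real n ^ i \<le> \<bar>coeff D i\<bar> * real n ^ degree D" by (intro mult_mono) auto
  qed
  also have "\<dots> \<le> real C * real n ^ degree D"
   unfolding sum_distrib_right[symmetric] C_def by (intro mult_right_mono) (auto simp: real_nat_ceiling_ge)
  finally have "real d \<le> real (C * n ^ degree D)" using d by simp
  then have "d \<le> C * n ^ degree D" by (simp only: of_nat_le_iff)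
  also have "\<dots> \<le> max n 2 ^ C * max n 2 ^ degree D"
  proof (intro mult_le_mono power_mono)
   have "C \<le> 2 ^ C" by (simp add: less_imp_le)
   also have "\<dots> \<le> max n 2 ^ C" by (intro power_mono) auto
   finally show "C \<le> max n 2 ^ C" .
  qed auto
  finally show "d \<le> max n 2 ^ (C + degree D)" by (simp add: power_add)
 qed
qed

text \<open>Each factor becomes a power of \<open>max n 2\<close> through
  \<open>v \<le> 2 ^ v\<close>. This is affordable for quantities that depend on k, e and p only,
  while n and d enter with fixed exponents.\<close>

lemma XX_bound:
 fixes n d k e a c c' c0 :: nat
 assumes "1 \<le> n" "d \<le> max n 2 ^ c0"
 defines "m \<equiv> mm a c k e"
 shows "XX a c c' n d k e \<le> max n 2 ^ ((c' + (3 + c0 + m + k * e) + 8 * (k + 1) * k) * (29 * (k * m + m + k)))"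
proof -
 let ?N = "max n 2"
 have N: "1 \<le> ?N" "2 \<le> ?N" by auto
 have up: "i \<le> j ==> ?N ^ i \<le> ?N ^ j" for i j using N by (intro power_increasing) auto
 have v: "v \<le> ?N ^ v" for v
 proof -
  have "v \<le> 2 ^ v" by (simp add: less_imp_le)
  also have "\<dots> \<le> ?N ^ v" by (intro power_mono) auto
  finally show ?thesis .
 qed
 have u: "?N ^ 1 \<le> ?N ^ (1 + c0 + m + k * e)" "?N ^ c0 \<le> ?N ^ (1 + c0 + m + k * e)" "?N ^ m \<le> ?N ^ (1 + c0 + m + k * e)"
  "?N ^ (k * e) \<le> ?N ^ (1 + c0 + m + k * e)" by (intro up; simp)+
 have "n \<le> ?N ^ 1" by simp
 then have "n + d + m + k * e \<le> 4 * ?N ^ (1 + c0 + m + k * e)"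
  using assms(2) v[of m] v[of "k * e"] u by linarith
 also have "\<dots> \<le> ?N ^ 2 * ?N ^ (1 + c0 + m + k * e)" using power_mono[OF N(2), of 2] by (intro mult_le_mono1) simp
 also have "\<dots> = ?N ^ (3 + c0 + m + k * e)"
  by (subst power_add[symmetric]) (rule arg_cong[where f = "(^) ?N"], simp)
 finally have s: "n + d + m + k * e \<le> ?N ^ (3 + c0 + m + k * e)" .
 have "(8 * (k + 1)) ^ k \<le> (?N ^ (8 * (k + 1))) ^ k" by (intro power_mono v) simp
 then have "(8 * (k + 1)) ^ k \<le> ?N ^ (8 * (k + 1) * k)" by (simp only: power_mult)
 then have "YY a c c' n d k e \<le> ?N ^ c' * ?N ^ (3 + c0 + m + k * e) * ?N ^ (8 * (k + 1) * k)"
  unfolding YY_def m_def[symmetric] by (intro mult_le_mono v s)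
 also have "\<dots> = ?N ^ (c' + (3 + c0 + m + k * e) + 8 * (k + 1) * k)" by (simp only: power_add)
 finally have "YY a c c' n d k e ^ (29 * (k * m + m + k)) \<le> (?N ^ (c' + (3 + c0 + m + k * e) + 8 * (k + 1) * k)) ^ (29 * (k * m + m + k))"
  by (intro power_mono) simp_all
 then show ?thesis unfolding XX_def m_def[symmetric] by (simp only: power_mult)
qed

theorem theorem3p5:
 fixes p :: real and B D :: "real poly"
 assumes "p > 2"
 shows "\<exists>(P :: prog) (q :: real poly).
  \<forall>(n::nat) (d::nat) (k::nat) (\<epsilon>::real) (A :: real mat).
   n \<ge> 1 \<longrightarrow> d \<ge> 1 \<longrightarrow> real d \<le> poly D (real n) \<longrightarrow> k \<ge> 1 \<longrightarrow> 0 < \<epsilon> \<longrightarrow> \<epsilon> \<le> 1 \<longrightarrow>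
   A \<in> carrier_mat n d \<longrightarrow> (\<forall>i<n. \<forall>j<d. \<bar>A $$ (i, j)\<bar> \<le> poly B (real n)) \<longrightarrow>
   (\<exists>t s. exec P (input_state p \<epsilon> k A) t s \<and>
     real t \<le> real (max n 2) powr poly q (real k / \<epsilon>) \<and>
     entrywise_norm p (output_U n k s * output_V n d k s - A)
      \<le> (3 + \<epsilon>) * lowrank_opt p k A)"
proof -
 have p: "1 \<le> p" using assms by simp
 obtain c a where ac: "1 \<le> a" "a \<le> c" and par: "\<forall>k e. 1 \<le> k \<longrightarrow> 1 \<le> e \<longrightarrow> (\<exists>G0 :: nat.
  8 * real k * (p + 2 * ((2 * real k) powr p * real k) + 1) \<le> real G0 * (1 / (64 * real e)) \<and>
  (2 * real G0 + 1) ^ k * exp (- ((1 / (64 * real e))\<^sup>2 * real (c * (k * e) ^ a) / (128 * 4 powr p * ((2 * real k) powr p * real k))))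
   < 1 / (64 * real e) / (1 + 1 / (64 * real e)))"
  using sampling_parameters[OF p] by (elim exE conjE) (rule that; assumption)
 define c' where "c' = nat \<lceil>64 * (4 * p + 1)\<rceil>"
 have c': "128 \<le> c'" "64 * (4 * p + 1) \<le> real c'" using p by (simp_all add: c'_def) linarith+
 obtain c0 where c0: "\<forall>n d. 1 \<le> n \<longrightarrow> real d \<le> poly D (real n) \<longrightarrow> d \<le> max n 2 ^ c0" using poly_le_power by blast
 obtain c1 where c1: "\<forall>X\<ge>1. tm (SETUP a c c') X \<le> c1 * X ^ c1" using tm_poly by blast
 obtain c2 where c2: "\<forall>X\<ge>1. tm MAIN X \<le> c2 * X ^ c2" using tm_poly by blast
 \<comment> \<open>\<open>31 = 19 + 12\<close>: the constant steps of the prologue, and three steps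
   for each unit of n, d, k and e in its loops, all of which are at most \<open>X\<close>.\<close>
 define cc where "cc = 31 + c1 + c2"
 \<comment> \<open>For \<epsilon> at most 1 the integer e is at most 2 / \<epsilon>, so k and
   \<open>k * e\<close> are both at most twice the argument k / \<epsilon>.\<close>
 define z :: "real poly" where "z = [:0, 2:]"
 define qm where "qm = Polynomial.smult (real c) (z ^ a)"
 define q1 where "q1 = [:real c' + 3 + real c0:] + qm + z + Polynomial.smult 8 ((z + 1) * z)"
 \<comment> \<open>The exponent of the time bound, with k, \<open>k * e\<close> and m replaced by
   their polynomial bounds.\<close>
 define q where "q = [:real cc:] + Polynomial.smult (real cc * 29) (q1 * (z * qm + qm + z))"
 show ?thesis
 proof (rule exI[of _ "Seq PRE (Seq (comp (SETUP a c c')) (comp MAIN))"], rule exI[of _ q], intro allI impI)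
  fix n d k :: nat and \<epsilon> :: real and A :: "real mat"
  assume nd: "1 \<le> n" "1 \<le> d" and dD: "real d \<le> poly D (real n)" and k: "1 \<le> k" and \<epsilon>: "0 < \<epsilon>" "\<epsilon> \<le> 1" and A: "A \<in> carrier_mat n d"
  define e where "e = nat \<lceil>1 / \<epsilon>\<rceil>"
  define X where "X = XX a c c' n d k e"
  define t where "t = n + d + k + 2"
  define m where "m = mm a c k e"
  let ?N = "max n 2"
  let ?T = "6 + (Suc (t * Suc 2) + (5 + Suc (e * Suc 2))) + (tm (SETUP a c c') X + tm MAIN X)"
  obtain T s where ex: "exec (Seq PRE (Seq (comp (SETUP a c c')) (comp MAIN))) (input_state p \<epsilon> k A) T s" "T \<le> ?T"
   "entrywise_norm p (output_U n k s * output_V n d k s - A) \<le> (3 + \<epsilon>) * lowrank_opt p k A"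
   using correct[OF p nd k \<epsilon>(1) A ac par[rule_format] c'] unfolding runs_def e_def X_def t_def by blast
  have e1: "1 \<le> e" using \<epsilon> by (simp add: e_def Suc_le_eq)
  have Yb: "128 \<le> YY a c c' n d k e" "n \<le> YY a c c' n d k e" "d \<le> YY a c c' n d k e" "k \<le> YY a c c' n d k e" "e \<le> YY a c c' n d k e"
   using YY_bounds[OF nd k e1 ac c'(1)] by blast+
  have YX: "YY a c c' n d k e \<le> X"
  proof -
   have "YY a c c' n d k e ^ 1 \<le> YY a c c' n d k e ^ 29" using Yb by (intro power_increasing) auto
   then show ?thesis using SETUP_triple(2)[OF nd k e1 ac c'(1), of "(\<lambda>_. 0)(0 := n, 1 := d, 2 := k, 3 := e)"] by (simp add: X_def)
  qed
  have X1: "1 \<le> X" using Yb YX by simp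
  have Xp: "X ^ i \<le> X ^ cc" if "i \<le> cc" for i using that X1 by (intro power_increasing)
  have "?T \<le> 31 * X ^ 1 + (c1 * X ^ c1 + c2 * X ^ c2)"
   using c1 c2 X1 Yb YX by (intro add_mono) (auto simp: t_def)
  also have "\<dots> \<le> 31 * X ^ cc + (c1 * X ^ cc + c2 * X ^ cc)"
   by (intro add_mono mult_le_mono2 Xp) (simp_all add: cc_def)
  also have "\<dots> = cc * X ^ cc" by (simp add: cc_def algebra_simps)
  also have "\<dots> \<le> ?N ^ cc * (?N ^ ((c' + (3 + c0 + m + k * e) + 8 * (k + 1) * k) * (29 * (k * m + m + k)))) ^ cc"
  proof (intro mult_le_mono power_mono)
   have "cc \<le> 2 ^ cc" by (simp add: less_imp_le)
   also have "\<dots> \<le> ?N ^ cc" by (intro power_mono) auto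
   finally show "cc \<le> ?N ^ cc" .
   show "X \<le> ?N ^ ((c' + (3 + c0 + m + k * e) + 8 * (k + 1) * k) * (29 * (k * m + m + k)))"
    using XX_bound[OF nd(1)] c0 nd(1) dD unfolding X_def m_def by blast
  qed simp
  also have "\<dots> = ?N ^ (cc + (c' + (3 + c0 + m + k * e) + 8 * (k + 1) * k) * (29 * (k * m + m + k)) * cc)"
   by (simp only: power_add power_mult)
  finally have T: "T \<le> ?N ^ (cc + (c' + (3 + c0 + m + k * e) + 8 * (k + 1) * k) * (29 * (k * m + m + k)) * cc)"
   using ex(2) by linarith
  define x where "x = real k / \<epsilon>"
  have zx: "poly z x = 2 * x" by (simp add: z_def)
  have kx: "real k \<le> x" using \<epsilon> k by (simp add: x_def field_simps)
  have x0: "0 \<le> x" using \<epsilon> by (simp add: x_def)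
  have "real e \<le> 1 / \<epsilon> + 1" using \<epsilon> unfolding e_def by (simp add: of_nat_nat)
  also have "\<dots> \<le> 2 / \<epsilon>" using \<epsilon> by (simp add: field_simps)
  finally have "real k * real e \<le> real k * (2 / \<epsilon>)" by (intro mult_left_mono) auto
  then have kex: "real (k * e) \<le> 2 * x" by (simp add: x_def mult.commute)
  have mx: "real m \<le> poly qm x"
  proof -
   have "real m = real c * real (k * e) ^ a" by (simp add: m_def mm_def)
   also have "\<dots> \<le> real c * (2 * x) ^ a" using kex by (intro mult_left_mono power_mono) auto
   finally show ?thesis by (simp add: qm_def zx poly_power)
  qed
  have kx2: "real k \<le> 2 * x" using kx x0 by simp
  have "real (cc + (c' + (3 + c0 + m + k * e) + 8 * (k + 1) * k) * (29 * (k * m + m + k)) * cc)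
    = real cc + real cc * 29 * ((real c' + 3 + real c0 + real m + real (k * e) + 8 * ((real k + 1) * real k)) * (real k * real m + real m + real k))"
   by (simp add: algebra_simps)
  also have "\<dots> \<le> real cc + real cc * 29 * ((real c' + 3 + real c0 + poly qm x + 2 * x + 8 * ((2 * x + 1) * (2 * x))) * (2 * x * poly qm x + poly qm x + 2 * x))"
   using mx kex kx2 x0 order_trans[OF of_nat_0_le_iff mx]
   by (intro add_left_mono mult_left_mono mult_mono add_mono order.refl mult_nonneg_nonneg add_nonneg_nonneg) auto
  also have "\<dots> = poly q x" by (simp add: q_def q1_def zx)
  finally have E: "real (cc + (c' + (3 + c0 + m + k * e) + 8 * (k + 1) * k) * (29 * (k * m + m + k)) * cc) \<le> poly q x" .
  have "real T \<le> real ?N ^ (cc + (c' + (3 + c0 + m + k * e) + 8 * (k + 1) * k) * (29 * (k * m + m + k)) * cc)"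
   using T by (simp only: of_nat_power[symmetric] of_nat_le_iff)
  also have "\<dots> = real ?N powr real (cc + (c' + (3 + c0 + m + k * e) + 8 * (k + 1) * k) * (29 * (k * m + m + k)) * cc)"
   by (rule powr_realpow[symmetric]) simp
  also have "\<dots> \<le> real ?N powr poly q x" using E by (intro powr_mono) simp_all
  finally show "\<exists>t s. exec (Seq PRE (Seq (comp (SETUP a c c')) (comp MAIN))) (input_state p \<epsilon> k A) t s \<and>
     real t \<le> real (max n 2) powr poly q (real k / \<epsilon>) \<and>
     entrywise_norm p (output_U n k s * output_V n d k s - A) \<le> (3 + \<epsilon>) * lowrank_opt p k A"
   using ex(1,3) unfolding x_def by blast
 qed
qed

end
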